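(* There is a polynomial-time algorithm which, given a line graph $G$, decides whether $G$ is h-perfect.
   Context: Graphs are finite and undirected. The line graph $L(H)$ of a graph $H$ (possibly with parallel edges, no loops) is the simple graph with vertex set $E(H)$ in which two vertices are adjacent iff the corresponding edges of $H$ share an end; a graph is a line graph if it is $L(H)$ for some $H$. The stable set polytope $\mathrm{STAB}(G)$ of a graph $G$ is the convex hull of the incidence vectors (in $\mathbb{R}^{V(G)}$) of the stable sets of $G$. A circuit is a connected 2-regular subgraph, odd if it has an odd number of edges. A graph $G$ is h-perfect if $\mathrm{STAB}(G)$ is exactly the set of $x\in\mathbb{R}^{V(G)}$ satisfying the non-negativity inequalities $x_v\ge 0$ ($v\in V(G)$), the clique inequalities $\sum_{v\in K}x_v\le 1$ for every inclusion-wise maximal clique $K$ of $G$, and the odd-circuit inequalities $\sum_{v\in V(C)}x_v\le \frac{|V(C)|-1}{2}$ for every odd circuit $C$ of $G$. *)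

theory Defs
  imports
    "HOL-Analysis.Analysis"
    "HOL-Analysis.Finite_Function_Topology"
    "HOL-Library.Ramsey"
    "HOL-Computational_Algebra.Polynomial"
begin

section \<open>Graphs and line graphs\<close>

definition simple_graph :: "'v set \<Rightarrow> 'v set set \<Rightarrow> bool" where
  "simple_graph V E \<longleftrightarrow> finite V \<and> (\<forall>e\<in>E. e \<subseteq> V \<and> card e = 2)"

text \<open>In a multigraph, \<open>F\<close> is the set of (names of) edges and \<open>ends e\<close> is the set of the two ends
  of \<open>e\<close>; parallel edges are different elements of \<open>F\<close> with equal \<open>ends\<close>.\<close>

definition multigraph :: "'w set \<Rightarrow> 'e set \<Rightarrow> ('e \<Rightarrow> 'w set) \<Rightarrow> bool" where
  "multigraph W F ends \<longleftrightarrow>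
     finite W \<and> finite F \<and> (\<forall>e\<in>F. ends e \<subseteq> W \<and> card (ends e) = 2)"

definition line_graph_edges :: "'e set \<Rightarrow> ('e \<Rightarrow> 'w set) \<Rightarrow> 'e set set" where
  "line_graph_edges F ends =
     {{e, f} |e f. e \<in> F \<and> f \<in> F \<and> e \<noteq> f \<and> ends e \<inter> ends f \<noteq> {}}"

text \<open>The vertices of \<open>G = (V, E)\<close> serve as the edge names of the root graph. Root graphs are finite,
  so it is no restriction that their vertices are natural numbers.\<close>

definition line_graph :: "'v set \<Rightarrow> 'v set set \<Rightarrow> bool" where
  "line_graph V E \<longleftrightarrow>
     (\<exists>(W :: nat set) ends. multigraph W V ends \<and> E = line_graph_edges V ends)"

lemma line_graph_imp_simple_graph:
  assumes "line_graph V E"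
  shows "simple_graph V E"
  using assms
  by (auto simp: line_graph_def multigraph_def line_graph_edges_def simple_graph_def)


section \<open>h-perfect graphs\<close>

text \<open>\<open>\<real>\<^sup>V\<close> is the subspace of those \<open>x :: 'v \<Rightarrow>\<^sub>0 real\<close> with \<open>keys x \<subseteq> V\<close>.\<close>

definition incidence_vector :: "'v set \<Rightarrow> ('v \<Rightarrow>\<^sub>0 real)" where
  "incidence_vector S = (\<Sum>v\<in>S. Poly_Mapping.single v 1)"

lemma lookup_incidence_vector:
  "finite S \<Longrightarrow> Poly_Mapping.lookup (incidence_vector S) v = (if v \<in> S then 1 else 0)"
  by (simp add: incidence_vector_def lookup_sum lookup_single when_def)

definition STAB :: "'v set \<Rightarrow> 'v set set \<Rightarrow> ('v \<Rightarrow>\<^sub>0 real) set" where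
  "STAB V E = convex hull (incidence_vector ` {S. S \<subseteq> V \<and> indep S E})"

definition maximal_clique :: "'v set \<Rightarrow> 'v set set \<Rightarrow> 'v set \<Rightarrow> bool" where
  "maximal_clique V E K \<longleftrightarrow>
     K \<subseteq> V \<and> clique K E \<and> (\<forall>K'. K' \<subseteq> V \<and> clique K' E \<and> K \<subseteq> K' \<longrightarrow> K' = K)"

definition connected_graph :: "'v set \<Rightarrow> 'v set set \<Rightarrow> bool" where
  "connected_graph V E \<longleftrightarrow> V \<noteq> {} \<and> (\<forall>u\<in>V. \<forall>v\<in>V. (u, v) \<in> {(x, y). {x, y} \<in> E}\<^sup>*)"

definition circuit :: "'v set \<Rightarrow> 'v set set \<Rightarrow> 'v set \<Rightarrow> 'v set set \<Rightarrow> bool" where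
  "circuit V E U D \<longleftrightarrow>
     U \<subseteq> V \<and> D \<subseteq> E \<and> simple_graph U D \<and> connected_graph U D \<and>
     (\<forall>v\<in>U. card {e\<in>D. v \<in> e} = 2)"

definition h_perfect :: "'v set \<Rightarrow> 'v set set \<Rightarrow> bool" where
  "h_perfect V E \<longleftrightarrow>
     STAB V E =
       {x. Poly_Mapping.keys x \<subseteq> V \<and>
           (\<forall>v\<in>V. Poly_Mapping.lookup x v \<ge> 0) \<and>
           (\<forall>K. maximal_clique V E K \<longrightarrow> (\<Sum>v\<in>K. Poly_Mapping.lookup x v) \<le> 1) \<and>
           (\<forall>U D. circuit V E U D \<and> odd (card D) \<longrightarrow>
              (\<Sum>v\<in>U. Poly_Mapping.lookup x v) \<le> (real (card U) - 1) / 2)}"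


section \<open>Random access machine programs\<close>

text \<open>Structured programs for a unit-cost random access machine whose only arithmetic operations are
  addition and truncated subtraction. The memory consists of arrays of natural numbers indexed by
  natural numbers; the names of the arrays are constants in the program, so a program accesses only
  finitely many of them, and indices are computed. A program is a fixed finite object, so every
  step evaluates boundedly many operators and enlarges the largest number in memory by at most a
  constant factor (plus a constant). All numbers thus have length linear in the running time and
  the length of the input, which makes polynomial time here the same as on Turing machines.\<close>

type_synonym memory = "nat \<Rightarrow> nat \<Rightarrow> nat"

datatype aexp =
  Num nat
| Get nat aexp
| Plus aexp aexp
| Minus aexp aexp

fun aval :: "aexp \<Rightarrow> memory \<Rightarrow> nat" where
  "aval (Num k) m = k"
| "aval (Get a i) m = m a (aval i m)"
| "aval (Plus x y) m = aval x m + aval y m"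
| "aval (Minus x y) m = aval x m - aval y m"

datatype com =
  Skip
| Put nat aexp aexp
| Seq com com
| If aexp com com
| While aexp com

text \<open>\<open>exec c m t m'\<close>: started in memory \<open>m\<close>, the program \<open>c\<close> halts after exactly \<open>t\<close> steps in memory
  \<open>m'\<close>. A test succeeds iff its value is nonzero.\<close>

inductive exec :: "com \<Rightarrow> memory \<Rightarrow> nat \<Rightarrow> memory \<Rightarrow> bool" where
  Skip: "exec Skip m 1 m"
| Put: "exec (Put a i x) m 1 (m(a := (m a)(aval i m := aval x m)))"
| Seq: "exec c m t m' \<Longrightarrow> exec d m' t' m'' \<Longrightarrow> exec (Seq c d) m (t + t') m''"
| IfTrue: "aval b m \<noteq> 0 \<Longrightarrow> exec c m t m' \<Longrightarrow> exec (If b c d) m (1 + t) m'"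
| IfFalse: "aval b m = 0 \<Longrightarrow> exec d m t m' \<Longrightarrow> exec (If b c d) m (1 + t) m'"
| WhileTrue: "aval b m \<noteq> 0 \<Longrightarrow> exec c m t m' \<Longrightarrow> exec (While b c) m' t' m'' \<Longrightarrow>
    exec (While b c) m (1 + t + t') m''"
| WhileFalse: "aval b m = 0 \<Longrightarrow> exec (While b c) m 1 m"

lemma exec_deterministic:
  "exec c m t m' \<Longrightarrow> exec c m u m'' \<Longrightarrow> u = t \<and> m'' = m'"
proof (induction arbitrary: u m'' rule: exec.induct)
  case (Skip m)
  then show ?case by (cases rule: exec.cases) simp_all
next
  case (Put a i x m)
  then show ?case by (cases rule: exec.cases) simp_all
next
  case (Seq c m t m' d t' m1)
  from Seq.prems show ?case by cases (use Seq.IH in blast)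
next
  case (IfTrue b m c t m' d)
  from IfTrue.prems show ?case by cases (use IfTrue in blast)+
next
  case (IfFalse b m d t m' c)
  from IfFalse.prems show ?case by cases (use IfFalse in blast)+
next
  case (WhileTrue b m c t m' t' m1)
  from WhileTrue.prems show ?case by cases (use WhileTrue in blast)+
next
  case (WhileFalse b m c)
  from WhileFalse.prems show ?case by cases (use WhileFalse in simp_all)
qed

text \<open>A graph with vertex set \<open>{..<n}\<close> is given by the number \<open>n\<close> in cell \<open>0\<close> of array \<open>0\<close> and by its
  adjacency matrix, stored row by row in array \<open>1\<close>. All other cells are \<open>0\<close>.\<close>

definition graph_input :: "nat \<Rightarrow> nat set set \<Rightarrow> memory" where
  "graph_input n E = (\<lambda>a i.
     if a = 0 \<and> i = 0 then n
     else if a = 1 \<and> i < n * n \<and> {i div n, i mod n} \<in> E then 1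
     else 0)"

text \<open>The answer is left in cell \<open>0\<close> of array \<open>0\<close>. The input consists of \<open>n\<^sup>2 + 1\<close> cells, so running
  time polynomial in \<open>n\<close> is the same as polynomial in the size of the input. Nothing is
  required on graphs outside the class \<open>Q\<close>.\<close>

definition decides_in_polynomial_time ::
    "com \<Rightarrow> (nat set \<Rightarrow> nat set set \<Rightarrow> bool) \<Rightarrow> (nat set \<Rightarrow> nat set set \<Rightarrow> bool) \<Rightarrow> bool" where
  "decides_in_polynomial_time c Q P \<longleftrightarrow>
     (\<exists>p :: nat poly. \<forall>n E. simple_graph {..<n} E \<and> Q {..<n} E \<longrightarrow>
        (\<exists>t m. exec c (graph_input n E) t m \<and> t \<le> poly p n \<and>
               m 0 0 = (if P {..<n} E then 1 else 0)))"

end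

theory Submission
  imports Defs
begin

text \<open>Let \<open>G\<close> be the line graph of \<open>H\<close>, so that stable sets of \<open>G\<close> are matchings of \<open>H\<close>. Then \<open>G\<close> is h-perfect iff
  \<open>H\<close> contains no bad theta: an odd circuit \<open>C\<close> with an ear \<open>P\<close> of odd length, except for a triangle with a
  doubled edge. A bad theta carries a point that satisfies all the inequalities but violates Edmonds'
  matching inequality. Conversely, take a linear functional that separates a point from the matching
  polytope and has as many maximum matchings as possible. None of the inequalities is tight at all of
  these, so Gallai's lemma yields a factor-critical subgraph without cut vertex, and in the absence of
  bad thetas this is an odd circuit, whose inequality is tight, or a triangle with parallel edges, whose
  line graph is a clique.

  For a simple graph, the absence of bad thetas means that in every block with an odd circuit, circuits
  \<open>y\<close> and \<open>z\<close> satisfy \<open>card (y \<inter> z) \<equiv> card y * card z\<close> modulo 2. Both sides are bilinear on the cycle space,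
  so fundamental circuits suffice. Parallel edges are twins in \<open>G\<close>; after dropping all but one vertex of
  each class of twins, it remains to exclude odd circuits of length at least 5 through an edge with a
  twin, which reduces to reachability around a triangle.

  All of this is definable in \<open>G\<close> by first-order formulas with parity quantifiers and inductive
  definitions: the ends of an edge \<open>x\<close> are distinguished by the first neighbour of \<open>x\<close>, and the spanning forest
  is the lexicographically first one. Such definitions are compiled to programs that tabulate the
  relations.\<close>

section \<open>The cycle space of a multigraph\<close>

text \<open>Two obstacles shape the proof. A graph may have exponentially many thetas; their absence
  becomes an identity between bilinear forms over GF(2), which has to be tested on a basis of the
  cycle space only. And the input shows only the line graph, whose root graph is not unique: a
  triangle and a star of three edges have the same line graph. So ends of edges are coded by
  numbers, and equality of codes is expressed by adjacency, on components large enough for triangles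
  to be recognised. All graph arguments concern edge sets and their boundary modulo 2. A circuit is
  a minimal nonempty set without boundary; a path from \<open>u\<close> to \<open>v\<close> is
  replaced by a join, a set with boundary \<open>{u} \<triangle> {v}\<close>; blocks appear as
  classes of circuits linked by common edges. The recurring device is exchange: if \<open>W\<close>
  meets \<open>C\<close> and \<open>W - C\<close> is minimal, then \<open>W \<triangle> C\<close> is
  a single circuit. Programs are compiled from formulas, so that correctness of a program is truth
  of a formula and the time bound follows from syntax alone.\<close>

definition sdiff :: "'a set \<Rightarrow> 'a set \<Rightarrow> 'a set" (infixl "\<triangle>" 65) where
  "A \<triangle> B = (A - B) \<union> (B - A)"

lemma mem_sdiff [simp]: "x \<in> A \<triangle> B \<longleftrightarrow> (x \<in> A) \<noteq> (x \<in> B)"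
  by (auto simp: sdiff_def)

lemma sdiff_empty [simp]: "A \<triangle> {} = A" "{} \<triangle> A = A" "A \<triangle> A = {}"
  by (auto simp: sdiff_def)

lemma sdiff_eq_empty [simp]: "A \<triangle> B = {} \<longleftrightarrow> A = B"
  by (auto simp: sdiff_def)

lemma sdiff_assoc: "A \<triangle> B \<triangle> C = A \<triangle> (B \<triangle> C)"
  by (auto simp: set_eq_iff)

lemma finite_sdiff [simp]: "finite A \<Longrightarrow> finite B \<Longrightarrow> finite (A \<triangle> B)"
  by (auto simp: sdiff_def)

lemma sdiff_subset: "A \<subseteq> C \<Longrightarrow> B \<subseteq> C \<Longrightarrow> A \<triangle> B \<subseteq> C"
  by (auto simp: sdiff_def)

lemma sdiff_Int: "(A \<triangle> B) \<inter> C = (A \<inter> C) \<triangle> (B \<inter> C)"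
  by (auto simp: sdiff_def)

text \<open>The closing step of the exchange arguments: outside \<open>X\<close>, both
  \<open>D\<close> and \<open>X \<triangle> B\<close> agree with \<open>B\<close>, so whatever
  \<open>D\<close> leaves over lies in \<open>X\<close>.\<close>

lemma sdiff_rest:
  assumes "D - X = B - X"
  shows "X \<triangle> B - D \<subseteq> X" "B \<triangle> X - D \<subseteq> X"
  using assms unfolding sdiff_def by blast+

lemma card_sdiff:
  assumes "finite A" "finite B"
  shows "card (A \<triangle> B) + 2 * card (A \<inter> B) = card A + card B"
proof -
  have "card (A \<triangle> B) = card (A - B) + card (B - A)"
    unfolding sdiff_def using assms by (intro card_Un_disjoint) auto
  moreover have "card A = card (A - B) + card (A \<inter> B)" "card B = card (B - A) + card (A \<inter> B)"
    using assms by (metis card_Diff_subset_Int Int_commute card_mono finite_Int inf.cobounded1 le_add_diff_inverse2)+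
  ultimately show ?thesis by simp
qed

lemma even_card_sdiff:
  assumes "finite A" "finite B"
  shows "even (card (A \<triangle> B)) \<longleftrightarrow> (even (card A) \<longleftrightarrow> even (card B))"
proof -
  have "even (card (A \<triangle> B) + 2 * card (A \<inter> B)) \<longleftrightarrow> even (card A + card B)"
    using card_sdiff[OF assms] by simp
  then show ?thesis by simp
qed

lemma obtain_min:
  fixes m :: "'a \<Rightarrow> nat"
  assumes "P k"
  obtains x where "P x" "\<And>y. P y \<Longrightarrow> m x \<le> m y"
  using ex_has_least_nat[of P k m] assms by blast

locale multi =
  fixes F :: "'e set" and ends :: "'e \<Rightarrow> 'w set"
  assumes finF: "finite F" and ends2: "e \<in> F \<Longrightarrow> card (ends e) = 2"
begin

definition deg :: "'e set \<Rightarrow> 'w \<Rightarrow> nat" where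
  "deg A v = card {e \<in> A. v \<in> ends e}"

definition bd :: "'e set \<Rightarrow> 'w set" where
  "bd A = {v. odd (deg A v)}"

definition verts :: "'e set \<Rightarrow> 'w set" where
  "verts A = (\<Union>e\<in>A. ends e)"

definition joined :: "'e set \<Rightarrow> 'w \<Rightarrow> 'w \<Rightarrow> bool" where
  "joined S u v \<longleftrightarrow> (u, v) \<in> {(x, y). \<exists>e\<in>S. ends e = {x, y}}\<^sup>*"

definition circ :: "'e set \<Rightarrow> bool" where
  "circ C \<longleftrightarrow> C \<noteq> {} \<and> bd C = {} \<and> (\<forall>A\<subseteq>C. bd A = {} \<longrightarrow> A = {} \<or> A = C)"

text \<open>\<open>theta C P\<close>: the set \<open>P\<close> is (the edge set of) a path with both ends, but no edge and no interior
  vertex, on the circuit \<open>C\<close>. The case excluded in \<open>bad\<close> is a triangle with a doubled edge, whose line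
  graph is complete.\<close>

definition theta :: "'e set \<Rightarrow> 'e set \<Rightarrow> bool" where
  "theta C P \<longleftrightarrow> circ C \<and> P \<inter> C = {} \<and> P \<noteq> {} \<and> bd P \<noteq> {} \<and> (\<exists>A\<subseteq>C. bd (A \<union> P) = {}) \<and>
     (\<forall>z\<subseteq>C \<union> P. bd z = {} \<longrightarrow> z \<inter> P = {} \<or> P \<subseteq> z)"

definition bad :: "'e set \<Rightarrow> 'e set \<Rightarrow> bool" where
  "bad C P \<longleftrightarrow> theta C P \<and> odd (card C) \<and> odd (card P) \<and> card C + card P \<noteq> 4"

text \<open>On circuits within \<open>F\<close>, the classes correspond to the blocks of the graph;
  this avoids any talk of cut vertices.\<close>

definition linked :: "'e set \<Rightarrow> 'e set \<Rightarrow> bool" where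
  "linked X Y \<longleftrightarrow>
     (X, Y) \<in> {(A, B). circ A \<and> circ B \<and> A \<subseteq> F \<and> B \<subseteq> F \<and> A \<inter> B \<noteq> {}}\<^sup>*"

lemma finite_sub: "A \<subseteq> F \<Longrightarrow> finite A"
  using finF finite_subset by blast

lemma ends_obtain:
  assumes "e \<in> F" obtains a b where "ends e = {a, b}" "a \<noteq> b"
  using ends2[OF assms] by (auto simp: card_2_iff)

lemma finite_ends: "e \<in> F \<Longrightarrow> finite (ends e)"
  using ends2 card.infinite by fastforce

lemma other_end:
  assumes "e \<in> F" "v \<in> ends e" obtains w where "ends e = {v, w}" "w \<noteq> v"
  using ends_obtain[OF assms(1)] assms(2) by (metis insert_commute insert_iff singletonD)

lemma bd_empty [simp]: "bd {} = {}"
  by (auto simp: bd_def deg_def)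

lemma bd_sdiff:
  assumes "A \<subseteq> F" "B \<subseteq> F"
  shows "bd (A \<triangle> B) = bd A \<triangle> bd B"
proof -
  have "even (deg (A \<triangle> B) v) \<longleftrightarrow> (even (deg A v) \<longleftrightarrow> even (deg B v))" for v
  proof -
    have "{e \<in> A \<triangle> B. v \<in> ends e} = {e \<in> A. v \<in> ends e} \<triangle> {e \<in> B. v \<in> ends e}"
      by auto
    then show ?thesis
      unfolding deg_def using assms by (simp add: even_card_sdiff finite_sub)
  qed
  then show ?thesis unfolding set_eq_iff bd_def mem_sdiff mem_Collect_eq by metis
qed

lemma bd_Un:
  assumes "A \<subseteq> F" "B \<subseteq> F" "A \<inter> B = {}"
  shows "bd (A \<union> B) = bd A \<triangle> bd B"
proof -
  have "A \<union> B = A \<triangle> B" using assms(3) by auto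
  then show ?thesis using bd_sdiff assms by simp
qed

lemma bd_Diff:
  assumes "A \<subseteq> F" "B \<subseteq> A"
  shows "bd (A - B) = bd A \<triangle> bd B"
proof -
  have "A - B = A \<triangle> B" using assms(2) by auto
  then show ?thesis using bd_sdiff assms by (metis subset_trans)
qed

lemma deg_single: "deg {e} v = (if v \<in> ends e then 1 else 0)"
proof -
  have "{f \<in> {e}. v \<in> ends f} = (if v \<in> ends e then {e} else {})" by auto
  then show ?thesis by (simp add: deg_def)
qed

lemma bd_single: "bd {e} = ends e"
  by (auto simp: bd_def deg_single)

lemma deg_mono: "A \<subseteq> B \<Longrightarrow> B \<subseteq> F \<Longrightarrow> deg A v \<le> deg B v"
  unfolding deg_def by (intro card_mono) (auto dest: finite_sub)

lemma deg_Un: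
  assumes "A \<subseteq> F" "B \<subseteq> F" "A \<inter> B = {}"
  shows "deg (A \<union> B) v = deg A v + deg B v"
proof -
  have "{e \<in> A \<union> B. v \<in> ends e} = {e \<in> A. v \<in> ends e} \<union> {e \<in> B. v \<in> ends e}" by auto
  then show ?thesis unfolding deg_def
    using assms by (simp add: card_Un_disjoint finite_sub disjoint_iff)
qed

lemma deg_zero_iff: "A \<subseteq> F \<Longrightarrow> deg A v = 0 \<longleftrightarrow> v \<notin> verts A"
  by (auto simp: deg_def verts_def dest: finite_sub)

lemma finite_verts: "A \<subseteq> F \<Longrightarrow> finite (verts A)"
  unfolding verts_def using finite_sub finite_ends by blast

lemma verts_mono: "A \<subseteq> B \<Longrightarrow> verts A \<subseteq> verts B"
  by (auto simp: verts_def)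

lemma bd_subset_verts: "A \<subseteq> F \<Longrightarrow> bd A \<subseteq> verts A"
  using deg_zero_iff[of A] by (force simp: bd_def)

lemma sum_deg:
  assumes "A \<subseteq> F" "finite X"
  shows "(\<Sum>v\<in>X. deg A v) = (\<Sum>e\<in>A. card (ends e \<inter> X))"
proof -
  have "(\<Sum>v\<in>X. deg A v) = (\<Sum>v\<in>X. \<Sum>e\<in>A. if v \<in> ends e then 1 else 0)"
    unfolding deg_def using finite_sub[OF assms(1)] by (simp flip: sum.inter_filter)
  also have "\<dots> = (\<Sum>e\<in>A. \<Sum>v\<in>X. if v \<in> ends e then 1 else 0)"
    by (rule sum.swap)
  also have "\<dots> = (\<Sum>e\<in>A. card (ends e \<inter> X))"
  proof (rule sum.cong)
    fix e
    have "{v \<in> X. v \<in> ends e} = ends e \<inter> X" by auto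
    then show "(\<Sum>v\<in>X. if v \<in> ends e then 1 else 0) = card (ends e \<inter> X)"
      using assms(2) by (simp flip: sum.inter_filter)
  qed simp
  finally show ?thesis .
qed

lemma sum_deg_verts:
  assumes "A \<subseteq> F" "finite X" "verts A \<subseteq> X"
  shows "(\<Sum>v\<in>X. deg A v) = 2 * card A"
proof -
  have "card (ends e \<inter> X) = 2" if "e \<in> A" for e
    using that assms ends2 by (metis Int_absorb2 UN_I in_mono subsetI verts_def)
  then show ?thesis using sum_deg[OF assms(1,2)] by simp
qed

text \<open>Incidences between \<open>A\<close> and \<open>X\<close> are counted twice: modulo 2 the
  degrees count the boundary vertices in \<open>X\<close>, and an edge counts iff exactly one of its
  ends lies in \<open>X\<close>.\<close>

lemma handshake:
  assumes "A \<subseteq> F" "finite X"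
  shows "even (card (X \<inter> bd A)) \<longleftrightarrow> even (card {e \<in> A. card (ends e \<inter> X) = 1})"
proof -
  have "even (\<Sum>v\<in>X. deg A v) \<longleftrightarrow> even (card {v \<in> X. odd (deg A v)})"
    using assms(2) by (rule even_sum_iff)
  moreover have "{v \<in> X. odd (deg A v)} = X \<inter> bd A" by (auto simp: bd_def)
  moreover have "even (\<Sum>e\<in>A. card (ends e \<inter> X)) \<longleftrightarrow> even (card {e \<in> A. odd (card (ends e \<inter> X))})"
    using finite_sub[OF assms(1)] by (rule even_sum_iff)
  moreover have "{e \<in> A. odd (card (ends e \<inter> X))} = {e \<in> A. card (ends e \<inter> X) = 1}"
  proof -
    have "odd (card (ends e \<inter> X)) \<longleftrightarrow> card (ends e \<inter> X) = 1" if "e \<in> A" for e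
    proof -
      have "card (ends e \<inter> X) \<le> 2"
        using that assms(1) ends2 finite_ends by (metis card_mono inf.cobounded1 subsetD)
      then have "card (ends e \<inter> X) \<in> {0,1,2}" by auto
      then show ?thesis by auto
    qed
    then show ?thesis by auto
  qed
  ultimately show ?thesis using sum_deg[OF assms] by simp
qed

lemma handshake_closed:
  assumes "A \<subseteq> F" "finite X" "\<And>e. e \<in> A \<Longrightarrow> ends e \<subseteq> X \<or> ends e \<inter> X = {}"
  shows "even (card (X \<inter> bd A))"
proof -
  have "card (ends e \<inter> X) \<noteq> 1" if "e \<in> A" for e
    using assms(3)[OF that] ends2[of e] that assms(1) by (auto simp: Int_absorb2)
  then have "{e \<in> A. card (ends e \<inter> X) = 1} = {}" by auto
  then show ?thesis using handshake[OF assms(1,2)] by (metis card.empty even_zero)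
qed

lemma even_card_bd: "A \<subseteq> F \<Longrightarrow> even (card (bd A))"
  using handshake_closed[of A "verts A"] bd_subset_verts[of A] finite_verts[of A]
  by (metis Int_absorb1 UN_upper verts_def)

section \<open>Joins as a substitute for paths\<close>

lemma joined_refl [simp]: "joined S u u"
  by (simp add: joined_def)

lemma joined_trans: "joined S u v \<Longrightarrow> joined S v w \<Longrightarrow> joined S u w"
  unfolding joined_def by (rule rtrancl_trans)

lemma joined_sym: "joined S u v \<Longrightarrow> joined S v u"
  unfolding joined_def
  by (rule symD[OF sym_rtrancl]) (auto intro!: symI simp: insert_commute)

lemma joined_edge: "e \<in> S \<Longrightarrow> ends e = {u, v} \<Longrightarrow> joined S u v"
  unfolding joined_def by blast

lemma joined_ends: "e \<in> S \<Longrightarrow> e \<in> F \<Longrightarrow> u \<in> ends e \<Longrightarrow> v \<in> ends e \<Longrightarrow> joined S u v"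
  by (metis joined_edge joined_refl other_end insertE singletonD)

lemma joined_mono: "joined S u v \<Longrightarrow> S \<subseteq> T \<Longrightarrow> joined T u v"
  unfolding joined_def by (erule rtrancl_mono[THEN subsetD, rotated]) auto

lemma joined_induct [consumes 1, case_names base step]:
  assumes "joined S u v" "P u"
    "\<And>x y e. joined S u x \<Longrightarrow> P x \<Longrightarrow> e \<in> S \<Longrightarrow> ends e = {x, y} \<Longrightarrow> P y"
  shows "P v"
  using assms(1) unfolding joined_def
proof (induction rule: rtrancl_induct)
  case base then show ?case by (rule assms(2))
next
  case (step y z)
  then show ?case using assms(3)[of y _ z] by (auto simp: joined_def)
qed

lemma joined_imp_join:
  assumes "joined S u v" "S \<subseteq> F"
  shows "\<exists>A\<subseteq>S. bd A = {u} \<triangle> {v}"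
  using assms(1)
proof (induction rule: joined_induct)
  case base
  then show ?case by (intro exI[of _ "{}"]) simp
next
  case (step x y e)
  then obtain A where A: "A \<subseteq> S" "bd A = {u} \<triangle> {x}" by blast
  have "card (ends e) = 2" using step assms(2) ends2 by blast
  then have "x \<noteq> y" using step by auto
  then have "bd (A \<triangle> {e}) = {u} \<triangle> {y}"
    using A step assms(2) by (subst bd_sdiff) (auto simp: bd_single)
  then show ?case using A step by (intro exI[of _ "A \<triangle> {e}"]) (auto simp: sdiff_def)
qed

text \<open>No edge of \<open>A\<close> leaves the component of \<open>u\<close>, so this component
  contains an even number of boundary vertices, hence \<open>v\<close> besides
  \<open>u\<close>.\<close>

lemma join_imp_joined:
  assumes "A \<subseteq> F" "bd A = {u} \<triangle> {v}"
  shows "joined A u v"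
proof (rule ccontr)
  assume n: "\<not> joined A u v"
  let ?X = "{x \<in> insert u (verts A). joined A u x}"
  have "ends e \<subseteq> ?X \<or> ends e \<inter> ?X = {}" if "e \<in> A" for e
    using that assms(1) joined_ends[of e A] joined_trans
    by (smt (verit, ccfv_threshold) UN_I disjoint_iff insertCI mem_Collect_eq subset_iff verts_def)
  then have "even (card (?X \<inter> bd A))"
    using assms(1) finite_verts by (intro handshake_closed) auto
  moreover have "u \<noteq> v" using n by auto
  then have "?X \<inter> bd A = {u}" unfolding assms(2) using n by auto
  ultimately show False by simp
qed

lemma joined_in_verts:
  assumes "joined S u v" "u \<noteq> v"
  shows "v \<in> verts S"
  using assms unfolding joined_def
  by (cases rule: rtranclE) (auto simp: verts_def)

lemma joined_other_bd:
  assumes "A \<subseteq> F" "u \<in> bd A"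
  obtains v where "v \<in> bd A" "v \<noteq> u" "joined A u v"
proof -
  let ?X = "{x \<in> verts A. joined A u x}"
  have "ends e \<subseteq> ?X \<or> ends e \<inter> ?X = {}" if "e \<in> A" for e
    using that assms(1) joined_ends[of e A] joined_trans
    by (smt (verit, ccfv_threshold) UN_I disjoint_iff mem_Collect_eq subset_iff verts_def)
  then have "even (card (?X \<inter> bd A))"
    using assms(1) finite_verts by (intro handshake_closed) auto
  moreover have "u \<in> ?X \<inter> bd A" using assms bd_subset_verts by auto
  ultimately have "?X \<inter> bd A \<noteq> {u}" by auto
  with \<open>u \<in> ?X \<inter> bd A\<close> show ?thesis using that by auto
qed

text \<open>Joins from \<open>v\<close> to all members of \<open>X\<close> are added up; an odd
  number of them leaves \<open>v\<close> over.\<close>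

lemma join_even_set:
  assumes "S \<subseteq> F" "finite X" "\<And>x. x \<in> X \<Longrightarrow> joined S v x"
  shows "\<exists>J\<subseteq>S. bd J = X \<triangle> (if even (card X) then {} else {v})"
  using assms(2,3)
proof (induction X)
  case empty
  then show ?case by (intro exI[of _ "{}"]) simp
next
  case (insert x X)
  then obtain J where J: "J \<subseteq> S" "bd J = X \<triangle> (if even (card X) then {} else {v})" by auto
  obtain A where A: "A \<subseteq> S" "bd A = {v} \<triangle> {x}"
    using joined_imp_join[of S v x] insert assms(1) by auto
  have "bd (J \<triangle> A) = insert x X \<triangle> (if even (card (insert x X)) then {} else {v})"
    using J A assms(1) insert(1,2) by (subst bd_sdiff) (auto split: if_splits)
  moreover have "J \<triangle> A \<subseteq> S" using J A by (simp add: sdiff_subset)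
  ultimately show ?case by blast
qed

subsection \<open>Circuits\<close>

lemma circD:
  assumes "circ C"
  shows "C \<noteq> {}" "bd C = {}" "\<And>A. A \<subseteq> C \<Longrightarrow> bd A = {} \<Longrightarrow> A = {} \<or> A = C"
  using assms by (auto simp: circ_def)

lemma circ_in_cycle:
  assumes "A \<subseteq> F" "bd A = {}" "e \<in> A"
  obtains D where "circ D" "e \<in> D" "D \<subseteq> A"
proof -
  let ?P = "\<lambda>D. e \<in> D \<and> bd D = {} \<and> D \<subseteq> A"
  obtain D where D: "?P D" and min: "\<And>B. ?P B \<Longrightarrow> card D \<le> card B"
    by (rule obtain_min[of ?P A]) (use assms in blast, rule that)
  have fD: "D \<subseteq> F" using D assms(1) by blast
  have "B = {} \<or> B = D" if B: "B \<subseteq> D" "bd B = {}" for B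
  proof (rule ccontr)
    assume n: "\<not> ?thesis"
    have "bd (D - B) = {}" using bd_Diff[OF fD B(1)] D B by simp
    then have "?P B \<or> ?P (D - B)" using B D by auto
    moreover have "card B < card D" "card (D - B) < card D"
      using n B finite_sub[OF fD] by (auto intro!: psubset_card_mono)
    ultimately show False using min by (meson not_le)
  qed
  then have "circ D" using D by (auto simp: circ_def)
  then show ?thesis using that D by blast
qed

text \<open>A cycle is a disjoint union of circuits: splitting off a circuit that meets
  \<open>X\<close> evenly leaves a smaller cycle that still meets it oddly.\<close>

lemma odd_circ:
  assumes "A \<subseteq> F" "bd A = {}" "odd (card (A \<inter> X))"
  obtains D where "circ D" "D \<subseteq> A" "odd (card (D \<inter> X))"
proof -
  have "\<exists>D. circ D \<and> D \<subseteq> A \<and> odd (card (D \<inter> X))"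
    using assms
  proof (induction "card A" arbitrary: A rule: less_induct)
    case less
    then have "A \<noteq> {}" by auto
    then obtain e where "e \<in> A" by auto
    then obtain D where D: "circ D" "e \<in> D" "D \<subseteq> A"
      using circ_in_cycle less.prems by metis
    show ?case
    proof (cases "odd (card (D \<inter> X))")
      case False
      have fA: "finite A" using less.prems finite_sub by blast
      have "A \<inter> X = (D \<inter> X) \<triangle> ((A - D) \<inter> X)" using D by auto
      then have "odd (card ((A - D) \<inter> X))"
        using False less.prems fA D(3)
        by (metis even_card_sdiff finite_Diff finite_Int finite_subset)
      moreover have "bd (A - D) = {}"
        using D less.prems circD(2) by (subst bd_Diff) auto
      moreover have "card (A - D) < card A"
        using D fA \<open>e \<in> A\<close> by (intro psubset_card_mono) auto
      ultimately obtain D' where "circ D'" "D' \<subseteq> A - D" "odd (card (D' \<inter> X))"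
        using less.hyps[of "A - D"] less.prems by blast
      then show ?thesis by blast
    qed (use D in auto)
  qed
  then show ?thesis using that by blast
qed

section \<open>Exchange arguments and blocks\<close>

lemma circ_not_psubset: "circ C \<Longrightarrow> circ D \<Longrightarrow> C \<subseteq> D \<Longrightarrow> C = D"
  using circD(1,2)[of C] circD(3)[of D C] by blast

text \<open>By exchange, for a circuit \<open>B\<close> with \<open>B - X\<close> minimal.\<close>

lemma link_step:
  assumes "circ X" "d \<in> X" "X \<subseteq> F" "circ B" "B \<subseteq> F" "X \<inter> B \<noteq> {}" "circ C" "C \<inter> B \<noteq> {}"
  obtains D where "circ D" "D \<subseteq> F" "d \<in> D" "D \<inter> C \<noteq> {}"
proof (cases "X \<inter> C = {}")
  case True
  let ?P = "\<lambda>B. circ B \<and> B \<subseteq> F \<and> X \<inter> B \<noteq> {} \<and> C \<inter> B \<noteq> {}"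
  have P0: "?P B" using assms by simp
  obtain B where B: "?P B" and min: "\<And>B'. ?P B' \<Longrightarrow> card (B - X) \<le> card (B' - X)"
    by (rule obtain_min[of ?P, OF P0]) (rule that)
  obtain c where c: "c \<in> C" "c \<in> B" using B by auto
  have XB: "bd (X \<triangle> B) = {}" "X \<triangle> B \<subseteq> F" "c \<in> X \<triangle> B"
    using B assms c True by (auto simp: bd_sdiff circD(2) sdiff_subset)
  then obtain D where D: "circ D" "c \<in> D" "D \<subseteq> X \<triangle> B"
    using circ_in_cycle by metis
  have DF: "D \<subseteq> F" using D XB by blast
  have "\<not> D \<subseteq> B" using B D circ_not_psubset[of D B] by auto
  then have "D \<inter> X \<noteq> {}" using D(3) by (auto simp: subset_iff)
  then have "card (B - X) \<le> card (D - X)" using min[of D] D DF c by blast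
  moreover have "D - X \<subseteq> B - X" using D(3) by (auto simp: subset_iff)
  ultimately have eq: "D - X = B - X"
    using B finite_sub by (meson card_seteq finite_Diff)
  show ?thesis
  proof (cases "d \<in> D")
    case True
    then show ?thesis using that[of D] D DF c by blast
  next
    case False
    show ?thesis
    proof (cases "d \<in> B")
      case True
      then show ?thesis using that[of B] B by blast
    next
      case dB: False
      \<comment> \<open>The rest is a cycle inside the circuit \<open>X\<close> and contains
        \<open>d\<close>, so it is all of \<open>X\<close>; then \<open>X\<close> and
        \<open>B\<close> would be disjoint.\<close>
      let ?R = "(X \<triangle> B) - D"
      have "bd ?R = {}" using XB D circD(2) by (subst bd_Diff) auto
      moreover have "?R \<subseteq> X" using sdiff_rest[OF eq] by blast
      ultimately have "?R = {} \<or> ?R = X" using circD(3)[OF assms(1)] by blast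
      moreover have "d \<in> ?R" using False dB assms by auto
      ultimately have "?R = X" by auto
      then have "X \<inter> B = {}" by auto
      then show ?thesis using B by blast
    qed
  qed
next
  case False
  then show ?thesis using that[of X] assms by blast
qed

lemma linked_refl [simp]: "linked X X"
  by (simp add: linked_def)

lemma linked_trans: "linked X Y \<Longrightarrow> linked Y Z \<Longrightarrow> linked X Z"
  unfolding linked_def by (rule rtrancl_trans)

lemma linked_sym: "linked X Y \<Longrightarrow> linked Y X"
  unfolding linked_def by (rule symD[OF sym_rtrancl]) (simp_all add: sym_def Int_commute)

lemma linked_meet:
  "circ X \<Longrightarrow> circ Y \<Longrightarrow> X \<subseteq> F \<Longrightarrow> Y \<subseteq> F \<Longrightarrow> X \<inter> Y \<noteq> {} \<Longrightarrow> linked X Y"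
  unfolding linked_def by (rule r_into_rtrancl) simp

text \<open>A circuit through \<open>d\<close> is pushed along the chain by
  \<open>link_step\<close>, so that a single circuit through \<open>d\<close> reaches the last
  member.\<close>

lemma linked_through:
  assumes "linked X Y" "circ X" "X \<subseteq> F" "d \<in> X"
  obtains D where "circ D" "D \<subseteq> F" "d \<in> D" "D \<inter> Y \<noteq> {}"
proof -
  have "\<exists>D. circ D \<and> D \<subseteq> F \<and> d \<in> D \<and> D \<inter> Y \<noteq> {}"
    using assms(1) unfolding linked_def
  proof (induction rule: rtrancl_induct)
    case base
    then show ?case using assms by (intro exI[of _ X]) auto
  next
    case (step Y Z)
    then obtain D where D: "circ D" "D \<subseteq> F" "d \<in> D" "D \<inter> Y \<noteq> {}" by blast
    have Z: "circ Y" "Y \<subseteq> F" "circ Z" "Z \<inter> Y \<noteq> {}" using step(2) by auto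
    show ?case
      by (rule link_step[OF D(1) D(3) D(2) Z(1,2) D(4) Z(3,4)]) (intro exI conjI)
  qed
  then show ?thesis using that by blast
qed

text \<open>Consider the cycles that meet \<open>X\<close> oddly and whose edges outside
  \<open>C\<close> belong to \<open>W\<close>, and take one whose part outside \<open>C\<close> is
  smallest. This part is an ear of \<open>C\<close>: a cycle splitting it would write
  \<open>z\<close> as a sum of two cycles with smaller parts, one of which meets \<open>X\<close>
  oddly. So \<open>th\<close> applies to it.\<close>

lemma theta_minimal:
  assumes "circ C" "C \<subseteq> F" "X \<inter> C = {}"
    and th: "\<And>P. theta C P \<Longrightarrow> P \<subseteq> F \<Longrightarrow> even (card (P \<inter> X))"
    and W: "circ W" "W \<subseteq> F" "W \<inter> C \<noteq> {}"
  shows "even (card (W \<inter> X))"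
proof (rule ccontr)
  assume odd: "odd (card (W \<inter> X))"
  let ?Q = "\<lambda>z. z \<subseteq> F \<and> bd z = {} \<and> z - C \<subseteq> W - C \<and> odd (card (z \<inter> X))"
  have Q0: "?Q W" using odd W circD(2)[OF W(1)] by simp
  obtain z where z: "?Q z" and min: "\<And>z'. ?Q z' \<Longrightarrow> card (z - C) \<le> card (z' - C)"
    by (rule obtain_min[of ?Q, OF Q0]) (rule that)
  let ?P = "z - C"
  have Pne: "?P \<noteq> {}"
  proof
    assume "?P = {}"
    then have "z \<inter> X = {}" using assms(3) by blast
    then show False using z by simp
  qed
  have PF: "?P \<subseteq> F" "finite (W - C)" using z W finite_sub by auto
  have "bd ?P \<noteq> {}"
  proof
    assume "bd ?P = {}"
    \<comment> \<open>A nonempty cycle inside the circuit \<open>W\<close> is all of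
      \<open>W\<close>; but \<open>W\<close> meets \<open>C\<close> and \<open>?P\<close> does
      not.\<close>
    then have "?P = W" using circD(3)[OF W(1), of ?P] z Pne by blast
    then show False using W(3) by blast
  qed
  moreover have "bd (z \<inter> C \<union> ?P) = {}"
    using z by (simp add: Int_Diff_Un)
  moreover have "z' \<inter> ?P = {} \<or> ?P \<subseteq> z'" if z': "z' \<subseteq> C \<union> ?P" "bd z' = {}" for z'
  proof (rule ccontr)
    assume n: "\<not> ?thesis"
    have z'F: "z' \<subseteq> F" using z' z assms(2) by blast
    let ?y = "z \<triangle> z'"
    have y: "?y \<subseteq> F" "bd ?y = {}" using z z'F z' by (auto simp: bd_sdiff sdiff_subset)
    have "z \<inter> X = (z' \<inter> X) \<triangle> (?y \<inter> X)" by auto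
    then have "odd (card (z' \<inter> X)) \<or> odd (card (?y \<inter> X))"
      using z z'F y finite_sub by (metis even_card_sdiff finite_Int)
    moreover have "z' - C \<subset> ?P" "?y - C \<subset> ?P" using z' n by auto
    moreover have "finite ?P" using z finite_sub by blast
    ultimately show False
      using min[of z'] min[of ?y] z z'F z' y psubset_card_mono
      by (smt (verit) not_le order_trans psubset_imp_subset)
  qed
  ultimately have "theta C ?P"
    unfolding theta_def using assms(1) Pne by blast
  then have "even (card (?P \<inter> X))" using th PF by blast
  moreover have "?P \<inter> X = z \<inter> X" using assms(3) by auto
  ultimately show False using z by simp
qed

text \<open>A circuit \<open>y\<close> that
  misses \<open>C\<close> is treated by a circuit \<open>W\<close> meeting both: \<open>W\<close> and \<open>W \<triangle> y\<close> get different weights, and by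
  minimality of \<open>W - y\<close> the latter is a circuit meeting \<open>C\<close>.\<close>

lemma ears_even:
  assumes C: "circ C" "C \<subseteq> F" "X \<inter> C = {}"
    and th: "\<And>P. theta C P \<Longrightarrow> P \<subseteq> F \<Longrightarrow> even (card (P \<inter> X))"
    and y: "circ y" "y \<subseteq> F" "linked C y"
  shows "even (card (y \<inter> X))"
proof (rule ccontr)
  assume odd: "odd (card (y \<inter> X))"
  have meet: "even (card (W \<inter> X))" if "circ W" "W \<subseteq> F" "W \<inter> C \<noteq> {}" for W
    by (rule theta_minimal[OF C _ that]) (rule th)
  have yC: "y \<inter> C = {}" using meet[OF y(1,2)] odd by blast
  obtain c where c: "c \<in> C" using circD(1)[OF C(1)] by blast
  let ?Q = "\<lambda>W. circ W \<and> W \<subseteq> F \<and> W \<inter> C \<noteq> {} \<and> W \<inter> y \<noteq> {}"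
  obtain W0 where "?Q W0"
    using linked_through[OF y(3) C(1,2) c] c by (metis Int_iff empty_iff)
  then obtain W where W: "?Q W" and min: "\<And>W'. ?Q W' \<Longrightarrow> card (W - y) \<le> card (W' - y)"
    by (rule obtain_min[of ?Q]) (rule that)
  obtain c where c: "c \<in> C" "c \<in> W" using W by auto
  have Wy: "bd (W \<triangle> y) = {}" "W \<triangle> y \<subseteq> F" "c \<in> W \<triangle> y"
    using W y c yC by (auto simp: bd_sdiff circD(2) sdiff_subset)
  then obtain D where D: "circ D" "c \<in> D" "D \<subseteq> W \<triangle> y" using circ_in_cycle by metis
  have DF: "D \<subseteq> F" using D Wy by blast
  have "\<not> D \<subseteq> W" using W D circ_not_psubset[of D W] by auto
  then have "D \<inter> y \<noteq> {}" using D(3) by (auto simp: subset_iff)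
  then have "card (W - y) \<le> card (D - y)" using min[of D] D DF c by blast
  moreover have "D - y \<subseteq> W - y" using D(3) by (auto simp: subset_iff)
  ultimately have eq: "D - y = W - y"
    using W finite_sub by (meson card_seteq finite_Diff)
  let ?R = "(W \<triangle> y) - D"
  have "bd ?R = {}" using Wy D circD(2) by (subst bd_Diff) auto
  moreover have "?R \<subseteq> y" using sdiff_rest[OF eq] by blast
  ultimately have "?R = {} \<or> ?R = y" using circD(3)[OF y(1)] by blast
  moreover have "?R \<noteq> y" using W by auto
  ultimately have "D = W \<triangle> y" using D by auto
  then have "D \<inter> X = (W \<inter> X) \<triangle> (y \<inter> X)" by auto
  then have "odd (card (D \<inter> X)) \<or> odd (card (W \<inter> X))"
    using odd W y finite_sub by (metis even_card_sdiff finite_Int)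
  then show False using meet[of D] meet[of W] D DF W c by blast
qed

text \<open>Take a circuit \<open>W\<close> through \<open>d\<close> that meets \<open>C\<close>,
  with \<open>W - C\<close> minimal. If it is even and \<open>d\<close> is not on \<open>C\<close>,
  then by exchange \<open>W \<triangle> C\<close> is a single circuit; it contains \<open>d\<close>
  and is odd.\<close>

lemma odd_circ_through:
  assumes "circ C" "C \<subseteq> F" "odd (card C)" "circ X" "X \<subseteq> F" "d \<in> X" "linked X C"
  obtains D where "circ D" "D \<subseteq> F" "d \<in> D" "odd (card D)"
proof -
  let ?Q = "\<lambda>W. circ W \<and> W \<subseteq> F \<and> d \<in> W \<and> W \<inter> C \<noteq> {}"
  obtain W0 where "?Q W0" using linked_through assms by metis
  then obtain W where W: "?Q W" and min: "\<And>W'. ?Q W' \<Longrightarrow> card (W - C) \<le> card (W' - C)"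
    by (rule obtain_min[of ?Q]) (rule that)
  show ?thesis
  proof (cases "odd (card W) \<or> d \<in> C")
    case True
    then show ?thesis using that[of W] that[of C] W assms by blast
  next
    case False
    have WC: "bd (W \<triangle> C) = {}" "W \<triangle> C \<subseteq> F" "d \<in> W \<triangle> C"
      using W assms False by (auto simp: bd_sdiff circD(2) sdiff_subset)
    then obtain D where D: "circ D" "d \<in> D" "D \<subseteq> W \<triangle> C" using circ_in_cycle by metis
    have DF: "D \<subseteq> F" using D WC by blast
    have "\<not> D \<subseteq> W" using W D circ_not_psubset[of D W] by auto
    then have "D \<inter> C \<noteq> {}" using D(3) by (auto simp: subset_iff)
    then have "card (W - C) \<le> card (D - C)" using min[of D] D DF by blast
    moreover have "D - C \<subseteq> W - C" using D(3) by (auto simp: subset_iff)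
    ultimately have eq: "D - C = W - C"
      using W finite_sub by (meson card_seteq finite_Diff)
    let ?R = "(W \<triangle> C) - D"
    have "bd ?R = {}" using WC D circD(2) by (subst bd_Diff) auto
    moreover have "?R \<subseteq> C" using sdiff_rest[OF eq] by blast
    ultimately have "?R = {} \<or> ?R = C" using circD(3)[OF assms(1)] by blast
    moreover have "?R \<noteq> C" using W by auto
    ultimately have "D = W \<triangle> C" using D by auto
    then have "odd (card D)"
      using False assms W even_card_sdiff[of W C] finite_sub by auto
    then show ?thesis using that D DF by blast
  qed
qed

text \<open>Some odd circuit meets \<open>Z\<close>. If \<open>X\<close> is one with
  \<open>X - Z\<close> smallest, then an odd circuit contained in \<open>X \<triangle> Z\<close>
  exhausts it. So \<open>Z\<close> is the sum of two odd circuits that both meet it, which reduces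
  parities for even circuits to parities for odd ones.\<close>

lemma even_circ_split:
  assumes "circ C" "C \<subseteq> F" "odd (card C)" "circ Z" "Z \<subseteq> F" "linked Z C" "even (card Z)"
  obtains X where "circ X" "X \<subseteq> F" "odd (card X)" "X \<inter> Z \<noteq> {}"
    "circ (X \<triangle> Z)" "odd (card (X \<triangle> Z))" "(X \<triangle> Z) \<inter> Z \<noteq> {}"
proof -
  let ?Q = "\<lambda>W. circ W \<and> W \<subseteq> F \<and> odd (card W) \<and> W \<inter> Z \<noteq> {}"
  obtain d where "d \<in> Z" using circD(1)[OF assms(4)] by blast
  then obtain W0 where "?Q W0" using odd_circ_through[OF assms(1-5)] assms(6)
    by (metis Int_iff empty_iff)
  then obtain X where X: "?Q X" and min: "\<And>X'. ?Q X' \<Longrightarrow> card (X - Z) \<le> card (X' - Z)"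
    by (rule obtain_min[of ?Q]) (rule that)
  have XZ: "bd (X \<triangle> Z) = {}" "X \<triangle> Z \<subseteq> F" "odd (card ((X \<triangle> Z) \<inter> UNIV))"
    using X assms even_card_sdiff[of X Z] finite_sub by (auto simp: bd_sdiff circD(2) sdiff_subset)
  obtain D where D: "circ D" "D \<subseteq> X \<triangle> Z" "odd (card D)"
    using odd_circ[OF XZ(2,1,3)] by auto
  have DF: "D \<subseteq> F" using D XZ by blast
  have "\<not> D \<subseteq> X"
  proof
    assume "D \<subseteq> X"
    then have "D = X" using circ_not_psubset D X by blast
    then show False using D X by auto
  qed
  then have DZ: "D \<inter> Z \<noteq> {}" using D(2) by (auto simp: subset_iff)
  then have "card (X - Z) \<le> card (D - Z)" using min[of D] D DF by blast
  moreover have "D - Z \<subseteq> X - Z" using D(2) by (auto simp: subset_iff)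
  ultimately have eq: "D - Z = X - Z"
    using X finite_sub by (meson card_seteq finite_Diff)
  let ?R = "(X \<triangle> Z) - D"
  have "bd ?R = {}" using XZ D circD(2) by (subst bd_Diff) auto
  moreover have "?R \<subseteq> Z" using sdiff_rest[OF eq] by blast
  ultimately have "?R = {} \<or> ?R = Z" using circD(3)[OF assms(4)] by blast
  moreover have "?R \<noteq> Z" using X by auto
  ultimately have "D = X \<triangle> Z" using D by auto
  then show ?thesis using that[of X] X D DZ by blast
qed

text \<open>A circuit minus a vertex is connected: the edges of \<open>C\<close> touching the
  component of \<open>x\<close> in \<open>C - u\<close> have even degree everywhere except perhaps
  at \<open>u\<close>. A boundary is never a single vertex, so these edges form a cycle, which is
  all of \<open>C\<close>.\<close>

lemma circ_joined_avoiding: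
  assumes "circ C" "C \<subseteq> F" "x \<in> verts C" "y \<in> verts C" "x \<noteq> u" "y \<noteq> u"
  shows "joined {e \<in> C. u \<notin> ends e} x y"
proof -
  let ?S = "{e \<in> C. u \<notin> ends e}"
  let ?X = "{w \<in> verts C. w \<noteq> u \<and> joined ?S x w}"
  let ?A = "{e \<in> C. ends e \<inter> ?X \<noteq> {}}"
  have AF: "?A \<subseteq> F" using assms by auto
  have inX: "ends e \<subseteq> ?X \<union> {u}" if e: "e \<in> ?A" for e
  proof
    fix w assume w: "w \<in> ends e"
    obtain w' where w': "w' \<in> ends e" "w' \<in> ?X" using e by blast
    have "joined ?S x w" if "w \<noteq> u"
    proof (cases "u \<in> ends e")
      case True
      moreover have "e \<in> F" using e assms(2) by blast
      ultimately have "w = w'" using w w' that by (elim other_end) auto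
      then show ?thesis using w' by simp
    next
      case False
      then show ?thesis
        using w w' e assms(2) joined_ends[of e ?S w' w] joined_trans[of ?S x w' w] by auto
    qed
    then show "w \<in> ?X \<union> {u}" using w e by (auto simp: verts_def)
  qed
  have degX: "deg ?A w = deg C w" if "w \<in> ?X" for w
  proof -
    have "{e \<in> ?A. w \<in> ends e} = {e \<in> C. w \<in> ends e}" using that by auto
    then show ?thesis by (simp add: deg_def)
  qed
  have sub: "bd ?A \<subseteq> {u}"
  proof
    fix w assume w: "w \<in> bd ?A"
    then have "w \<in> verts ?A" using bd_subset_verts AF by auto
    then have "w \<in> ?X \<union> {u}" using inX by (force simp: verts_def)
    moreover have "w \<notin> ?X"
    proof
      assume "w \<in> ?X"
      then have "odd (deg C w)" using w degX by (simp add: bd_def)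
      then show False using circD(2)[OF assms(1)] by (auto simp: bd_def)
    qed
    ultimately show "w \<in> {u}" by blast
  qed
  have "bd ?A \<noteq> {u}"
  proof
    assume "bd ?A = {u}"
    then show False using even_card_bd[OF AF] by simp
  qed
  then have "bd ?A = {}" using sub by (simp only: subset_singleton_iff simp_thms)
  moreover have "?A \<noteq> {}"
  proof -
    obtain e where "e \<in> C" "x \<in> ends e" using assms(3) by (auto simp: verts_def)
    moreover have "x \<in> ?X" using assms(3,5) by simp
    ultimately have "e \<in> ?A" by blast
    then show ?thesis by blast
  qed
  ultimately have "?A = C" using circD(3)[OF assms(1), of ?A] by blast
  moreover obtain e where "e \<in> C" "y \<in> ends e" using assms(4) by (auto simp: verts_def)
  ultimately have "y \<in> ?X \<union> {u}" using inX by blast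
  then show ?thesis using assms(6) by blast
qed

lemma circ_joined:
  assumes "circ C" "C \<subseteq> F" "x \<in> verts C" "y \<in> verts C"
  shows "joined C x y"
proof -
  let ?X = "{w \<in> verts C. joined C x w}"
  let ?A = "{e \<in> C. ends e \<inter> ?X \<noteq> {}}"
  have AF: "?A \<subseteq> F" using assms by auto
  have inX: "ends e \<subseteq> ?X" if e: "e \<in> ?A" for e
  proof
    fix w assume w: "w \<in> ends e"
    obtain w' where "w' \<in> ends e" "joined C x w'" using e by blast
    then show "w \<in> ?X" using w e assms(2) joined_ends[of e C w' w] joined_trans[of C x w' w]
      by (auto simp: verts_def)
  qed
  have "deg ?A w = (if w \<in> ?X then deg C w else 0)" for w
  proof (cases "w \<in> ?X")
    case True
    then have "{e \<in> ?A. w \<in> ends e} = {e \<in> C. w \<in> ends e}" by auto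
    then show ?thesis using True by (simp add: deg_def)
  next
    case False
    then have "w \<notin> verts ?A" using inX by (auto simp: verts_def)
    then have "deg ?A w = 0" using deg_zero_iff[OF AF] by blast
    then show ?thesis using False by (simp only: if_False)
  qed
  moreover have "even (deg C w)" for w using circD(2)[OF assms(1)] by (auto simp: bd_def)
  ultimately have "even (deg ?A w)" for w
    by (cases "w \<in> ?X") (simp_all only: if_True if_False even_zero)
  then have "bd ?A = {}" by (simp only: bd_def Collect_empty_eq) simp
  moreover have "?A \<noteq> {}"
  proof -
    obtain e where "e \<in> C" "x \<in> ends e" using assms(3) by (auto simp: verts_def)
    moreover have "x \<in> ?X" using assms(3) by simp
    ultimately have "e \<in> ?A" by blast
    then show ?thesis by blast
  qed
  ultimately have "?A = C" using circD(3)[OF assms(1), of ?A] by blast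
  moreover obtain e where "e \<in> C" "y \<in> ends e" using assms(4) by (auto simp: verts_def)
  ultimately show ?thesis using inX by blast
qed

text \<open>Two edges at \<open>v\<close>, together with a join of their other ends that avoids
  \<open>v\<close>, form a cycle; by minimality it is all of \<open>C\<close>.\<close>

lemma circ_deg:
  assumes "circ C" "C \<subseteq> F" "v \<in> verts C"
  shows "deg C v = 2"
proof -
  obtain e1 where e1: "e1 \<in> C" "v \<in> ends e1" using assms by (auto simp: verts_def)
  have ev: "even (deg C v)" using circD(2)[OF assms(1)] by (auto simp: bd_def)
  have "{e \<in> C. v \<in> ends e} \<noteq> {e1}" using ev by (auto simp: deg_def)
  then obtain e2 where e2: "e2 \<in> C" "v \<in> ends e2" "e2 \<noteq> e1" using e1 by blast
  obtain x where x: "ends e1 = {v, x}" "x \<noteq> v" using other_end e1 assms by blast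
  obtain y where y: "ends e2 = {v, y}" "y \<noteq> v" using other_end e2 assms by blast
  let ?S = "{e \<in> C. v \<notin> ends e}"
  have "x \<in> verts C" "y \<in> verts C" using x y e1 e2 by (auto simp: verts_def)
  then have "joined ?S x y" using circ_joined_avoiding[OF assms(1,2)] x y by simp
  then obtain J where J: "J \<subseteq> ?S" "bd J = {x} \<triangle> {y}"
    using joined_imp_join[of ?S x y] assms by auto
  have F: "J \<subseteq> F" "{e1, e2} \<subseteq> F" using J e1 e2 assms by auto
  have ee: "{e1, e2} = {e1} \<triangle> {e2}" using e2 by auto
  have b12: "bd {e1, e2} = {x} \<triangle> {y}"
    unfolding ee using F x y by (subst bd_sdiff) (auto simp: bd_single)
  have "bd (J \<union> {e1, e2}) = {}"
  proof -
    have "J \<inter> {e1, e2} = {}" using J e1 e2 by auto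
    then show ?thesis using bd_Un[OF F] J b12 by simp
  qed
  moreover have "J \<union> {e1, e2} \<subseteq> C" using J e1 e2 by auto
  ultimately have "C = J \<union> {e1, e2}" using circD(3)[OF assms(1)] by blast
  then have "{e \<in> C. v \<in> ends e} = {e1, e2}" using J e1 e2 by auto
  then show ?thesis using e2 by (simp add: deg_def)
qed

lemma circ_card_verts:
  assumes "circ C" "C \<subseteq> F"
  shows "card (verts C) = card C"
proof -
  have "(\<Sum>v\<in>verts C. deg C v) = 2 * card C"
    using sum_deg_verts finite_verts assms by blast
  moreover have "(\<Sum>v\<in>verts C. deg C v) = 2 * card (verts C)"
    using circ_deg assms by simp
  ultimately show ?thesis by simp
qed

end

section \<open>Separation and maximal faces\<close>

lemma lookup_scaleR [simp]: "Poly_Mapping.lookup (c *\<^sub>R x) v = c *\<^sub>R Poly_Mapping.lookup x v"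
proof -
  have "finite {i. c *\<^sub>R Poly_Mapping.lookup x i \<noteq> 0}"
    by (rule finite_subset[OF _ finite_lookup[of x]]) auto
  then show ?thesis by (simp add: scaleR_poly_mapping_def lookup_Abs_poly_mapping)
qed

lemma abs_lookup_le_norm: "\<bar>Poly_Mapping.lookup x v\<bar> \<le> norm (x :: 'a \<Rightarrow>\<^sub>0 real)"
proof (cases "v \<in> Poly_Mapping.keys x")
  case True
  then have "\<bar>Poly_Mapping.lookup x v\<bar> \<le> (\<Sum>n\<in>Poly_Mapping.keys x. \<bar>Poly_Mapping.lookup x n\<bar>)"
    by (intro member_le_sum) auto
  then show ?thesis by (simp add: norm_poly_mapping_def dist_poly_mapping_def)
next
  case False
  then show ?thesis by (simp add: in_keys_iff)
qed

lemma continuous_on_lookup: "continuous_on S (\<lambda>x :: 'a \<Rightarrow>\<^sub>0 real. Poly_Mapping.lookup x v)"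
proof -
  have "bounded_linear (\<lambda>x :: 'a \<Rightarrow>\<^sub>0 real. Poly_Mapping.lookup x v)"
    by (rule bounded_linear_intro[of _ 1]) (simp_all add: lookup_add abs_lookup_le_norm)
  then show ?thesis by (rule bounded_linear.continuous_on) (rule continuous_on_id)
qed

lemma convex_keys: "convex {x :: 'a \<Rightarrow>\<^sub>0 real. Poly_Mapping.keys x \<subseteq> V}"
proof (rule convexI)
  fix x y :: "'a \<Rightarrow>\<^sub>0 real" and u v :: real
  assume "x \<in> {x. Poly_Mapping.keys x \<subseteq> V}" "y \<in> {x. Poly_Mapping.keys x \<subseteq> V}"
  then show "u *\<^sub>R x + v *\<^sub>R y \<in> {x. Poly_Mapping.keys x \<subseteq> V}"
    by (auto simp: in_keys_iff lookup_add subset_iff) (metis add_0_right mult_zero_right)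
qed

lemma keys_incidence: "finite M \<Longrightarrow> Poly_Mapping.keys (incidence_vector M) = M"
  by (auto simp: in_keys_iff lookup_incidence_vector split: if_splits)

lemma sum_lookup_incidence:
  assumes "finite V" "M \<subseteq> V"
  shows "(\<Sum>v\<in>V. a v * Poly_Mapping.lookup (incidence_vector M) v) = sum a M"
proof -
  have fM: "finite M" using assms finite_subset by blast
  have "(\<Sum>v\<in>V. a v * Poly_Mapping.lookup (incidence_vector M) v) = (\<Sum>v\<in>V. if v \<in> M then a v else 0)"
    by (rule sum.cong) (simp_all add: lookup_incidence_vector fM)
  also have "\<dots> = sum a M" using assms by (simp add: sum.inter_restrict[symmetric] Int_absorb1)
  finally show ?thesis .
qed

text \<open>The separating functional is \<open>z - p\<close> for the point \<open>p\<close> of the polytope nearest to \<open>z\<close>.\<close>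

lemma separate_from_hull:
  fixes z :: "'a \<Rightarrow>\<^sub>0 real"
  assumes V: "finite V" and MM: "MM \<subseteq> Pow V" "MM \<noteq> {}"
    and z: "Poly_Mapping.keys z \<subseteq> V" "z \<notin> convex hull (incidence_vector ` MM)"
  obtains a :: "'a \<Rightarrow> real"
  where "\<And>M. M \<in> MM \<Longrightarrow> sum a M < (\<Sum>v\<in>V. a v * Poly_Mapping.lookup z v)"
proof -
  let ?K = "convex hull (incidence_vector ` MM) :: ('a \<Rightarrow>\<^sub>0 real) set"
  define q where "q p = (\<Sum>v\<in>V. (Poly_Mapping.lookup z v - Poly_Mapping.lookup p v)\<^sup>2)" for p
  have "finite MM" using V MM finite_subset by (metis finite_Pow_iff)
  then have "compact ?K" by (simp add: finite_imp_compact_convex_hull)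
  moreover have "?K \<noteq> {}" using MM by simp
  moreover have "continuous_on ?K q"
    unfolding q_def by (intro continuous_intros continuous_on_lookup)
  ultimately have "\<exists>p\<in>?K. \<forall>x\<in>?K. q p \<le> q x" by (rule continuous_attains_inf)
  then obtain p where p: "p \<in> ?K" "\<And>x. x \<in> ?K \<Longrightarrow> q p \<le> q x" by auto
  define a where "a v = Poly_Mapping.lookup z v - Poly_Mapping.lookup p v" for v
  have "?K \<subseteq> {x. Poly_Mapping.keys x \<subseteq> V}"
  proof (rule hull_minimal)
    show "incidence_vector ` MM \<subseteq> {x. Poly_Mapping.keys x \<subseteq> V}"
    proof clarify
      fix M v assume "M \<in> MM" "v \<in> Poly_Mapping.keys (incidence_vector M :: 'a \<Rightarrow>\<^sub>0 real)"
      then show "v \<in> V" using MM V keys_incidence[of M] finite_subset[of M V] by blast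
    qed
  qed (rule convex_keys)
  then have pV: "Poly_Mapping.keys p \<subseteq> V" using p by auto
  have "\<exists>v\<in>V. a v \<noteq> 0"
  proof (rule ccontr)
    assume "\<not> ?thesis"
    then have eqV: "Poly_Mapping.lookup z v = Poly_Mapping.lookup p v" if "v \<in> V" for v
      using that by (auto simp: a_def)
    have "Poly_Mapping.lookup z v = Poly_Mapping.lookup p v" for v
      using eqV[of v] z(1) pV by (metis in_keys_iff subsetD)
    then have "z = p" by (simp add: poly_mapping_eqI)
    then show False using z p by simp
  qed
  then obtain w where w: "w \<in> V" "a w \<noteq> 0" by blast
  have pos: "0 < (\<Sum>v\<in>V. (a v)\<^sup>2)"
    by (rule sum_pos2[OF V w(1)]) (use w in auto)
  have "sum a M < (\<Sum>v\<in>V. a v * Poly_Mapping.lookup z v)" if M: "M \<in> MM" for M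
  proof -
    let ?x = "incidence_vector M :: 'a \<Rightarrow>\<^sub>0 real"
    define u where "u v = Poly_Mapping.lookup ?x v - Poly_Mapping.lookup p v" for v
    \<comment> \<open>The point \<open>p\<close> is compared with the points of the segment from
      \<open>p\<close> to \<open>?x\<close>, which lie in the hull.\<close>
    have le: "2 * (\<Sum>v\<in>V. a v * u v) \<le> t * (\<Sum>v\<in>V. (u v)\<^sup>2)" if t: "0 < t" "t \<le> 1" for t
    proof -
      have "(1 - t) *\<^sub>R p + t *\<^sub>R ?x \<in> ?K"
        using p(1) M t by (intro convexD[OF convex_convex_hull]) (auto intro: hull_inc)
      then have qle: "q p \<le> q ((1 - t) *\<^sub>R p + t *\<^sub>R ?x)" by (rule p(2))
      have lk: "Poly_Mapping.lookup ((1 - t) *\<^sub>R p + t *\<^sub>R ?x) v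
          = (1 - t) * Poly_Mapping.lookup p v + t * Poly_Mapping.lookup ?x v" for v
        by (simp only: lookup_add lookup_scaleR real_scaleR_def)
      have "q ((1 - t) *\<^sub>R p + t *\<^sub>R ?x) = (\<Sum>v\<in>V. (a v)\<^sup>2 - 2 * t * (a v * u v) + t\<^sup>2 * (u v)\<^sup>2)"
        unfolding q_def a_def u_def lk
        by (rule sum.cong) (simp_all add: lookup_add power2_eq_square algebra_simps)
      also have "\<dots> = q p - 2 * t * (\<Sum>v\<in>V. a v * u v) + t\<^sup>2 * (\<Sum>v\<in>V. (u v)\<^sup>2)"
        by (simp add: sum.distrib sum_subtractf sum_distrib_left q_def a_def)
      finally have "t * (2 * (\<Sum>v\<in>V. a v * u v)) \<le> t * (t * (\<Sum>v\<in>V. (u v)\<^sup>2))"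
        using qle by (simp add: power2_eq_square algebra_simps)
      then show ?thesis using t by simp
    qed
    have "(\<Sum>v\<in>V. a v * u v) \<le> 0"
    proof (rule ccontr)
      assume n: "\<not> ?thesis"
      let ?A = "\<Sum>v\<in>V. a v * u v" and ?B = "\<Sum>v\<in>V. (u v)\<^sup>2"
      have B: "0 \<le> ?B" by (simp add: sum_nonneg)
      \<comment> \<open>Chosen so that \<open>?t * (?A + ?B) = ?A\<close>, which turns the bound
        into \<open>2 * ?A \<le> ?A\<close>.\<close>
      let ?t = "?A / (?A + ?B)"
      have "0 < ?t" "?t \<le> 1" using n B by auto
      then have "2 * ?A \<le> ?t * ?B" by (rule le)
      also have "\<dots> \<le> ?t * (?A + ?B)" using n \<open>0 < ?t\<close> by (intro mult_left_mono) auto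
      also have "\<dots> = ?A" using n B by auto
      finally show False using n by simp
    qed
    then have "(\<Sum>v\<in>V. a v * Poly_Mapping.lookup ?x v) \<le> (\<Sum>v\<in>V. a v * Poly_Mapping.lookup p v)"
      by (simp add: u_def right_diff_distrib sum_subtractf)
    also have "\<dots> < (\<Sum>v\<in>V. a v * Poly_Mapping.lookup z v)"
    proof -
      have "(\<Sum>v\<in>V. a v * Poly_Mapping.lookup z v) - (\<Sum>v\<in>V. a v * Poly_Mapping.lookup p v) = (\<Sum>v\<in>V. (a v)\<^sup>2)"
        by (simp add: a_def power2_eq_square right_diff_distrib flip: sum_subtractf)
      then show ?thesis using pos by simp
    qed
    finally show ?thesis using sum_lookup_incidence[OF V, of M a] M MM by auto
  qed
  then show ?thesis using that by blast
qed

text \<open>Among the separating functionals take one with the most maximisers. Subtracting a multiple of a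
  valid inequality that is tight at all maximisers would create further ones.\<close>

lemma maximal_face:
  fixes z :: "'a \<Rightarrow> real"
  assumes fin: "finite MM"
    and a0: "\<And>M. M \<in> MM \<Longrightarrow> sum a0 M < (\<Sum>v\<in>V. a0 v * z v)"
  obtains a where "\<And>M. M \<in> MM \<Longrightarrow> sum a M < (\<Sum>v\<in>V. a v * z v)"
    "\<And>c g M. (\<And>M. M \<in> MM \<Longrightarrow> sum c M \<le> g) \<Longrightarrow> (\<Sum>v\<in>V. c v * z v) \<le> g \<Longrightarrow>
       (\<And>M. M \<in> MM \<Longrightarrow> (\<And>N. N \<in> MM \<Longrightarrow> sum a N \<le> sum a M) \<Longrightarrow> sum c M = g) \<Longrightarrow> M \<in> MM \<Longrightarrow> sum c M = g"
proof -
  define opt where "opt a = {M \<in> MM. \<forall>N\<in>MM. sum a N \<le> sum a M}" for a :: "'a \<Rightarrow> real"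
  let ?P = "\<lambda>a. \<forall>M\<in>MM. sum a M < (\<Sum>v\<in>V. a v * z v)"
  have bound: "card (opt a) \<le> card MM" for a
    unfolding opt_def using fin by (intro card_mono) auto
  obtain a where a: "?P a" and amax: "\<And>b. ?P b \<Longrightarrow> card (opt b) \<le> card (opt a)"
  proof -
    have "?P a0" using a0 by blast
    then have "\<exists>x. ?P x \<and> (\<forall>y. ?P y \<longrightarrow> card (opt y) \<le> card (opt x))"
      by (rule ex_has_greatest_nat[of ?P a0 "\<lambda>x. card (opt x)" "Suc (card MM)"])
        (simp add: bound less_Suc_eq_le)
    then show ?thesis using that by blast
  qed
  have "sum c M = g"
    if valid: "\<And>M. M \<in> MM \<Longrightarrow> sum c M \<le> g" and zc: "(\<Sum>v\<in>V. c v * z v) \<le> g"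
      and tight: "\<And>M. M \<in> MM \<Longrightarrow> (\<And>N. N \<in> MM \<Longrightarrow> sum a N \<le> sum a M) \<Longrightarrow> sum c M = g"
      and M: "M \<in> MM" for c g M
  proof (rule ccontr)
    assume "sum c M \<noteq> g"
    then have L: "M \<in> {M \<in> MM. sum c M < g}" (is "_ \<in> ?L") using valid M by force
    have finL: "finite ?L" using fin by simp
    have ne: "MM \<noteq> {}" using M by auto
    define b where "b = Max (sum a ` MM)"
    have bge: "sum a N \<le> b" if "N \<in> MM" for N using that fin by (simp add: b_def)
    have "b \<in> sum a ` MM" unfolding b_def using fin ne by (intro Max_in) auto
    then obtain B where B: "B \<in> MM" "sum a B = b" by auto
    have opt_iff: "N \<in> opt a \<longleftrightarrow> N \<in> MM \<and> sum a N = b" for N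
      using bge B by (auto simp: opt_def intro: antisym)
    have tight': "sum c N = g" if "N \<in> opt a" for N
      using tight[of N] that by (auto simp: opt_def)
    \<comment> \<open>The multiple of \<open>c\<close> whose subtraction makes \<open>N\<close>
      catch up with the maximisers of \<open>a\<close>. The least of these values creates the new
      maximiser \<open>M1\<close> and lets no matching overtake.\<close>
    define r where "r N = (b - sum a N) / (g - sum c N)" for N
    define eps where "eps = Min (r ` ?L)"
    have "eps \<in> r ` ?L" unfolding eps_def using finL L by (intro Min_in) auto
    then obtain M1 where M1: "M1 \<in> ?L" "r M1 = eps" by auto
    have epsle: "eps \<le> r N" if "N \<in> ?L" for N using that finL by (simp add: eps_def)
    have "M1 \<notin> opt a" using M1 tight' by auto
    then have "sum a M1 < b" using M1 bge[of M1] opt_iff[of M1] by auto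
    then have eps0: "0 < eps" using M1 by (auto simp: r_def)
    define a' where "a' v = a v - eps * c v" for v
    have sa': "sum a' N = sum a N - eps * sum c N" for N
      by (simp add: a'_def sum_subtractf sum_distrib_left)
    have le: "sum a' N \<le> b - eps * g" if N: "N \<in> MM" for N
    proof (cases "sum c N < g")
      case True
      then have "eps * (g - sum c N) \<le> b - sum a N"
        using epsle[of N] N by (simp add: r_def pos_le_divide_eq)
      then show ?thesis by (simp add: sa' algebra_simps)
    next
      case False
      then have "sum c N = g" using valid[OF N] by simp
      then show ?thesis using bge[OF N] by (simp add: sa')
    qed
    have eqM1: "sum a' M1 = b - eps * g"
      using M1 by (auto simp: sa' r_def field_simps)
    \<comment> \<open>The new functional still separates because \<open>z\<close> satisfies the
      subtracted inequality.\<close>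
    have "?P a'"
    proof
      fix N assume N: "N \<in> MM"
      have "sum a' N \<le> b - eps * g" by (rule le[OF N])
      also have "\<dots> < (\<Sum>v\<in>V. a v * z v) - eps * g" using a B by auto
      also have "\<dots> \<le> (\<Sum>v\<in>V. a v * z v) - eps * (\<Sum>v\<in>V. c v * z v)"
        using zc eps0 by simp
      also have "\<dots> = (\<Sum>v\<in>V. a' v * z v)"
        by (simp add: a'_def sum_subtractf sum_distrib_left left_diff_distrib mult.assoc)
      finally show "sum a' N < (\<Sum>v\<in>V. a' v * z v)" .
    qed
    then have "card (opt a') \<le> card (opt a)" by (rule amax)
    moreover have "insert M1 (opt a) \<subseteq> opt a'"
    proof
      fix N assume "N \<in> insert M1 (opt a)"
      then have "N \<in> MM" "sum a' N = b - eps * g"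
        using eqM1 M1 tight'[of N] opt_iff[of N] by (auto simp: sa')
      then show "N \<in> opt a'" using le by (simp add: opt_def)
    qed
    then have "card (insert M1 (opt a)) \<le> card (opt a')"
      using fin by (intro card_mono) (auto simp: opt_def)
    moreover have "finite (opt a)" using fin by (simp add: opt_def)
    ultimately show False using \<open>M1 \<notin> opt a\<close> by simp
  qed
  then show ?thesis using that[of a] a by blast
qed

section \<open>Matchings\<close>

lemma card_of_remove:
  assumes "finite S" "v \<in> S" "card (S - {v}) = k"
  shows "card S = k + 1"
  using card_Suc_Diff1[OF assms(1,2)] assms(3) by simp

context multi
begin

lemma multi_sub: "G \<subseteq> F \<Longrightarrow> multi G ends"
  by unfold_locales (auto intro: finite_sub ends2)

definition mtch :: "'e set \<Rightarrow> bool" where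
  "mtch M \<longleftrightarrow> M \<subseteq> F \<and> (\<forall>e\<in>M. \<forall>f\<in>M. e \<noteq> f \<longrightarrow> ends e \<inter> ends f = {})"

definition induced :: "'w set \<Rightarrow> 'e set" where
  "induced S = {e \<in> F. ends e \<subseteq> S}"

lemma induced_sub: "induced S \<subseteq> F"
  by (auto simp: induced_def)

lemma mtch_sub: "mtch M \<Longrightarrow> M \<subseteq> F"
  by (simp add: mtch_def)

lemma mtch_subset: "mtch M \<Longrightarrow> N \<subseteq> M \<Longrightarrow> mtch N"
  unfolding mtch_def by (meson subsetD subset_trans)

lemma mtch_same: "mtch M \<Longrightarrow> e \<in> M \<Longrightarrow> f \<in> M \<Longrightarrow> v \<in> ends e \<Longrightarrow> v \<in> ends f \<Longrightarrow> e = f"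
  unfolding mtch_def by blast

lemma mtchI:
  assumes "M \<subseteq> F" "\<And>v e f. e \<in> M \<Longrightarrow> f \<in> M \<Longrightarrow> v \<in> ends e \<Longrightarrow> v \<in> ends f \<Longrightarrow> e = f"
  shows "mtch M"
  using assms unfolding mtch_def by blast

lemma deg_mtch:
  assumes "mtch M"
  shows "deg M v = (if v \<in> verts M then 1 else 0)"
proof (cases "v \<in> verts M")
  case True
  then obtain e where e: "e \<in> M" "v \<in> ends e" by (auto simp: verts_def)
  then have "{f \<in> M. v \<in> ends f} = {e}" using mtch_same[OF assms] by blast
  then show ?thesis using True by (simp add: deg_def)
next
  case False
  then show ?thesis using deg_zero_iff[OF mtch_sub[OF assms]] by simp
qed

lemma bd_mtch: "mtch M \<Longrightarrow> bd M = verts M"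
  by (auto simp: bd_def deg_mtch)

lemma card_verts_mtch:
  assumes "mtch M"
  shows "card (verts M) = 2 * card M"
proof -
  have "(\<Sum>v\<in>verts M. deg M v) = 2 * card M"
    using assms mtch_sub finite_verts by (intro sum_deg_verts) auto
  then show ?thesis using assms by (simp add: deg_mtch)
qed

lemma verts_induced: "verts (M \<inter> induced S) \<subseteq> S"
  by (auto simp: verts_def induced_def)

lemma card_mtch_induced:
  assumes "mtch M" "finite S"
  shows "2 * card (M \<inter> induced S) \<le> card S"
  using card_verts_mtch[OF mtch_subset[OF assms(1), of "M \<inter> induced S"]]
    card_mono[OF assms(2) verts_induced[of M S]] by auto

lemma finite_mtch: "finite {M. mtch M}"
  by (rule finite_subset[of _ "Pow F"]) (auto simp: mtch_def finF)

section \<open>Optimal matchings and Gallai's argument\<close>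

definition opt :: "('e \<Rightarrow> real) \<Rightarrow> 'e set \<Rightarrow> bool" where
  "opt a M \<longleftrightarrow> mtch M \<and> (\<forall>N. mtch N \<longrightarrow> sum a N \<le> sum a M)"

text \<open>As in Gallai's lemma, the component of \<open>M \<triangle> N\<close> at \<open>t\<close> is switched; it is given by a join \<open>J\<close>.\<close>

lemma opt_switch:
  assumes M: "opt a M" "u \<notin> verts M" "v \<notin> verts M" "u \<noteq> v"
    and N: "opt a N" "t \<notin> verts N" and t: "t \<in> verts M"
  obtains M' where "opt a M'" "t \<notin> verts M'" "u \<notin> verts M' \<or> v \<notin> verts M'"
proof -
  have mM: "mtch M" and mN: "mtch N" using M N by (auto simp: opt_def)
  then have MF: "M \<subseteq> F" and NF: "N \<subseteq> F" by (auto simp: mtch_def)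
  define A where "A = M \<triangle> N"
  have AF: "A \<subseteq> F" using MF NF by (simp add: A_def sdiff_subset)
  have bdA: "bd A = verts M \<triangle> verts N"
    unfolding A_def using bd_sdiff[OF MF NF] bd_mtch mM mN by simp
  then have tA: "t \<in> bd A" using t N by simp
  then obtain s where s: "s \<in> bd A" "s \<noteq> t" "joined A t s" using joined_other_bd AF by metis
  then obtain J where J: "J \<subseteq> A" "bd J = {t} \<triangle> {s}" using joined_imp_join AF by blast
  have JF: "J \<subseteq> F" using J AF by blast
  have degA: "deg A w \<le> deg M w + deg N w" for w
  proof -
    have "{e \<in> A. w \<in> ends e} \<subseteq> {e \<in> M. w \<in> ends e} \<union> {e \<in> N. w \<in> ends e}"
      by (auto simp: A_def)
    then have "deg A w \<le> card ({e \<in> M. w \<in> ends e} \<union> {e \<in> N. w \<in> ends e})"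
      unfolding deg_def using finite_sub MF NF by (intro card_mono) auto
    then show ?thesis unfolding deg_def using card_Un_le order_trans by blast
  qed
  have degA2: "deg A w \<le> 2" for w
    using degA[of w] mM mN by (simp add: deg_mtch split: if_splits)
  \<comment> \<open>\<open>A\<close> has degrees at most two. At \<open>s\<close> and
    \<open>t\<close> its degree is odd, hence one; at other vertices of \<open>J\<close> the degree
    in \<open>J\<close> is even and positive, hence two. So \<open>J\<close> takes every edge of
    \<open>A\<close> at its vertices: it is a whole component.\<close>
  have full: "{e \<in> A. w \<in> ends e} \<subseteq> J" if "w \<in> verts J" for w
  proof -
    have pos: "deg J w \<noteq> 0" using that deg_zero_iff[OF JF] by blast
    have le: "deg J w \<le> deg A w" using deg_mono[OF J(1) AF] .
    have "deg J w = deg A w"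
    proof (cases "w = s \<or> w = t")
      case True
      then have "odd (deg A w)" using s tA by (auto simp: bd_def)
      then show ?thesis using le pos degA2[of w] by (cases "deg A w = 2") auto
    next
      case False
      then have "w \<notin> bd J" using J by auto
      then have "even (deg J w)" by (simp add: bd_def)
      then show ?thesis using le pos degA2[of w] by (cases "deg J w = 1") auto
    qed
    then have "{e \<in> J. w \<in> ends e} = {e \<in> A. w \<in> ends e}"
      using J(1) finite_sub[OF AF] unfolding deg_def by (intro card_subset_eq) auto
    then show ?thesis by blast
  qed
  have sw: "{e \<in> K \<triangle> J. w \<in> ends e} = (if w \<in> verts J then {e \<in> L. w \<in> ends e} else {e \<in> K. w \<in> ends e})"
    if KL: "K \<triangle> L = A" for K L w
  proof (cases "w \<in> verts J")
    case True
    have "e \<in> K \<triangle> J \<longleftrightarrow> e \<in> L" if e: "w \<in> ends e" for e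
    proof -
      have "e \<in> J \<longleftrightarrow> e \<in> A" using full[OF True] J(1) e by blast
      then show ?thesis using KL by auto
    qed
    then show ?thesis using True by auto
  next
    case False
    then have "e \<notin> J" if "w \<in> ends e" for e using that by (auto simp: verts_def)
    then show ?thesis using False by auto
  qed
  have swM: "mtch (K \<triangle> J)" if KL: "K \<triangle> L = A" "mtch K" "mtch L" for K L
  proof (rule mtchI)
    show "K \<triangle> J \<subseteq> F" using KL JF mtch_sub by (simp add: sdiff_subset)
    fix w e f assume "e \<in> K \<triangle> J" "f \<in> K \<triangle> J" "w \<in> ends e" "w \<in> ends f"
    then have "e \<in> {e \<in> K \<triangle> J. w \<in> ends e}" "f \<in> {e \<in> K \<triangle> J. w \<in> ends e}" by auto
    then show "e = f" unfolding sw[OF KL(1)]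
      using mtch_same[OF KL(2)] mtch_same[OF KL(3)] by (auto split: if_splits)
  qed
  define M' where "M' = M \<triangle> J"
  define N' where "N' = N \<triangle> J"
  have KL: "M \<triangle> N = A" "N \<triangle> M = A" by (auto simp: A_def)
  have mM': "mtch M'" unfolding M'_def using swM[OF KL(1)] mM mN by blast
  have mN': "mtch N'" unfolding N'_def using swM[OF KL(2)] mM mN by blast
  have "sum a M' + sum a N' = sum a M + sum a N"
  proof -
    have fin: "finite M" "finite N" using MF NF finite_sub by auto
    have e1: "M' = (M - J) \<union> (J \<inter> N)" "N' = (N - J) \<union> (J \<inter> M)"
      using J(1) by (auto simp: M'_def N'_def A_def)
    have d1: "(M - J) \<inter> (J \<inter> N) = {}" "(N - J) \<inter> (J \<inter> M) = {}" by auto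
    have "sum a M' = sum a (M - J) + sum a (J \<inter> N)" "sum a N' = sum a (N - J) + sum a (J \<inter> M)"
      unfolding e1 using fin d1 by (simp_all add: sum.union_disjoint)
    moreover have "sum a M = sum a (M - J) + sum a (J \<inter> M)" "sum a N = sum a (N - J) + sum a (J \<inter> N)"
      using fin by (simp_all add: sum.Int_Diff[of M a J] sum.Int_Diff[of N a J] Int_commute)
    ultimately show ?thesis by simp
  qed
  \<comment> \<open>The total weight of the two matchings is unchanged, so neither can lose.\<close>
  then have "opt a M'"
    using M(1) N(1) mM' mN' unfolding opt_def by (smt (verit))
  moreover have vM': "w \<in> verts M' \<longleftrightarrow> (if w \<in> verts J then w \<in> verts N else w \<in> verts M)" for w
  proof -
    have "w \<in> verts K \<longleftrightarrow> {e \<in> K. w \<in> ends e} \<noteq> {}" for K by (auto simp: verts_def)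
    then show ?thesis unfolding M'_def using sw[OF KL(1), of w] by metis
  qed
  moreover have "t \<in> verts J" "\<not> (u \<in> verts J \<and> v \<in> verts J)"
  proof -
    have "t \<in> bd J" using J s by simp
    then show "t \<in> verts J" using bd_subset_verts[OF JF] by blast
    \<comment> \<open>A vertex missed by \<open>M\<close> has degree at most one in
      \<open>A\<close>, so it can lie on \<open>J\<close> only as an end. The ends are
      \<open>s\<close> and \<open>t\<close>, and \<open>t\<close> is covered by \<open>M\<close>; so
      at most one of \<open>u\<close> and \<open>v\<close> is on \<open>J\<close>.\<close>
    have notin: "w \<notin> verts J" if w: "w \<notin> verts M" "w \<noteq> s" for w
    proof -
      have "w \<noteq> t" using w t by auto
      then have "w \<notin> bd J" using J w by simp
      then have "even (deg J w)" by (simp add: bd_def)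
      moreover have "deg J w \<le> 1"
        using deg_mono[OF J(1) AF, of w] degA[of w] w mM mN by (simp add: deg_mtch split: if_splits)
      ultimately have "deg J w = 0" by (metis le_0_eq le_Suc_eq One_nat_def odd_one)
      then show ?thesis using deg_zero_iff[OF JF] by blast
    qed
    then show "\<not> (u \<in> verts J \<and> v \<in> verts J)" using M by metis
  qed
  ultimately show ?thesis using that[of M'] N(2) M(2,3) by metis
qed

text \<open>The vertex set \<open>S0\<close> of a component of the edges of positive weight is
  tight, that is, every optimal matching misses exactly one of its vertices by edges inside it. A
  tight set of least size has no cut vertex, since a cut vertex would split off a smaller tight
  set.\<close>

lemma critical_set:
  fixes a :: "'e \<Rightarrow> real"
  assumes nonneg: "\<And>e. e \<in> F \<Longrightarrow> 0 \<le> a e" and e0: "e0 \<in> F" "0 < a e0"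
    and missed: "\<And>v. \<exists>M. opt a M \<and> v \<notin> verts M"
  obtains S where "finite S" "odd (card S)" "3 \<le> card S"
    "\<And>M. opt a M \<Longrightarrow> 2 * card (M \<inter> induced S) + 1 = card S"
    "\<And>v x y. v \<in> S \<Longrightarrow> x \<in> S - {v} \<Longrightarrow> y \<in> S - {v} \<Longrightarrow> joined {e \<in> induced S. v \<notin> ends e} x y"
proof -
  \<comment> \<open>No optimal matching misses both vertices. By \<open>opt_switch\<close> this
    relation is transitive; it holds along edges of positive weight, hence throughout a component of
    these.\<close>
  define near where "near u v \<longleftrightarrow> u = v \<or> (\<forall>M. opt a M \<longrightarrow> u \<in> verts M \<or> v \<in> verts M)" for u v
  define E where "E = {e \<in> F. 0 < a e}"
  have near_edge: "near u v" if e: "e \<in> E" "ends e = {u, v}" for e u v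
  proof (rule ccontr)
    assume "\<not> near u v"
    then obtain M where M: "opt a M" and n: "\<not> (u \<in> verts M \<or> v \<in> verts M)"
      by (auto simp: near_def)
    have eM: "e \<notin> M" using n e by (auto simp: verts_def)
    have "mtch (insert e M)"
      using M n e unfolding mtch_def opt_def E_def verts_def by auto
    then have "sum a (insert e M) \<le> sum a M" using M by (simp add: opt_def)
    moreover have "finite M" using M finite_sub by (auto simp: opt_def mtch_def)
    ultimately show False using eM e by (simp add: E_def)
  qed
  have near_trans: "near u v" if ut: "near u t" and tv: "near t v" for u t v
  proof (rule ccontr)
    assume n: "\<not> near u v"
    then obtain M where M: "opt a M" "u \<notin> verts M" "v \<notin> verts M" and uv: "u \<noteq> v"
      by (auto simp: near_def)
    have ne: "u \<noteq> t" "t \<noteq> v" using n ut tv by auto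
    then have "t \<in> verts M" using ut M by (auto simp: near_def)
    moreover obtain N where N: "opt a N" "t \<notin> verts N" using missed by blast
    ultimately obtain M' where "opt a M'" "t \<notin> verts M'" "u \<notin> verts M' \<or> v \<notin> verts M'"
      using opt_switch[OF M uv N] by metis
    then show False using ut tv ne by (auto simp: near_def)
  qed
  obtain u0 v0 where u0: "ends e0 = {u0, v0}" "u0 \<noteq> v0" using ends_obtain e0 by metis
  have EF: "E \<subseteq> F" by (auto simp: E_def)
  have e0E: "e0 \<in> E" using e0 by (simp add: E_def)
  have near0: "near u0 v" if "joined E u0 v" for v
    using that
  proof (induction rule: joined_induct)
    case base
    then show ?case by (simp add: near_def)
  next
    case (step x y e)
    then show ?case using near_edge near_trans by blast
  qed
  have near_sym: "near u v \<Longrightarrow> near v u" for u v by (auto simp: near_def)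
  define S0 where "S0 = {v. joined E u0 v}"
  have S0v: "S0 \<subseteq> insert u0 (verts F)"
    using joined_in_verts[of E u0] verts_mono[OF EF] by (auto simp: S0_def)
  then have finS0: "finite S0" using finite_verts[of F] finite_subset by auto
  have S0: "u0 \<in> S0" "v0 \<in> S0" using joined_edge[OF e0E u0(1)] by (auto simp: S0_def)
  have closed: "ends e \<subseteq> S0" if "e \<in> E" "ends e \<inter> S0 \<noteq> {}" for e
    using that joined_ends[of e E] joined_trans[of E u0] EF unfolding S0_def by blast
  have optE: "opt a (M \<inter> E)" if M: "opt a M" for M
  proof -
    have "sum a (M \<inter> E) = sum a M"
    proof (rule sum.mono_neutral_left)
      show "finite M" using M finite_sub by (auto simp: opt_def mtch_def)
      show "\<forall>e\<in>M - M \<inter> E. a e = 0"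
      proof
        fix e assume "e \<in> M - M \<inter> E"
        then have "e \<in> F" "\<not> 0 < a e" using M by (auto simp: opt_def mtch_def E_def)
        then show "a e = 0" using nonneg[of e] by simp
      qed
    qed auto
    then show ?thesis using M mtch_subset[of M "M \<inter> E"] by (simp add: opt_def)
  qed
  have cover: "S0 - {v} \<subseteq> verts (M \<inter> E \<inter> induced S0)"
    if M: "opt a M" "v \<in> S0" "v \<notin> verts (M \<inter> E)" for M v
  proof
    fix w assume w: "w \<in> S0 - {v}"
    have "joined E u0 w" "joined E u0 v" using w M(2) by (auto simp: S0_def)
    then have "near w v" using near_trans[OF near_sym[OF near0] near0] by blast
    then have "w \<in> verts (M \<inter> E)" using optE[OF M(1)] w M(3) by (auto simp: near_def)
    then obtain e where e: "e \<in> M" "e \<in> E" "w \<in> ends e" by (auto simp: verts_def)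
    then have "ends e \<subseteq> S0" using closed[of e] w by blast
    then show "w \<in> verts (M \<inter> E \<inter> induced S0)" using e EF by (auto simp: verts_def induced_def)
  qed
  define tight where "tight S \<longleftrightarrow> finite S \<and> odd (card S) \<and> 3 \<le> card S \<and>
      (\<forall>M. opt a M \<longrightarrow> 2 * card (M \<inter> induced S) + 1 = card S)" for S
  have oddS0: "odd (card S0)"
  proof -
    obtain M where M: "opt a M" "u0 \<notin> verts M" using missed by blast
    then have u: "u0 \<notin> verts (M \<inter> E)" by (auto simp: verts_def)
    let ?K = "M \<inter> E \<inter> induced S0"
    have "verts ?K \<subseteq> S0 - {u0}" using u verts_induced[of "M \<inter> E" S0] by (auto simp: verts_def)
    then have "verts ?K = S0 - {u0}" using cover[OF M(1) S0(1) u] by blast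
    moreover have "mtch ?K" using M mtch_subset[of M ?K] by (auto simp: opt_def)
    ultimately have "card (S0 - {u0}) = 2 * card ?K" using card_verts_mtch by metis
    then show ?thesis using card_of_remove[OF finS0 S0(1)] by simp
  qed
  have tight0: "tight S0"
    unfolding tight_def
  proof (intro conjI allI impI)
    show "finite S0" "odd (card S0)" by fact+
    have "card {u0, v0} \<le> card S0" using S0 finS0 by (intro card_mono) auto
    then show "3 \<le> card S0" using u0 oddS0 by (cases "card S0 = 2") auto
    fix M assume M: "opt a M"
    have mM: "mtch M" using M by (simp add: opt_def)
    let ?K = "M \<inter> E \<inter> induced S0"
    have mK: "mtch ?K" by (rule mtch_subset[OF mM]) blast
    have "\<not> S0 \<subseteq> verts ?K"
    proof
      assume "S0 \<subseteq> verts ?K"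
      then have "S0 = verts ?K" using verts_induced[of "M \<inter> E" S0] by blast
      then show False using card_verts_mtch[OF mK] oddS0 by simp
    qed
    then obtain v where v: "v \<in> S0" "v \<notin> verts ?K" by blast
    have "v \<notin> verts (M \<inter> E)"
    proof
      assume "v \<in> verts (M \<inter> E)"
      then obtain e where e: "e \<in> M" "e \<in> E" "v \<in> ends e" by (auto simp: verts_def)
      then have "ends e \<subseteq> S0" using closed[of e] v by blast
      then show False using e v EF by (auto simp: verts_def induced_def)
    qed
    then have "card (S0 - {v}) \<le> card (verts ?K)"
      using cover[OF M v(1)] finite_verts[of ?K] mtch_sub[OF mK] by (intro card_mono) auto
    then have "card S0 \<le> 2 * card ?K + 1" using card_verts_mtch[OF mK] v finS0 by simp
    also have "card ?K \<le> card (M \<inter> induced S0)"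
      using mtch_sub[OF mM] finite_sub by (intro card_mono) auto
    finally show "2 * card (M \<inter> induced S0) + 1 = card S0"
      using card_mtch_induced[OF mM finS0] oddS0 by presburger
  qed
  obtain S where S: "tight S" and min: "\<And>T. tight T \<Longrightarrow> card S \<le> card T"
    by (rule obtain_min[of tight, OF tight0]) (rule that)
  have finS: "finite S" and oddS: "odd (card S)" and tS: "\<And>M. opt a M \<Longrightarrow> 2 * card (M \<inter> induced S) + 1 = card S"
    using S by (auto simp: tight_def)
  have conn: "joined {e \<in> induced S. v \<notin> ends e} x y"
    if v: "v \<in> S" and xy: "x \<in> S - {v}" "y \<in> S - {v}" for v x y
  proof (rule ccontr)
    let ?G = "{e \<in> induced S. v \<notin> ends e}"
    assume n: "\<not> joined ?G x y"
    define X where "X = {w \<in> S - {v}. joined ?G x w}"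
    define Y where "Y = S - {v} - X"
    have X: "x \<in> X" "X \<subseteq> S - {v}" "finite X" and Y: "y \<in> Y" "finite Y"
      using xy n finS by (auto simp: X_def Y_def)
    have side: "ends e \<subseteq> X \<or> ends e \<subseteq> Y" if e: "e \<in> ?G" for e
    proof -
      have sub: "ends e \<subseteq> S - {v}" using e by (auto simp: induced_def)
      show ?thesis
      proof (cases "ends e \<inter> X = {}")
        case True
        then show ?thesis using sub by (auto simp: Y_def)
      next
        case False
        then obtain w where w: "w \<in> ends e" "joined ?G x w" by (auto simp: X_def)
        have "e \<in> F" using e by (auto simp: induced_def)
        then have "joined ?G x w'" if "w' \<in> ends e" for w'
          using joined_ends[OF e _ w(1) that] joined_trans[OF w(2)] by blast
        then show ?thesis using sub by (auto simp: X_def)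
      qed
    qed
    obtain M where M: "opt a M" "v \<notin> verts M" using missed by blast
    have mM: "mtch M" using M by (simp add: opt_def)
    let ?K = "M \<inter> induced S"
    have mK: "mtch ?K" by (rule mtch_subset[OF mM]) blast
    have KG: "?K \<subseteq> ?G" using M(2) by (auto simp: verts_def)
    have "card (verts ?K) = card (S - {v})"
      using card_verts_mtch[OF mK] tS[OF M(1)] v finS by simp
    moreover have "verts ?K \<subseteq> S - {v}" using verts_induced[of M S] M(2) by (auto simp: verts_def)
    ultimately have vK: "verts ?K = S - {v}" using finS by (intro card_subset_eq) auto
    have "verts {e \<in> ?K. ends e \<subseteq> X} = X"
    proof
      show "X \<subseteq> verts {e \<in> ?K. ends e \<subseteq> X}"
      proof
        fix w assume w: "w \<in> X"
        then have "w \<in> verts ?K" using vK X(2) by auto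
        then obtain e where e: "e \<in> ?K" "w \<in> ends e" by (auto simp: verts_def)
        then have "ends e \<subseteq> X" using side[of e] KG w by (auto simp: Y_def)
        then show "w \<in> verts {e \<in> ?K. ends e \<subseteq> X}" using e by (auto simp: verts_def)
      qed
    qed (auto simp: verts_def)
    moreover have "mtch {e \<in> ?K. ends e \<subseteq> X}" by (rule mtch_subset[OF mK]) auto
    \<comment> \<open>An optimal matching that misses \<open>v\<close> matches
      \<open>S - {v}\<close> perfectly, and no edge runs between \<open>X\<close> and
      \<open>Y\<close>.\<close>
    ultimately have evX: "card X = 2 * card {e \<in> ?K. ends e \<subseteq> X}" using card_verts_mtch by metis
    have cS: "card S = card X + card Y + 1"
    proof -
      have "S = insert v (X \<union> Y)" "v \<notin> X \<union> Y" using v X by (auto simp: Y_def)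
      moreover have "X \<inter> Y = {}" by (auto simp: Y_def)
      ultimately show ?thesis using X Y by (simp add: card_Un_disjoint)
    qed
    define S1 where "S1 = insert v X"
    define S2 where "S2 = insert v Y"
    have c1: "card S1 = card X + 1" and c2: "card S2 = card Y + 1"
    proof -
      have "v \<notin> X" "v \<notin> Y" using X by (auto simp: Y_def)
      then show "card S1 = card X + 1" "card S2 = card Y + 1" using X Y by (simp_all add: S1_def S2_def)
    qed
    have fin12: "finite S1" "finite S2" using X Y by (auto simp: S1_def S2_def)
    have Xpos: "0 < card X" "0 < card Y" using X Y card_gt_0_iff by blast+
    \<comment> \<open>\<open>S1\<close> and \<open>S2\<close> are odd and share only
      \<open>v\<close>, so their sizes add up to \<open>card S + 1\<close>. The bounds for matchings
      inside them then add up to exactly what tightness of \<open>S\<close> demands, so both are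
      attained.\<close>
    have "tight S1"
      unfolding tight_def
    proof (intro conjI allI impI)
      show "finite S1" by fact
      show o1: "odd (card S1)" using c1 evX by simp
      show "3 \<le> card S1" using c1 Xpos evX by presburger
      have o2: "odd (card S2)" using c2 cS oddS evX by presburger
      fix M assume M: "opt a M"
      have mM: "mtch M" using M by (simp add: opt_def)
      have "M \<inter> induced S \<subseteq> (M \<inter> induced S1) \<union> (M \<inter> induced S2)"
      proof
        fix e assume e: "e \<in> M \<inter> induced S"
        then have eF: "e \<in> F" "ends e \<subseteq> S" by (auto simp: induced_def)
        have "ends e \<subseteq> S1 \<or> ends e \<subseteq> S2"
        proof (cases "v \<in> ends e")
          case True
          then obtain w where "ends e = {v, w}" "w \<noteq> v" using other_end[OF eF(1)] by metis
          then show ?thesis using eF(2) by (auto simp: S1_def S2_def Y_def)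
        next
          case False
          then show ?thesis using side[of e] e by (auto simp: S1_def S2_def)
        qed
        then show "e \<in> (M \<inter> induced S1) \<union> (M \<inter> induced S2)" using e eF by (auto simp: induced_def)
      qed
      then have "card (M \<inter> induced S) \<le> card ((M \<inter> induced S1) \<union> (M \<inter> induced S2))"
        using finite_sub mtch_sub[OF mM] by (intro card_mono) auto
      also have "\<dots> \<le> card (M \<inter> induced S1) + card (M \<inter> induced S2)" by (rule card_Un_le)
      finally have "card S \<le> 2 * card (M \<inter> induced S1) + 2 * card (M \<inter> induced S2) + 1"
        using tS[OF M] by simp
      moreover have "2 * card (M \<inter> induced S1) + 1 \<le> card S1" "2 * card (M \<inter> induced S2) + 1 \<le> card S2"
        using card_mtch_induced[OF mM fin12(1)] card_mtch_induced[OF mM fin12(2)] o1 o2 by presburger+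
      ultimately show "2 * card (M \<inter> induced S1) + 1 = card S1" using cS c1 c2 by linarith
    qed
    then have "card S \<le> card S1" by (rule min)
    then show False using cS c1 Xpos by simp
  qed
  show ?thesis
    by (rule that[of S]) (use S conn in \<open>auto simp: tight_def\<close>)
qed

end

section \<open>Factor-critical graphs without cut vertices and without bad thetas\<close>

context multi
begin

lemma vertsI: "e \<in> A \<Longrightarrow> v \<in> ends e \<Longrightarrow> v \<in> verts A"
  by (auto simp: verts_def)

lemma bd_insert_join:
  assumes "J \<subseteq> F" "bd J = {x} \<triangle> {y}" "e \<in> F" "e \<notin> J" "ends e = {x, y}"
  shows "bd (insert e J) = {}"
proof -
  have "x \<noteq> y" using ends2[OF assms(3)] assms(5) by auto
  then have "{x} \<triangle> {y} = {x, y}" unfolding sdiff_def by blast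
  then have "bd {e} = {x} \<triangle> {y}" using assms(5) bd_single by simp
  moreover have "insert e J = {e} \<union> J" "{e} \<inter> J = {}" using assms(4) by auto
  ultimately show ?thesis using bd_Un[of "{e}" J] assms by simp
qed

lemma thetaD:
  assumes "theta C P"
  shows "circ C" "P \<inter> C = {}" "P \<noteq> {}" "bd P \<noteq> {}" "\<exists>A\<subseteq>C. bd (A \<union> P) = {}"
    "\<And>z. z \<subseteq> C \<union> P \<Longrightarrow> bd z = {} \<Longrightarrow> z \<inter> P = {} \<or> P \<subseteq> z"
  using assms unfolding theta_def by metis+

lemma circ_card_ge2:
  assumes "circ C" "C \<subseteq> F"
  shows "2 \<le> card C"
proof (rule ccontr)
  assume "\<not> 2 \<le> card C"
  moreover have "card C \<noteq> 0" using circD(1)[OF assms(1)] finite_sub[OF assms(2)] by simp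
  ultimately have "card C = 1" by linarith
  then obtain e where e: "C = {e}" by (auto simp: card_1_singleton_iff)
  then have "ends e = {}" using circD(2)[OF assms(1)] bd_single by simp
  then show False using ends2[of e] e assms(2) by simp
qed

lemma adjacent_common_circ:
  assumes e: "e \<in> F" "f \<in> F" "e \<noteq> f" "ends e = {v, x}" "ends f = {v, y}" "x \<noteq> v" "y \<noteq> v"
    and j: "joined {e \<in> F. v \<notin> ends e} x y"
  obtains D where "circ D" "D \<subseteq> F" "e \<in> D" "f \<in> D"
proof -
  let ?S = "{e \<in> F. v \<notin> ends e}"
  obtain J where J: "J \<subseteq> ?S" "bd J = {x} \<triangle> {y}" using joined_imp_join[OF j] by auto
  have JF: "J \<subseteq> F" using J by auto
  have ef: "{e, f} = {e} \<triangle> {f}" using e(3) by auto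
  have b: "bd {e, f} = {x} \<triangle> {y}"
    unfolding ef using e by (subst bd_sdiff) (auto simp: bd_single)
  have "J \<inter> {e, f} = {}" using J e by auto
  then have A: "bd (J \<union> {e, f}) = {}" "J \<union> {e, f} \<subseteq> F"
    using bd_Un[of J "{e, f}"] JF e J b by auto
  then obtain D where D: "circ D" "e \<in> D" "D \<subseteq> J \<union> {e, f}" using circ_in_cycle by (metis UnI2 insertI1)
  have "f \<in> D"
  proof (rule ccontr)
    assume "f \<notin> D"
    then have "{g \<in> D. v \<in> ends g} = {e}" using D J e by auto
    then have "deg D v = 1" by (simp add: deg_def)
    then have "v \<in> bd D" by (simp add: bd_def)
    then show False using circD(2)[OF D(1)] by simp
  qed
  then show ?thesis using that D A by blast
qed

text \<open>The circuit \<open>C\<close> through \<open>r s\<close> comes from near-perfect matchings missing \<open>r\<close> and \<open>s\<close>; if \<open>C\<close> does not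
  span, then contracting it leaves a bipartite graph, which is not factor-critical.\<close>

lemma critical_is_circ:
  assumes S: "finite S" "verts F \<subseteq> S" "5 \<le> card S"
    and conn: "\<And>v x y. v \<in> S \<Longrightarrow> x \<in> S - {v} \<Longrightarrow> y \<in> S - {v} \<Longrightarrow> joined {e \<in> F. v \<notin> ends e} x y"
    and crit: "\<And>v. v \<in> S \<Longrightarrow> \<exists>N. mtch N \<and> verts N = S - {v}"
    and nobad: "\<And>C P. bad C P \<Longrightarrow> C \<union> P \<subseteq> F \<Longrightarrow> False"
  shows "circ F \<and> verts F = S"
proof -
  have oddS: "odd (card S)"
  proof -
    have "S \<noteq> {}" using S by auto
    then obtain v where v: "v \<in> S" by blast
    then obtain N where "mtch N" "verts N = S - {v}" using crit by blast
    then have "card (S - {v}) = 2 * card N" using card_verts_mtch by metis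
    then show ?thesis using card_of_remove[OF S(1) v] by simp
  qed
  have connS: "joined F x y" if "x \<in> S" "y \<in> S" for x y
  proof -
    have "\<not> S \<subseteq> {x, y}"
    proof
      assume "S \<subseteq> {x, y}"
      then have "card S \<le> card {x, y}" by (intro card_mono) auto
      also have "\<dots> \<le> 2" by (simp add: card_insert_if)
      finally show False using S by simp
    qed
    then obtain v where "v \<in> S" "v \<noteq> x" "v \<noteq> y" by blast
    then show ?thesis using conn[of v x y] that joined_mono[of _ x y F] by auto
  qed
  have "S \<noteq> {}" using S by auto
  then obtain r where r: "r \<in> S" by blast
  obtain v where v: "v \<in> S" "v \<noteq> r"
  proof -
    have "S \<noteq> {r}" using S by auto
    then show ?thesis using r that by blast
  qed
  have "r \<in> verts F" using joined_in_verts[OF connS[OF v(1) r]] v(2) by simp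
  then obtain e0 where e0: "e0 \<in> F" "r \<in> ends e0" by (auto simp: verts_def)
  then obtain s where s: "ends e0 = {r, s}" "s \<noteq> r" using other_end by metis
  have sS: "s \<in> S" using s e0 S(2) by (auto simp: verts_def)
  obtain M where M: "mtch M" "verts M = S - {r}" using crit r by blast
  obtain N where N: "mtch N" "verts N = S - {s}" using crit sS by blast
  have MF: "M \<subseteq> F" and NF: "N \<subseteq> F" using M N mtch_sub by auto
  \<comment> \<open>The boundary of \<open>M \<triangle> N\<close> is \<open>{r, s}\<close>, and
    \<open>e0\<close> cancels it.\<close>
  define A where "A = (M \<triangle> N) \<triangle> {e0}"
  have AF: "A \<subseteq> F" using MF NF e0 by (simp add: A_def sdiff_subset)
  have "bd A = (S - {r}) \<triangle> (S - {s}) \<triangle> {r, s}"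
    unfolding A_def using MF NF e0 M N s
    by (simp add: bd_sdiff sdiff_subset bd_mtch bd_single)
  also have "\<dots> = {}" unfolding set_eq_iff mem_sdiff using r sS s(2) by blast
  finally have bdA: "bd A = {}" .
  have e0M: "e0 \<notin> M" "e0 \<notin> N" using vertsI[of e0 M r] vertsI[of e0 N s] M(2) N(2) s(1) by auto
  then have "e0 \<in> A" by (simp add: A_def)
  then obtain C where C: "circ C" "e0 \<in> C" "C \<subseteq> A" using circ_in_cycle AF bdA by metis
  have CF: "C \<subseteq> F" using C AF by blast
  have vCS: "verts C \<subseteq> S" using verts_mono[OF CF] S(2) by blast
  have finVC: "finite (verts C)" using finite_verts[OF CF] .
  have rC: "r \<in> verts C" using C e0 by (auto simp: verts_def)
  \<comment> \<open>\<open>M\<close> does not leave \<open>C\<close>: if the \<open>M\<close>-edge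
    at a vertex of \<open>C\<close> were off \<open>C\<close>, only one edge, from \<open>N\<close>
    or \<open>e0\<close> itself, would remain there, but a circuit has degree two. Hence
    \<open>M\<close> matches all of \<open>C\<close> but \<open>r\<close>, and \<open>C\<close> is
    odd.\<close>
  have MC: "m \<in> C" if m: "m \<in> M" "w \<in> ends m" "w \<in> verts C" for m w
  proof (rule ccontr)
    assume mC: "m \<notin> C"
    have "{e \<in> C. w \<in> ends e} \<subseteq> {e \<in> N. w \<in> ends e} - {m} \<union> ({e0} \<inter> {e. w \<in> ends e})"
    proof
      fix e assume e: "e \<in> {e \<in> C. w \<in> ends e}"
      then have "e \<in> A" "e \<noteq> m" using C mC by auto
      moreover have "e \<notin> M" using mtch_same[OF M(1) _ m(1), of e w] e m \<open>e \<noteq> m\<close> by auto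
      ultimately show "e \<in> {e \<in> N. w \<in> ends e} - {m} \<union> ({e0} \<inter> {e. w \<in> ends e})"
        using e by (auto simp: A_def)
    qed
    moreover have "card ({e \<in> N. w \<in> ends e} - {m} \<union> ({e0} \<inter> {e. w \<in> ends e})) \<le> 1"
    proof (cases "w \<in> ends e0")
      case True
      have "w \<noteq> r" using vertsI[OF m(1,2)] M(2) by blast
      then have "w = s" using True s by auto
      then have "{e \<in> N. w \<in> ends e} = {}" using vertsI[of _ N w] N(2) by blast
      then have "{e \<in> N. w \<in> ends e} - {m} \<union> ({e0} \<inter> {e. w \<in> ends e}) \<subseteq> {e0}" by auto
      then show ?thesis using card_mono[of "{e0}"] by fastforce
    next
      case False
      have "card ({e \<in> N. w \<in> ends e} - {m}) \<le> deg N w"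
        unfolding deg_def using finite_sub[OF NF] by (intro card_mono) auto
      also have "\<dots> \<le> 1" using deg_mtch[OF N(1)] by simp
      finally show ?thesis using False by simp
    qed
    moreover have "finite ({e \<in> N. w \<in> ends e} - {m} \<union> ({e0} \<inter> {e. w \<in> ends e}))"
      using finite_sub[OF NF] by simp
    ultimately have "deg C w \<le> 1" unfolding deg_def by (meson card_mono le_trans)
    then show False using circ_deg[OF C(1) CF m(3)] by simp
  qed
  have mMC: "mtch (M \<inter> C)" by (rule mtch_subset[OF M(1)]) auto
  have "verts (M \<inter> C) = verts C - {r}"
  proof
    show "verts (M \<inter> C) \<subseteq> verts C - {r}"
      using verts_mono[of "M \<inter> C" C] verts_mono[of "M \<inter> C" M] M(2) by blast
    show "verts C - {r} \<subseteq> verts (M \<inter> C)"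
    proof
      fix w assume w: "w \<in> verts C - {r}"
      then have "w \<in> verts M" using M vCS by auto
      then obtain m where "m \<in> M" "w \<in> ends m" by (auto simp: verts_def)
      then show "w \<in> verts (M \<inter> C)" using MC[of m w] w by (auto simp: verts_def)
    qed
  qed
  then have "card (verts C - {r}) = 2 * card (M \<inter> C)" using card_verts_mtch[OF mMC] by metis
  then have "card (verts C) = 2 * card (M \<inter> C) + 1" using card_of_remove[OF finVC rC] by simp
  then have oddC: "odd (card C)" using circ_card_verts[OF C(1) CF] by simp
  define Y where "Y = S - verts C"
  have Moff: "verts (M - C) = Y"
  proof
    show "verts (M - C) \<subseteq> Y"
    proof
      fix w assume "w \<in> verts (M - C)"
      then obtain m where m: "m \<in> M" "m \<notin> C" "w \<in> ends m" by (auto simp: verts_def)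
      then have "w \<notin> verts C" using MC by blast
      then show "w \<in> Y" using vertsI[OF m(1,3)] M(2) by (simp add: Y_def)
    qed
    show "Y \<subseteq> verts (M - C)"
    proof
      fix w assume w: "w \<in> Y"
      then have "w \<in> verts M" using M rC by (auto simp: Y_def)
      then obtain m where m: "m \<in> M" "w \<in> ends m" by (auto simp: verts_def)
      then have "m \<notin> C" using w by (auto simp: Y_def verts_def)
      then show "w \<in> verts (M - C)" using m by (auto simp: verts_def)
    qed
  qed
  \<comment> \<open>The edges that survive the contraction of \<open>C\<close>. Once every cycle is
    known to contain an even number of them, the contracted graph is bipartite.\<close>
  define X where "X = {e \<in> F. \<not> ends e \<subseteq> verts C}"
  have XC: "X \<inter> C = {}" by (auto simp: X_def verts_def)
  have ears: "even (card (P \<inter> X))" if th: "theta C P" and PF: "P \<subseteq> F" for P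
  proof -
    obtain B where B: "B \<subseteq> C" "bd (B \<union> P) = {}" using thetaD(5)[OF th] by blast
    have PC: "P \<inter> C = {}" "P \<noteq> {}" using thetaD[OF th] by blast+
    have "bd B \<triangle> bd P = {}" using bd_Un[of B P] B PF CF PC by blast
    then have bdP: "bd P \<subseteq> verts C"
      using bd_subset_verts[of B] verts_mono[OF B(1)] subset_trans[OF B(1) CF] by auto
    show ?thesis
    proof (cases "\<exists>e\<in>P. ends e \<subseteq> verts C")
      case True
      \<comment> \<open>Such an edge forms a cycle with a join inside \<open>C\<close>; as a cycle
        contains all of \<open>P\<close> or nothing of it, the ear is this edge alone.\<close>
      then obtain e where e: "e \<in> P" "ends e \<subseteq> verts C" by blast
      obtain x y where xy: "ends e = {x, y}" "x \<noteq> y" using ends_obtain e PF by blast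
      then have "joined C x y" using circ_joined[OF C(1) CF] e by auto
      then obtain J where J: "J \<subseteq> C" "bd J = {x} \<triangle> {y}" using joined_imp_join CF by blast
      have "e \<in> F" "e \<notin> J" "J \<subseteq> F" using e J PC PF CF by auto
      then have "bd ({e} \<union> J) = {}" using bd_insert_join[OF _ J(2)] xy by simp
      moreover have "{e} \<union> J \<subseteq> C \<union> P" using e J by auto
      ultimately have "({e} \<union> J) \<inter> P = {} \<or> P \<subseteq> {e} \<union> J" using thetaD(6)[OF th] by blast
      then have "P = {e}" using e J PC by blast
      then have "P \<inter> X = {}" using e by (auto simp: X_def)
      then show ?thesis by simp
    next
      case False
      then have PX: "P \<inter> X = P" using PF by (auto simp: X_def)
      show ?thesis
      proof (rule ccontr)
        assume "odd (card (P \<inter> X))"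
        then have oP: "odd (card P)" using PX by simp
        have "card C + card P = 4"
        proof (rule ccontr)
          assume "card C + card P \<noteq> 4"
          then have "bad C P" unfolding bad_def using th oddC oP by (intro conjI)
          then show False using nobad CF PF by (metis Un_least)
        qed
        moreover have "card C \<noteq> 1" using circ_card_ge2[OF C(1) CF] by simp
        ultimately have "card P = 1" using oddC oP by presburger
        then obtain e where e: "P = {e}" by (auto simp: card_1_singleton_iff)
        then have "ends e \<subseteq> verts C" using bdP bd_single by simp
        then show False using False e by blast
      qed
    qed
  qed
  have near: "\<exists>D. circ D \<and> D \<subseteq> F \<and> e \<in> D \<and> f \<in> D"
    if ef: "e \<in> F" "f \<in> F" "e \<noteq> f" "v \<in> ends e" "v \<in> ends f" for e f v
  proof -
    obtain x where x: "ends e = {v, x}" "x \<noteq> v" using other_end ef by metis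
    obtain y where y: "ends f = {v, y}" "y \<noteq> v" using other_end ef by metis
    have "v \<in> S" "x \<in> S" "y \<in> S" using x y ef S(2) by (auto simp: verts_def)
    then have "joined {e \<in> F. v \<notin> ends e} x y" using conn x y by simp
    then show ?thesis using adjacent_common_circ[OF ef(1-3) x(1) y(1) x(2) y(2)] by metis
  qed
  \<comment> \<open>Since no vertex separates \<open>S\<close>, edges with a common end lie on a
    common circuit; by connectedness all edges are in the block of \<open>C\<close>.\<close>
  have reach: "\<exists>D. circ D \<and> D \<subseteq> F \<and> linked C D \<and> e \<in> D" if e: "e \<in> F" for e
  proof -
    have "\<forall>e\<in>F. w \<in> ends e \<longrightarrow> (\<exists>D. circ D \<and> D \<subseteq> F \<and> linked C D \<and> e \<in> D)" if "joined F r w" for w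
      using that
    proof (induction rule: joined_induct)
      case base
      show ?case
      proof (intro ballI impI)
        fix e assume e: "e \<in> F" "r \<in> ends e"
        show "\<exists>D. circ D \<and> D \<subseteq> F \<and> linked C D \<and> e \<in> D"
        proof (cases "e = e0")
          case True
          then show ?thesis using C CF by (intro exI[of _ C]) simp
        next
          case False
          then obtain D where D: "circ D" "D \<subseteq> F" "e \<in> D" "e0 \<in> D" using near[OF e(1) e0(1) _ e(2) e0(2)] by blast
          then have "linked C D" using linked_meet[OF C(1) D(1) CF D(2)] C(2) by blast
          then show ?thesis using D by blast
        qed
      qed
    next
      case (step x y e)
      then obtain D where D: "circ D" "D \<subseteq> F" "linked C D" "e \<in> D" by blast
      show ?case
      proof (intro ballI impI)
        fix f assume f: "f \<in> F" "y \<in> ends f"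
        show "\<exists>D. circ D \<and> D \<subseteq> F \<and> linked C D \<and> f \<in> D"
        proof (cases "f = e")
          case True
          then show ?thesis using D by blast
        next
          case False
          then obtain D' where D': "circ D'" "D' \<subseteq> F" "e \<in> D'" "f \<in> D'"
            using near[of e f y] step f by blast
          then have "linked D D'" using linked_meet[OF D(1) D'(1) D(2) D'(2)] D(4) by blast
          then show ?thesis using D' D(3) linked_trans by blast
        qed
      qed
    qed
    moreover obtain w where w: "w \<in> ends e" using ends_obtain[OF e] by blast
    moreover have "joined F r w" using connS[OF r] w e S(2) by (auto simp: verts_def)
    ultimately show ?thesis using e by blast
  qed
  have evX: "even (card (y \<inter> X))" if y: "circ y" "y \<subseteq> F" for y
  proof -
    obtain e where e: "e \<in> y" using circD(1)[OF y(1)] by blast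
    then obtain D where D: "circ D" "D \<subseteq> F" "linked C D" "e \<in> D" using reach y by blast
    have "linked D y" using linked_meet[OF D(1) y(1) D(2) y(2)] D e by blast
    then have "linked C y" using D linked_trans by blast
    then show ?thesis using ears_even[OF C(1) CF XC ears y] by blast
  qed
  have evZ: "even (card (z \<inter> X))" if z: "bd z = {}" "z \<subseteq> F" for z
  proof (rule ccontr)
    assume "odd (card (z \<inter> X))"
    then obtain D where "circ D" "D \<subseteq> z" "odd (card (D \<inter> X))" using odd_circ[OF z(2,1)] by metis
    then show False using evX z by blast
  qed
  \<comment> \<open>The colour of \<open>v\<close> in the bipartite contraction: the parity of a
    join from \<open>r\<close>, counted in \<open>X\<close>. It does not depend on the join because
    cycles are even in \<open>X\<close>; the vertices of \<open>C\<close> all get the colour of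
    \<open>r\<close>.\<close>
  define phi where "phi v \<longleftrightarrow> (\<exists>J\<subseteq>F. bd J = {r} \<triangle> {v} \<and> odd (card (J \<inter> X)))" for v
  have phi: "phi v \<longleftrightarrow> odd (card (J \<inter> X))" if J: "J \<subseteq> F" "bd J = {r} \<triangle> {v}" for J v
  proof
    assume "phi v"
    then obtain K where K: "K \<subseteq> F" "bd K = {r} \<triangle> {v}" "odd (card (K \<inter> X))" by (auto simp: phi_def)
    have "even (card ((J \<triangle> K) \<inter> X))"
      using J K by (intro evZ) (auto simp: bd_sdiff sdiff_subset)
    then show "odd (card (J \<inter> X))"
      using K J finite_sub unfolding sdiff_Int by (simp add: even_card_sdiff)
  qed (use J in \<open>auto simp: phi_def\<close>)
  have phiE: "phi x \<noteq> phi y \<longleftrightarrow> e \<in> X" if e: "e \<in> F" "ends e = {x, y}" for e x y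
  proof -
    have "x \<in> S" using e S(2) by (auto simp: verts_def)
    then obtain J where J: "J \<subseteq> F" "bd J = {r} \<triangle> {x}" using joined_imp_join[OF connS[OF r]] by blast
    have xy: "x \<noteq> y" using ends2[OF e(1)] e(2) by auto
    have J': "J \<triangle> {e} \<subseteq> F" "bd (J \<triangle> {e}) = {r} \<triangle> {y}"
      using J e xy by (auto simp: sdiff_subset bd_sdiff bd_single)
    have "{e} \<inter> X = (if e \<in> X then {e} else {})" by auto
    then have "odd (card ((J \<triangle> {e}) \<inter> X)) \<longleftrightarrow> (odd (card (J \<inter> X)) \<noteq> (e \<in> X))"
      using J finite_sub unfolding sdiff_Int by (simp add: even_card_sdiff)
    then show ?thesis using phi[OF J] phi[OF J'] by blast
  qed
  have phiC: "\<not> phi w" if wC: "w \<in> verts C" for w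
  proof -
    obtain J where J: "J \<subseteq> C" "bd J = {r} \<triangle> {w}"
      using circ_joined[OF C(1) CF rC wC] joined_imp_join CF by blast
    have "J \<inter> X = {}" using J XC by blast
    then show ?thesis using phi[of J w] J CF by auto
  qed
  have finY: "finite Y" using S by (simp add: Y_def)
  have card_end: "card {e \<in> K. ends e \<inter> T \<noteq> {}} = card T"
    if K: "mtch K" "T \<subseteq> verts K" and one: "\<And>e. e \<in> K \<Longrightarrow> card (ends e \<inter> T) \<le> 1" for K T
  proof -
    have KF: "K \<subseteq> F" using K mtch_sub by blast
    have finT: "finite T" using K finite_verts[OF KF] finite_subset by blast
    have "card T = (\<Sum>v\<in>T. deg K v)" using K by (simp add: deg_mtch subset_iff)
    also have "\<dots> = (\<Sum>e\<in>K. card (ends e \<inter> T))" by (rule sum_deg[OF KF finT])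
    also have "\<dots> = (\<Sum>e\<in>K. if ends e \<inter> T \<noteq> {} then 1 else 0)"
    proof (rule sum.cong)
      fix e assume e: "e \<in> K"
      have "0 < card (ends e \<inter> T) \<longleftrightarrow> ends e \<inter> T \<noteq> {}" using finT by (simp add: card_gt_0_iff)
      then show "card (ends e \<inter> T) = (if ends e \<inter> T \<noteq> {} then 1 else 0)" using one[OF e] by (cases "ends e \<inter> T = {}") simp_all
    qed simp
    also have "\<dots> = card {e \<in> K. ends e \<inter> T \<noteq> {}}" using finite_sub[OF KF] by (simp flip: sum.inter_filter)
    finally show ?thesis by simp
  qed
  define P1 where "P1 = {w \<in> Y. phi w}"
  define P0 where "P0 = {w \<in> Y. \<not> phi w}"
  have bip: "card (ends e \<inter> P0) \<le> 1" "card (ends e \<inter> P1) \<le> 1" "ends e \<inter> P0 \<noteq> {} \<Longrightarrow> ends e \<inter> P1 \<noteq> {}"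
    "ends e \<inter> P1 \<noteq> {} \<Longrightarrow> ends e \<subseteq> Y \<Longrightarrow> ends e \<inter> P0 \<noteq> {}" if e: "e \<in> F" for e
  proof -
    obtain x y where xy: "ends e = {x, y}" "x \<noteq> y" using ends_obtain[OF e] by metis
    have eX: "e \<in> X" if "ends e \<inter> Y \<noteq> {}" using that e by (auto simp: X_def Y_def)
    have sub: "P0 \<subseteq> Y" "P1 \<subseteq> Y" by (auto simp: P0_def P1_def)
    have d: "phi x \<noteq> phi y" if "ends e \<inter> Y \<noteq> {}" using phiE[OF e xy(1)] eX[OF that] by blast
    have one: "card (ends e \<inter> Q) \<le> 1" if "\<not> (x \<in> Q \<and> y \<in> Q)" for Q
    proof -
      have "ends e \<inter> Q \<subseteq> {x} \<or> ends e \<inter> Q \<subseteq> {y}" using that xy(1) by auto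
      then show ?thesis
        using card_mono[of "{x}" "ends e \<inter> Q"] card_mono[of "{y}" "ends e \<inter> Q"] by auto
    qed
    have meets: "ends e \<inter> Y \<noteq> {}" if "x \<in> Y" using that xy(1) by auto
    have "\<not> (x \<in> P0 \<and> y \<in> P0)" "\<not> (x \<in> P1 \<and> y \<in> P1)"
      using d meets unfolding P0_def P1_def by blast+
    then show "card (ends e \<inter> P0) \<le> 1" "card (ends e \<inter> P1) \<le> 1" using one by blast+
    have SS: "x \<in> S" "y \<in> S" using xy e S(2) by (auto simp: verts_def)
    show "ends e \<inter> P1 \<noteq> {}" if "ends e \<inter> P0 \<noteq> {}"
    proof -
      have "phi x \<noteq> phi y" using d that sub by blast
      then obtain w where w: "w \<in> {x, y}" "phi w" by blast
      then have "w \<in> P1" using phiC SS by (auto simp: Y_def P1_def)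
      then show ?thesis using w xy(1) by blast
    qed
    show "ends e \<inter> P0 \<noteq> {}" if "ends e \<inter> P1 \<noteq> {}" "ends e \<subseteq> Y"
    proof -
      have xyY: "x \<in> Y" "y \<in> Y" using that xy(1) by auto
      then have "x \<in> P0 \<or> y \<in> P0" using d meets by (auto simp: P0_def)
      then show ?thesis using xy(1) by blast
    qed
  qed
  \<comment> \<open>\<open>M\<close> matches the two colour classes \<open>P0\<close> and
    \<open>P1\<close> of \<open>Y\<close> with each other, so they have equal size. A matching
    missing only some \<open>x\<close> in \<open>P1\<close> would match \<open>P0\<close> into
    \<open>P1 - {x}\<close>: the edges at \<open>P0\<close> lead to \<open>P1\<close>, never to
    \<open>C\<close>, which has the colour of \<open>P0\<close>.\<close>
  have "Y = {}"
  proof (rule ccontr)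
    assume "Y \<noteq> {}"
    have mMo: "mtch (M - C)" by (rule mtch_subset[OF M(1)]) auto
    have MoF: "M - C \<subseteq> F" using MF by blast
    have "card P0 = card {e \<in> M - C. ends e \<inter> P0 \<noteq> {}}"
      by (rule card_end[symmetric, OF mMo]) (use Moff bip(1) MoF in \<open>auto simp: P0_def\<close>)
    also have "{e \<in> M - C. ends e \<inter> P0 \<noteq> {}} = {e \<in> M - C. ends e \<inter> P1 \<noteq> {}}"
    proof -
      have "ends e \<inter> P0 \<noteq> {} \<longleftrightarrow> ends e \<inter> P1 \<noteq> {}" if "e \<in> M - C" for e
      proof -
        have "e \<in> F" "ends e \<subseteq> Y" using that vertsI[of e "M - C"] Moff MF by blast+
        then show ?thesis using bip(3,4)[of e] by blast
      qed
      then show ?thesis by blast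
    qed
    also have "card \<dots> = card P1"
      by (rule card_end[OF mMo]) (use Moff bip(2) MoF in \<open>auto simp: P1_def\<close>)
    finally have c01: "card P0 = card P1" .
    have fin01: "finite P0" "finite P1" using finY by (auto simp: P0_def P1_def)
    have "Y = P0 \<union> P1" by (auto simp: P0_def P1_def)
    then have "P1 \<noteq> {}" using c01 fin01 \<open>Y \<noteq> {}\<close> by auto
    then obtain x where x: "x \<in> P1" by blast
    then have xS: "x \<in> S" by (auto simp: P1_def Y_def)
    then obtain K where K: "mtch K" "verts K = S - {x}" using crit by blast
    have KF: "K \<subseteq> F" using K mtch_sub by blast
    have "P0 \<subseteq> verts K" using K x by (auto simp: P0_def P1_def Y_def)
    then have "card P0 = card {e \<in> K. ends e \<inter> P0 \<noteq> {}}"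
      using card_end[OF K(1), of P0] bip(1) KF by force
    also have "\<dots> \<le> card {e \<in> K. ends e \<inter> (P1 - {x}) \<noteq> {}}"
    proof (rule card_mono)
      show "finite {e \<in> K. ends e \<inter> (P1 - {x}) \<noteq> {}}" using finite_sub[OF KF] by simp
      show "{e \<in> K. ends e \<inter> P0 \<noteq> {}} \<subseteq> {e \<in> K. ends e \<inter> (P1 - {x}) \<noteq> {}}"
      proof
        fix e assume e: "e \<in> {e \<in> K. ends e \<inter> P0 \<noteq> {}}"
        then have "ends e \<inter> P1 \<noteq> {}" using bip(3)[of e] KF by blast
        moreover have "x \<notin> ends e" using vertsI[of e K x] e K(2) by blast
        ultimately show "e \<in> {e \<in> K. ends e \<inter> (P1 - {x}) \<noteq> {}}" using e by blast
      qed
    qed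
    also have "\<dots> = card (P1 - {x})"
    proof (rule card_end[OF K(1)])
      show "P1 - {x} \<subseteq> verts K" using K by (auto simp: P1_def Y_def)
      fix e assume "e \<in> K"
      then have "card (ends e \<inter> P1) \<le> 1" "finite (ends e)" using bip(2) KF finite_ends by auto
      moreover have "card (ends e \<inter> (P1 - {x})) \<le> card (ends e \<inter> P1)"
        using calculation(2) by (intro card_mono) auto
      ultimately show "card (ends e \<inter> (P1 - {x})) \<le> 1" by simp
    qed
    also have "\<dots> < card P1" using x fin01 by (intro psubset_card_mono) auto
    finally show False using c01 by simp
  qed
  then have vC: "verts C = S" using vCS by (auto simp: Y_def)
  then have c5: "5 \<le> card C" using S circ_card_verts[OF C(1) CF] by simp
  \<comment> \<open>Any further edge is an ear consisting of one edge, and this is bad because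
    \<open>C\<close> has at least five edges.\<close>
  have "F \<subseteq> C"
  proof (rule ccontr)
    assume "\<not> F \<subseteq> C"
    then obtain e where e: "e \<in> F" "e \<notin> C" by blast
    obtain x y where xy: "ends e = {x, y}" "x \<noteq> y" using ends_obtain[OF e(1)] by metis
    have "x \<in> verts C" "y \<in> verts C" using e xy vC S(2) by (auto simp: verts_def)
    then have "joined C x y" by (rule circ_joined[OF C(1) CF])
    then obtain J where J: "J \<subseteq> C" "bd J = {x} \<triangle> {y}" using joined_imp_join[OF _ CF] by blast
    have "e \<notin> J" "J \<subseteq> F" using e J CF by auto
    then have "bd (J \<union> {e}) = {}" using bd_insert_join[OF _ J(2) e(1)] xy by simp
    moreover have "bd {e} \<noteq> {}" using xy by (simp add: bd_single)
    ultimately have "theta C {e}" unfolding theta_def using C(1) e(2) J(1) by blast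
    then have "bad C {e}" unfolding bad_def using oddC c5 by (intro conjI) auto
    moreover have "C \<union> {e} \<subseteq> F" using CF e by simp
    ultimately show False by (rule nobad)
  qed
  then have "F = C" using CF by blast
  then show ?thesis using C(1) vC by simp
qed

end

section \<open>The stable set polytope of a line graph\<close>

lemma convex_lookup_le:
  "convex {x :: 'a \<Rightarrow>\<^sub>0 real. (\<Sum>v\<in>K. c v * Poly_Mapping.lookup x v) \<le> g}"
proof (rule convexI)
  fix x y :: "'a \<Rightarrow>\<^sub>0 real" and u v :: real
  assume xy: "x \<in> {x. (\<Sum>v\<in>K. c v * Poly_Mapping.lookup x v) \<le> g}"
    "y \<in> {x. (\<Sum>v\<in>K. c v * Poly_Mapping.lookup x v) \<le> g}" and uv: "0 \<le> u" "0 \<le> v" "u + v = 1"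
  have "(\<Sum>w\<in>K. c w * Poly_Mapping.lookup (u *\<^sub>R x + v *\<^sub>R y) w)
      = u * (\<Sum>w\<in>K. c w * Poly_Mapping.lookup x w) + v * (\<Sum>w\<in>K. c w * Poly_Mapping.lookup y w)"
    by (simp add: lookup_add sum.distrib sum_distrib_left distrib_left mult.left_commute)
  also have "\<dots> \<le> u * g + v * g" using xy uv by (intro add_mono mult_left_mono) auto
  also have "\<dots> = g" using uv by (simp flip: distrib_right)
  finally show "u *\<^sub>R x + v *\<^sub>R y \<in> {x. (\<Sum>v\<in>K. c v * Poly_Mapping.lookup x v) \<le> g}" by simp
qed

context multi
begin

lemma line_edge_iff:
  "{e, f} \<in> line_graph_edges F ends \<longleftrightarrow> e \<in> F \<and> f \<in> F \<and> e \<noteq> f \<and> ends e \<inter> ends f \<noteq> {}"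
  unfolding line_graph_edges_def by (auto simp: doubleton_eq_iff)

lemma stable_iff_mtch: "M \<subseteq> F \<and> indep M (line_graph_edges F ends) \<longleftrightarrow> mtch M"
  unfolding indep_def mtch_def line_edge_iff by blast

lemma STAB_eq: "STAB F (line_graph_edges F ends) = convex hull (incidence_vector ` {M. mtch M})"
  unfolding STAB_def stable_iff_mtch ..

lemma STAB_le:
  assumes x: "x \<in> STAB F (line_graph_edges F ends)" and K: "finite K"
    and le: "\<And>M. mtch M \<Longrightarrow> (\<Sum>v\<in>K \<inter> M. c v) \<le> (g :: real)"
  shows "(\<Sum>v\<in>K. c v * Poly_Mapping.lookup x v) \<le> g"
proof -
  have "convex hull (incidence_vector ` {M. mtch M}) \<subseteq> {x. (\<Sum>v\<in>K. c v * Poly_Mapping.lookup x v) \<le> g}"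
  proof (rule hull_minimal)
    show "incidence_vector ` {M. mtch M} \<subseteq> {x. (\<Sum>v\<in>K. c v * Poly_Mapping.lookup x v) \<le> g}"
    proof clarify
      fix M assume M: "mtch M"
      then have fM: "finite M" using mtch_sub finite_sub by blast
      have "(\<Sum>v\<in>K. c v * Poly_Mapping.lookup (incidence_vector M) v) = (\<Sum>v\<in>K. if v \<in> M then c v else 0)"
        by (rule sum.cong) (simp_all add: lookup_incidence_vector fM)
      also have "\<dots> = (\<Sum>v\<in>K \<inter> M. c v)" using K by (simp add: sum.inter_restrict)
      finally show "(\<Sum>v\<in>K. c v * Poly_Mapping.lookup (incidence_vector M) v) \<le> g" using le[OF M] by simp
    qed
  qed (rule convex_lookup_le)
  then show ?thesis using x unfolding STAB_eq by blast
qed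

lemma keys_STAB:
  assumes "x \<in> STAB F (line_graph_edges F ends)"
  shows "Poly_Mapping.keys x \<subseteq> F"
proof -
  have "convex hull (incidence_vector ` {M. mtch M}) \<subseteq> {x. Poly_Mapping.keys (x :: 'e \<Rightarrow>\<^sub>0 real) \<subseteq> F}"
  proof (rule hull_minimal)
    show "incidence_vector ` {M. mtch M} \<subseteq> {x. Poly_Mapping.keys (x :: 'e \<Rightarrow>\<^sub>0 real) \<subseteq> F}"
    proof clarify
      fix M e assume "mtch M" "e \<in> Poly_Mapping.keys (incidence_vector M :: 'e \<Rightarrow>\<^sub>0 real)"
      then show "e \<in> F" using mtch_sub[of M] finite_sub[of M] keys_incidence[of M] by blast
    qed
  qed (rule convex_keys)
  then show ?thesis using assms unfolding STAB_eq by blast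
qed

lemma clique_mtch:
  assumes "clique K (line_graph_edges F ends)" "mtch M"
  shows "card (K \<inter> M) \<le> 1"
proof (rule ccontr)
  assume "\<not> card (K \<inter> M) \<le> 1"
  moreover have "finite (K \<inter> M)" using assms(2) mtch_sub finite_sub by blast
  ultimately obtain e f where "e \<in> K \<inter> M" "f \<in> K \<inter> M" "e \<noteq> f"
    by (metis card_le_Suc0_iff_eq One_nat_def)
  then show False using assms unfolding clique_def line_edge_iff mtch_def by blast
qed

text \<open>A circuit of the line graph is itself viewed as a multigraph in which every edge is its
  own set of ends (\<open>id\<close>), so the earlier degree counts apply.\<close>

lemma circuit_sums:
  assumes "circuit V E U D"
  shows "card D = card U" "\<And>X. finite X \<Longrightarrow> X \<subseteq> U \<Longrightarrow> 2 * card X = (\<Sum>d\<in>D. card (d \<inter> X))"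
    "\<And>g. 2 * (\<Sum>v\<in>U. g v) = (\<Sum>d\<in>D. \<Sum>v\<in>d. (g v :: nat))" "finite U" "finite D" "D \<subseteq> E"
    "\<And>d. d \<in> D \<Longrightarrow> card d = 2 \<and> d \<subseteq> U" "\<And>v. v \<in> U \<Longrightarrow> card {d \<in> D. v \<in> d} = 2"
proof -
  have sg: "simple_graph U D" and two: "\<And>v. v \<in> U \<Longrightarrow> card {e \<in> D. v \<in> e} = 2" and DE: "D \<subseteq> E"
    using assms by (auto simp: circuit_def)
  have finU: "finite U" and dU: "\<And>d. d \<in> D \<Longrightarrow> card d = 2 \<and> d \<subseteq> U" using sg by (auto simp: simple_graph_def)
  have finD: "finite D" by (rule finite_subset[of _ "Pow U"]) (use dU finU in auto)
  interpret D: multi D id by unfold_locales (use finD dU in auto)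
  have degD: "D.deg D v = 2" if "v \<in> U" for v using two[OF that] by (simp add: D.deg_def)
  show *: "2 * card X = (\<Sum>d\<in>D. card (d \<inter> X))" if "finite X" "X \<subseteq> U" for X
  proof -
    have "(\<Sum>v\<in>X. D.deg D v) = (\<Sum>v\<in>X. 2)" using degD that by (intro sum.cong) auto
    then show ?thesis using D.sum_deg[of D X] that by simp
  qed
  have "(\<Sum>d\<in>D. card (d \<inter> U)) = (\<Sum>d\<in>D. 2)"
    using dU by (intro sum.cong) (auto simp: Int_absorb2)
  then show "card D = card U" using *[OF finU] by simp
  show "2 * (\<Sum>v\<in>U. g v) = (\<Sum>d\<in>D. \<Sum>v\<in>d. g v)" for g :: "_ \<Rightarrow> nat"
  proof -
    have "(\<Sum>d\<in>D. \<Sum>v\<in>d. g v) = (\<Sum>d\<in>D. \<Sum>v\<in>U. if v \<in> d then g v else 0)"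
    proof (rule sum.cong)
      fix d assume "d \<in> D"
      then have "d = U \<inter> d" using dU by auto
      then show "(\<Sum>v\<in>d. g v) = (\<Sum>v\<in>U. if v \<in> d then g v else 0)"
        using finU by (metis sum.inter_restrict)
    qed simp
    also have "\<dots> = (\<Sum>v\<in>U. \<Sum>d\<in>D. if v \<in> d then g v else 0)" by (rule sum.swap)
    also have "\<dots> = (\<Sum>v\<in>U. 2 * g v)"
      using two finD by (intro sum.cong) (simp_all flip: sum.inter_filter)
    finally show ?thesis by (simp add: sum_distrib_left)
  qed
  show "finite U" "finite D" "D \<subseteq> E" "\<And>d. d \<in> D \<Longrightarrow> card d = 2 \<and> d \<subseteq> U" "\<And>v. v \<in> U \<Longrightarrow> card {d \<in> D. v \<in> d} = 2"
    by (fact finU finD DE dU two)+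
qed

lemma circuit_mtch:
  assumes "circuit F (line_graph_edges F ends) U D" "odd (card D)" "mtch M"
  shows "2 * card (U \<inter> M) + 1 \<le> card U"
proof -
  note D = circuit_sums[OF assms(1)]
  have "2 * card (U \<inter> M) = (\<Sum>d\<in>D. card (d \<inter> (U \<inter> M)))" by (rule D(2)) (use D(4) in auto)
  also have "\<dots> \<le> (\<Sum>d\<in>D. 1)"
  proof (rule sum_mono)
    fix d assume d: "d \<in> D"
    then obtain e f where ef: "d = {e, f}" "e \<noteq> f" using D(7)[OF d] by (auto simp: card_2_iff)
    then have "ends e \<inter> ends f \<noteq> {}" using d D(6) line_edge_iff by blast
    then have "\<not> (e \<in> M \<and> f \<in> M)" using assms(3) ef(2) unfolding mtch_def by blast
    then have "d \<inter> (U \<inter> M) \<subseteq> {e} \<or> d \<inter> (U \<inter> M) \<subseteq> {f}" using ef by auto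
    then show "card (d \<inter> (U \<inter> M)) \<le> 1"
      using card_mono[of "{e}" "d \<inter> (U \<inter> M)"] card_mono[of "{f}" "d \<inter> (U \<inter> M)"] by auto
  qed
  also have "\<dots> = card U" using D(1) by simp
  finally have "2 * card (U \<inter> M) \<le> card U" .
  moreover have "odd (card U)" using D(1) assms(2) by simp
  ultimately show ?thesis by presburger
qed

text \<open>Length two has to be excluded: two parallel edges yield only one edge of the line
  graph.\<close>

lemma circ_is_circuit:
  assumes C: "circ C" "C \<subseteq> F" "3 \<le> card C"
  obtains D where "circuit F (line_graph_edges F ends) C D"
proof -
  define D where "D = {{e, f} |e f. e \<in> C \<and> f \<in> C \<and> e \<noteq> f \<and> ends e \<inter> ends f \<noteq> {}}"
  have D_iff: "{e, f} \<in> D \<longleftrightarrow> e \<in> C \<and> f \<in> C \<and> e \<noteq> f \<and> ends e \<inter> ends f \<noteq> {}" for e f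
    unfolding D_def by (auto simp: doubleton_eq_iff)
  have other: "\<exists>f. f \<noteq> e \<and> {g \<in> C. v \<in> ends g} = {e, f}" if e: "e \<in> C" "v \<in> ends e" for e v
  proof -
    have "card {g \<in> C. v \<in> ends g} = 2"
      using circ_deg[OF C(1,2) vertsI[OF e]] by (simp add: deg_def)
    then obtain p q where pq: "{g \<in> C. v \<in> ends g} = {p, q}" "p \<noteq> q" unfolding card_2_iff by blast
    have "e = p \<or> e = q" using e pq(1) by blast
    then show ?thesis
    proof
      assume "e = p"
      then show ?thesis using pq by (intro exI[of _ q]) simp
    next
      assume "e = q"
      then show ?thesis using pq by (intro exI[of _ p]) (simp add: insert_commute)
    qed
  qed
  have two: "card {d \<in> D. e \<in> d} = 2" if e: "e \<in> C" for e
  proof -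
    obtain a b where ab: "ends e = {a, b}" "a \<noteq> b" using ends_obtain e C(2) by blast
    obtain f where f: "f \<noteq> e" "{g \<in> C. a \<in> ends g} = {e, f}" using other[OF e, of a] ab by auto
    obtain h where h: "h \<noteq> e" "{g \<in> C. b \<in> ends g} = {e, h}" using other[OF e, of b] ab by auto
    have fC: "f \<in> C" "a \<in> ends f" and hC: "h \<in> C" "b \<in> ends h" using f h by blast+
    have "f \<noteq> h"
    proof
      assume "f = h"
      then have bf: "b \<in> ends f" using hC by simp
      have "ends f = {a, b}"
        using fC bf ab(2) other_end[of f a] C(2) by (metis insert_iff singletonD subsetD)
      moreover have "{e, f} = {e} \<triangle> {f}" using f(1) by auto
      ultimately have "bd {e, f} = {}"
        using bd_sdiff[of "{e}" "{f}"] e fC C(2) ab by (simp add: bd_single subset_iff)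
      then have "C = {e, f}" using circD(3)[OF C(1), of "{e, f}"] e fC by blast
      then have "card C \<le> 2" by (simp add: card_insert_if)
      then show False using C(3) by simp
    qed
    have "{d \<in> D. e \<in> d} = {{e, f}, {e, h}}"
    proof
      show "{d \<in> D. e \<in> d} \<subseteq> {{e, f}, {e, h}}"
      proof
        fix d assume d: "d \<in> {d \<in> D. e \<in> d}"
        then obtain g where g: "d = {e, g}" unfolding D_def by blast
        then have gC: "g \<in> C" "g \<noteq> e" "ends e \<inter> ends g \<noteq> {}" using d D_iff by auto
        have "g \<in> {e, f}" if "a \<in> ends g" unfolding f(2)[symmetric] using that gC by simp
        moreover have "g \<in> {e, h}" if "b \<in> ends g" unfolding h(2)[symmetric] using that gC by simp
        moreover have "a \<in> ends g \<or> b \<in> ends g" using gC(3) ab(1) by auto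
        ultimately have "g \<in> {e, f} \<or> g \<in> {e, h}" by blast
        then show "d \<in> {{e, f}, {e, h}}" using g gC(2) by auto
      qed
      have "a \<in> ends e \<inter> ends f" "b \<in> ends e \<inter> ends h" using ab fC hC by auto
      then have "{e, f} \<in> D" "{e, h} \<in> D" using e fC hC f(1) h(1) D_iff by auto
      then show "{{e, f}, {e, h}} \<subseteq> {d \<in> D. e \<in> d}" by auto
    qed
    moreover have "{e, f} \<noteq> {e, h}" using \<open>f \<noteq> h\<close> by (auto simp: doubleton_eq_iff)
    ultimately show ?thesis by simp
  qed
  have adj: "(e, g) \<in> {(x, y). {x, y} \<in> D}\<^sup>*" if "e \<in> C" "g \<in> C" "v \<in> ends e" "v \<in> ends g" for e g v
    using that D_iff by (cases "e = g") auto
  have conn: "(e, g) \<in> {(x, y). {x, y} \<in> D}\<^sup>*" if e: "e \<in> C" and g: "g \<in> C" for e g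
  proof -
    obtain a where a: "a \<in> ends e" using ends_obtain e C(2) by blast
    obtain b where b: "b \<in> ends g" using ends_obtain g C(2) by blast
    have "joined C a b" using circ_joined[OF C(1,2) vertsI[OF e a] vertsI[OF g b]] .
    then have "\<forall>h\<in>C. b \<in> ends h \<longrightarrow> (e, h) \<in> {(x, y). {x, y} \<in> D}\<^sup>*"
    proof (induction rule: joined_induct)
      case base
      then show ?case using adj[OF e _ a] by blast
    next
      case (step x y k)
      then have ek: "(e, k) \<in> {(x, y). {x, y} \<in> D}\<^sup>*" by blast
      have yk: "y \<in> ends k" using step(3) by simp
      show ?case using rtrancl_trans[OF ek adj[OF step(2) _ yk]] by blast
    qed
    then show ?thesis using g b by blast
  qed
  have "circuit F (line_graph_edges F ends) C D"
    unfolding circuit_def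
  proof (intro conjI ballI)
    show "C \<subseteq> F" by fact
    show "D \<subseteq> line_graph_edges F ends"
    proof
      fix d assume "d \<in> D"
      then obtain e f where ef: "d = {e, f}" "e \<in> C" "f \<in> C" "e \<noteq> f" "ends e \<inter> ends f \<noteq> {}"
        unfolding D_def by blast
      then show "d \<in> line_graph_edges F ends" using C(2) line_edge_iff by blast
    qed
    show "simple_graph C D"
      using finite_sub[OF C(2)] by (auto simp: simple_graph_def D_def)
    show "connected_graph C D" using conn circD(1)[OF C(1)] by (simp add: connected_graph_def)
    show "card {e \<in> D. v \<in> e} = 2" if "v \<in> C" for v using two[OF that] .
  qed
  then show ?thesis using that by blast
qed

lemma clique_extend:
  assumes "clique K (line_graph_edges F ends)" "K \<subseteq> F"
  obtains K' where "maximal_clique F (line_graph_edges F ends) K'" "K \<subseteq> K'"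
proof -
  let ?E = "line_graph_edges F ends"
  let ?P = "\<lambda>K'. K' \<subseteq> F \<and> clique K' ?E \<and> K \<subseteq> K'"
  have P0: "?P K" using assms by simp
  have "\<exists>x. ?P x \<and> (\<forall>y. ?P y \<longrightarrow> card y \<le> card x)"
    by (rule ex_has_greatest_nat[of ?P K card "Suc (card F)"])
      (use P0 card_mono[OF finF] in \<open>auto simp: less_Suc_eq_le\<close>)
  then obtain K' where K': "?P K'" "\<And>y. ?P y \<Longrightarrow> card y \<le> card K'" by auto
  have "K'' = K'" if "K'' \<subseteq> F" "clique K'' ?E" "K' \<subseteq> K''" for K''
  proof -
    have "K \<subseteq> K''" using K'(1) that(3) by blast
    then have "card K'' \<le> card K'" using K'(2) that by simp
    then show ?thesis using card_seteq[OF finite_sub[OF that(1)] that(3)] by simp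
  qed
  then have "maximal_clique F ?E K'" using K'(1) unfolding maximal_clique_def by auto
  then show ?thesis using that K'(1) by blast
qed

section \<open>The inequalities, and why they suffice in the absence of bad thetas\<close>

definition relaxation :: "('e \<Rightarrow>\<^sub>0 real) set" where
  "relaxation = {x. Poly_Mapping.keys x \<subseteq> F \<and> (\<forall>v\<in>F. Poly_Mapping.lookup x v \<ge> 0) \<and>
     (\<forall>K. maximal_clique F (line_graph_edges F ends) K \<longrightarrow> (\<Sum>v\<in>K. Poly_Mapping.lookup x v) \<le> 1) \<and>
     (\<forall>U D. circuit F (line_graph_edges F ends) U D \<and> odd (card D) \<longrightarrow>
        (\<Sum>v\<in>U. Poly_Mapping.lookup x v) \<le> (real (card U) - 1) / 2)}"

lemma h_perfect_iff: "h_perfect F (line_graph_edges F ends) \<longleftrightarrow> STAB F (line_graph_edges F ends) = relaxation"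
  unfolding h_perfect_def relaxation_def ..

lemma STAB_subset_relaxation: "STAB F (line_graph_edges F ends) \<subseteq> relaxation"
proof
  fix x assume x: "x \<in> STAB F (line_graph_edges F ends)"
  have "0 \<le> Poly_Mapping.lookup x v" if v: "v \<in> F" for v
    using STAB_le[OF x, of "{v}" "\<lambda>_. -1" 0] by (simp add: sum_nonpos)
  moreover have "(\<Sum>v\<in>K. Poly_Mapping.lookup x v) \<le> 1"
    if K: "maximal_clique F (line_graph_edges F ends) K" for K
  proof -
    have K': "K \<subseteq> F" "clique K (line_graph_edges F ends)" using K by (auto simp: maximal_clique_def)
    have "(\<Sum>v\<in>K \<inter> M. (1 :: real)) \<le> 1" if "mtch M" for M using clique_mtch[OF K'(2) that] by simp
    then show ?thesis using STAB_le[OF x finite_sub[OF K'(1)], of "\<lambda>_. 1" 1] by simp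
  qed
  moreover have "(\<Sum>v\<in>U. Poly_Mapping.lookup x v) \<le> (real (card U) - 1) / 2"
    if U: "circuit F (line_graph_edges F ends) U D" "odd (card D)" for U D
  proof -
    have "(\<Sum>v\<in>U \<inter> M. (1 :: real)) \<le> (real (card U) - 1) / 2" if M: "mtch M" for M
    proof -
      have "real (2 * card (U \<inter> M) + 1) \<le> real (card U)" using circuit_mtch[OF U M] by (simp only: of_nat_le_iff)
      then show ?thesis by simp
    qed
    then have "(\<Sum>v\<in>U. 1 * Poly_Mapping.lookup x v) \<le> (real (card U) - 1) / 2"
      by (rule STAB_le[OF x circuit_sums(4)[OF U(1)]])
    then show ?thesis by simp
  qed
  ultimately show "x \<in> relaxation" using keys_STAB[OF x] by (auto simp: relaxation_def)
qed

text \<open>Each kind of inequality has slack at some matching: \<open>{e}\<close> for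
  nonnegativity, the empty matching for cliques and odd circuits. By the maximality of the face of
  \<open>a\<close>, none of them can therefore be an equation at all maximisers of
  \<open>a\<close>.\<close>

lemma no_bad_imp_h_perfect:
  assumes nobad: "\<And>C P. bad C P \<Longrightarrow> C \<union> P \<subseteq> F \<Longrightarrow> False"
  shows "h_perfect F (line_graph_edges F ends)"
proof -
  let ?E = "line_graph_edges F ends"
  have "z \<in> STAB F ?E" if z: "z \<in> relaxation" for z
  proof (rule ccontr)
    assume "z \<notin> STAB F ?E"
    then have zn: "z \<notin> convex hull (incidence_vector ` {M. mtch M})" by (simp add: STAB_eq)
    have zF: "Poly_Mapping.keys z \<subseteq> F" and znn: "\<And>v. v \<in> F \<Longrightarrow> 0 \<le> Poly_Mapping.lookup z v"
      and zK: "\<And>K. maximal_clique F ?E K \<Longrightarrow> (\<Sum>v\<in>K. Poly_Mapping.lookup z v) \<le> 1"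
      and zC: "\<And>U D. circuit F ?E U D \<Longrightarrow> odd (card D) \<Longrightarrow> (\<Sum>v\<in>U. Poly_Mapping.lookup z v) \<le> (real (card U) - 1) / 2"
      using z by (auto simp: relaxation_def)
    have m0: "mtch {}" by (simp add: mtch_def)
    have MM: "{M. mtch M} \<subseteq> Pow F" "{M. mtch M} \<noteq> {}" using mtch_sub m0 by auto
    obtain a0 where a0: "\<And>M. M \<in> {M. mtch M} \<Longrightarrow> sum a0 M < (\<Sum>v\<in>F. a0 v * Poly_Mapping.lookup z v)"
      using separate_from_hull[OF finF MM zF zn] by blast
    obtain a where a: "\<And>M. M \<in> {M. mtch M} \<Longrightarrow> sum a M < (\<Sum>v\<in>F. a v * Poly_Mapping.lookup z v)"
      and face: "\<And>c g M. (\<And>M. M \<in> {M. mtch M} \<Longrightarrow> sum c M \<le> g) \<Longrightarrow> (\<Sum>v\<in>F. c v * Poly_Mapping.lookup z v) \<le> g \<Longrightarrow>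
       (\<And>M. M \<in> {M. mtch M} \<Longrightarrow> (\<And>N. N \<in> {M. mtch M} \<Longrightarrow> sum a N \<le> sum a M) \<Longrightarrow> sum c M = g) \<Longrightarrow> M \<in> {M. mtch M} \<Longrightarrow> sum c M = g"
      using maximal_face[OF finite_mtch a0] by blast
    have face': "card (K \<inter> M) = g"
      if "K \<subseteq> F" "\<And>M. mtch M \<Longrightarrow> card (K \<inter> M) \<le> g" "(\<Sum>v\<in>K. Poly_Mapping.lookup z v) \<le> real g"
        "\<And>M. opt a M \<Longrightarrow> card (K \<inter> M) = g" "mtch M" for K g M
    proof -
      define c where "c v = (if v \<in> K then 1 else 0 :: real)" for v
      have cM: "sum c N = real (card (K \<inter> N))" if "mtch N" for N
        using finite_sub[OF mtch_sub[OF that]] by (simp add: c_def sum.If_cases Int_commute)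
      have "(\<Sum>v\<in>F. c v * Poly_Mapping.lookup z v) = (\<Sum>v\<in>F. if v \<in> K then Poly_Mapping.lookup z v else 0)"
        by (rule sum.cong) (simp_all add: c_def)
      also have "\<dots> = (\<Sum>v\<in>K. Poly_Mapping.lookup z v)"
        using finF \<open>K \<subseteq> F\<close> by (simp add: sum.inter_restrict[symmetric] Int_absorb1)
      finally have cz: "(\<Sum>v\<in>F. c v * Poly_Mapping.lookup z v) = (\<Sum>v\<in>K. Poly_Mapping.lookup z v)" .
      have "sum c M = real g"
        by (rule face) (use that cM cz in \<open>auto simp: opt_def\<close>)
      then show ?thesis using cM[OF \<open>mtch M\<close>] by simp
    qed
    have nonneg: "0 \<le> a e" if e: "e \<in> F" for e
    proof (rule ccontr)
      assume neg: "\<not> 0 \<le> a e"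
      define c where "c v = (if v = e then -1 else 0 :: real)" for v
      have cM: "sum c N = (if e \<in> N then -1 else 0)" if "mtch N" for N
        using finite_sub[OF mtch_sub[OF that]] by (simp add: c_def)
      have "(\<Sum>v\<in>F. c v * Poly_Mapping.lookup z v) = (\<Sum>v\<in>F. if v = e then - Poly_Mapping.lookup z v else 0)"
        by (rule sum.cong) (simp_all add: c_def)
      also have "\<dots> = - Poly_Mapping.lookup z e" using finF e by simp
      finally have cz: "(\<Sum>v\<in>F. c v * Poly_Mapping.lookup z v) \<le> 0" using znn[OF e] by simp
      have me: "mtch {e}" using e by (simp add: mtch_def)
      have "sum c {e} = 0"
      proof (rule face)
        show "sum c M \<le> 0" if "M \<in> {M. mtch M}" for M using cM[of M] that by simp
        show "(\<Sum>v\<in>F. c v * Poly_Mapping.lookup z v) \<le> 0" by (rule cz)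
        show "{e} \<in> {M. mtch M}" using me by simp
        fix M assume M: "M \<in> {M. mtch M}" and best: "\<And>N. N \<in> {M. mtch M} \<Longrightarrow> sum a N \<le> sum a M"
        have "e \<notin> M"
        proof
          assume eM: "e \<in> M"
          have "mtch (M - {e})" using M mtch_subset[of M "M - {e}"] by auto
          then have "sum a (M - {e}) \<le> sum a M" using best by simp
          moreover have "finite M" using M mtch_sub finite_sub by blast
          ultimately show False using eM neg by (simp add: sum_diff1)
        qed
        then show "sum c M = 0" using cM M by simp
      qed
      then show False using cM[OF me] by simp
    qed
    obtain e0 where e0: "e0 \<in> F" "0 < a e0"
    proof -
      have "\<exists>e\<in>F. 0 < a e"
      proof (rule ccontr)
        assume "\<not> ?thesis"
        then have "a e = 0" if "e \<in> F" for e using nonneg[OF that] that by force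
        then show False using a[of "{}"] m0 by simp
      qed
      then show ?thesis using that by blast
    qed
    have clique_not_tight: "\<not> (\<forall>M. opt a M \<longrightarrow> 1 \<le> card (K \<inter> M))" if K: "clique K ?E" "K \<subseteq> F" for K
    proof
      assume hit: "\<forall>M. opt a M \<longrightarrow> 1 \<le> card (K \<inter> M)"
      obtain K' where K': "maximal_clique F ?E K'" "K \<subseteq> K'" using clique_extend K by blast
      have K'F: "K' \<subseteq> F" "clique K' ?E" using K' by (auto simp: maximal_clique_def)
      have "card (K' \<inter> {}) = 1"
      proof (rule face'[OF K'F(1)])
        show le: "card (K' \<inter> M) \<le> 1" if "mtch M" for M using clique_mtch[OF K'F(2) that] .
        show "(\<Sum>v\<in>K'. Poly_Mapping.lookup z v) \<le> real 1" using zK[OF K'(1)] by simp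
        show "mtch {}" by (rule m0)
        fix M assume M: "opt a M"
        then have mM: "mtch M" by (simp add: opt_def)
        have "card (K \<inter> M) \<le> card (K' \<inter> M)"
          using K'(2) finite_sub[OF mtch_sub[OF mM]] by (intro card_mono) auto
        then show "card (K' \<inter> M) = 1" using hit M le[OF mM] by fastforce
      qed
      then show False by simp
    qed
    have missed: "\<exists>M. opt a M \<and> v \<notin> verts M" for v
    proof (rule ccontr)
      assume n: "\<nexists>M. opt a M \<and> v \<notin> verts M"
      let ?K = "{e \<in> F. v \<in> ends e}"
      have "clique ?K ?E" unfolding clique_def line_edge_iff by blast
      moreover have "1 \<le> card (?K \<inter> M)" if M: "opt a M" for M
      proof -
        have MF: "M \<subseteq> F" using M by (auto simp: opt_def mtch_def)
        obtain e where "e \<in> M" "v \<in> ends e" using n M by (auto simp: verts_def)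
        then have "?K \<inter> M \<noteq> {}" using MF by blast
        moreover have "finite (?K \<inter> M)" using finF by simp
        ultimately show ?thesis by (simp add: Suc_le_eq card_gt_0_iff)
      qed
      ultimately show False using clique_not_tight[of ?K] by auto
    qed
    obtain S where S: "finite S" "odd (card S)" "3 \<le> card S"
      "\<And>M. opt a M \<Longrightarrow> 2 * card (M \<inter> induced S) + 1 = card S"
      "\<And>v x y. v \<in> S \<Longrightarrow> x \<in> S - {v} \<Longrightarrow> y \<in> S - {v} \<Longrightarrow> joined {e \<in> induced S. v \<notin> ends e} x y"
      by (rule critical_set[OF nonneg e0 missed]) (assumption | rule that)+
    show False
    proof (cases "card S = 3")
      case True
      \<comment> \<open>Any two edges on three vertices share an end, parallel edges
        included.\<close>
      have "clique (induced S) ?E"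
        unfolding clique_def line_edge_iff
      proof (intro ballI impI conjI notI)
        fix e f assume ef: "e \<in> induced S" "f \<in> induced S" "e \<noteq> f" and d: "ends e \<inter> ends f = {}"
        then have "ends e \<union> ends f \<subseteq> S" "e \<in> F" "f \<in> F" by (auto simp: induced_def)
        moreover have "card (ends e \<union> ends f) = 4"
          using d ends2 finite_ends calculation(2,3) by (simp add: card_Un_disjoint)
        ultimately show False using card_mono[OF S(1), of "ends e \<union> ends f"] True by simp
      qed (auto simp: induced_def)
      moreover have "1 \<le> card (induced S \<inter> M)" if "opt a M" for M
        using S(4)[OF that] True by (simp add: Int_commute)
      ultimately show False using clique_not_tight[OF _ induced_sub] by blast
    next
      case False
      then have S5: "5 \<le> card S" using S(2,3) by presburger
      interpret I: multi "induced S" ends by (rule multi_sub[OF induced_sub])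
      have "circ (induced S) \<and> verts (induced S) = S"
      proof (rule I.critical_is_circ)
        show "finite S" "5 \<le> card S" by fact+
        show "verts (induced S) \<subseteq> S" by (auto simp: verts_def induced_def)
        show "joined {e \<in> induced S. v \<notin> ends e} x y" if "v \<in> S" "x \<in> S - {v}" "y \<in> S - {v}" for v x y
          using S(5) that .
        show False if "bad C P" "C \<union> P \<subseteq> induced S" for C P
          using nobad[of C P] that induced_sub[of S] by blast
        fix v assume v: "v \<in> S"
        obtain M where M: "opt a M" "v \<notin> verts M" using missed by blast
        let ?N = "M \<inter> induced S"
        have mM: "mtch M" using M by (simp add: opt_def)
        have mN: "mtch ?N" by (rule mtch_subset[OF mM]) blast
        have "I.mtch ?N" using mN unfolding mtch_def I.mtch_def by blast
        moreover have "verts ?N = S - {v}"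
        proof (rule card_subset_eq)
          show "finite (S - {v})" using S(1) by simp
          show "verts ?N \<subseteq> S - {v}"
            using verts_induced[of M S] M(2) verts_mono[of ?N M] by blast
          show "card (verts ?N) = card (S - {v})"
            using card_verts_mtch[OF mN] S(4)[OF M(1)] v S(1) by simp
        qed
        ultimately show "\<exists>N. I.mtch N \<and> verts N = S - {v}" by blast
      qed
      then have C: "circ (induced S)" "verts (induced S) = S" by auto
      have cC: "card (induced S) = card S" using circ_card_verts[OF C(1) induced_sub] C(2) by simp
      then have "3 \<le> card (induced S)" using S by simp
      then obtain D where D: "circuit F ?E (induced S) D" using circ_is_circuit[OF C(1) induced_sub] by blast
      have oD: "odd (card D)" using circuit_sums(1)[OF D] cC S(2) by simp
      define g where "g = (card S - 1) div 2"
      have g: "2 * g + 1 = card S" using S(2,3) unfolding g_def by presburger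
      have "card (induced S \<inter> {}) = g"
      proof (rule face'[OF induced_sub])
        show "card (induced S \<inter> M) \<le> g" if "mtch M" for M
          using circuit_mtch[OF D oD that] cC g by simp
        have "(real (card (induced S)) - 1) / 2 = real g" using cC g by (simp flip: g)
        then show "(\<Sum>v\<in>induced S. Poly_Mapping.lookup z v) \<le> real g" using zC[OF D oD] by simp
        show "card (induced S \<inter> M) = g" if "opt a M" for M
          using S(4)[OF that] g by (simp add: Int_commute)
      qed (rule m0)
      then show False using g S5 by simp
    qed
  qed
  then show ?thesis using STAB_subset_relaxation h_perfect_iff by blast
qed

end

section \<open>Thetas\<close>

locale theta_graph = multi F ends for F :: "'e set" and ends :: "'e \<Rightarrow> 'w set" +
  fixes C P :: "'e set"
  assumes th: "theta C P" and CF: "C \<subseteq> F" and PF: "P \<subseteq> F"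
begin

abbreviation "T \<equiv> C \<union> P"

lemma circC: "circ C" and PC: "P \<inter> C = {}" and Pne: "P \<noteq> {}" and bdP: "bd P \<noteq> {}"
  using thetaD[OF th] by blast+

lemma TF: "T \<subseteq> F" using CF PF by blast

text \<open>\<open>A\<close> and \<open>A'\<close> are the two arcs into which the ends of the ear
  divide \<open>C\<close>; each of them forms a circuit with \<open>P\<close>.\<close>

definition A where "A = (SOME A. A \<subseteq> C \<and> bd (A \<union> P) = {})"

lemma A: "A \<subseteq> C" "bd (A \<union> P) = {}"
proof -
  have "\<exists>A. A \<subseteq> C \<and> bd (A \<union> P) = {}" using thetaD(5)[OF th] by blast
  then have "A \<subseteq> C \<and> bd (A \<union> P) = {}" unfolding A_def by (rule someI_ex)
  then show "A \<subseteq> C" "bd (A \<union> P) = {}" by auto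
qed

lemma AF: "A \<subseteq> F" using A CF by blast

definition "A' = C - A"

lemma A': "A' \<subseteq> C" "bd (A' \<union> P) = {}"
proof -
  show "A' \<subseteq> C" by (auto simp: A'_def)
  have "A' \<union> P = (A \<union> P) \<triangle> C" unfolding A'_def sdiff_def using A(1) PC by blast
  then show "bd (A' \<union> P) = {}"
    using bd_sdiff[of "A \<union> P" C] A AF PF CF circD(2)[OF circC] by simp
qed

text \<open>A cycle containing \<open>P\<close> is moved into \<open>C\<close> by adding
  \<open>A \<union> P\<close>, and the only cycles inside \<open>C\<close> are the empty set and
  \<open>C\<close>.\<close>

lemma cycle_cases:
  assumes "z \<subseteq> T" "bd z = {}" "z \<noteq> {}"
  shows "z = C \<or> z = A \<union> P \<or> z = A' \<union> P"
proof -
  have zF: "z \<subseteq> F" using assms TF by blast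
  consider "z \<inter> P = {}" | "P \<subseteq> z" using thetaD(6)[OF th assms(1,2)] by blast
  then show ?thesis
  proof cases
    case 1
    then have "z \<subseteq> C" using assms(1) by blast
    then show ?thesis using circD(3)[OF circC] assms(2,3) by blast
  next
    case 2
    let ?y = "z \<triangle> (A \<union> P)"
    have "bd ?y = {}" using bd_sdiff[OF zF, of "A \<union> P"] AF PF assms(2) A(2) by simp
    moreover have "?y \<subseteq> C" unfolding sdiff_def using 2 assms(1) A(1) by blast
    ultimately have "?y = {} \<or> ?y = C" using circD(3)[OF circC] by blast
    then show ?thesis
    proof
      assume "?y = {}"
      then show ?thesis by simp
    next
      assume y: "?y = C"
      have "z = ?y \<triangle> (A \<union> P)" by (simp add: sdiff_assoc)
      then have "z = C \<triangle> (A \<union> P)" by (simp only: y)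
      also have "C \<triangle> (A \<union> P) = A' \<union> P" unfolding A'_def sdiff_def using A(1) PC by blast
      finally show ?thesis by simp
    qed
  qed
qed

lemma A_ne: "A \<noteq> C" "A' \<noteq> C"
proof -
  have no: "B \<noteq> C" if "bd (B \<union> P) = {}" for B
  proof
    assume "B = C"
    moreover have "C \<inter> P = {}" using PC by blast
    ultimately have "bd C \<triangle> bd P = {}" using bd_Un[OF CF PF] that by simp
    then show False using bdP circD(2)[OF circC] by simp
  qed
  show "A \<noteq> C" "A' \<noteq> C" using no A(2) A'(2) by blast+
qed

lemma circ1: "circ (A \<union> P)" and circ2: "circ (A' \<union> P)"
proof -
  have c: "circ (B \<union> P)" if B: "B \<subseteq> C" "bd (B \<union> P) = {}" "B \<noteq> C" for B
    unfolding circ_def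
  proof (intro conjI allI impI)
    show "B \<union> P \<noteq> {}" using Pne by blast
    show "bd (B \<union> P) = {}" by fact
    fix z assume z: "z \<subseteq> B \<union> P" "bd z = {}"
    have BF: "B \<union> P \<subseteq> F" and zF: "z \<subseteq> F" using B CF PF z by blast+
    have "z \<subseteq> T" using z B by blast
    then consider "z \<inter> P = {}" | "P \<subseteq> z" using thetaD(6)[OF th _ z(2)] by blast
    then show "z = {} \<or> z = B \<union> P"
    proof cases
      case 1
      then have "z \<subseteq> B" using z(1) by blast
      then show ?thesis using circD(3)[OF circC _ z(2)] B by blast
    next
      case 2
      have "bd ((B \<union> P) - z) = {}" using bd_Diff[OF BF z(1)] z(2) B(2) by simp
      moreover have "(B \<union> P) - z \<subseteq> B" using 2 by blast
      ultimately have "(B \<union> P) - z = {}" using circD(3)[OF circC, of "(B \<union> P) - z"] B by blast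
      then show ?thesis using z(1) by blast
    qed
  qed
  show "circ (A \<union> P)" "circ (A' \<union> P)" using c A A' A_ne by blast+
qed

lemma bdA: "bd A = bd P"
proof -
  have "A \<inter> P = {}" using A(1) PC by blast
  then have "bd A \<triangle> bd P = {}" using bd_Un[OF AF PF] A(2) by simp
  then show ?thesis by simp
qed

text \<open>A join inside \<open>P\<close> between two boundary vertices closes up through
  \<open>C\<close> to a cycle. Since \<open>P\<close> is indivisible, the join is all of
  \<open>P\<close>.\<close>

lemma two_branches: "\<exists>u v. u \<noteq> v \<and> bd P = {u, v}"
proof -
  obtain u where u: "u \<in> bd P" using bdP by blast
  obtain v where v: "v \<in> bd P" "v \<noteq> u" "joined P u v" using joined_other_bd[OF PF u] by metis
  obtain J where J: "J \<subseteq> P" "bd J = {u} \<triangle> {v}" using joined_imp_join[OF v(3) PF] by blast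
  have "bd P \<subseteq> verts C"
    using bdA bd_subset_verts[OF AF] verts_mono[OF A(1)] by blast
  then have "joined C u v" using circ_joined[OF circC CF] u v by blast
  then obtain K where K: "K \<subseteq> C" "bd K = {u} \<triangle> {v}" using joined_imp_join CF by blast
  have "J \<subseteq> F" "K \<subseteq> F" "J \<inter> K = {}" using J K PF CF PC by blast+
  then have "bd (J \<union> K) = {}" using bd_Un J K by simp
  moreover have "J \<union> K \<subseteq> T" using J K by blast
  ultimately have "(J \<union> K) \<inter> P = {} \<or> P \<subseteq> J \<union> K" using thetaD(6)[OF th] by blast
  moreover have "J \<noteq> {}"
  proof
    assume "J = {}"
    then have "{u} \<triangle> {v} = {}" using J(2) by simp
    then show False using v by simp
  qed
  ultimately have "P \<subseteq> J" using J K PC by blast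
  then have "P = J" using J by blast
  moreover have "{u} \<triangle> {v} = {u, v}" unfolding sdiff_def using v by blast
  ultimately have "bd P = {u, v}" using J by simp
  then show ?thesis using v by blast
qed

definition u where "u = (SOME u. \<exists>v. u \<noteq> v \<and> bd P = {u, v})"
definition v where "v = (SOME v. u \<noteq> v \<and> bd P = {u, v})"

lemma uv: "u \<noteq> v" "bd P = {u, v}"
proof -
  have "\<exists>v. u \<noteq> v \<and> bd P = {u, v}" unfolding u_def by (rule someI_ex) (rule two_branches)
  then have "u \<noteq> v \<and> bd P = {u, v}" unfolding v_def by (rule someI_ex)
  then show "u \<noteq> v" "bd P = {u, v}" by auto
qed

lemma uvC: "u \<in> verts C" "v \<in> verts C"
  using uv(2) bdA bd_subset_verts[OF AF] verts_mono[OF A(1)] by blast+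

text \<open>\<open>C\<close>, \<open>A \<union> P\<close> and \<open>A' \<union> P\<close> are
  circuits, so the degrees of \<open>A\<close>, \<open>A'\<close> and \<open>P\<close> at
  \<open>w\<close> add up pairwise to 0 or 2; the parity at \<open>P\<close> decides between the
  remaining cases.\<close>

lemma degs:
  shows degP: "w \<in> verts C \<Longrightarrow> deg P w = (if w \<in> {u, v} then 1 else 0)"
    and degT: "w \<in> verts T \<Longrightarrow> deg T w = (if w \<in> {u, v} then 3 else 2)"
proof -
  have dT: "deg T w = deg C w + deg P w" by (rule deg_Un[OF CF PF]) (use PC in blast)
  have dC: "deg C w = deg A w + deg A' w"
  proof -
    have "C = A \<union> A'" "A \<inter> A' = {}" "A' \<subseteq> F" using A(1) CF by (auto simp: A'_def)
    then show ?thesis using deg_Un[OF AF] by metis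
  qed
  have d1: "deg (A \<union> P) w = deg A w + deg P w" by (rule deg_Un[OF AF PF]) (use A PC in blast)
  have d2: "deg (A' \<union> P) w = deg A' w + deg P w"
    by (rule deg_Un[OF _ PF]) (use A' CF PC in blast)+
  have c02: "deg D w = 0 \<or> deg D w = 2" if "circ D" "D \<subseteq> F" for D
    using circ_deg[OF that] deg_zero_iff[OF that(2)] by blast
  have e1: "deg A w + deg P w \<in> {0, 2}" using c02[OF circ1] AF PF d1 by auto
  have e2: "deg A' w + deg P w \<in> {0, 2}" using c02[OF circ2] A'(1) CF PF d2 by auto
  have par: "odd (deg P w) \<longleftrightarrow> w \<in> {u, v}" using uv(2) by (auto simp: bd_def)
  have c2: "deg C w = 2" if "w \<in> verts C" using circ_deg[OF circC CF that] .
  show P: "deg P w = (if w \<in> {u, v} then 1 else 0)" if w: "w \<in> verts C"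
  proof (cases "w \<in> {u, v}")
    case True
    then have "odd (deg P w)" using par by blast
    then have "deg P w = 1" using e1 by (cases "deg P w = 1"; cases "deg P w = 0"; cases "deg P w = 2") auto
    then show ?thesis using True by simp
  next
    case False
    then have "even (deg P w)" using par by blast
    then have "deg P w = 0" using e1 e2 c2[OF w] dC by (cases "deg P w = 0"; cases "deg P w = 2") auto
    then show ?thesis using False by simp
  qed
  show "deg T w = (if w \<in> {u, v} then 3 else 2)" if w: "w \<in> verts T"
  proof (cases "w \<in> verts C")
    case True
    then show ?thesis using P[OF True] c2[OF True] dT by simp
  next
    case False
    then have "deg C w = 0" using deg_zero_iff[OF CF] by blast
    moreover have "deg T w \<noteq> 0" using deg_zero_iff[OF TF] w by blast
    moreover have "w \<notin> {u, v}" using False uvC by blast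
    ultimately show ?thesis using dT dC e1 by auto
  qed
qed

lemma verts_T: "verts T = verts C \<union> verts P"
  by (auto simp: verts_def)

lemma uvT: "u \<in> verts T" "v \<in> verts T"
  using uvC verts_T by blast+

lemma card_T: "card T = card C + card P"
  using finite_sub CF PF PC by (simp add: card_Un_disjoint Int_commute)

lemma card_verts_T: "card (verts T) + 1 = card T"
proof -
  have fin: "finite (verts T)" using finite_verts[OF TF] .
  have "2 * card T = (\<Sum>w\<in>verts T. deg T w)" using sum_deg_verts[OF TF fin] by simp
  also have "\<dots> = (\<Sum>w\<in>verts T. 2 + (if w \<in> {u, v} then 1 else 0))"
    using degT by (intro sum.cong) auto
  also have "\<dots> = 2 * card (verts T) + card {w \<in> verts T. w \<in> {u, v}}"
    unfolding sum.distrib using fin by (simp flip: sum.inter_filter)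
  also have "{w \<in> verts T. w \<in> {u, v}} = {u, v}" using uvT by blast
  finally show ?thesis using uv(1) by simp
qed

lemma branch_in_cycle:
  assumes "z \<subseteq> T" "bd z = {}" "z \<noteq> {}"
  shows "u \<in> verts z" "v \<in> verts z"
proof -
  have "u \<in> verts P" "v \<in> verts P" using uv(2) bd_subset_verts[OF PF] by blast+
  moreover have "verts P \<subseteq> verts (A \<union> P)" "verts P \<subseteq> verts (A' \<union> P)" by (auto simp: verts_def)
  ultimately show "u \<in> verts z" "v \<in> verts z" using cycle_cases[OF assms] uvC by blast+
qed

lemma deg_le1_mtch:
  assumes "J \<subseteq> F" "\<And>w. deg J w \<le> 1"
  shows "mtch J"
proof (rule mtchI[OF assms(1)])
  fix w e f assume ef: "e \<in> J" "f \<in> J" "w \<in> ends e" "w \<in> ends f"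
  have "finite {e \<in> J. w \<in> ends e}" using finite_sub[OF assms(1)] by simp
  then show "e = f" using assms(2)[of w] ef unfolding deg_def
    by (metis (mono_tags, lifting) One_nat_def card_le_Suc0_iff_eq mem_Collect_eq)
qed

lemma joined_from_v:
  assumes "w \<in> verts T" "w \<noteq> u"
  shows "joined {e \<in> T. u \<notin> ends e} v w"
proof -
  have vP: "v \<in> verts (A \<union> P)"
    using uv(2) bd_subset_verts[OF PF] by (auto simp: verts_def)
  consider "w \<in> verts C" | "w \<in> verts (A \<union> P)" using assms(1) by (auto simp: verts_def)
  then show ?thesis
  proof cases
    case 1
    have "joined {e \<in> C. u \<notin> ends e} v w"
      using circ_joined_avoiding[OF circC CF uvC(2) 1 uv(1)[symmetric] assms(2)] .
    then show ?thesis by (rule joined_mono) blast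
  next
    case 2
    have "A \<union> P \<subseteq> F" using AF PF by blast
    then have "joined {e \<in> A \<union> P. u \<notin> ends e} v w"
      using circ_joined_avoiding[OF circ1 _ vP 2 uv(1)[symmetric] assms(2)] by blast
    then show ?thesis by (rule joined_mono) (use A(1) in blast)
  qed
qed

text \<open>The join of \<open>T - u\<close> with boundary all other vertices is a perfect matching of \<open>T - u\<close>: by the
  handshake lemma for the interior of \<open>P\<close>, it does not use the edge of \<open>P\<close> at \<open>v\<close>.\<close>

lemma near_perfect:
  assumes oC: "odd (card C)" and oP: "odd (card P)"
  obtains J where "mtch J" "J \<subseteq> T" "verts J = verts T - {u}"
proof -
  let ?S = "{e \<in> T. u \<notin> ends e}"
  let ?X = "verts T - {u}"
  have SF: "?S \<subseteq> F" using TF by blast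
  have fin: "finite (verts T)" using finite_verts[OF TF] .
  have cX: "card ?X = card (verts T) - 1" using uvT fin by simp
  have evT: "even (card T)" using card_T oC oP by simp
  have "even (a - 1)" if "a + 1 = b" "even b" for a b :: nat using that by presburger
  then have evX: "even (card ?X)" using cX card_verts_T evT by metis
  have "\<exists>J\<subseteq>?S. bd J = ?X \<triangle> (if even (card ?X) then {} else {v})"
    by (rule join_even_set[OF SF]) (use fin joined_from_v in auto)
  then obtain J where J: "J \<subseteq> ?S" "bd J = ?X" using evX by auto
  have JT: "J \<subseteq> T" and JF: "J \<subseteq> F" using J SF by blast+
  have Ju: "u \<notin> verts J" using J(1) by (auto simp: verts_def)
  have odd: "odd (deg J w) \<longleftrightarrow> w \<in> ?X" for w
  proof -
    have "odd (deg J w) \<longleftrightarrow> w \<in> bd J" by (simp add: bd_def)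
    then show ?thesis using J(2) by simp
  qed
  have le: "deg J w \<le> deg T w" for w using deg_mono[OF JT TF] .
  have other: "w = v" if e: "e \<in> P" "e \<in> J" "w \<in> ends e" "w \<in> verts C" for e w
  proof -
    have "{e \<in> P. w \<in> ends e} \<noteq> {}" using e by blast
    then have "deg P w \<noteq> 0" using finite_sub[OF PF] unfolding deg_def by simp
    then have "w \<in> {u, v}" using degP[OF e(4)] by (auto split: if_splits)
    moreover have "w \<noteq> u" using vertsI[OF e(2,3)] Ju by blast
    ultimately show ?thesis by blast
  qed
  have dv: "deg J v \<noteq> 3"
  proof
    assume d3: "deg J v = 3"
    have "deg T v = 3" using degT[OF uvT(2)] by simp
    then have "{e \<in> J. v \<in> ends e} = {e \<in> T. v \<in> ends e}"
      using d3 JT finite_sub[OF TF] unfolding deg_def by (intro card_subset_eq) auto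
    moreover have "card {e \<in> P. v \<in> ends e} = 1" using degP[OF uvC(2)] by (simp add: deg_def)
    then obtain e where e: "{e \<in> P. v \<in> ends e} = {e}" by (auto simp: card_1_singleton_iff)
    then have eP: "e \<in> P" "v \<in> ends e" by blast+
    ultimately have eJ: "e \<in> J" by blast
    let ?Y = "verts T - verts C"
    have vY: "v \<notin> ?Y" using uvC by blast
    obtain y where y: "ends e = {v, y}" "y \<noteq> v" using other_end[of e v] eP PF by blast
    have yT: "y \<in> verts T" using vertsI[of e T y] eP y by blast
    have yC: "y \<notin> verts C" using other[OF eP(1) eJ, of y] y by blast
    have eY: "ends e \<inter> ?Y = {y}" unfolding y(1) using vY yT yC by simp
    have "{f \<in> J. card (ends f \<inter> ?Y) = 1} = {e}"
    proof
      show "{e} \<subseteq> {f \<in> J. card (ends f \<inter> ?Y) = 1}" using eJ eY by simp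
      show "{f \<in> J. card (ends f \<inter> ?Y) = 1} \<subseteq> {e}"
      proof
        fix f assume "f \<in> {f \<in> J. card (ends f \<inter> ?Y) = 1}"
        then have f: "f \<in> J" "card (ends f \<inter> ?Y) = 1" by auto
        then obtain x where x: "ends f \<inter> ?Y = {x}" by (auto simp: card_1_singleton_iff)
        have xf: "x \<in> ends f" "x \<in> ?Y" using x by blast+
        have fF: "f \<in> F" using f(1) JF by blast
        obtain w where w: "ends f = {x, w}" "w \<noteq> x" using other_end[OF fF xf(1)] by metis
        have "f \<notin> C" using vertsI[OF _ xf(1)] xf(2) by blast
        then have fP: "f \<in> P" using f(1) JT by blast
        have "w \<notin> ?Y"
        proof
          assume "w \<in> ?Y"
          then have "w \<in> ends f \<inter> ?Y" using w(1) by simp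
          then show False unfolding x using w(2) by simp
        qed
        moreover have "w \<in> verts T" using vertsI[of f T w] fP w by blast
        ultimately have "w = v" using other[OF fP f(1)] w by blast
        then have "f \<in> {e \<in> P. v \<in> ends e}" using fP w(1) by simp
        then show "f \<in> {e}" using e by simp
      qed
    qed
    then have "odd (card (?Y \<inter> bd J))" using handshake[OF JF, of ?Y] fin by simp
    moreover have "?Y \<inter> bd J = ?Y" using J(2) uvC by blast
    moreover have "card ?Y = card (verts T) - card (verts C)"
      using finite_verts[OF CF] verts_T by (simp add: card_Diff_subset)
    moreover have "card (verts C) = card C" using circ_card_verts[OF circC CF] .
    moreover have "card (verts T) - card C = card P - 1" using card_T card_verts_T by linarith
    ultimately show False using oP by simp
  qed
  have le1: "deg J w \<le> 1" for w
  proof (cases "w \<in> ?X")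
    case True
    then have "odd (deg J w)" using odd by blast
    moreover have "deg J w \<le> 3" using le[of w] degT[of w] True by (auto split: if_splits)
    moreover have "deg J w \<noteq> 3" using dv le[of w] degT[of w] True by (cases "w = v") auto
    moreover have "a \<le> 1" if "odd a" "a \<le> 3" "a \<noteq> 3" for a :: nat using that by presburger
    ultimately show ?thesis by blast
  next
    case False
    then have "w \<notin> verts J" using Ju verts_mono[OF JT] by blast
    then have "deg J w = 0" using deg_zero_iff[OF JF] by blast
    then show ?thesis by simp
  qed
  have m: "mtch J" by (rule deg_le1_mtch[OF JF le1])
  then have "verts J = ?X" using bd_mtch J(2) by simp
  then show ?thesis using that m JT by blast
qed

end

text \<open>For the clique inequalities: edges that form a clique of the line graph share a vertex
  or run along a triangle.\<close>

lemma pairwise_meeting: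
  assumes two: "\<And>X. X \<in> K \<Longrightarrow> card X = 2" and meet: "\<And>X Y. X \<in> K \<Longrightarrow> Y \<in> K \<Longrightarrow> X \<inter> Y \<noteq> {}"
    and no: "\<not> (\<exists>w. \<forall>X\<in>K. w \<in> X)"
  obtains a b c where "a \<noteq> b" "b \<noteq> c" "a \<noteq> c" "K = {{a, b}, {b, c}, {a, c}}"
proof -
  obtain X where X: "X \<in> K" using no by blast
  obtain a b where ab: "X = {a, b}" "a \<noteq> b" using two[OF X] by (auto simp: card_2_iff)
  have third: "\<exists>z. Y = {x, z} \<and> z \<noteq> x \<and> z \<noteq> y" if "Y \<in> K" "y \<notin> Y" "x \<in> Y" for x y Y
  proof -
    obtain p q where "Y = {p, q}" "p \<noteq> q" using two[OF \<open>Y \<in> K\<close>] by (auto simp: card_2_iff)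
    then show ?thesis using that(2,3) by (metis insert_commute insert_iff singletonD)
  qed
  obtain Y where Y: "Y \<in> K" "a \<notin> Y" using no by blast
  have "b \<in> Y" using meet[OF X Y(1)] Y(2) ab(1) by blast
  then obtain c where c: "Y = {b, c}" "c \<noteq> b" "c \<noteq> a" using third[OF Y] by blast
  obtain Z where Z: "Z \<in> K" "b \<notin> Z" using no by blast
  have "a \<in> Z" "c \<in> Z" using meet[OF X Z(1)] meet[OF Y(1) Z(1)] Z(2) ab(1) c(1) by blast+
  moreover obtain p q where "Z = {p, q}" using two[OF Z(1)] by (auto simp: card_2_iff)
  ultimately have Z': "Z = {a, c}" using c(3) by auto
  have "Q \<in> {{a, b}, {b, c}, {a, c}}" if Q: "Q \<in> K" for Q
  proof -
    obtain p q where pq: "Q = {p, q}" "p \<noteq> q" using two[OF Q] by (auto simp: card_2_iff)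
    have "a \<in> Q \<or> b \<in> Q" "b \<in> Q \<or> c \<in> Q" "a \<in> Q \<or> c \<in> Q"
      using meet[OF Q X] meet[OF Q Y(1)] meet[OF Q Z(1)] ab(1) c(1) Z' by blast+
    then show ?thesis using pq ab(2) c(2,3) by auto
  qed
  then have "K = {{a, b}, {b, c}, {a, c}}" using X Y Z ab c Z' by blast
  then show ?thesis using that ab(2) c(2,3) by metis
qed

lemma (in multi) deg_zeroI: "A \<subseteq> F \<Longrightarrow> v \<notin> verts A \<Longrightarrow> deg A v = 0"
  by (simp add: deg_zero_iff)

section \<open>The point carried by a bad theta\<close>

context theta_graph
begin

lemma cycle_cards:
  "card C = card A + card A'" "card (A \<union> P) = card A + card P" "card (A' \<union> P) = card A' + card P"
proof -
  have fin: "finite A" "finite A'" "finite P" using finite_sub AF PF A'(1) CF by blast+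
  have "C = A \<union> A'" "A \<inter> A' = {}" using A(1) by (auto simp: A'_def)
  then show "card C = card A + card A'" using fin card_Un_disjoint by metis
  have "A \<inter> P = {}" "A' \<inter> P = {}" using A(1) A'(1) PC by blast+
  then show "card (A \<union> P) = card A + card P" "card (A' \<union> P) = card A' + card P"
    using fin by (simp_all add: card_Un_disjoint)
qed

text \<open>The point is \<open>s / 3\<close>, where \<open>s\<close> is 1 on \<open>T\<close> and
  one more on a matching \<open>N\<close> covering all vertices of \<open>T\<close> except
  \<open>u\<close>, \<open>v\<close> and the vertex matched to \<open>v\<close> by \<open>J\<close>.
  Every vertex gets weight at most 3, as \<open>N\<close> misses the two vertices of degree three.
  The total is \<open>card T + card N = 3 * card J + 1\<close>, whereas a matching has at most
  \<open>card J\<close> edges in \<open>T\<close>.\<close>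

lemma bad_imp_not_h_perfect:
  assumes oC: "odd (card C)" and oP: "odd (card P)" and n4: "card C + card P \<noteq> 4"
  shows "\<not> h_perfect F (line_graph_edges F ends)"
proof -
  let ?E = "line_graph_edges F ends"
  obtain J where J: "mtch J" "J \<subseteq> T" "verts J = verts T - {u}" using near_perfect[OF oC oP] by blast
  have JF: "J \<subseteq> F" using J TF by blast
  have finT: "finite T" and finVT: "finite (verts T)" using finite_sub[OF TF] finite_verts[OF TF] by auto
  have "v \<in> verts J" using J(3) uvT uv(1) by simp
  then obtain m where m: "m \<in> J" "v \<in> ends m" by (auto simp: verts_def)
  define N where "N = J - {m}"
  have NT: "N \<subseteq> T" and NF: "N \<subseteq> F" using J JF by (auto simp: N_def)
  have mN: "mtch N" by (rule mtch_subset[OF J(1)]) (auto simp: N_def)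
  have avoid: "u \<notin> verts N" "v \<notin> verts N"
  proof -
    have "verts N \<subseteq> verts J" by (rule verts_mono) (auto simp: N_def)
    then show "u \<notin> verts N" using J(3) by blast
    show "v \<notin> verts N"
    proof
      assume "v \<in> verts N"
      then obtain f where f: "f \<in> J" "f \<noteq> m" "v \<in> ends f" by (auto simp: N_def verts_def)
      then show False using mtch_same[OF J(1) m(1) f(1) m(2) f(3)] by simp
    qed
  qed
  have "card (verts T - {u}) = 2 * card J" using card_verts_mtch[OF J(1)] J(3) by simp
  then have cVT: "card (verts T) = 2 * card J + 1" using card_of_remove[OF finVT uvT(1)] by simp
  have cT: "card T = 2 * card J + 2" using card_verts_T cVT by simp
  have cN: "card N + 1 = card J" using card_of_remove[OF finite_sub[OF JF] m(1)] by (simp add: N_def)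
  define s :: "'e \<Rightarrow> nat" where "s e = (if e \<in> T then if e \<in> N then 2 else 1 else 0)" for e
  have s2: "s e \<le> 2" for e by (simp add: s_def)
  have s_sum: "(\<Sum>e\<in>K. s e) = card (K \<inter> T) + card (K \<inter> N)" if "finite K" for K
  proof -
    have "(\<Sum>e\<in>K. s e) = (\<Sum>e\<in>K. (if e \<in> T then 1 else 0) + (if e \<in> N then 1 else 0))"
      by (rule sum.cong) (use NT in \<open>auto simp: s_def\<close>)
    also have "\<dots> = card (K \<inter> T) + card (K \<inter> N)"
      unfolding sum.distrib using that by (simp flip: sum.inter_filter add: Int_def)
    finally show ?thesis .
  qed
  have deg_s: "(\<Sum>e\<in>K. s e) \<le> 3" if K: "K \<subseteq> F" "\<And>e. e \<in> K \<Longrightarrow> e \<in> T \<Longrightarrow> w \<in> ends e" for K w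
  proof -
    have "card (K \<inter> T) \<le> deg T w"
      unfolding deg_def by (rule card_mono) (use K finT in auto)
    moreover have "card (K \<inter> N) \<le> deg N w"
      unfolding deg_def by (rule card_mono) (use K NT finite_sub[OF NF] in auto)
    moreover have "deg T w + deg N w \<le> 3"
    proof (cases "w \<in> verts T")
      case True
      show ?thesis
      proof (cases "w \<in> {u, v}")
        case True
        then have "w \<notin> verts N" using avoid by blast
        then have "deg N w = 0" by (rule deg_zeroI[OF NF])
        then show ?thesis using degT[OF \<open>w \<in> verts T\<close>] True by simp
      next
        case False
        then show ?thesis using degT[OF True] deg_mtch[OF mN, of w] by simp
      qed
    next
      case False
      then have "w \<notin> verts N" using verts_mono[OF NT] by blast
      then show ?thesis using False deg_zeroI[OF NF] deg_zeroI[OF TF] by simp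
    qed
    ultimately show ?thesis using s_sum[OF finite_sub[OF K(1)]] by linarith
  qed
  have pair_s: "s e + s f \<le> 3" if "{e, f} \<in> ?E" for e f
  proof -
    have ef: "e \<in> F" "f \<in> F" "e \<noteq> f" "ends e \<inter> ends f \<noteq> {}" using that line_edge_iff by blast+
    then obtain w where "w \<in> ends e" "w \<in> ends f" by blast
    then have "(\<Sum>g\<in>{e, f}. s g) \<le> 3" using ef by (intro deg_s[of _ w]) auto
    then show ?thesis using ef(3) by simp
  qed
  have cyc_uv: "u \<in> verts z" "v \<in> verts z" if "z \<subseteq> T" "bd z = {}" "z \<noteq> {}" for z
    using branch_in_cycle[OF that] by blast+
  have no_N: "s e \<le> 1" if "u \<in> ends e \<or> v \<in> ends e" for e
  proof -
    have "e \<notin> N" using that avoid vertsI by blast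
    then show ?thesis by (simp add: s_def)
  qed
  \<comment> \<open>Edges with a common vertex are bounded by its weight. Otherwise the clique
    contains a triangle of \<open>T\<close>; as a cycle it passes through both \<open>u\<close> and
    \<open>v\<close>, so each of its edges meets one of them and none is in
    \<open>N\<close>.\<close>
  have clq: "(\<Sum>e\<in>K. s e) \<le> 3" if K: "clique K ?E" "K \<subseteq> F" for K
  proof (cases "\<exists>w. \<forall>X\<in>ends ` (K \<inter> T). w \<in> X")
    case True
    then obtain w where w: "\<And>e. e \<in> K \<Longrightarrow> e \<in> T \<Longrightarrow> w \<in> ends e" by blast
    then show ?thesis using deg_s[OF K(2)] by blast
  next
    case False
    have two: "card X = 2" if "X \<in> ends ` (K \<inter> T)" for X using that ends2 K(2) by blast
    have "X \<inter> Y \<noteq> {}" if "X \<in> ends ` (K \<inter> T)" "Y \<in> ends ` (K \<inter> T)" for X Y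
    proof -
      obtain e f where ef: "e \<in> K" "f \<in> K" "X = ends e" "Y = ends f" using \<open>X \<in> _\<close> \<open>Y \<in> _\<close> by blast
      show ?thesis
      proof (cases "e = f")
        case True
        then show ?thesis using ef two[OF \<open>X \<in> _\<close>] by auto
      next
        case False
        then show ?thesis using ef K(1) unfolding clique_def line_edge_iff by blast
      qed
    qed
    then obtain a b c where abc: "a \<noteq> b" "b \<noteq> c" "a \<noteq> c" "ends ` (K \<inter> T) = {{a, b}, {b, c}, {a, c}}"
      using pairwise_meeting[OF two _ False] by metis
    have "{a, b} \<in> ends ` (K \<inter> T)" "{b, c} \<in> ends ` (K \<inter> T)" "{a, c} \<in> ends ` (K \<inter> T)"
      unfolding abc(4) by auto
    then obtain e1 e2 e3 where e: "e1 \<in> K \<inter> T" "ends e1 = {a, b}" "e2 \<in> K \<inter> T" "ends e2 = {b, c}"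
      "e3 \<in> K \<inter> T" "ends e3 = {a, c}" unfolding image_iff by metis
    have "{a, b} \<noteq> {b, c}" "{a, b} \<noteq> {a, c}" "{b, c} \<noteq> {a, c}"
      using abc(1-3) by (simp_all add: doubleton_eq_iff)
    then have ne: "e1 \<noteq> e2" "e1 \<noteq> e3" "e2 \<noteq> e3" using e(2,4,6) by metis+
    let ?t = "{e1, e2, e3}"
    have eF: "e1 \<in> F" "e2 \<in> F" "e3 \<in> F" using e K(2) by blast+
    have "{e1, e2} = {e1} \<triangle> {e2}" unfolding sdiff_def using ne by blast
    then have "bd {e1, e2} = {a, b} \<triangle> {b, c}" using bd_sdiff[of "{e1}" "{e2}"] eF e by (simp add: bd_single)
    also have "\<dots> = {a} \<triangle> {c}" unfolding sdiff_def using abc(1-3) by blast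
    finally have "bd (insert e3 {e1, e2}) = {}"
      using bd_insert_join[of "{e1, e2}" a c e3] eF e ne by simp
    then have bt: "bd ?t = {}" by (simp add: insert_commute)
    have tT: "?t \<subseteq> T" using e by blast
    have ct: "card ?t = 3" using ne by simp
    have vt: "verts ?t = {a, b, c}" using e by (auto simp: verts_def)
    have uvt: "u \<in> {a, b, c}" "v \<in> {a, b, c}" using cyc_uv[OF tT bt] vt by auto
    have "K \<inter> T \<subseteq> ?t"
    proof (rule ccontr)
      assume "\<not> K \<inter> T \<subseteq> ?t"
      then obtain e4 where e4: "e4 \<in> K \<inter> T" "e4 \<notin> ?t" by blast
      have "ends e4 \<in> {{a, b}, {b, c}, {a, c}}" using e4(1) abc(4) by blast
      then obtain f where f: "f \<in> ?t" "ends f = ends e4" using e(2,4,6) by blast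
      have fe: "f \<noteq> e4" using f e4 by blast
      have F4: "{f} \<subseteq> F" "{e4} \<subseteq> F" using f e4 eF K(2) by auto
      let ?d = "{f, e4}"
      have "?d = {f} \<triangle> {e4}" unfolding sdiff_def using fe by blast
      then have bd4: "bd ?d = {}" using bd_sdiff[OF F4] f(2) by (simp add: bd_single)
      have dT: "?d \<subseteq> T" using f(1) e4(1) tT by blast
      have cd: "card ?d = 2" using fe by simp
      have "card z = card C \<or> card z = card A + card P \<or> card z = card A' + card P"
        if "z = C \<or> z = A \<union> P \<or> z = A' \<union> P" for z
        using that cycle_cards by auto
      moreover have "?t = C \<or> ?t = A \<union> P \<or> ?t = A' \<union> P" by (rule cycle_cases[OF tT bt]) simp
      moreover have "?d = C \<or> ?d = A \<union> P \<or> ?d = A' \<union> P" by (rule cycle_cases[OF dT bd4]) simp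
      ultimately have "3 = card C \<or> 3 = card A + card P \<or> 3 = card A' + card P"
        "2 = card C \<or> 2 = card A + card P \<or> 2 = card A' + card P" using ct cd by metis+
      \<comment> \<open>Circuits of lengths two and three in the same theta force
        \<open>card C = 3\<close> and \<open>card P = 1\<close>, the exempted case of a triangle
        with a doubled edge.\<close>
      moreover have "\<not> (3 = c \<or> 3 = k + p \<or> 3 = l + p) \<or> \<not> (2 = c \<or> 2 = k + p \<or> 2 = l + p)"
        if "odd c" "odd p" "c + p \<noteq> 4" "c = k + l" for c p k l :: nat
        using that by presburger
      ultimately show False using oC oP n4 cycle_cards(1) by blast
    qed
    then have KT: "K \<inter> T = ?t" using e by blast
    have "(\<Sum>x\<in>K. s x) = (\<Sum>x\<in>K \<inter> T. s x)"
      by (rule sum.mono_neutral_right) (use finite_sub[OF K(2)] in \<open>auto simp: s_def\<close>)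
    also have "\<dots> \<le> (\<Sum>x\<in>?t. 1)"
      unfolding KT
    proof (rule sum_mono)
      fix x assume x: "x \<in> ?t"
      have "ends x = {a, b} \<or> ends x = {b, c} \<or> ends x = {a, c}" using x e(2,4,6) by blast
      moreover have "u = a \<or> u = b \<or> u = c" "v = a \<or> v = b \<or> v = c" using uvt by blast+
      ultimately have "u \<in> ends x \<or> v \<in> ends x" using uv(1) by (elim disjE) simp_all
      then show "s x \<le> 1" by (rule no_N)
    qed
    also have "\<dots> = 3" using ct by simp
    finally show ?thesis .
  qed
  have odd_circuit: "2 * (\<Sum>e\<in>U. s e) + 3 \<le> 3 * card U"
    if UD: "circuit F ?E U D" and oD: "odd (card D)" for U D
  proof (rule ccontr)
    assume n: "\<not> 2 * (\<Sum>e\<in>U. s e) + 3 \<le> 3 * card U"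
    note D = circuit_sums[OF UD]
    have UF: "U \<subseteq> F" using UD by (auto simp: circuit_def)
    have ds: "(\<Sum>e\<in>d. s e) \<le> 3" if d: "d \<in> D" for d
    proof -
      obtain e f where ef: "d = {e, f}" "e \<noteq> f" using D(7)[OF d] by (auto simp: card_2_iff)
      then show ?thesis using pair_s[of e f] d D(6) by auto
    qed
    have "2 * (\<Sum>e\<in>U. s e) + (\<Sum>d\<in>D. 3 - (\<Sum>e\<in>d. s e)) = (\<Sum>d\<in>D. (\<Sum>e\<in>d. s e) + (3 - (\<Sum>e\<in>d. s e)))"
      unfolding D(3) by (simp add: sum.distrib)
    also have "\<dots> = (\<Sum>d\<in>D. 3)" by (rule sum.cong) (use ds in auto)
    finally have def_sum: "2 * (\<Sum>e\<in>U. s e) + (\<Sum>d\<in>D. 3 - (\<Sum>e\<in>d. s e)) = 3 * card U" using D(1) by simp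
    have oU: "odd (card U)" using D(1) oD by simp
    \<comment> \<open>A violation leaves total slack at most 2 in the inequalities
      \<open>s e + s f \<le> 3\<close> along the circuit. The slack has the parity of
      \<open>card U\<close>, which is odd; so a single pair \<open>d0\<close> has slack one and all
      others are tight.\<close>
    have "(\<Sum>d\<in>D. 3 - (\<Sum>e\<in>d. s e)) = 1"
    proof -
      have "y = 1" if "2 * x + y = 3 * k" "\<not> 2 * x + 3 \<le> 3 * k" "odd k" for x y k :: nat
        using that by presburger
      then show ?thesis using def_sum n oU by blast
    qed
    then obtain d0 where d0: "d0 \<in> D" "3 - (\<Sum>e\<in>d0. s e) = 1" and
      rest: "\<And>d. d \<in> D \<Longrightarrow> d \<noteq> d0 \<Longrightarrow> 3 - (\<Sum>e\<in>d. s e) = 0"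
      using sum_eq_1_iff[OF D(5)] by (metis (no_types, lifting) )
    have sd0: "(\<Sum>e\<in>d0. s e) = 2" using d0 by simp
    have sd: "(\<Sum>e\<in>d. s e) = 3" if "d \<in> D" "d \<noteq> d0" for d using rest[OF that] ds[OF that(1)] by simp
    have nbrs: "\<exists>f g. f \<noteq> g \<and> {e, f} \<in> D \<and> {e, g} \<in> D \<and> f \<noteq> e \<and> g \<noteq> e" if e: "e \<in> U" for e
    proof -
      obtain d d' where dd: "{d \<in> D. e \<in> d} = {d, d'}" "d \<noteq> d'" using D(8)[OF e] by (auto simp: card_2_iff)
      then have d: "d \<in> D" "e \<in> d" "d' \<in> D" "e \<in> d'" by blast+
      obtain f where f: "d = {e, f}" "f \<noteq> e"
        using D(7)[OF d(1)] d(2) by (auto simp: card_2_iff)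
      obtain g where g: "d' = {e, g}" "g \<noteq> e"
        using D(7)[OF d(3)] d(4) by (auto simp: card_2_iff)
      show ?thesis using f g dd(2) d by blast
    qed
    have UT: "U \<subseteq> T"
    proof
      fix e assume e: "e \<in> U"
      obtain f g where fg: "f \<noteq> g" "{e, f} \<in> D" "{e, g} \<in> D" "f \<noteq> e" "g \<noteq> e" using nbrs[OF e] by blast
      have "{e, f} \<noteq> {e, g}" using fg(1) by (auto simp: doubleton_eq_iff)
      then have "{e, f} \<noteq> d0 \<or> {e, g} \<noteq> d0" by blast
      then have "s e + s f = 3 \<or> s e + s g = 3" using sd[OF fg(2)] sd[OF fg(3)] fg(4,5) by auto
      then have "s e \<noteq> 0" using s2[of f] s2[of g] by linarith
      then show "e \<in> T" by (simp add: s_def split: if_splits)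
    qed
    have s1: "1 \<le> s e" if "e \<in> U" for e using that UT by (auto simp: s_def)
    obtain e0 f0 where ef0: "d0 = {e0, f0}" "e0 \<noteq> f0" using D(7)[OF d0(1)] by (auto simp: card_2_iff)
    have ef0U: "e0 \<in> U" "f0 \<in> U" using D(7)[OF d0(1)] ef0 by auto
    have "s e0 + s f0 = 2" using sd0 ef0 by simp
    then have s01: "s e0 = 1" "s f0 = 1" using s1[OF ef0U(1)] s1[OF ef0U(2)] by auto
    have "s e = 2" if "e \<in> N" for e using that subsetD[OF NT that] by (simp add: s_def)
    then have ef0N: "e0 \<notin> N" "f0 \<notin> N" using s01 by fastforce+
    have "ends e0 \<inter> ends f0 \<noteq> {}" using d0(1) ef0 D(6) line_edge_iff by blast
    then obtain z where z: "z \<in> ends e0" "z \<in> ends f0" by blast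
    let ?M = "N \<inter> U"
    have mM: "mtch ?M" by (rule mtch_subset[OF mN]) blast
    let ?Y = "verts ?M"
    have UTv: "verts U \<subseteq> verts T" using verts_mono[OF UT] .
    \<comment> \<open>An edge \<open>n\<close> of \<open>N\<close> has ends of degree two in
      \<open>T\<close>, hence just two neighbours in \<open>T\<close>. Its two neighbours on the
      circuit must be these, so \<open>U\<close> contains all edges of \<open>T\<close> at the ends
      of \<open>n\<close>.\<close>
    have degU: "deg U w = 2" if w: "w \<in> ?Y" for w
    proof -
      obtain n where n: "n \<in> N" "n \<in> U" "w \<in> ends n" using w by (auto simp: verts_def)
      have nF: "n \<in> F" using n UF by blast
      have at: "\<exists>m. {e \<in> T. y \<in> ends e} = {n, m}" if y: "y \<in> ends n" for y
      proof -
        have "y \<in> verts N" using vertsI n y by blast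
        then have "y \<noteq> u" "y \<noteq> v" "y \<in> verts T" using avoid verts_mono[OF NT] by blast+
        then have "card {e \<in> T. y \<in> ends e} = 2" using degT by (simp add: deg_def)
        then obtain p q where pq: "{e \<in> T. y \<in> ends e} = {p, q}" by (auto simp: card_2_iff)
        have "n \<in> {p, q}" unfolding pq[symmetric] using n UT y by blast
        then show ?thesis using pq by (metis insertE insert_commute singletonD)
      qed
      obtain x where x: "ends n = {w, x}" "x \<noteq> w" using other_end[OF nF n(3)] by metis
      obtain m1 where m1: "{e \<in> T. w \<in> ends e} = {n, m1}" using at x by blast
      obtain m2 where m2: "{e \<in> T. x \<in> ends e} = {n, m2}" using at x by blast
      obtain f g where fg: "f \<noteq> g" "{n, f} \<in> D" "{n, g} \<in> D" "f \<noteq> n" "g \<noteq> n" using nbrs[OF n(2)] by blast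
      have in12: "h \<in> {m1, m2}" if h: "{n, h} \<in> D" "h \<noteq> n" for h
      proof -
        have hU: "h \<in> U" using D(7)[OF h(1)] by blast
        have "ends n \<inter> ends h \<noteq> {}" using h(1) D(6) line_edge_iff by blast
        then have "{w, x} \<inter> ends h \<noteq> {}" unfolding x(1) .
        then have "w \<in> ends h \<or> x \<in> ends h" by blast
        then have "h \<in> {e \<in> T. w \<in> ends e} \<or> h \<in> {e \<in> T. x \<in> ends e}" using hU UT by blast
        then show ?thesis unfolding m1 m2 using h(2) by blast
      qed
      have "f \<in> U" "g \<in> U" using D(7)[OF fg(2)] D(7)[OF fg(3)] by blast+
      then have "m1 \<in> U" using in12[OF fg(2,4)] in12[OF fg(3,5)] fg(1) by blast
      have "{e \<in> T. w \<in> ends e} \<subseteq> U" unfolding m1 using n(2) \<open>m1 \<in> U\<close> by simp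
      then have "{e \<in> U. w \<in> ends e} = {e \<in> T. w \<in> ends e}" using UT by blast
      then have "deg U w = deg T w" by (simp add: deg_def)
      moreover have "w \<in> verts N" using vertsI n by blast
      then have "w \<noteq> u" "w \<noteq> v" "w \<in> verts T" using avoid verts_mono[OF NT] by blast+
      ultimately show ?thesis using degT by simp
    qed
    have YT: "?Y \<subseteq> verts T" by (rule verts_mono) (use NT in blast)
    have finY: "finite ?Y" using YT finVT finite_subset by blast
    have zY: "z \<notin> ?Y"
    proof
      assume "z \<in> ?Y"
      then obtain n where n: "n \<in> N" "n \<in> U" "z \<in> ends n" by (auto simp: verts_def)
      have "{n, e0, f0} \<subseteq> {e \<in> T. z \<in> ends e}" using n ef0U z UT by blast
      then have "card {n, e0, f0} \<le> deg T z" unfolding deg_def using finT by (intro card_mono) auto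
      moreover have "card {n, e0, f0} = 3"
      proof -
        have "n \<noteq> e0" "n \<noteq> f0" using n(1) ef0N by blast+
        then show ?thesis using ef0(2) by simp
      qed
      moreover have "z \<in> verts N" using vertsI n by blast
      then have "z \<noteq> u" "z \<noteq> v" "z \<in> verts T" using avoid verts_mono[OF NT] by blast+
      then have "deg T z = 2" using degT by simp
      ultimately show False by simp
    qed
    have dz: "2 \<le> deg U z"
    proof -
      have "{e0, f0} \<subseteq> {e \<in> U. z \<in> ends e}" using ef0U z by blast
      then have "card {e0, f0} \<le> deg U z" unfolding deg_def using D(4) by (intro card_mono) auto
      then show ?thesis using ef0(2) by simp
    qed
    have zT: "z \<in> verts T" using vertsI[OF ef0U(1) z(1)] UTv by blast
    have "(\<Sum>w\<in>verts T. deg U w) = 2 * card U" by (rule sum_deg_verts[OF UF finVT UTv])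
    moreover have "(\<Sum>w\<in>verts T. deg U w) = (\<Sum>w\<in>?Y. deg U w) + (\<Sum>w\<in>verts T - ?Y. deg U w)"
      using sum.subset_diff[OF YT finVT, of "deg U"] by simp
    moreover have "(\<Sum>w\<in>?Y. deg U w) = 4 * card ?M"
      using degU card_verts_mtch[OF mM] by simp
    moreover have "(\<Sum>e\<in>U. s e) = card U + card ?M"
      using s_sum[OF D(4)] UT by (simp add: Int_absorb2 Int_commute)
    \<comment> \<open>With \<open>k = card U\<close> and \<open>m = card ?M\<close>, the violation
      gives \<open>k < 2 * m + 3\<close>, hence \<open>k \<le> 2 * m + 1\<close> by parity. So a
      degree sum of at most two is left outside \<open>?Y\<close>, and \<open>z\<close> uses it
      up.\<close>
    moreover have "y \<le> 2"
      if "t = 2 * k" "t = 4 * m + y" "x = k + m" "\<not> 2 * x + 3 \<le> 3 * k" "odd k" for t k m x y :: nat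
      using that by presburger
    ultimately have left: "(\<Sum>w\<in>verts T - ?Y. deg U w) \<le> 2" using n oU by metis
    have zero: "deg U w = 0" if w: "w \<in> verts T" "w \<notin> ?Y" "w \<noteq> z" for w
    proof -
      have "(\<Sum>x\<in>{w, z}. deg U x) \<le> (\<Sum>w\<in>verts T - ?Y. deg U w)"
        using w zT zY finVT by (intro sum_mono2) auto
      then show ?thesis using left dz w(3) by simp
    qed
    have dz2: "deg U z = 2"
    proof -
      have "(\<Sum>x\<in>{z}. deg U x) \<le> (\<Sum>w\<in>verts T - ?Y. deg U w)"
        using zT zY finVT by (intro sum_mono2) auto
      then show ?thesis using left dz by simp
    qed
    have "even (deg U w)" for w
    proof (cases "w \<in> verts T")
      case True
      then show ?thesis using degU[of w] zero[of w] dz2 by (metis even_numeral even_zero)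
    next
      case False
      then have "deg U w = 0" using UTv deg_zeroI[OF UF] by blast
      then show ?thesis by simp
    qed
    then have "bd U = {}" by (simp add: bd_def)
    moreover have "U \<noteq> {}" using ef0U by blast
    \<comment> \<open>\<open>U\<close> is a cycle of the theta whose only vertex outside
      \<open>?Y\<close> is \<open>z\<close>, but every nonempty cycle contains both \<open>u\<close>
      and \<open>v\<close>, which are missed by \<open>N\<close>.\<close>
    ultimately have uvU: "u \<in> verts U" "v \<in> verts U" using cyc_uv[OF UT] by blast+
    have uvY: "u \<notin> ?Y" "v \<notin> ?Y" using avoid verts_mono[of ?M N] by blast+
    moreover have "deg U u \<noteq> 0" "deg U v \<noteq> 0" using uvU deg_zero_iff[OF UF] by simp_all
    ultimately have "u = z" "v = z" using zero[OF uvT(1) uvY(1)] zero[OF uvT(2) uvY(2)] by argo+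
    then show False using uv(1) by simp
  qed
  define x where "x = Abs_poly_mapping (\<lambda>e. real (s e) / 3)"
  have "finite {e. real (s e) / 3 \<noteq> 0}"
    by (rule finite_subset[OF _ finT]) (auto simp: s_def split: if_splits)
  then have lx: "Poly_Mapping.lookup x e = real (s e) / 3" for e
    by (simp add: x_def lookup_Abs_poly_mapping)
  have sx: "(\<Sum>e\<in>K. Poly_Mapping.lookup x e) = real (\<Sum>e\<in>K. s e) / 3" for K
    by (simp add: lx sum_divide_distrib)
  have "x \<in> relaxation"
    unfolding relaxation_def
  proof (intro CollectI conjI allI impI ballI)
    show "Poly_Mapping.keys x \<subseteq> F"
    proof
      fix e assume "e \<in> Poly_Mapping.keys x"
      then have "s e \<noteq> 0" by (simp add: in_keys_iff lx)
      then show "e \<in> F" using TF by (auto simp: s_def split: if_splits)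
    qed
    show "0 \<le> Poly_Mapping.lookup x e" for e by (simp add: lx)
    show "(\<Sum>e\<in>K. Poly_Mapping.lookup x e) \<le> 1" if "maximal_clique F ?E K" for K
    proof -
      have "(\<Sum>e\<in>K. s e) \<le> 3" using that clq by (auto simp: maximal_clique_def)
      then have "real (\<Sum>e\<in>K. s e) \<le> 3" by (metis of_nat_le_iff of_nat_numeral)
      then show ?thesis unfolding sx by simp
    qed
    show "(\<Sum>e\<in>U. Poly_Mapping.lookup x e) \<le> (real (card U) - 1) / 2"
      if "circuit F ?E U D \<and> odd (card D)" for U D
    proof -
      have "2 * (\<Sum>e\<in>U. s e) + 3 \<le> 3 * card U" using odd_circuit[of U D] that by blast
      then have "real (2 * (\<Sum>e\<in>U. s e) + 3) \<le> real (3 * card U)" by (simp only: of_nat_le_iff)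
      then show ?thesis unfolding sx by simp
    qed
  qed
  moreover have "x \<notin> STAB F ?E"
  proof
    assume "x \<in> STAB F ?E"
    then have "(\<Sum>e\<in>T. 1 * Poly_Mapping.lookup x e) \<le> real (card J)"
    proof (rule STAB_le[OF _ finT])
      fix M assume M: "mtch M"
      have mTM: "mtch (T \<inter> M)" by (rule mtch_subset[OF M]) blast
      have "card (verts (T \<inter> M)) \<le> card (verts T)"
        using finVT verts_mono[of "T \<inter> M" T] by (intro card_mono) auto
      then have "card (T \<inter> M) \<le> card J" using card_verts_mtch[OF mTM] cVT by simp
      then show "(\<Sum>e\<in>T \<inter> M. 1) \<le> real (card J)" by simp
    qed
    then have "real (\<Sum>e\<in>T. s e) / 3 \<le> real (card J)" using sx[of T] by simp
    moreover have "(\<Sum>e\<in>T. s e) = card T + card N" using s_sum[OF finT] NT by (simp add: Int_absorb1)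
    ultimately have "real (card T + card N) \<le> real (3 * card J)" by simp
    then have "card T + card N \<le> 3 * card J" by (simp only: of_nat_le_iff)
    then show False using cT cN by simp
  qed
  ultimately show ?thesis using h_perfect_iff by blast
qed

end

theorem (in multi) h_perfect_iff_no_bad:
  "h_perfect F (line_graph_edges F ends) \<longleftrightarrow> (\<forall>C P. bad C P \<longrightarrow> \<not> C \<union> P \<subseteq> F)"
proof
  assume h: "h_perfect F (line_graph_edges F ends)"
  show "\<forall>C P. bad C P \<longrightarrow> \<not> C \<union> P \<subseteq> F"
  proof (intro allI impI notI)
    fix C P assume b: "bad C P" "C \<union> P \<subseteq> F"
    interpret t: theta_graph F ends C P
      by unfold_locales (use b in \<open>auto simp: bad_def\<close>)
    show False using t.bad_imp_not_h_perfect h b(1) by (simp add: bad_def)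
  qed
next
  assume "\<forall>C P. bad C P \<longrightarrow> \<not> C \<union> P \<subseteq> F"
  then show "h_perfect F (line_graph_edges F ends)" using no_bad_imp_h_perfect by blast
qed

section \<open>Parities of intersections of circuits\<close>

lemma even_sum_cong:
  fixes p q :: "'a \<Rightarrow> nat"
  assumes "finite I" "\<And>i. i \<in> I \<Longrightarrow> even (p i) \<longleftrightarrow> even (q i)"
  shows "even (sum p I) \<longleftrightarrow> even (sum q I)"
proof -
  have "{i \<in> I. odd (p i)} = {i \<in> I. odd (q i)}" using assms(2) by blast
  then show ?thesis using assms(1) by (simp add: even_sum_iff)
qed

context multi
begin

definition simple :: bool where
  "simple \<longleftrightarrow> (\<forall>e\<in>F. \<forall>f\<in>F. ends e = ends f \<longrightarrow> e = f)"

lemma simple_circ_card: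
  assumes simple "circ C" "C \<subseteq> F"
  shows "3 \<le> card C"
proof (rule ccontr)
  assume "\<not> 3 \<le> card C"
  then have "card C = 2" using circ_card_ge2[OF assms(2,3)] by simp
  then obtain e f where ef: "C = {e, f}" "e \<noteq> f" by (auto simp: card_2_iff)
  have F: "{e} \<subseteq> F" "{f} \<subseteq> F" using ef assms(3) by auto
  have "C = {e} \<triangle> {f}" unfolding ef(1) sdiff_def using ef(2) by blast
  then have "ends e = ends f" using bd_sdiff[OF F] circD(2)[OF assms(2)] by (simp add: bd_single)
  then show False using assms(1) ef(2) F unfolding simple_def by blast
qed

text \<open>The thetas exempted in \<open>bad\<close> have four edges and would contain a circuit of
  length two.\<close>

lemma simple_theta_even:
  assumes s: simple and nobad: "\<forall>C P. bad C P \<longrightarrow> \<not> C \<union> P \<subseteq> F"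
    and th: "theta C P" "C \<subseteq> F" "P \<subseteq> F" and oC: "odd (card C)"
  shows "even (card P)"
proof (rule ccontr)
  assume oP: "odd (card P)"
  interpret t: theta_graph F ends C P by unfold_locales (fact th)+
  have "card C + card P = 4"
  proof (rule ccontr)
    assume "card C + card P \<noteq> 4"
    then have "bad C P" unfolding bad_def using th(1) oC oP by (intro conjI)
    then show False using nobad th by (metis Un_least)
  qed
  moreover have "3 \<le> card C" by (rule simple_circ_card[OF s t.circC th(2)])
  moreover have "t.A \<union> P \<subseteq> F" "t.A' \<union> P \<subseteq> F" using t.AF th t.A'(1) by blast+
  then have "3 \<le> card t.A + card P" "3 \<le> card t.A' + card P"
    using simple_circ_card[OF s t.circ1] simple_circ_card[OF s t.circ2] t.cycle_cards by simp_all
  moreover have "False" if "c + p = 4" "3 \<le> c" "3 \<le> k + p" "3 \<le> l + p" "c = k + l" "odd p" for c p k l :: nat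
    using that by presburger
  ultimately show False using t.cycle_cards(1) oP by blast
qed

text \<open>\<open>ears_even\<close> with the edges outside \<open>C\<close> as weight:
  \<open>y\<close> contains an even number of them.\<close>

lemma odd_circ_parity:
  assumes s: simple and nobad: "\<forall>C P. bad C P \<longrightarrow> \<not> C \<union> P \<subseteq> F"
    and C: "circ C" "C \<subseteq> F" "odd (card C)" and y: "circ y" "y \<subseteq> F" "linked C y"
  shows "odd (card (C \<inter> y)) \<longleftrightarrow> odd (card y)"
proof -
  have "even (card (y \<inter> (F - C)))"
  proof (rule ears_even[OF C(1,2) _ _ y])
    show "(F - C) \<inter> C = {}" by blast
    fix P assume P: "theta C P" "P \<subseteq> F"
    have "P \<inter> (F - C) = P" using P thetaD(2)[OF P(1)] by blast
    then show "even (card (P \<inter> (F - C)))" using simple_theta_even[OF s nobad P(1) C(2) P(2) C(3)] by simp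
  qed
  moreover have "card y = card (C \<inter> y) + card (y \<inter> (F - C))"
  proof -
    have "y = (C \<inter> y) \<union> (y \<inter> (F - C))" "(C \<inter> y) \<inter> (y \<inter> (F - C)) = {}" using y(2) by blast+
    then show ?thesis using finite_sub[OF y(2)] card_Un_disjoint[of "C \<inter> y" "y \<inter> (F - C)"] by simp
  qed
  ultimately show ?thesis by simp
qed

text \<open>If one of the circuits is odd, it serves as \<open>C\<close> in
  \<open>odd_circ_parity\<close>. If both are even, \<open>z\<close> is a sum of two odd circuits,
  each of which meets \<open>y\<close> evenly.\<close>

lemma circ_parity:
  assumes s: simple and nobad: "\<forall>C P. bad C P \<longrightarrow> \<not> C \<union> P \<subseteq> F"
    and C: "circ C" "C \<subseteq> F" "odd (card C)"
    and y: "circ y" "y \<subseteq> F" "linked C y" and z: "circ z" "z \<subseteq> F" "linked C z"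
  shows "odd (card (y \<inter> z)) \<longleftrightarrow> odd (card y) \<and> odd (card z)"
proof -
  note par = odd_circ_parity[OF s nobad]
  have yz: "linked y z" using linked_trans[OF linked_sym[OF y(3)] z(3)] .
  show ?thesis
  proof (cases "odd (card y) \<or> odd (card z)")
    case True
    then show ?thesis
      using par[OF y(1,2) _ z(1,2) yz] par[OF z(1,2) _ y(1,2) linked_sym[OF yz]] by (metis Int_commute)
  next
    case False
    then have ev: "even (card z)" by blast
    obtain X where X: "circ X" "X \<subseteq> F" "odd (card X)" "X \<inter> z \<noteq> {}"
      "circ (X \<triangle> z)" "odd (card (X \<triangle> z))" "(X \<triangle> z) \<inter> z \<noteq> {}"
      using even_circ_split[OF C z(1,2) linked_sym[OF z(3)] ev] by metis
    have XzF: "X \<triangle> z \<subseteq> F" using X(2) z(2) by (rule sdiff_subset)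
    have l1: "linked X y" using linked_trans[OF linked_meet[OF X(1) z(1) X(2) z(2) X(4)] linked_sym[OF yz]] .
    have l2: "linked (X \<triangle> z) y"
      using linked_trans[OF linked_meet[OF X(5) z(1) XzF z(2) X(7)] linked_sym[OF yz]] .
    have "y \<inter> z = (X \<inter> y) \<triangle> ((X \<triangle> z) \<inter> y)" unfolding sdiff_def by blast
    then have "even (card (y \<inter> z))"
      using even_card_sdiff[of "X \<inter> y" "(X \<triangle> z) \<inter> y"] finite_sub[OF y(2)]
        par[OF X(1-3) y(1,2) l1] par[OF X(5) XzF X(6) y(1,2) l2] False by simp
    then show ?thesis using False by blast
  qed
qed

end

section \<open>Fundamental circuits of the lexicographically first spanning forest\<close>

locale ordered_multi = multi F ends for F :: "nat set" and ends :: "nat \<Rightarrow> 'w set"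
begin

definition endjoined :: "nat set \<Rightarrow> nat \<Rightarrow> bool" where
  "endjoined S e \<longleftrightarrow> (\<forall>a\<in>ends e. \<forall>b\<in>ends e. joined S a b)"

text \<open>The greedy choice of Kruskal's algorithm: an edge is taken unless smaller edges already
  join its ends. Membership thus becomes a question of reachability.\<close>

definition tree :: "nat set" where
  "tree = {e \<in> F. \<not> endjoined {f \<in> F. f < e} e}"

lemma endjoined_iff:
  assumes "ends e = {a, b}" shows "endjoined S e \<longleftrightarrow> joined S a b"
  using assms joined_sym[of S a b] by (auto simp: endjoined_def)

lemma treeF: "tree \<subseteq> F"
  by (auto simp: tree_def)

lemma endjoined_join:
  assumes "e \<in> F" "S \<subseteq> F"
  shows "endjoined S e \<longleftrightarrow> (\<exists>J\<subseteq>S. bd J = ends e)"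
proof -
  obtain a b where ab: "ends e = {a, b}" "a \<noteq> b" using ends_obtain[OF assms(1)] by metis
  have s: "{a} \<triangle> {b} = ends e" unfolding sdiff_def ab(1) using ab(2) by blast
  show ?thesis
  proof
    assume "endjoined S e"
    then have "joined S a b" using endjoined_iff[OF ab(1)] by blast
    then have "\<exists>J\<subseteq>S. bd J = {a} \<triangle> {b}" by (rule joined_imp_join[OF _ assms(2)])
    then show "\<exists>J\<subseteq>S. bd J = ends e" unfolding s .
  next
    assume "\<exists>J\<subseteq>S. bd J = ends e"
    then have "\<exists>J\<subseteq>S. bd J = {a} \<triangle> {b}" unfolding s .
    then obtain J where J: "J \<subseteq> S" "bd J = {a} \<triangle> {b}" by blast
    have "joined J a b" by (rule join_imp_joined[OF subset_trans[OF J(1) assms(2)] J(2)])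
    then show "endjoined S e" using joined_mono[OF _ J(1)] endjoined_iff[OF ab(1)] by blast
  qed
qed

text \<open>The largest edge of a cycle has its ends joined by smaller edges, so it is not in
  \<open>tree\<close>.\<close>

lemma tree_acyclic:
  assumes "A \<subseteq> tree" "bd A = {}"
  shows "A = {}"
proof (rule ccontr)
  assume ne: "A \<noteq> {}"
  have AF: "A \<subseteq> F" using assms(1) treeF by blast
  then have fin: "finite A" by (rule finite_sub)
  define e where "e = Max A"
  have e: "e \<in> A" unfolding e_def using Max_in[OF fin ne] .
  have "bd (A - {e}) = bd A \<triangle> bd {e}" by (rule bd_Diff[OF AF]) (use e in blast)
  then have "bd (A - {e}) = ends e" using assms(2) by (simp add: bd_single)
  moreover have "A - {e} \<subseteq> {f \<in> F. f < e}"
  proof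
    fix f assume f: "f \<in> A - {e}"
    then have "f \<le> e" unfolding e_def using Max_ge[OF fin] by blast
    then show "f \<in> {f \<in> F. f < e}" using f AF by auto
  qed
  ultimately have "endjoined {f \<in> F. f < e} e" using endjoined_join[of e "{f \<in> F. f < e}"] e AF by blast
  then show False using assms(1) e by (auto simp: tree_def)
qed

lemma tree_spans: "e \<in> F \<Longrightarrow> endjoined {f \<in> tree. f \<le> e} e"
proof (induction e rule: less_induct)
  case (less e)
  obtain a b where ab: "ends e = {a, b}" "a \<noteq> b" using ends_obtain[OF less.prems] by metis
  show ?case
  proof (cases "e \<in> tree")
    case True
    then have "joined {f \<in> tree. f \<le> e} a b" by (intro joined_edge[of e _ a b]) (simp_all add: ab)
    then show ?thesis using endjoined_iff[OF ab(1)] by blast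
  next
    case False
    then have "joined {f \<in> F. f < e} a b"
      using less.prems endjoined_iff[OF ab(1)] unfolding tree_def by blast
    then have "joined {f \<in> tree. f \<le> e} a b"
    proof (induction rule: joined_induct)
      case base
      then show ?case by simp
    next
      case (step x y f)
      have f: "f \<in> F" "f < e" using step.hyps by auto
      have "joined {g \<in> tree. g \<le> f} x y" using less.IH[OF f(2,1)] endjoined_iff[of f x y] step.hyps by blast
      then have "joined {g \<in> tree. g \<le> e} x y" by (rule joined_mono) (use f in auto)
      then show ?case using joined_trans step.IH by blast
    qed
    then show ?thesis using endjoined_iff[OF ab(1)] by blast
  qed
qed

definition fund :: "nat \<Rightarrow> nat set" where
  "fund e = (SOME D. e \<in> D \<and> D \<subseteq> insert e tree \<and> bd D = {})"

lemma fund: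
  assumes "e \<in> F - tree"
  shows "e \<in> fund e" "fund e \<subseteq> insert e tree" "bd (fund e) = {}"
proof -
  have eF: "e \<in> F" "e \<notin> tree" using assms by auto
  have "\<exists>J\<subseteq>{f \<in> tree. f \<le> e}. bd J = ends e"
    using tree_spans[OF eF(1)] endjoined_join[OF eF(1), of "{f \<in> tree. f \<le> e}"] treeF by blast
  then obtain J where J: "J \<subseteq> tree" "bd J = ends e" by blast
  have "{e} \<subseteq> F" "J \<subseteq> F" "{e} \<inter> J = {}" using eF J treeF by blast+
  then have "bd ({e} \<union> J) = {}" using bd_Un[of "{e}" J] J by (simp add: bd_single)
  then have "\<exists>D. e \<in> D \<and> D \<subseteq> insert e tree \<and> bd D = {}" using J(1) by (intro exI[of _ "{e} \<union> J"]) blast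
  then have "e \<in> fund e \<and> fund e \<subseteq> insert e tree \<and> bd (fund e) = {}" unfolding fund_def by (rule someI_ex)
  then show "e \<in> fund e" "fund e \<subseteq> insert e tree" "bd (fund e) = {}" by auto
qed

lemma fundF: "e \<in> F - tree \<Longrightarrow> fund e \<subseteq> F"
  using fund(2) treeF by blast

lemma fund_nontree: "e \<in> F - tree \<Longrightarrow> f \<in> F - tree \<Longrightarrow> f \<in> fund e \<longleftrightarrow> f = e"
  using fund(1,2) by blast

lemma circ_fund:
  assumes e: "e \<in> F - tree"
  shows "circ (fund e)"
  unfolding circ_def
proof (intro conjI allI impI)
  show "fund e \<noteq> {}" "bd (fund e) = {}" using fund[OF e] by blast+
  fix A assume A: "A \<subseteq> fund e" "bd A = {}"
  show "A = {} \<or> A = fund e"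
  proof (cases "e \<in> A")
    case True
    have "bd (fund e - A) = {}" using bd_Diff[OF fundF[OF e] A(1)] A(2) fund(3)[OF e] by simp
    moreover have "fund e - A \<subseteq> tree" using fund(2)[OF e] True by blast
    ultimately have "fund e - A = {}" by (intro tree_acyclic)
    then show ?thesis using A(1) by blast
  next
    case False
    then have "A \<subseteq> tree" using A(1) fund(2)[OF e] by blast
    then show ?thesis using tree_acyclic A(2) by blast
  qed
qed

text \<open>\<open>fund e - {e}\<close> is the only join of the ends of \<open>e\<close> inside
  \<open>tree\<close>, so removing \<open>f\<close> separates these ends iff \<open>f\<close>
  belongs to it. This makes the circuits chosen by \<open>SOME\<close> definable by
  reachability.\<close>

lemma mem_fund_iff:
  assumes e: "e \<in> F - tree"
  shows "f \<in> fund e \<longleftrightarrow> f = e \<or> (f \<in> tree \<and> \<not> endjoined (tree - {f}) e)"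
proof (cases "f \<in> tree")
  case True
  have eF: "e \<in> F" and fe: "f \<noteq> e" using e True by auto
  let ?J = "fund e - {e}"
  have J: "?J \<subseteq> tree" "?J \<subseteq> F" using fund(2)[OF e] fundF[OF e] by auto
  have bJ: "bd ?J = ends e"
    using bd_Diff[OF fundF[OF e], of "{e}"] fund[OF e] by (simp add: bd_single)
  have tF: "tree - {f} \<subseteq> F" using treeF by blast
  have "endjoined (tree - {f}) e \<longleftrightarrow> f \<notin> fund e"
  proof
    assume "f \<notin> fund e"
    then have "?J \<subseteq> tree - {f}" using J by blast
    then show "endjoined (tree - {f}) e" using endjoined_join[OF eF tF] bJ by blast
  next
    assume "endjoined (tree - {f}) e"
    then obtain K where K: "K \<subseteq> tree - {f}" "bd K = ends e" using endjoined_join[OF eF tF] by blast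
    have "bd (K \<triangle> ?J) = {}" using bd_sdiff[OF subset_trans[OF K(1) tF] J(2)] K(2) bJ by simp
    moreover have "K \<triangle> ?J \<subseteq> tree" by (rule sdiff_subset) (use K J in blast)+
    ultimately have "K \<triangle> ?J = {}" by (intro tree_acyclic)
    then have "K = ?J" by simp
    then show "f \<notin> fund e" using K(1) fe by blast
  qed
  then show ?thesis using True fe by blast
next
  case False
  then show ?thesis using fund(1,2)[OF e] by blast
qed

text \<open>The sum modulo 2 of the fundamental circuits of the members of \<open>I\<close>.\<close>

definition span :: "nat set \<Rightarrow> nat set" where
  "span I = {g \<in> F. odd (card {e \<in> I. g \<in> fund e})}"

lemma bd_span:
  assumes "finite I" "I \<subseteq> F - tree"
  shows "bd (span I) = {}"
  using assms
proof (induction I)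
  case empty
  then show ?case by (simp add: span_def)
next
  case (insert e I)
  have e: "e \<in> F - tree" using insert by blast
  have "span (insert e I) = fund e \<triangle> span I"
  proof -
    have "{x \<in> insert e I. g \<in> fund x} = (if g \<in> fund e then insert e {x \<in> I. g \<in> fund x} else {x \<in> I. g \<in> fund x})" for g
      by auto
    then have "odd (card {x \<in> insert e I. g \<in> fund x}) \<longleftrightarrow> (g \<in> fund e) \<noteq> odd (card {x \<in> I. g \<in> fund x})" for g
      using insert(1,2) by simp
    then show ?thesis using fundF[OF e] unfolding set_eq_iff mem_sdiff span_def mem_Collect_eq by blast
  qed
  moreover have "span I \<subseteq> F" by (auto simp: span_def)
  ultimately show ?case using bd_sdiff[OF fundF[OF e], of "span I"] fund(3)[OF e] insert by simp
qed

text \<open>An edge outside \<open>tree\<close> lies on no fundamental circuit but its own, so the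
  two cycles differ only inside \<open>tree\<close>, where there are no nonempty cycles.\<close>

lemma span_eq:
  assumes "y \<subseteq> F" "bd y = {}"
  shows "span (y - tree) = y"
proof -
  have I: "finite (y - tree)" "y - tree \<subseteq> F - tree" using assms(1) finite_sub by auto
  have sF: "span (y - tree) \<subseteq> F" by (auto simp: span_def)
  let ?d = "span (y - tree) \<triangle> y"
  have "bd ?d = {}" using bd_sdiff[OF sF assms(1)] bd_span[OF I] assms(2) by simp
  moreover have "?d \<subseteq> tree"
  proof
    fix g assume g: "g \<in> ?d"
    show "g \<in> tree"
    proof (rule ccontr)
      assume gt: "g \<notin> tree"
      have gF: "g \<in> F - tree" using g gt sF assms(1) by auto
      have "{e \<in> y - tree. g \<in> fund e} = (if g \<in> y then {g} else {})"
        using fund_nontree[OF _ gF] I(2) gt by auto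
      then have "g \<in> span (y - tree) \<longleftrightarrow> g \<in> y" using gF by (simp add: span_def)
      then show False using g by simp
    qed
  qed
  ultimately have "?d = {}" by (intro tree_acyclic)
  then show ?thesis by simp
qed

text \<open>Modulo 2, both sides count the pairs of \<open>e\<close> in \<open>I\<close> and
  \<open>g\<close> in \<open>B\<close> with \<open>g\<close> on the fundamental circuit of
  \<open>e\<close>.\<close>

lemma card_span_Int:
  assumes "finite I" "B \<subseteq> F"
  shows "even (card (span I \<inter> B)) \<longleftrightarrow> even (\<Sum>e\<in>I. card (fund e \<inter> B))"
proof -
  have fB: "finite B" using finite_sub assms(2) .
  have "(\<Sum>e\<in>I. card (fund e \<inter> B)) = (\<Sum>e\<in>I. \<Sum>g\<in>B. if g \<in> fund e then 1 else 0)"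
    using fB by (intro sum.cong) (simp_all flip: sum.inter_filter add: Int_def conj_commute)
  also have "\<dots> = (\<Sum>g\<in>B. \<Sum>e\<in>I. if g \<in> fund e then 1 else 0)" by (rule sum.swap)
  also have "\<dots> = (\<Sum>g\<in>B. card {e \<in> I. g \<in> fund e})"
    using assms(1) by (intro sum.cong) (simp_all flip: sum.inter_filter)
  finally have "even (\<Sum>e\<in>I. card (fund e \<inter> B)) \<longleftrightarrow> even (card {g \<in> B. odd (card {e \<in> I. g \<in> fund e})})"
    using even_sum_iff[OF fB] by simp
  moreover have "{g \<in> B. odd (card {e \<in> I. g \<in> fund e})} = span I \<inter> B"
    using assms(2) by (auto simp: span_def)
  ultimately show ?thesis by simp
qed

definition flink :: "nat \<Rightarrow> nat \<Rightarrow> bool" where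
  "flink e g \<longleftrightarrow> (e, g) \<in> {(x, y). x \<in> F - tree \<and> y \<in> F - tree \<and> fund x \<inter> fund y \<noteq> {}}\<^sup>*"

lemma flink_refl [simp]: "flink e e"
  by (simp add: flink_def)

lemma flink_trans: "flink x y \<Longrightarrow> flink y z \<Longrightarrow> flink x z"
  unfolding flink_def by (rule rtrancl_trans)

lemma flink_sym: "flink x y \<Longrightarrow> flink y x"
  unfolding flink_def by (rule symD[OF sym_rtrancl]) (simp_all add: sym_def Int_commute)

lemma flink_meet: "x \<in> F - tree \<Longrightarrow> y \<in> F - tree \<Longrightarrow> fund x \<inter> fund y \<noteq> {} \<Longrightarrow> flink x y"
  unfolding flink_def by (rule r_into_rtrancl) simp

lemma flink_linked:
  assumes "flink e g" "e \<in> F - tree"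
  shows "linked (fund e) (fund g)"
  using assms(1) unfolding flink_def
proof (induction rule: rtrancl_induct)
  case base
  then show ?case by simp
next
  case (step x y)
  then have xy: "x \<in> F - tree" "y \<in> F - tree" "fund x \<inter> fund y \<noteq> {}" by simp_all
  have "linked (fund x) (fund y)"
    by (rule linked_meet) (use circ_fund fundF xy in simp_all)
  then show ?case using step.IH linked_trans by blast
qed

lemma flink_nontree: "flink e g \<Longrightarrow> e \<in> F - tree \<Longrightarrow> g \<in> F - tree"
  unfolding flink_def by (erule rtranclE) simp_all

text \<open>The fundamental circuits of one class \<open>K\<close> share no edge with those of the
  other members of \<open>y - tree\<close>. Their sum is therefore a nonempty cycle inside
  \<open>y\<close>, that is, \<open>y\<close> itself.\<close>

lemma circ_flink:
  assumes y: "circ y" "y \<subseteq> F" and e: "e \<in> y - tree" and f: "f \<in> y - tree"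
  shows "flink e f"
proof -
  define K where "K = {g \<in> y - tree. flink e g}"
  have I: "finite (y - tree)" "y - tree \<subseteq> F - tree" using y(2) finite_sub by auto
  have Ky: "K \<subseteq> y - tree" by (auto simp: K_def)
  have K: "finite K" "K \<subseteq> F - tree" using I Ky finite_subset by blast+
  have sy: "span (y - tree) = y" using span_eq[OF y(2) circD(2)[OF y(1)]] .
  have "span K \<subseteq> span (y - tree)"
  proof
    fix g assume g: "g \<in> span K"
    then have o: "odd (card {x \<in> K. g \<in> fund x})" and gF: "g \<in> F" by (auto simp: span_def)
    then have "{x \<in> K. g \<in> fund x} \<noteq> {}" by (metis card.empty even_zero)
    then obtain x where x: "x \<in> K" "g \<in> fund x" by blast
    have "x' \<in> K" if x': "x' \<in> y - tree" "g \<in> fund x'" for x'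
    proof -
      have "flink x x'" using flink_meet[of x x'] x x' K(2) I(2) by blast
      then show ?thesis using x(1) x'(1) flink_trans unfolding K_def by blast
    qed
    then have "{x \<in> y - tree. g \<in> fund x} = {x \<in> K. g \<in> fund x}" unfolding K_def by blast
    then show "g \<in> span (y - tree)" using o gF by (simp add: span_def)
  qed
  then have sub: "span K \<subseteq> y" using sy by simp
  have nt: "g \<in> span K \<longleftrightarrow> g \<in> K" if g: "g \<in> F - tree" for g
  proof -
    have "{x \<in> K. g \<in> fund x} = (if g \<in> K then {g} else {})" using fund_nontree[OF _ g] K(2) by auto
    then show ?thesis using g by (simp add: span_def)
  qed
  have "e \<in> K" using e by (simp add: K_def)
  then have "span K \<noteq> {}" using nt[of e] K(2) by blast
  then have "span K = y" using circD(3)[OF y(1) sub bd_span[OF K]] by blast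
  then have "f \<in> K" using nt[of f] f I(2) by blast
  then show ?thesis by (simp add: K_def)
qed

text \<open>Only pairs in the same block are compared, and only in blocks with an odd fundamental
  circuit: a bipartite block contains no bad theta.\<close>

definition parity_cond :: bool where
  "parity_cond \<longleftrightarrow> (\<forall>e g. e \<in> F - tree \<longrightarrow> flink e g \<longrightarrow> (\<exists>h. flink e h \<and> odd (card (fund h))) \<longrightarrow>
     (odd (card (fund e \<inter> fund g)) \<longleftrightarrow> odd (card (fund e)) \<and> odd (card (fund g))))"

lemma no_bad_imp_parity_cond:
  assumes s: simple and nobad: "\<forall>C P. bad C P \<longrightarrow> \<not> C \<union> P \<subseteq> F"
  shows parity_cond
  unfolding parity_cond_def
proof (intro allI impI)
  fix e g assume e: "e \<in> F - tree" and eg: "flink e g" and "\<exists>h. flink e h \<and> odd (card (fund h))"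
  then obtain h where h: "flink e h" "odd (card (fund h))" by blast
  have gh: "g \<in> F - tree" "h \<in> F - tree" using flink_nontree[OF eg e] flink_nontree[OF h(1) e] .
  have he: "flink h e" using flink_sym[OF h(1)] .
  have "linked (fund h) (fund e)" "linked (fund h) (fund g)"
    using flink_linked[OF he gh(2)] flink_linked[OF flink_trans[OF he eg] gh(2)] .
  then show "odd (card (fund e \<inter> fund g)) \<longleftrightarrow> odd (card (fund e)) \<and> odd (card (fund g))"
    using circ_parity[OF s nobad circ_fund[OF gh(2)] fundF[OF gh(2)] h(2) circ_fund[OF e] fundF[OF e] _
        circ_fund[OF gh(1)] fundF[OF gh(1)]] by blast
qed

lemma sum_fund_parity:
  assumes "y \<subseteq> F" "bd y = {}" "B \<subseteq> F"
  shows "even (card (y \<inter> B)) \<longleftrightarrow> even (\<Sum>e\<in>y - tree. card (fund e \<inter> B))"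
  using card_span_Int[of "y - tree" B] span_eq[OF assms(1,2)] assms finite_sub by simp

lemma odd_fund_in:
  assumes "y \<subseteq> F" "bd y = {}" "odd (card y)"
  obtains e where "e \<in> y - tree" "odd (card (fund e))"
proof -
  have "odd (\<Sum>e\<in>y - tree. card (fund e \<inter> F))"
    using sum_fund_parity[OF assms(1,2), of F] assms by (simp add: Int_absorb2)
  then have "\<exists>e\<in>y - tree. odd (card (fund e \<inter> F))" by (metis (mono_tags, lifting) dvd_sum)
  then obtain e where e: "e \<in> y - tree" "odd (card (fund e \<inter> F))" by blast
  then have "e \<in> F - tree" using assms(1) by blast
  then have "fund e \<inter> F = fund e" using fundF by blast
  then show ?thesis using e that by simp
qed

text \<open>Both circuits are sums of fundamental circuits. The common edge puts all of these into
  one class, which has an odd member because \<open>C\<close> is odd. So the condition holds for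
  every pair, and expanding both sums gives \<open>card C * card y\<close> modulo 2.\<close>

lemma parity_cond_circ:
  assumes parity_cond and C: "circ C" "C \<subseteq> F" "odd (card C)" and y: "circ y" "y \<subseteq> F" and m: "C \<inter> y \<noteq> {}"
  shows "odd (card (C \<inter> y)) \<longleftrightarrow> odd (card y)"
proof -
  have bC: "bd C = {}" and by0: "bd y = {}" using circD(2) C(1) y(1) by blast+
  have fin: "finite (C - tree)" "finite (y - tree)" using C y finite_sub by auto
  have CI: "C - tree \<subseteq> F - tree" "y - tree \<subseteq> F - tree" using C y by auto
  obtain h where h: "h \<in> C - tree" "odd (card (fund h))" using odd_fund_in[OF C(2) bC C(3)] by blast
  obtain g where g: "g \<in> C" "g \<in> y" using m by blast
  have ex: "\<exists>e\<in>D - tree. g \<in> fund e" if D: "D \<subseteq> F" "bd D = {}" "g \<in> D" for D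
  proof -
    have "g \<in> span (D - tree)" using span_eq[OF D(1,2)] D(3) by simp
    then have "odd (card {e \<in> D - tree. g \<in> fund e})" by (simp add: span_def)
    then have "{e \<in> D - tree. g \<in> fund e} \<noteq> {}" by (metis card.empty even_zero)
    then show ?thesis by blast
  qed
  obtain e1 where e1: "e1 \<in> C - tree" "g \<in> fund e1" using ex[OF C(2) bC g(1)] by blast
  obtain f1 where f1: "f1 \<in> y - tree" "g \<in> fund f1" using ex[OF y(2) by0 g(2)] by blast
  have ef1: "flink e1 f1" using flink_meet[of e1 f1] e1 f1 CI by blast
  have pair: "even (card (fund e \<inter> fund f)) \<longleftrightarrow> even (card (fund e) * card (fund f))"
    if ef: "e \<in> C - tree" "f \<in> y - tree" for e f
  proof -
    have "flink e f"
      using flink_trans[OF circ_flink[OF C(1,2) ef(1) e1(1)] flink_trans[OF ef1 circ_flink[OF y f1(1) ef(2)]]] .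
    moreover have "flink e h" by (rule circ_flink[OF C(1,2) ef(1) h(1)])
    ultimately show ?thesis
      using \<open>parity_cond\<close> ef(1) CI(1) h(2) unfolding parity_cond_def by auto
  qed
  have FI: "fund e \<inter> F = fund e" if "e \<in> F - tree" for e using fundF[OF that] by blast
  have sD: "even (card D) \<longleftrightarrow> even (\<Sum>e\<in>D - tree. card (fund e))" if D: "D \<subseteq> F" "bd D = {}" for D
  proof -
    have "(\<Sum>e\<in>D - tree. card (fund e \<inter> F)) = (\<Sum>e\<in>D - tree. card (fund e))"
      by (rule sum.cong) (use FI D(1) in auto)
    then show ?thesis using sum_fund_parity[OF D, of F] D(1) by (simp add: Int_absorb2)
  qed
  note sC = sD[OF C(2) bC] and sy = sD[OF y(2) by0]
  have "even (card (C \<inter> y)) \<longleftrightarrow> even (\<Sum>e\<in>C - tree. card (fund e \<inter> y))"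
    by (rule sum_fund_parity[OF C(2) bC y(2)])
  also have "\<dots> \<longleftrightarrow> even (\<Sum>e\<in>C - tree. \<Sum>f\<in>y - tree. card (fund e) * card (fund f))"
  proof (rule even_sum_cong[OF fin(1)])
    fix e assume e: "e \<in> C - tree"
    then have eF: "e \<in> F - tree" using CI by blast
    have "even (card (fund e \<inter> y)) \<longleftrightarrow> even (\<Sum>f\<in>y - tree. card (fund f \<inter> fund e))"
      using sum_fund_parity[OF y(2) by0 fundF[OF eF]] by (simp add: Int_commute)
    also have "\<dots> \<longleftrightarrow> even (\<Sum>f\<in>y - tree. card (fund e) * card (fund f))"
      by (rule even_sum_cong[OF fin(2)]) (use pair[OF e] in \<open>simp add: Int_commute\<close>)
    finally show "even (card (fund e \<inter> y)) \<longleftrightarrow> even (\<Sum>f\<in>y - tree. card (fund e) * card (fund f))" .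
  qed
  also have "(\<Sum>e\<in>C - tree. \<Sum>f\<in>y - tree. card (fund e) * card (fund f))
      = (\<Sum>e\<in>C - tree. card (fund e)) * (\<Sum>f\<in>y - tree. card (fund f))"
    by (simp add: sum_product)
  finally show ?thesis using sC sy C(3) by simp
qed

end

section \<open>Twins and representatives\<close>

context multi
begin

lemma bd_pair:
  assumes "e \<in> F" "f \<in> F" "e \<noteq> f"
  shows "bd {e, f} = ends e \<triangle> ends f"
proof -
  have "{e, f} = {e} \<union> {f}" "{e} \<inter> {f} = {}" using assms(3) by auto
  then show ?thesis using bd_Un[of "{e}" "{f}"] assms by (simp add: bd_single)
qed

lemma deg2_pair:
  assumes "deg A v = 2" "x \<in> A" "v \<in> ends x"
  obtains f where "f \<in> A" "v \<in> ends f" "f \<noteq> x" "\<And>e. e \<in> A \<Longrightarrow> v \<in> ends e \<Longrightarrow> e = x \<or> e = f"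
proof -
  have "card {e \<in> A. v \<in> ends e} = 2" using assms(1) by (simp add: deg_def)
  then obtain a b where ab: "{e \<in> A. v \<in> ends e} = {a, b}" "a \<noteq> b" by (auto simp: card_2_iff)
  have "x \<in> {a, b}" using assms(2,3) ab(1) by blast
  then obtain f where "{a, b} = {x, f}" "f \<noteq> x" using ab(2) by auto
  then show ?thesis using ab(1) that[of f] by blast
qed

text \<open>The picture around an edge \<open>x\<close>: its neighbours \<open>f\<close> and
  \<open>g\<close> have different far ends \<open>p\<close> and \<open>q\<close>, and the edge
  \<open>f'\<close> after \<open>f\<close> no longer touches \<open>x\<close>. In a triangle,
  \<open>p\<close> and \<open>q\<close> would coincide.\<close>

lemma circ_around:
  assumes y: "circ y" "y \<subseteq> F" "4 \<le> card y" and x: "x \<in> y"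
  obtains u v p q f g f' where "ends x = {u, v}" "u \<noteq> v"
    "f \<in> y" "f \<noteq> x" "ends f = {u, p}" "p \<notin> {u, v}" "g \<in> y" "g \<noteq> x" "ends g = {v, q}" "q \<notin> {u, v}" "p \<noteq> q"
    "\<And>e. e \<in> y \<Longrightarrow> ends e \<inter> {u, v} \<noteq> {} \<Longrightarrow> e = x \<or> e = f \<or> e = g"
    "f' \<in> y" "p \<in> ends f'" "f' \<noteq> f" "u \<notin> ends f'" "v \<notin> ends f'"
proof -
  have xF: "x \<in> F" using x y(2) by blast
  obtain u v where uv: "ends x = {u, v}" "u \<noteq> v" using ends_obtain[OF xF] by metis
  have closed: "Z = {} \<or> Z = y" if "Z \<subseteq> y" "bd Z = {}" for Z using circD(3)[OF y(1) that] .
  have deg: "deg y w = 2" if "e \<in> y" "w \<in> ends e" for e w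
    using circ_deg[OF y(1,2) vertsI[OF that]] .
  have nopar: "ends a \<noteq> ends b" if "a \<in> y" "b \<in> y" "a \<noteq> b" for a b
  proof
    assume "ends a = ends b"
    then have "bd {a, b} = {}" using bd_pair[of a b] that y(2) by auto
    then have "y = {a, b}" using closed[of "{a, b}"] that by blast
    then show False using y(3) that(3) by simp
  qed
  obtain f where f: "f \<in> y" "u \<in> ends f" "f \<noteq> x" "\<And>e. e \<in> y \<Longrightarrow> u \<in> ends e \<Longrightarrow> e = x \<or> e = f"
    using deg2_pair[OF deg[OF x] x] uv(1) by (metis insertI1)
  obtain g where g: "g \<in> y" "v \<in> ends g" "g \<noteq> x" "\<And>e. e \<in> y \<Longrightarrow> v \<in> ends e \<Longrightarrow> e = x \<or> e = g"
    using deg2_pair[OF deg[OF x] x] uv(1) by (metis insertI1 insertI2)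
  obtain p where p: "ends f = {u, p}" "p \<noteq> u" using other_end[of f u] f y(2) by blast
  obtain q where q: "ends g = {v, q}" "q \<noteq> v" using other_end[of g v] g y(2) by blast
  have pv: "p \<noteq> v" using nopar[OF f(1) x f(3)] p(1) uv(1) by auto
  have qu: "q \<noteq> u" using nopar[OF g(1) x g(3)] q(1) uv(1) by auto
  have fg: "f \<noteq> g" using p q pv uv(2) g(2) by auto
  have pq: "p \<noteq> q"
  proof
    assume e: "p = q"
    have "{x, f, g} = {x, f} \<union> {g}" "{x, f} \<inter> {g} = {}" using fg g(3) by auto
    then have "bd {x, f, g} = bd {x, f} \<triangle> ends g"
      using bd_Un[of "{x, f}" "{g}"] x f(1) g(1) y(2) by (auto simp: bd_single)
    also have "bd {x, f} = ends x \<triangle> ends f" using bd_pair[of x f] x f y(2) by auto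
    also have "ends x \<triangle> ends f \<triangle> ends g = {}"
      unfolding uv(1) p(1) q(1) e set_eq_iff mem_sdiff using uv(2) q(2) qu by (simp, metis)
    finally have "y = {x, f, g}" using closed[of "{x, f, g}"] x f(1) g(1) by blast
    moreover have "card {x, f, g} \<le> 3" by (simp add: card_insert_if)
    ultimately show False using y(3) by simp
  qed
  obtain f' where f': "f' \<in> y" "p \<in> ends f'" "f' \<noteq> f"
    using deg2_pair[OF deg[OF f(1)] f(1)] p(1) by (metis insertI1 insertI2)
  have "u \<notin> ends f'" using f(4)[OF f'(1)] f'(2,3) uv(1) p(2) pv by auto
  moreover have "v \<notin> ends f'" using g(4)[OF f'(1)] f'(2,3) uv(1) p(2) pv q pq by auto
  moreover have "e = x \<or> e = f \<or> e = g" if "e \<in> y" "ends e \<inter> {u, v} \<noteq> {}" for e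
    using f(4)[OF that(1)] g(4)[OF that(1)] that(2) by blast
  ultimately show ?thesis
    using that[OF uv f(1,3) p(1) _ g(1,3) q(1) _ pq _ f'] p(2) pv q(2) qu by blast
qed

definition adj :: "'e \<Rightarrow> 'e \<Rightarrow> bool" where
  "adj x y \<longleftrightarrow> x \<in> F \<and> y \<in> F \<and> x \<noteq> y \<and> ends x \<inter> ends y \<noteq> {}"

text \<open>Read off from the line graph alone. Parallel edges are twins, but not conversely: any
  two edges of a component that is a triangle are twins. This is why circuits of length at least
  four appear below.\<close>

definition twin :: "'e \<Rightarrow> 'e \<Rightarrow> bool" where
  "twin x y \<longleftrightarrow> adj x y \<and> (\<forall>z\<in>F. z \<noteq> x \<and> z \<noteq> y \<longrightarrow> (adj z x \<longleftrightarrow> adj z y))"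

lemma adj_sym: "adj x y \<Longrightarrow> adj y x"
  by (auto simp: adj_def)

lemma twinF: "twin x y \<Longrightarrow> x \<in> F \<and> y \<in> F \<and> x \<noteq> y"
  by (auto simp: twin_def adj_def)

lemma twin_sym: "twin x y \<Longrightarrow> twin y x"
  unfolding twin_def by (meson adj_sym)

lemma twin_adj: "twin x y \<Longrightarrow> z \<noteq> x \<Longrightarrow> z \<noteq> y \<Longrightarrow> adj z x \<longleftrightarrow> adj z y"
  unfolding twin_def adj_def by blast

lemma twin_trans:
  assumes "twin x y" "twin y z" "x \<noteq> z"
  shows "twin x z"
  unfolding twin_def
proof (intro conjI ballI impI)
  show xz: "adj x z" using twin_adj[OF assms(2), of x] twinF[OF assms(1)] assms by (auto simp: twin_def)
  fix w assume w: "w \<in> F" "w \<noteq> x \<and> w \<noteq> z"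
  show "adj w x \<longleftrightarrow> adj w z"
  proof (cases "w = y")
    case True
    then show ?thesis using assms(1,2) adj_sym unfolding twin_def by blast
  next
    case False
    then show ?thesis using twin_adj[OF assms(1), of w] twin_adj[OF assms(2), of w] w by blast
  qed
qed

lemma parallel_twin:
  assumes "x \<in> F" "y \<in> F" "x \<noteq> y" "ends x = ends y"
  shows "twin x y"
proof -
  have "ends x \<noteq> {}" using ends2[OF assms(1)] by auto
  then show ?thesis using assms by (auto simp: twin_def adj_def)
qed

text \<open>Let \<open>f\<close> and then \<open>f'\<close> follow \<open>x\<close> on the circuit.
  As \<open>f'\<close> does not touch \<open>x\<close>, it does not touch the twin \<open>t\<close>
  either, whereas \<open>f\<close> does; so \<open>t\<close> meets \<open>f\<close> in the end
  shared with \<open>x\<close>. The same holds on the other side of \<open>x\<close>.\<close>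

lemma circ_twin:
  assumes y: "circ y" "y \<subseteq> F" "4 \<le> card y" and x: "x \<in> y" and t: "twin x t"
  shows "ends t = ends x"
proof -
  have key: "u \<in> ends t" if h: "ends x = {u, v}" "f \<in> y" "f \<noteq> x" "ends f = {u, p}" "p \<notin> {u, v}"
    "f' \<in> y" "p \<in> ends f'" "f' \<noteq> f" "u \<notin> ends f'" "v \<notin> ends f'" for u v f p f'
  proof -
    have F: "x \<in> F" "f \<in> F" "f' \<in> F" using h x y(2) by auto
    have xf': "\<not> adj f' x" "f' \<noteq> x" using h by (auto simp: adj_def)
    have ff': "adj f' f" using h F by (auto simp: adj_def)
    have fx: "adj f x" using h F by (auto simp: adj_def)
    have tf: "t \<noteq> f" using twin_adj[OF t, of f'] xf' ff' h(8) by auto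
    have "t \<noteq> f'" using t adj_sym xf'(1) unfolding twin_def by blast
    then have "\<not> adj f' t" using twin_adj[OF t, of f'] xf' by auto
    then have "p \<notin> ends t" using h(7) F twinF[OF t] \<open>t \<noteq> f'\<close> by (auto simp: adj_def)
    moreover have "adj f t" using twin_adj[OF t, of f] fx tf h(3) by auto
    ultimately show ?thesis using h(4) by (auto simp: adj_def)
  qed
  obtain u v p q f g f' where a: "ends x = {u, v}" "u \<noteq> v"
    "f \<in> y" "f \<noteq> x" "ends f = {u, p}" "p \<notin> {u, v}" "g \<in> y" "g \<noteq> x" "ends g = {v, q}" "q \<notin> {u, v}" "p \<noteq> q"
    and near: "\<And>e. e \<in> y \<Longrightarrow> ends e \<inter> {u, v} \<noteq> {} \<Longrightarrow> e = x \<or> e = f \<or> e = g"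
    and f': "f' \<in> y" "p \<in> ends f'" "f' \<noteq> f" "u \<notin> ends f'" "v \<notin> ends f'"
    by (rule circ_around[OF y x]) (rule that; assumption)
  have dq: "deg y q = 2" using circ_deg[OF y(1,2) vertsI[OF a(7)]] a(9) by simp
  have qg: "q \<in> ends g" using a(9) by simp
  obtain g' where g': "g' \<in> y" "q \<in> ends g'" "g' \<noteq> g" using deg2_pair[OF dq a(7) qg] by metis
  have "g' \<noteq> x" "g' \<noteq> f" using g'(2) a(1,5,10,11) by auto
  then have g'x: "v \<notin> ends g'" and g'u: "u \<notin> ends g'" using near[OF g'(1)] g'(3) by auto
  have "u \<in> ends t" by (rule key[OF a(1,3-6) f'])
  moreover have "v \<in> ends t"
    by (rule key[OF _ a(7-9) _ g' g'x g'u]) (use a(1,10) in auto)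
  moreover have "card (ends t) = 2" using ends2 twinF[OF t] by blast
  ultimately have "{u, v} = ends t"
    using a(2) by (intro card_subset_eq) (auto intro: card_ge_0_finite)
  then show ?thesis using a(1) by simp
qed

lemma bd_image:
  assumes "inj_on \<phi> A" "\<And>x. x \<in> A \<Longrightarrow> ends (\<phi> x) = ends x"
  shows "bd (\<phi> ` A) = bd A"
proof -
  have "deg (\<phi> ` A) v = deg A v" for v
  proof -
    have "{e \<in> \<phi> ` A. v \<in> ends e} = \<phi> ` {e \<in> A. v \<in> ends e}" using assms(2) by auto
    moreover have "inj_on \<phi> {e \<in> A. v \<in> ends e}" using assms(1) by (rule inj_on_subset) auto
    ultimately show ?thesis by (simp add: deg_def card_image)
  qed
  then show ?thesis by (simp add: bd_def)
qed

lemma circ_image: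
  assumes "circ C" "inj_on \<phi> C" "\<And>x. x \<in> C \<Longrightarrow> ends (\<phi> x) = ends x"
  shows "circ (\<phi> ` C)"
  unfolding circ_def
proof (intro conjI allI impI)
  show "\<phi> ` C \<noteq> {}" using circD(1)[OF assms(1)] by simp
  show "bd (\<phi> ` C) = {}" using bd_image[OF assms(2,3)] circD(2)[OF assms(1)] by simp
  fix A assume A: "A \<subseteq> \<phi> ` C" "bd A = {}"
  then obtain B where B: "B \<subseteq> C" "A = \<phi> ` B" by (meson subset_imageE)
  have "bd A = bd B" unfolding B(2) by (rule bd_image) (use B assms(2,3) inj_on_subset in blast)+
  then have "B = {} \<or> B = C" using circD(3)[OF assms(1) B(1)] A(2) by simp
  then show "A = {} \<or> A = \<phi> ` C" using B(2) by blast
qed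

end

section \<open>Representatives of twin classes, and the two conditions to be tested\<close>

context ordered_multi
begin

definition reps :: "nat set" where
  "reps = {x \<in> F. \<not> (\<exists>y<x. twin y x)}"

definition rep :: "nat \<Rightarrow> nat" where
  "rep x = (LEAST y. y = x \<or> twin y x)"

lemma rep: "rep x = x \<or> twin (rep x) x" and rep_le: "y = x \<or> twin y x \<Longrightarrow> rep x \<le> y"
  unfolding rep_def by (rule LeastI[of _ x], simp) (rule Least_le)

lemma rep_reps:
  assumes "x \<in> F" shows "rep x \<in> reps"
proof -
  have "rep x \<in> F" using rep[of x] assms twinF by auto
  moreover have "\<not> twin y (rep x)" if "y < rep x" for y
    using rep[of x] rep_le[of y x] twin_trans[of y "rep x" x] that by force
  ultimately show ?thesis by (auto simp: reps_def)
qed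

lemma rep_eq:
  assumes "twin x y" shows "rep x = rep y"
proof -
  have "rep a \<le> rep b" if "twin a b" for a b
  proof (rule rep_le)
    show "rep b = a \<or> twin (rep b) a"
      using rep[of b] twin_sym[OF that] twin_trans[of "rep b" b a] by metis
  qed
  then show ?thesis using assms twin_sym[OF assms] by (meson antisym)
qed

lemma repsF: "reps \<subseteq> F"
  by (auto simp: reps_def)

lemma reps_simple:
  assumes "x \<in> reps" "y \<in> reps" "ends x = ends y" shows "x = y"
proof (rule ccontr)
  assume "x \<noteq> y"
  then have "twin x y" "twin y x" using parallel_twin assms repsF by auto
  then show False using assms(1,2) \<open>x \<noteq> y\<close> unfolding reps_def by (metis (mono_tags, lifting) linorder_neqE mem_Collect_eq)
qed

definition conn :: "nat \<Rightarrow> nat \<Rightarrow> bool" where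
  "conn x y \<longleftrightarrow> (x, y) \<in> {(x, y). x \<in> reps \<and> y \<in> reps \<and> adj x y}\<^sup>*"

lemma conn_refl [simp]: "conn x x"
  by (simp add: conn_def)

lemma conn_trans: "conn x y \<Longrightarrow> conn y z \<Longrightarrow> conn x z"
  unfolding conn_def by (rule rtrancl_trans)

lemma conn_sym: "conn x y \<Longrightarrow> conn y x"
  unfolding conn_def by (rule symD[OF sym_rtrancl]) (auto simp: sym_def intro: adj_sym)

lemma conn_adj: "x \<in> reps \<Longrightarrow> y \<in> reps \<Longrightarrow> adj x y \<Longrightarrow> conn x y"
  unfolding conn_def by (rule r_into_rtrancl) simp

lemma conn_share:
  "x \<in> reps \<Longrightarrow> y \<in> reps \<Longrightarrow> v \<in> ends x \<Longrightarrow> v \<in> ends y \<Longrightarrow> conn x y"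
  using repsF by (cases "x = y") (auto intro!: conn_adj simp: adj_def)

text \<open>In a simple graph on four vertices, an edge is disjoint from at most one other edge. An
  edge \<open>w\<close> with two disjoint partners therefore certifies that the component has more
  than four vertices.\<close>

definition spread :: "nat \<Rightarrow> bool" where
  "spread x \<longleftrightarrow> (\<exists>w\<in>reps. \<exists>w1\<in>reps. \<exists>w2\<in>reps. conn x w \<and> conn x w1 \<and> conn x w2 \<and>
     w \<noteq> w1 \<and> w \<noteq> w2 \<and> w1 \<noteq> w2 \<and> \<not> adj w w1 \<and> \<not> adj w w2)"

text \<open>The components contained in a complete graph on four vertices are left out: there, a star of three
  edges cannot be told from a triangle in the line graph. They contain no circuit of five edges.\<close>

definition kept :: "nat set" where
  "kept = {x \<in> reps. spread x}"

lemma kept_reps: "kept \<subseteq> reps"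
  by (auto simp: kept_def)

lemma keptF: "kept \<subseteq> F"
  using kept_reps repsF by blast

lemma kept_conn:
  assumes "x \<in> kept" "conn x y" "y \<in> reps" shows "y \<in> kept"
proof -
  have "conn y w" if "conn x w" for w using conn_trans[OF conn_sym[OF assms(2)] that] .
  then show ?thesis using assms(1,3) unfolding kept_def spread_def by blast
qed

lemma circ_conn:
  assumes y: "circ y" "y \<subseteq> reps" and ef: "e \<in> y" "f \<in> y"
  shows "conn e f"
proof -
  have yF: "y \<subseteq> F" using y(2) repsF by blast
  obtain u v where u: "u \<in> ends e" and v: "v \<in> ends f"
    using ends_obtain[of e] ends_obtain[of f] ef yF by (metis insertI1 subsetD)
  have "joined y u v" by (rule circ_joined[OF y(1) yF vertsI[OF ef(1) u] vertsI[OF ef(2) v]])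
  then have "\<forall>f\<in>y. v \<in> ends f \<longrightarrow> conn e f"
  proof (induction rule: joined_induct)
    case base
    show ?case using conn_share[of e _ u] u ef(1) y(2) by blast
  next
    case (step a b g)
    have "conn e g" using step by auto
    moreover have "conn g f" if "f \<in> y" "b \<in> ends f" for f
      using conn_share[of g f b] that step y(2) by auto
    ultimately show ?case using conn_trans by blast
  qed
  then show ?thesis using ef(2) v by blast
qed

lemma circ_kept:
  assumes y: "circ y" "y \<subseteq> reps" and m: "y \<inter> kept \<noteq> {}"
  shows "y \<subseteq> kept"
  using circ_conn[OF y] kept_conn m y(2) by blast

text \<open>Besides an edge and its two neighbours, at least two edges of the circuit remain; they
  do not touch the edge, as \<open>spread\<close> demands.\<close>

lemma long_circ_kept:
  assumes y: "circ y" "y \<subseteq> reps" and "5 \<le> card y"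
  shows "y \<subseteq> kept"
proof (rule circ_kept[OF y])
  have yF: "y \<subseteq> F" using y(2) repsF by blast
  obtain x where x: "x \<in> y" using circD(1)[OF y(1)] by blast
  have c4: "4 \<le> card y" using assms(3) by simp
  obtain u v f g where a: "ends x = {u, v}" "\<And>e. e \<in> y \<Longrightarrow> ends e \<inter> {u, v} \<noteq> {} \<Longrightarrow> e = x \<or> e = f \<or> e = g"
    by (rule circ_around[OF y(1) yF c4 x]) (rule that; assumption)
  have "\<not> y - {x, f, g} \<subseteq> {w}" for w
  proof
    assume "y - {x, f, g} \<subseteq> {w}"
    then have "card y \<le> card {x, f, g, w}" by (intro card_mono) auto
    also have "\<dots> \<le> 4" by (simp add: card_insert_if)
    finally show False using assms(3) by simp
  qed
  then obtain w1 w2 where w: "w1 \<in> y - {x, f, g}" "w2 \<in> y - {x, f, g}" "w1 \<noteq> w2" by blast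
  have "\<not> adj x w1" "\<not> adj x w2" using a w by (auto simp: adj_def)
  then have "spread x"
    unfolding spread_def using w x y(2) circ_conn[OF y x] by (intro bexI[of _ x] bexI[of _ w1] bexI[of _ w2]) auto
  then show "y \<inter> kept \<noteq> {}" using x y(2) by (auto simp: kept_def)
qed

interpretation K: ordered_multi kept ends
  using multi_sub[OF keptF] by (simp add: ordered_multi_def)

lemma kept_simple: "K.simple"
  unfolding K.simple_def using reps_simple kept_reps by blast

definition twins_cond :: bool where
  "twins_cond \<longleftrightarrow> \<not> (\<exists>Y d t. circ Y \<and> Y \<subseteq> kept \<and> odd (card Y) \<and> 5 \<le> card Y \<and> d \<in> Y \<and> twin d t)"

text \<open>A twin of an edge of the long circuit \<open>Y\<close> is parallel to it, hence an ear
  of one edge.\<close>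

lemma no_bad_imp_twins_cond:
  assumes nobad: "\<forall>C P. bad C P \<longrightarrow> \<not> C \<union> P \<subseteq> F"
  shows twins_cond
  unfolding twins_cond_def
proof (intro notI, elim exE conjE)
  fix Y d t assume Y: "circ Y" "Y \<subseteq> kept" "odd (card Y)" "5 \<le> card Y" and d: "d \<in> Y" "twin d t"
  have YF: "Y \<subseteq> F" using Y(2) keptF by blast
  have e: "ends t = ends d" by (rule circ_twin[OF Y(1) YF _ d]) (use Y(4) in simp)
  have tF: "t \<in> F" "d \<in> F" "t \<noteq> d" using twinF[OF d(2)] by auto
  have tY: "t \<notin> Y" using reps_simple[of t d] e tF(3) d(1) Y(2) kept_reps by blast
  have "theta Y {t}"
    unfolding theta_def
  proof (intro conjI)
    show "bd {t} \<noteq> {}" using ends2[OF tF(1)] by (auto simp: bd_single)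
    show "\<exists>A\<subseteq>Y. bd (A \<union> {t}) = {}"
      using bd_pair[OF tF(1,2)] tF(3) e d(1) by (intro exI[of _ "{d}"]) (simp add: insert_commute)
  qed (use Y(1) tY in auto)
  then have "bad Y {t}" unfolding bad_def using Y(3,4) by simp
  then show False using nobad YF tF(1) by blast
qed

text \<open>Of the arcs of \<open>C\<close>, one is odd, say \<open>B\<close>. Then
  \<open>B \<union> P\<close> is even but meets the odd circuit \<open>C\<close> in the odd set
  \<open>B\<close>, against the parity condition. To apply it, the theta is carried over to
  representatives. This preserves ends unless the theta contains parallel edges, and in that case
  \<open>C\<close> is a long odd circuit through an edge with a twin.\<close>

lemma conds_imp_no_bad:
  assumes par: "K.parity_cond" and tw: twins_cond and b: "bad C P" and sub: "C \<union> P \<subseteq> F"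
  shows False
proof -
  have th: "theta C P" "odd (card C)" "odd (card P)" "card C + card P \<noteq> 4" using b by (simp_all add: bad_def)
  interpret t: theta_graph F ends C P using th(1) sub by unfold_locales auto
  note cc = t.cycle_cards
  have fin: "finite C" "finite P" using sub finite_sub by auto
  have ex: "\<exists>B B'. B \<union> B' = C \<and> B \<inter> B' = {} \<and> circ (B \<union> P) \<and> circ (B' \<union> P) \<and> odd (card B) \<and>
    (\<forall>z\<subseteq>C \<union> P. bd z = {} \<longrightarrow> z \<noteq> {} \<longrightarrow> z = C \<or> z = B \<union> P \<or> z = B' \<union> P)"
  proof -
    have AA: "t.A \<union> t.A' = C" "t.A' \<union> t.A = C" "t.A \<inter> t.A' = {}" "t.A' \<inter> t.A = {}"
      using t.A(1) by (auto simp: t.A'_def)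
    have cyc: "\<forall>z\<subseteq>C \<union> P. bd z = {} \<longrightarrow> z \<noteq> {} \<longrightarrow> z = C \<or> z = t.A \<union> P \<or> z = t.A' \<union> P"
      "\<forall>z\<subseteq>C \<union> P. bd z = {} \<longrightarrow> z \<noteq> {} \<longrightarrow> z = C \<or> z = t.A' \<union> P \<or> z = t.A \<union> P"
      using t.cycle_cases by metis+
    show ?thesis
    proof (cases "odd (card t.A)")
      case True
      show ?thesis
        by (rule exI[of _ t.A], rule exI[of _ t.A'], intro conjI) (rule AA t.circ1 t.circ2 True cyc)+
    next
      case False
      then have odd': "odd (card t.A')" using cc(1) th(2) by simp
      show ?thesis
        by (rule exI[of _ t.A'], rule exI[of _ t.A], intro conjI) (rule AA t.circ1 t.circ2 odd' cyc)+
    qed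
  qed
  then obtain B B' where B: "B \<union> B' = C" "B \<inter> B' = {}" "circ (B \<union> P)" "circ (B' \<union> P)" "odd (card B)"
    and cyc: "\<And>z. z \<subseteq> C \<union> P \<Longrightarrow> bd z = {} \<Longrightarrow> z \<noteq> {} \<Longrightarrow> z = C \<or> z = B \<union> P \<or> z = B' \<union> P" by metis
  have PB: "B \<inter> P = {}" "B' \<inter> P = {}" using t.PC B(1) by blast+
  have BF: "B \<subseteq> F" "B' \<subseteq> F" using sub B(1) by auto
  have finB: "finite B" "finite B'" using finite_sub BF by auto
  have cC: "card C = card B + card B'" using B(1,2) finB by (metis card_Un_disjoint)
  have cBP: "card (B \<union> P) = card B + card P" "card (B' \<union> P) = card B' + card P"
    using PB finB fin by (simp_all add: card_Un_disjoint)
  have B'even: "even (card B')" using cC th(2) B(5) by simp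
  have CF: "C \<subseteq> F" "B \<union> P \<subseteq> F" "B' \<union> P \<subseteq> F" using sub B(1) by auto
  have repC: "ends (rep x) = ends x" if "circ y" "y \<subseteq> F" "4 \<le> card y" "x \<in> y" for x y
    using rep[of x] circ_twin[OF that, of "rep x"] twin_sym by metis
  show False
  proof (cases "\<exists>d d'. d \<in> C \<union> P \<and> d' \<in> C \<union> P \<and> d \<noteq> d' \<and> ends d = ends d'")
    case True
    then obtain d d' where d: "d \<in> C \<union> P" "d' \<in> C \<union> P" "d \<noteq> d'" "ends d = ends d'" by blast
    have "bd {d, d'} = {}" using bd_pair[of d d'] d sub by auto
    then have "{d, d'} = C \<or> {d, d'} = B \<union> P \<or> {d, d'} = B' \<union> P" using cyc[of "{d, d'}"] d by blast
    moreover have c2: "card {d, d'} = 2" using d(3) by simp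
    moreover have "odd (card C)" "odd (card (B' \<union> P))" using th cBP B'even by simp_all
    \<comment> \<open>Parallel edges form a circuit of length two, and \<open>B \<union> P\<close>
      is the only even one of the three circuits.\<close>
    ultimately have BP: "{d, d'} = B \<union> P" by (metis even_numeral)
    have "card B + card P = 2" using cBP(1) c2 BP by simp
    moreover have "b = 1 \<and> p = 1" if "b + p = 2" "odd b" "odd p" for b p :: nat using that by presburger
    ultimately have c1: "card B = 1" "card P = 1" using B(5) th(3) by blast+
    then obtain e p where e: "B = {e}" "P = {p}" by (metis card_1_singletonE)
    have ep: "e \<in> F" "p \<in> F" "e \<noteq> p" "ends e = ends p"
      using e BF sub PB BP d by (auto simp: doubleton_eq_iff)
    have c5: "5 \<le> card C"
    proof -
      have "5 \<le> a" if "2 \<le> a" "odd a" "a + p \<noteq> 4" "p = 1" for a p :: nat using that by presburger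
      from this[OF circ_card_ge2[OF t.circC CF(1)] th(2,4) c1(2)] show ?thesis .
    qed
    then have c4: "4 \<le> card C" by simp
    have pres: "\<And>x. x \<in> C \<Longrightarrow> ends (rep x) = ends x" using repC[OF t.circC CF(1) c4] .
    have inj: "inj_on rep C"
    proof (rule inj_onI, rule ccontr)
      fix x x' assume x: "x \<in> C" "x' \<in> C" "rep x = rep x'" "x \<noteq> x'"
      then have "ends x = ends x'" using pres by metis
      then have "bd {x, x'} = {}" using bd_pair[of x x'] x CF(1) by auto
      then have "{x, x'} = C" using circD(3)[OF t.circC, of "{x, x'}"] x by blast
      then show False using c5 x(4) by auto
    qed
    have C': "circ (rep ` C)" "rep ` C \<subseteq> reps" "card (rep ` C) = card C"
      using circ_image[OF t.circC inj pres] rep_reps CF(1) card_image[OF inj] by auto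
    have eC: "rep e \<in> rep ` C" using e(1) B(1) by blast
    have rep_ep: "rep e = rep p" using rep_eq[OF parallel_twin[OF ep]] .
    have "\<exists>t. twin (rep e) t" using rep[of e] rep[of p] rep_ep ep(3) by metis
    then show False
      using tw long_circ_kept[OF C'(1,2)] C' c5 th(2) eC unfolding twins_cond_def by metis
  next
    case False
    have ge3: "3 \<le> card y" if "circ y" "y \<subseteq> C \<union> P" for y
    proof (rule ccontr)
      have yF: "y \<subseteq> F" using that(2) sub by blast
      assume "\<not> 3 \<le> card y"
      then have "card y = 2" using circ_card_ge2[OF that(1) yF] by simp
      then obtain a b where ab: "y = {a, b}" "a \<noteq> b" by (auto simp: card_2_iff)
      have "bd {a, b} = ends a \<triangle> ends b" using bd_pair[of a b] ab yF by auto
      then have "ends a = ends b" using circD(2)[OF that(1)] ab(1) by simp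
      then show False using False ab that(2) by blast
    qed
    have g: "3 \<le> card C" "3 \<le> card (B \<union> P)" "3 \<le> card (B' \<union> P)"
      using ge3[OF t.circC] ge3[OF B(3)] ge3[OF B(4)] B(1) by auto
    have B'ne: "B' \<noteq> {}" using B(4) t.bdP circD(2) by auto
    then have "0 < card B'" using finB by (simp add: card_gt_0_iff)
    \<comment> \<open>The case \<open>card C = 3\<close>, \<open>card P = 1\<close> being exempted,
      one of the two odd circuits has length at least five. This places the theta in a kept
      component and lets \<open>circ_twin\<close> apply to the edges of \<open>B'\<close>; the even
      circuit serves for those of \<open>B \<union> P\<close>.\<close>
    then have long: "5 \<le> card C \<or> 5 \<le> card (B' \<union> P)" and four: "4 \<le> card (B \<union> P)"
    proof -
      have "5 \<le> b + b' \<or> 5 \<le> b' + p" "4 \<le> b + p"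
        if "3 \<le> b + p" "3 \<le> b' + p" "odd b" "even b'" "odd p" "0 < b'" "b + b' + p \<noteq> 4" for b b' p :: nat
        using that by presburger+
      from this[of "card B" "card P" "card B'"]
      show "5 \<le> card C \<or> 5 \<le> card (B' \<union> P)" "4 \<le> card (B \<union> P)"
        using g cBP cC B(5) B'even th(3,4) \<open>0 < card B'\<close> by simp_all
    qed
    have pres: "ends (rep x) = ends x" if "x \<in> C \<union> P" for x
    proof -
      consider "x \<in> B \<union> P" | "x \<in> B'" using \<open>x \<in> C \<union> P\<close> B(1) by blast
      then show ?thesis
      proof cases
        case 1
        then show ?thesis using repC[OF B(3) CF(2) four] by blast
      next
        case 2
        show ?thesis
        proof (cases "5 \<le> card C")
          case True
          show ?thesis by (rule repC[OF t.circC CF(1)]) (use True 2 B(1) in auto)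
        next
          case False
          show ?thesis by (rule repC[OF B(4) CF(3)]) (use False long 2 in auto)
        qed
      qed
    qed
    have inj: "inj_on rep (C \<union> P)"
    proof (rule inj_onI, rule ccontr)
      fix x x' assume x: "x \<in> C \<union> P" "x' \<in> C \<union> P" "rep x = rep x'" "x \<noteq> x'"
      then have "ends x = ends x'" using pres by metis
      then show False using False x by blast
    qed
    have im: "circ (rep ` y)" "rep ` y \<subseteq> reps" "card (rep ` y) = card y" if "circ y" "y \<subseteq> C \<union> P" for y
    proof -
      have i: "inj_on rep y" using inj that(2) by (rule inj_on_subset)
      show "circ (rep ` y)" by (rule circ_image[OF that(1) i]) (use pres that(2) in blast)
      show "rep ` y \<subseteq> reps" using that(2) sub rep_reps by blast
      show "card (rep ` y) = card y" by (rule card_image[OF i])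
    qed
    have sT: "C \<subseteq> C \<union> P" "B \<union> P \<subseteq> C \<union> P" "B' \<union> P \<subseteq> C \<union> P" using B(1) by auto
    note i1 = im[OF t.circC sT(1)] and i2 = im[OF B(3) sT(2)] and i3 = im[OF B(4) sT(3)]
    have "rep ` C \<subseteq> kept"
    proof (cases "5 \<le> card C")
      case True
      then show ?thesis using long_circ_kept[OF i1(1,2)] i1(3) by simp
    next
      case False
      then have "rep ` (B' \<union> P) \<subseteq> kept" using long_circ_kept[OF i3(1,2)] i3(3) long by simp
      then show ?thesis using circ_kept[OF i1(1,2)] B'ne B(1) by blast
    qed
    moreover have "B \<noteq> {}" using B(5) by auto
    ultimately have k: "rep ` C \<subseteq> kept" "rep ` (B \<union> P) \<subseteq> kept" "rep ` C \<inter> rep ` (B \<union> P) \<noteq> {}"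
      using circ_kept[OF i2(1,2)] B(1) by blast+
    have "C \<inter> (B \<union> P) = B" using B(1) t.PC by blast
    then have "rep ` C \<inter> rep ` (B \<union> P) = rep ` B"
      using inj_on_image_Int[OF inj sT(1,2)] by simp
    moreover have "card (rep ` B) = card B"
      by (rule card_image, rule inj_on_subset[OF inj]) (use B(1) in blast)
    ultimately have "odd (card (rep ` C \<inter> rep ` (B \<union> P)))" using B(5) by simp
    moreover have "even (card (rep ` (B \<union> P)))" using i2(3) cBP(1) B(5) th(3) by simp
    ultimately show False
      using K.parity_cond_circ[OF par i1(1) k(1) _ i2(1) k(2,3)] i1(3) th(2) by simp
  qed
qed

lemma no_bad_iff: "(\<forall>C P. bad C P \<longrightarrow> \<not> C \<union> P \<subseteq> F) \<longleftrightarrow> K.parity_cond \<and> twins_cond"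
proof
  assume n: "\<forall>C P. bad C P \<longrightarrow> \<not> C \<union> P \<subseteq> F"
  have "\<forall>C P. bad C P \<longrightarrow> \<not> C \<union> P \<subseteq> kept" using n keptF by blast
  then have "K.parity_cond" by (rule K.no_bad_imp_parity_cond[OF kept_simple])
  then show "K.parity_cond \<and> twins_cond" using no_bad_imp_twins_cond[OF n] by blast
qed (use conds_imp_no_bad in blast)

end

section \<open>Recovering the root graph from its line graph\<close>

context multi
begin

definition aconn :: "'e \<Rightarrow> 'e \<Rightarrow> bool" where
  "aconn x y \<longleftrightarrow> (x, y) \<in> {(x, y). adj x y}\<^sup>*"

end

locale spread_multi = ordered_multi F ends for F :: "nat set" and ends :: "nat \<Rightarrow> 'w set" +
  assumes simple: simple
    and spread_out: "x \<in> F \<Longrightarrow> \<exists>w w1 w2. aconn x w \<and> aconn x w1 \<and> aconn x w2 \<and>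
      w \<noteq> w1 \<and> w \<noteq> w2 \<and> w1 \<noteq> w2 \<and> \<not> adj w w1 \<and> \<not> adj w w2"
begin

lemma simpleD: "e \<in> F \<Longrightarrow> f \<in> F \<Longrightarrow> ends e = ends f \<Longrightarrow> e = f"
  using simple by (auto simp: simple_def)

lemma ends_two: "e \<in> F \<Longrightarrow> a \<in> ends e \<Longrightarrow> b \<in> ends e \<Longrightarrow> a \<noteq> b \<Longrightarrow> {a, b} = ends e"
  using ends2[of e] finite_ends[of e] by (intro card_subset_eq) auto

lemma aconn_F: "aconn x y \<Longrightarrow> x \<in> F \<Longrightarrow> y \<in> F"
  unfolding aconn_def by (erule rtranclE) (auto simp: adj_def)

text \<open>\<open>ht\<close> recognises the triangles of the root graph among those of the line graph, which may also be
  stars: every edge is adjacent to an even number of edges of a triangle, whereas a star of three edges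
  with this property spans its component on four vertices.\<close>

definition ht :: "nat \<Rightarrow> nat \<Rightarrow> nat \<Rightarrow> bool" where
  "ht x y z \<longleftrightarrow> adj x y \<and> adj y z \<and> adj x z \<and> (\<forall>w\<in>F. adj w z \<longleftrightarrow> adj w x \<noteq> adj w y)"

lemma one_common:
  assumes "adj x y" obtains v where "ends x \<inter> ends y = {v}"
proof -
  have F: "x \<in> F" "y \<in> F" "x \<noteq> y" "ends x \<inter> ends y \<noteq> {}" using assms by (auto simp: adj_def)
  obtain v where v: "v \<in> ends x" "v \<in> ends y" using F(4) by blast
  obtain a where a: "ends x = {v, a}" "a \<noteq> v" using other_end[OF F(1) v(1)] by metis
  obtain b where b: "ends y = {v, b}" "b \<noteq> v" using other_end[OF F(2) v(2)] by metis
  have "a \<noteq> b" using simpleD[OF F(1,2)] F(3) a b by auto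
  then have "ends x \<inter> ends y = {v}" using a b by auto
  then show ?thesis by (rule that)
qed

lemma star_no_ht:
  assumes t: "ht x y z" and v: "v \<in> ends x" "v \<in> ends y" "v \<in> ends z"
  shows False
proof -
  have F: "x \<in> F" "y \<in> F" "z \<in> F" "x \<noteq> y" "y \<noteq> z" "x \<noteq> z" using t by (auto simp: ht_def adj_def)
  have ev: "adj w z \<longleftrightarrow> adj w x \<noteq> adj w y" if "w \<in> F" for w using t that by (simp add: ht_def)
  obtain a where a: "ends x = {v, a}" "a \<noteq> v" using other_end[OF F(1) v(1)] by metis
  obtain b where b: "ends y = {v, b}" "b \<noteq> v" using other_end[OF F(2) v(2)] by metis
  obtain c where c: "ends z = {v, c}" "c \<noteq> v" using other_end[OF F(3) v(3)] by metis
  have abc: "a \<noteq> b" "b \<noteq> c" "a \<noteq> c" using simpleD[OF F(1,2)] simpleD[OF F(2,3)] simpleD[OF F(1,3)] F a b c by auto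
  let ?U = "{v, a, b, c}"
  \<comment> \<open>An edge outside the star cannot contain \<open>v\<close>, since it would touch
    all three edges of the star. So it contains an even number of \<open>a\<close>,
    \<open>b\<close>, \<open>c\<close>: two of them if it meets \<open>?U\<close> at all. Thus
    \<open>?U\<close> spans a whole component.\<close>
  have cl: "ends w \<subseteq> ?U" if w: "w \<in> F" and m: "ends w \<inter> ?U \<noteq> {}" for w
  proof (cases "w = x \<or> w = y \<or> w = z")
    case True
    then show ?thesis using a b c by auto
  next
    case False
    then have ad: "adj w x \<longleftrightarrow> v \<in> ends w \<or> a \<in> ends w" "adj w y \<longleftrightarrow> v \<in> ends w \<or> b \<in> ends w"
      "adj w z \<longleftrightarrow> v \<in> ends w \<or> c \<in> ends w"
      using w F a b c by (auto simp: adj_def)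
    have nv: "v \<notin> ends w" using ev[OF w] ad by blast
    obtain p q where pq: "ends w = {p, q}" "p \<noteq> q" using ends_obtain[OF w] by metis
    have "c \<in> ends w \<longleftrightarrow> (a \<in> ends w) \<noteq> (b \<in> ends w)" using ev[OF w] ad nv by blast
    then show ?thesis using m nv pq abc by auto
  qed
  have inU: "ends w \<subseteq> ?U" if "aconn x w" for w
    using that unfolding aconn_def
  proof (induction rule: rtrancl_induct)
    case base
    show ?case using a by auto
  next
    case (step w w')
    then have "w' \<in> F" "ends w \<inter> ends w' \<noteq> {}" by (auto simp: adj_def)
    then show ?case using cl[of w'] step.IH by blast
  qed
  obtain w w1 w2 where w: "aconn x w" "aconn x w1" "aconn x w2" "w \<noteq> w1" "w \<noteq> w2" "w1 \<noteq> w2" "\<not> adj w w1" "\<not> adj w w2"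
    using spread_out[OF F(1)] by blast
  have wF: "w \<in> F" "w1 \<in> F" "w2 \<in> F" using aconn_F[OF _ F(1)] w by blast+
  have cU: "card ?U = 4" using a b c abc by auto
  \<comment> \<open>Among four vertices, the edges disjoint from \<open>w\<close> all have the same
    ends, so the two partners granted by \<open>spread_out\<close> coincide.\<close>
  have "ends w' = ?U - ends w" if "w' \<in> F" "aconn x w'" "w \<noteq> w'" "\<not> adj w w'" for w'
  proof -
    have d: "ends w' \<subseteq> ?U - ends w" using inU[OF that(2)] that wF(1) by (auto simp: adj_def)
    have "card (?U - ends w) = 2"
      using card_Diff_subset[OF finite_ends[OF wF(1)] inU[OF w(1)]] cU ends2[OF wF(1)] by simp
    then show ?thesis using card_subset_eq[OF _ d] ends2[OF that(1)] by simp
  qed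
  from this[OF wF(2) w(2,4,7)] this[OF wF(3) w(3,5,8)] have "ends w1 = ends w2" by (rule trans[OF _ sym])
  then show False using simpleD[OF wF(2,3)] w(6) by blast
qed

lemma ht_iff: "ht x y z \<longleftrightarrow> adj x y \<and> adj y z \<and> adj x z \<and> ends x \<inter> ends y \<inter> ends z = {}"
proof
  assume "ht x y z"
  then show "adj x y \<and> adj y z \<and> adj x z \<and> ends x \<inter> ends y \<inter> ends z = {}"
    using star_no_ht[of x y z] unfolding ht_def by blast
next
  assume h: "adj x y \<and> adj y z \<and> adj x z \<and> ends x \<inter> ends y \<inter> ends z = {}"
  then have F: "x \<in> F" "y \<in> F" "z \<in> F" "x \<noteq> y" "y \<noteq> z" "x \<noteq> z" by (auto simp: adj_def)
  obtain a where a: "ends x \<inter> ends y = {a}" using one_common h by blast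
  obtain b where b: "ends y \<inter> ends z = {b}" using one_common h by blast
  obtain c where c: "ends x \<inter> ends z = {c}" using one_common h by blast
  have ne: "a \<noteq> b" "b \<noteq> c" "a \<noteq> c" using a b c h by blast+
  have sub: "{a, c} = ends x" "{a, b} = ends y" "{b, c} = ends z"
    by (rule ends_two; use a b c ne F in blast)+
  have "adj w z \<longleftrightarrow> adj w x \<noteq> adj w y" if w: "w \<in> F" for w
  proof (cases "w = x \<or> w = y \<or> w = z")
    case True
    then show ?thesis using h adj_sym by (auto simp: adj_def)
  next
    case False
    then have "ends w \<noteq> {a, c}" "ends w \<noteq> {a, b}" "ends w \<noteq> {b, c}" using simpleD[OF w] F sub by auto
    moreover obtain p q where "ends w = {p, q}" "p \<noteq> q" using ends_obtain[OF w] by metis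
    ultimately have "\<not> (a \<in> ends w \<and> c \<in> ends w)" "\<not> (a \<in> ends w \<and> b \<in> ends w)" "\<not> (b \<in> ends w \<and> c \<in> ends w)"
      using ne by auto
    moreover have "adj w x \<longleftrightarrow> a \<in> ends w \<or> c \<in> ends w" "adj w y \<longleftrightarrow> a \<in> ends w \<or> b \<in> ends w"
      "adj w z \<longleftrightarrow> b \<in> ends w \<or> c \<in> ends w"
      using False w F sub[symmetric] by (auto simp: adj_def)
    ultimately show ?thesis by blast
  qed
  then show "ht x y z" using h by (simp add: ht_def)
qed

definition nb :: "nat \<Rightarrow> nat" where
  "nb x = (LEAST f. adj x f)"

lemma nb:
  assumes "x \<in> F" shows "adj x (nb x)"
proof -
  have "\<exists>f. adj x f"
  proof (rule ccontr)
    assume no: "\<nexists>f. adj x f"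
    have "w = x" if "aconn x w" for w
      using that unfolding aconn_def by (induction rule: rtrancl_induct) (use no in auto)
    moreover obtain w w1 where "aconn x w" "aconn x w1" "w \<noteq> w1" using spread_out[OF assms] by blast
    ultimately show False by metis
  qed
  then show ?thesis unfolding nb_def by (rule LeastI_ex)
qed

text \<open>End \<open>0\<close> of an edge is the one shared with its first neighbour; every other number stands for
  the other end.\<close>

definition endv :: "nat \<Rightarrow> nat \<Rightarrow> 'w" where
  "endv x s = (if s = 0 then THE v. v \<in> ends x \<inter> ends (nb x) else THE v. v \<in> ends x - ends (nb x))"

lemma endv:
  assumes "x \<in> F"
  shows endv_nb: "ends x \<inter> ends (nb x) = {endv x 0}"
    and ends_endv: "s \<noteq> 0 \<Longrightarrow> ends x = {endv x 0, endv x s}"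
    and endv_ne: "s \<noteq> 0 \<Longrightarrow> endv x s \<noteq> endv x 0"
    and endv_eq: "s \<noteq> 0 \<Longrightarrow> t \<noteq> 0 \<Longrightarrow> endv x s = endv x t"
proof -
  obtain v where v: "ends x \<inter> ends (nb x) = {v}" using one_common[OF nb[OF assms]] .
  then obtain w where w: "ends x = {v, w}" "w \<noteq> v" using other_end[OF assms, of v] by blast
  then have w': "ends x - ends (nb x) = {w}" using v by auto
  have e0: "endv x 0 = v" using v by (simp add: endv_def)
  have e1: "endv x s = w" if "s \<noteq> 0" for s using w' that by (simp add: endv_def)
  show "ends x \<inter> ends (nb x) = {endv x 0}" using v e0 by simp
  show "s \<noteq> 0 \<Longrightarrow> ends x = {endv x 0, endv x s}" using w e0 e1 by simp
  show "s \<noteq> 0 \<Longrightarrow> endv x s \<noteq> endv x 0" using w e0 e1 by simp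
  show "s \<noteq> 0 \<Longrightarrow> t \<noteq> 0 \<Longrightarrow> endv x s = endv x t" using e1 by simp
qed

lemma endv_in: "x \<in> F \<Longrightarrow> endv x s \<in> ends x"
  using endv_nb[of x] ends_endv[of x s] by (cases "s = 0") auto

lemma endv_eq_iff: "x \<in> F \<Longrightarrow> endv x s = endv x t \<longleftrightarrow> (s = 0 \<longleftrightarrow> t = 0)"
  using endv_ne[of x s] endv_ne[of x t] endv_eq[of x s t] by (cases "s = 0"; cases "t = 0") auto

text \<open>Three pairwise adjacent edges share a vertex unless they form a triangle, so whether
  \<open>y\<close> contains end 0 of \<open>x\<close> can be read off from adjacency and
  \<open>ht\<close>.\<close>

definition at0 :: "nat \<Rightarrow> nat \<Rightarrow> bool" where
  "at0 x y \<longleftrightarrow> y = nb x \<or> (adj y (nb x) \<and> \<not> ht x y (nb x))"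

lemma at0_iff:
  assumes "adj x y" shows "at0 x y \<longleftrightarrow> endv x 0 \<in> ends y"
proof -
  have F: "x \<in> F" "y \<in> F" using assms by (auto simp: adj_def)
  note n = nb[OF F(1)] and e = endv_nb[OF F(1)]
  show ?thesis
  proof (cases "y = nb x")
    case True
    then show ?thesis using e by (auto simp: at0_def)
  next
    case False
    then have "endv x 0 \<in> ends y \<longrightarrow> adj y (nb x)" using n e F by (auto simp: adj_def)
    moreover have "adj y (nb x) \<longrightarrow> (ht x y (nb x) \<longleftrightarrow> endv x 0 \<notin> ends y)"
    proof
      assume y: "adj y (nb x)"
      have "ends x \<inter> ends y \<inter> ends (nb x) = {endv x 0} \<inter> ends y" unfolding e[symmetric] by blast
      then show "ht x y (nb x) \<longleftrightarrow> endv x 0 \<notin> ends y" using y assms n by (simp add: ht_iff)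
    qed
    ultimately show ?thesis using False unfolding at0_def by blast
  qed
qed

text \<open>Equality of the root vertices coded by \<open>(x, s)\<close> and \<open>(y, t)\<close>.
  Adjacent edges of a simple graph share just one vertex, so the codes agree iff each of them names
  that vertex.\<close>

definition same :: "nat \<Rightarrow> nat \<Rightarrow> nat \<Rightarrow> nat \<Rightarrow> bool" where
  "same x s y t \<longleftrightarrow> (x = y \<and> (s = 0 \<longleftrightarrow> t = 0)) \<or> (adj x y \<and> (s = 0 \<longleftrightarrow> at0 x y) \<and> (t = 0 \<longleftrightarrow> at0 y x))"

lemma same_iff:
  assumes F: "x \<in> F" "y \<in> F"
  shows "same x s y t \<longleftrightarrow> endv x s = endv y t"
proof (cases "x = y")
  case True
  then show ?thesis using endv_eq_iff[OF F(1)] by (auto simp: same_def adj_def)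
next
  case False
  show ?thesis
  proof (cases "adj x y")
    case True
    obtain v where v: "ends x \<inter> ends y = {v}" using one_common[OF True] .
    have h: "endv x s = v \<longleftrightarrow> (s = 0 \<longleftrightarrow> at0 x y)" if "adj x y" "ends x \<inter> ends y = {v}" for x y s
    proof -
      have F: "x \<in> F" using that(1) by (simp add: adj_def)
      have "endv x 0 = v \<longleftrightarrow> at0 x y" using at0_iff[OF that(1)] that(2) endv_in[OF F, of 0] by blast
      moreover have "endv x s = v \<longleftrightarrow> endv x 0 \<noteq> v" if "s \<noteq> 0"
      proof -
        have "v \<in> ends x" using \<open>ends x \<inter> ends y = {v}\<close> by blast
        then have "v = endv x 0 \<or> v = endv x s" using ends_endv[OF F that] by simp
        then show ?thesis using endv_ne[OF F that] by metis
      qed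
      ultimately show ?thesis by (cases "s = 0") auto
    qed
    have "endv x s = endv y t \<longleftrightarrow> endv x s = v \<and> endv y t = v"
    proof
      assume eq: "endv x s = endv y t"
      have "endv x s \<in> ends y" unfolding eq by (rule endv_in[OF F(2)])
      then have "endv x s \<in> ends x \<inter> ends y" using endv_in[OF F(1)] by blast
      then show "endv x s = v \<and> endv y t = v" unfolding v eq by simp
    qed simp
    also have "\<dots> \<longleftrightarrow> same x s y t"
      using h[OF True v, of s] h[OF adj_sym[OF True] v[unfolded Int_commute[of "ends x"]], of t] True False
      unfolding same_def by simp
    finally show ?thesis by simp
  next
    case no: False
    then have "ends x \<inter> ends y = {}" using F False by (auto simp: adj_def)
    then have "endv x s \<noteq> endv y t" using endv_in[OF F(1), of s] endv_in[OF F(2), of t] by (metis disjoint_iff)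
    then show ?thesis using False no by (simp add: same_def)
  qed
qed

lemma endjoined_endv:
  assumes "e \<in> F" "s \<noteq> 0" shows "endjoined S e \<longleftrightarrow> joined S (endv e 0) (endv e s)"
  by (rule endjoined_iff[OF ends_endv[OF assms]])

lemma joined_half_step:
  assumes "joined S v (endv y t)" "y \<in> S" "S \<subseteq> F" "u = 0 \<longleftrightarrow> t \<noteq> 0" "same y u x s" "x \<in> F"
  shows "joined S v (endv x s)"
proof -
  have y: "y \<in> F" using assms(2,3) by blast
  have "joined S (endv y t) (endv y u)" by (rule joined_ends[OF assms(2) y endv_in[OF y] endv_in[OF y]])
  then show ?thesis using joined_trans[OF assms(1)] same_iff[OF y assms(6)] assms(5) by simp
qed

text \<open>Reachability in terms of codes below \<open>n\<close>, the range of the variables of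
  formulas; \<open>1 < n\<close> provides a code for the second end. A step crosses \<open>y\<close>
  from its end \<open>t\<close> to the opposite end \<open>u\<close>, and then renames that vertex
  as \<open>(x, s)\<close>.\<close>

lemma joined_half_induct:
  assumes j: "joined S (endv e 0) v" and S: "S \<subseteq> F" and e: "e \<in> F" and n: "1 < (n :: nat)"
    and start: "\<And>x s. x \<in> F \<Longrightarrow> s < n \<Longrightarrow> same e 0 x s \<Longrightarrow> R x s"
    and step: "\<And>x s y t u. x \<in> F \<Longrightarrow> s < n \<Longrightarrow> t < n \<Longrightarrow> u < n \<Longrightarrow> R y t \<Longrightarrow> y \<in> S \<Longrightarrow> (u = 0 \<longleftrightarrow> t \<noteq> 0) \<Longrightarrow> same y u x s \<Longrightarrow> R x s"
  shows "x \<in> F \<Longrightarrow> s < n \<Longrightarrow> v = endv x s \<Longrightarrow> R x s"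
  using j
proof (induction arbitrary: x s rule: joined_induct)
  case base
  then show ?case using start same_iff[OF e] by simp
next
  case (step a b y)
  have y: "y \<in> F" using step.hyps(2) S by blast
  have ends: "ends y = {endv y 0, endv y 1}" using ends_endv[OF y, of 1] by simp
  have "endv y 1 \<noteq> endv y 0" using endv_ne[OF y, of 1] by simp
  then have "\<exists>t u. a = endv y t \<and> b = endv y u \<and> t < n \<and> u < n \<and> (u = 0 \<longleftrightarrow> t \<noteq> 0)"
  proof -
    have "{a, b} = {endv y 0, endv y 1}" using step.hyps(3) ends by simp
    then consider "a = endv y 0" "b = endv y 1" | "a = endv y 1" "b = endv y 0"
      by (auto simp: doubleton_eq_iff)
    then show ?thesis using n by cases (metis gr_zeroI less_trans zero_less_one zero_neq_one)+
  qed
  then obtain t u where tu: "a = endv y t" "b = endv y u" "t < n" "u < n" "u = 0 \<longleftrightarrow> t \<noteq> 0" by blast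
  have "R y t" by (rule step.IH[OF y tu(3,1)])
  then show ?case
    by (rule assms(6)[OF step.prems(1,2) tu(3,4) _ step.hyps(2) tu(5)])
      (use same_iff[OF y step.prems(1)] tu(2) step.prems(3) in simp)
qed

section \<open>Long odd circuits through a given edge\<close>

lemma ht_circ:
  assumes "ht d a b" shows "circ {d, a, b}" "card {d, a, b} = 3" "{d, a, b} \<subseteq> F"
proof -
  have h: "adj d a" "adj a b" "adj d b" "ends d \<inter> ends a \<inter> ends b = {}" using assms unfolding ht_iff by auto
  then have F: "d \<in> F" "a \<in> F" "b \<in> F" "d \<noteq> a" "a \<noteq> b" "d \<noteq> b" by (auto simp: adj_def)
  then show c: "card {d, a, b} = 3" and s: "{d, a, b} \<subseteq> F" by auto
  obtain p where p: "ends d \<inter> ends a = {p}" using one_common[OF h(1)] .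
  obtain q where q: "ends a \<inter> ends b = {q}" using one_common[OF h(2)] .
  obtain r where r: "ends d \<inter> ends b = {r}" using one_common[OF h(3)] .
  have ne: "p \<noteq> q" "q \<noteq> r" "p \<noteq> r" using p q r h(4) by blast+
  have sub: "{p, r} = ends d" "{p, q} = ends a" "{q, r} = ends b"
    by (rule ends_two; use p q r ne F in blast)+
  have "{d, a, b} = {d, a} \<union> {b}" "{d, a} \<inter> {b} = {}" using F by auto
  then have "bd {d, a, b} = ends d \<triangle> ends a \<triangle> ends b"
    using bd_Un[of "{d, a}" "{b}"] bd_pair[OF F(1,2,4)] F by (simp add: bd_single)
  also have "\<dots> = {}" unfolding sub[symmetric] set_eq_iff mem_sdiff using ne by (simp, metis)
  finally obtain D where D: "circ D" "d \<in> D" "D \<subseteq> {d, a, b}" using circ_in_cycle[OF s] by blast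
  have "3 \<le> card D" using simple_circ_card[OF simple D(1)] D(3) s by blast
  then have "D = {d, a, b}" using card_seteq[OF _ D(3)] c by simp
  then show "circ {d, a, b}" using D(1) by simp
qed

lemma circ3_ht:
  assumes "circ Y" "Y \<subseteq> F" "card Y = 3" "d \<in> Y"
  obtains a b where "Y = {d, a, b}" "ht d a b"
proof -
  have "card (Y - {d}) = 2" using assms by (simp add: card_Diff_singleton)
  then obtain a b where ab: "Y - {d} = {a, b}" "a \<noteq> b" by (auto simp: card_2_iff)
  have Y: "Y = {d, a, b}" using ab(1) assms(4) by blast
  have ne: "a \<noteq> d" "b \<noteq> d" using ab(1) by auto
  have F: "d \<in> F" "a \<in> F" "b \<in> F" using Y assms(2) by auto
  have "{d, a, b} = {d, a} \<union> {b}" "{d, a} \<inter> {b} = {}" using ne ab(2) by auto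
  then have "bd {d, a, b} = ends d \<triangle> ends a \<triangle> ends b"
    using bd_Un[of "{d, a}" "{b}"] bd_pair[OF F(1,2)] F ne by (simp add: bd_single)
  then have "ends d \<triangle> ends a \<triangle> ends b = {}" using circD(2)[OF assms(1)] Y by simp
  then have e: "ends d \<triangle> ends a = ends b" by simp
  obtain p q where d: "ends d = {p, q}" "p \<noteq> q" using ends_obtain[OF F(1)] by metis
  have c: "card (ends d \<triangle> ends a) + 2 * card (ends d \<inter> ends a) = 4"
    using card_sdiff[OF finite_ends[OF F(1)] finite_ends[OF F(2)]] ends2[OF F(1)] ends2[OF F(2)] by simp
  then have c1: "card (ends d \<inter> ends a) = 1" using e ends2[OF F(3)] by simp
  then obtain w where w: "ends d \<inter> ends a = {w}" by (meson card_1_singletonE)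
  obtain x where x: "ends d = {w, x}" "x \<noteq> w" using other_end[OF F(1), of w] w by blast
  obtain z where z: "ends a = {w, z}" "z \<noteq> w" using other_end[OF F(2), of w] w by blast
  have "x \<notin> ends a" "z \<notin> ends d" using w x z by auto
  then have "x \<in> ends b" "z \<in> ends b" "w \<notin> ends b" unfolding e[symmetric] mem_sdiff using x z by simp_all
  then have "ends d \<inter> ends b \<noteq> {}" "ends a \<inter> ends b \<noteq> {}" "ends d \<inter> ends a \<inter> ends b = {}"
    unfolding w using x z by auto
  moreover have "ends d \<inter> ends a \<noteq> {}" using w by simp
  ultimately have "ht d a b" unfolding ht_iff using F ne ab(2) by (auto simp: adj_def)
  then show ?thesis using Y that by blast
qed

text \<open>A walk in the line graph starting at \<open>f\<close>; every member from which it goes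
  on, other than \<open>f\<close>, is disjoint from \<open>d\<close>. It traces a path of the root
  graph that keeps away from the ends of \<open>d\<close>.\<close>

definition avoid :: "nat \<Rightarrow> nat \<Rightarrow> nat \<Rightarrow> bool" where
  "avoid d f g \<longleftrightarrow> (f, g) \<in> {(x, y). adj x y \<and> (x = f \<or> (x \<noteq> d \<and> \<not> adj x d))}\<^sup>*"

text \<open>As \<open>f\<close> and \<open>g\<close> are not adjacent, they meet \<open>d\<close> at
  different ends. So the walk closes up through \<open>d\<close> to a circuit, and this is not a
  triangle.\<close>

definition detour :: "nat \<Rightarrow> nat \<Rightarrow> nat \<Rightarrow> bool" where
  "detour d a b \<longleftrightarrow> (\<exists>f g. adj f d \<and> adj g d \<and> f \<noteq> a \<and> f \<noteq> b \<and> g \<noteq> a \<and> g \<noteq> b \<and> f \<noteq> g \<and> \<not> adj f g \<and> avoid d f g)"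

definition odd_block :: "nat \<Rightarrow> bool" where
  "odd_block d \<longleftrightarrow> (\<exists>e\<in>F - tree. d \<in> fund e \<and> (\<exists>g. flink e g \<and> odd (card (fund g))))"

lemma circ_odd_block:
  assumes Y: "circ Y" "Y \<subseteq> F" "odd (card Y)" "d \<in> Y"
  shows "odd_block d"
proof -
  have "span (Y - tree) = Y" by (rule span_eq[OF Y(2) circD(2)[OF Y(1)]])
  then have "odd (card {e \<in> Y - tree. d \<in> fund e})" using Y(4) unfolding span_def by blast
  then have "{e \<in> Y - tree. d \<in> fund e} \<noteq> {}" by (metis card.empty even_zero)
  then obtain e where e: "e \<in> Y - tree" "d \<in> fund e" by blast
  obtain g where g: "g \<in> Y - tree" "odd (card (fund g))" using odd_fund_in[OF Y(2) circD(2)[OF Y(1)] Y(3)] .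
  have "flink e g" by (rule circ_flink[OF Y(1,2) e(1) g(1)])
  then show ?thesis unfolding odd_block_def using e g Y(2) by blast
qed

lemma detour_circ:
  assumes t: "ht d a b" and det: "detour d a b"
  obtains Z where "circ Z" "Z \<subseteq> F" "Z \<inter> {d, a, b} = {d}" "card Z \<noteq> 3"
proof -
  obtain f g where fg: "adj f d" "adj g d" "f \<noteq> a" "f \<noteq> b" "g \<noteq> a" "g \<noteq> b" "f \<noteq> g" "\<not> adj f g" "avoid d f g"
    using det by (auto simp: detour_def)
  have F: "d \<in> F" "f \<in> F" "g \<in> F" "f \<noteq> d" "g \<noteq> d" using fg by (auto simp: adj_def)
  obtain \<alpha> where \<alpha>: "ends f \<inter> ends d = {\<alpha>}" using one_common[OF fg(1)] .
  obtain \<beta> where \<beta>: "ends g \<inter> ends d = {\<beta>}" using one_common[OF fg(2)] .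
  have dis: "ends f \<inter> ends g = {}" using fg(7,8) F by (auto simp: adj_def)
  have ab: "\<alpha> \<noteq> \<beta>" using \<alpha> \<beta> dis by blast
  have d: "ends d = {\<alpha>, \<beta>}"
    by (rule ends_two[symmetric]) (use \<alpha> \<beta> ab F in blast)+
  obtain p where p: "ends f = {\<alpha>, p}" "p \<noteq> \<alpha>" using other_end[OF F(2), of \<alpha>] \<alpha> by blast
  obtain q where q: "ends g = {\<beta>, q}" "q \<noteq> \<beta>" using other_end[OF F(3), of \<beta>] \<beta> by blast
  have pd: "p \<notin> ends d" using \<alpha> p by blast
  define S where "S = {e \<in> F. ends e \<inter> ends d = {}}"
  have SF: "S \<subseteq> F" by (auto simp: S_def)
  \<comment> \<open>Invariant of the walk. An edge at \<open>\<alpha>\<close> other than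
    \<open>f\<close> touches or equals \<open>d\<close>, so the walk cannot go on from it; any other
    member reached contains a vertex joined to \<open>p\<close> by edges disjoint from
    \<open>d\<close>.\<close>
  define ok where "ok x \<longleftrightarrow> x = f \<or> (\<alpha> \<in> ends x \<and> x \<in> F) \<or> (x \<in> F \<and> (\<exists>r\<in>ends x. joined S p r \<and> r \<notin> ends d))" for x
  have "ok g"
    using fg(9) unfolding avoid_def
  proof (induction rule: rtrancl_induct)
    case base
    show ?case by (simp add: ok_def)
  next
    case (step x y)
    have xy: "adj x y" "x = f \<or> (x \<noteq> d \<and> \<not> adj x d)" using step.hyps(2) by auto
    have F': "x \<in> F" "y \<in> F" using xy(1) by (auto simp: adj_def)
    obtain r where r: "r \<in> ends x" "r \<in> ends y" using xy(1) by (auto simp: adj_def)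
    show ?case
    proof (cases "x = f")
      case True
      then have "r = \<alpha> \<or> r = p" using r(1) p(1) by auto
      then show ?thesis using r(2) F'(2) pd unfolding ok_def by auto
    next
      case False
      then have x: "x \<in> S" using xy(2) F' F(1) by (auto simp: S_def adj_def)
      then have "\<alpha> \<notin> ends x" using d by (auto simp: S_def)
      then obtain r' where r': "r' \<in> ends x" "joined S p r'" using step.IH False unfolding ok_def by blast
      have "joined S p r" using joined_trans[OF r'(2) joined_ends[OF x F'(1) r'(1) r(1)]] .
      moreover have "r \<notin> ends d" using x r(1) by (auto simp: S_def)
      ultimately show ?thesis using r(2) F'(2) unfolding ok_def by blast
    qed
  qed
  moreover have "\<alpha> \<notin> ends g" using dis \<alpha> by blast
  ultimately obtain r where r: "r \<in> ends g" "joined S p r" "r \<notin> ends d" using fg(7) unfolding ok_def by blast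
  then have jq: "joined S p q" using q(1) d by auto
  obtain J where J: "J \<subseteq> S" "bd J = {p} \<triangle> {q}" using joined_imp_join[OF jq SF] by blast
  have no: "f \<notin> J" "g \<notin> J" "d \<notin> J" using J(1) \<alpha> \<beta> d unfolding S_def by auto
  have JF: "J \<subseteq> F" using J(1) SF by blast
  have "{d, f, g} = {d, f} \<union> {g}" "{d, f} \<inter> {g} = {}" using F fg(7) by auto
  then have "bd {d, f, g} = ends d \<triangle> ends f \<triangle> ends g"
    using bd_Un[of "{d, f}" "{g}"] bd_pair[OF F(1,2)] F by (simp add: bd_single)
  also have "\<dots> = {p} \<triangle> {q}"
    unfolding d p(1) q(1) set_eq_iff mem_sdiff using ab p(2) q(2) pd d by (simp, metis)
  finally have "bd (J \<union> {d, f, g}) = {}"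
    using bd_Un[OF JF, of "{d, f, g}"] F no J(2) by simp
  moreover have ZF: "J \<union> {d, f, g} \<subseteq> F" using JF F by auto
  ultimately obtain Z where Z: "circ Z" "d \<in> Z" "Z \<subseteq> J \<union> {d, f, g}" using circ_in_cycle[of "J \<union> {d, f, g}" d] by blast
  have ad: "adj d a" "adj d b" using t by (simp_all add: ht_def)
  have "a \<notin> J" "b \<notin> J" "a \<noteq> d" "b \<noteq> d" using J(1) ad unfolding S_def adj_def by blast+
  then have "Z \<inter> {d, a, b} = {d}" using Z(2,3) fg(3-6) by auto
  moreover have "card Z \<noteq> 3"
  proof
    assume c3: "card Z = 3"
    obtain x y where xy: "Z = {d, x, y}" "ht d x y" using circ3_ht[OF Z(1) subset_trans[OF Z(3) ZF] c3 Z(2)] .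
    have a: "adj d x" "adj d y" "adj x y" using xy(2) by (simp_all add: ht_def)
    have "x \<notin> J" "y \<notin> J" using J(1) a(1,2) unfolding S_def adj_def by blast+
    then have "{x, y} \<subseteq> {f, g}" using xy(1) Z(3) a unfolding adj_def by auto
    moreover have "x \<noteq> y" using a(3) by (simp add: adj_def)
    ultimately have "x = f \<and> y = g \<or> x = g \<and> y = f" by auto
    then show False using fg(8) a(3) adj_sym by blast
  qed
  ultimately show ?thesis using that Z ZF by blast
qed

lemma circ_detour:
  assumes Y: "circ Y" "Y \<subseteq> F" "4 \<le> card Y" "Y \<inter> {d, a, b} = {d}"
  shows "detour d a b"
proof -
  have dY: "d \<in> Y" using Y(4) by blast
  obtain u v p q f g f' where a: "ends d = {u, v}" "u \<noteq> v"
    "f \<in> Y" "f \<noteq> d" "ends f = {u, p}" "p \<notin> {u, v}" "g \<in> Y" "g \<noteq> d" "ends g = {v, q}" "q \<notin> {u, v}" "p \<noteq> q"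
    and near: "\<And>e. e \<in> Y \<Longrightarrow> ends e \<inter> {u, v} \<noteq> {} \<Longrightarrow> e = d \<or> e = f \<or> e = g"
    by (rule circ_around[OF Y(1-3) dY]) (rule that; assumption)
  have F: "d \<in> F" "f \<in> F" "g \<in> F" using dY a Y(2) by auto
  have fg: "f \<noteq> g" using a by auto
  let ?J = "Y - {d, f, g}"
  have "{d, f, g} = {d, f} \<union> {g}" "{d, f} \<inter> {g} = {}" using a fg by auto
  then have "bd {d, f, g} = ends d \<triangle> ends f \<triangle> ends g"
    using bd_Un[of "{d, f}" "{g}"] bd_pair[OF F(1,2)] a(4) F by (simp add: bd_single)
  also have "\<dots> = {p} \<triangle> {q}"
    unfolding a(1,5,9) set_eq_iff mem_sdiff using a(2,6,10,11) by (simp, metis)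
  finally have "bd ?J = {p} \<triangle> {q}"
    using bd_Diff[OF Y(2), of "{d, f, g}"] circD(2)[OF Y(1)] a(3,7) dY by simp
  then have "joined ?J p q" using join_imp_joined[of ?J] Y(2) by blast
  then have "\<forall>e\<in>F. q \<in> ends e \<longrightarrow> avoid d f e"
  proof (induction rule: joined_induct)
    case base
    have "avoid d f e" if "e \<in> F" "p \<in> ends e" for e
    proof (cases "e = f")
      case False
      then have "adj f e" using that F(2) a(5) by (auto simp: adj_def)
      then show ?thesis unfolding avoid_def by (intro r_into_rtrancl) simp
    qed (simp add: avoid_def)
    then show ?case by blast
  next
    case (step r r' h)
    have h: "h \<in> Y" "h \<noteq> d" "h \<noteq> f" "h \<noteq> g" "h \<in> F" using step.hyps(2) Y(2) by auto
    have fh: "avoid d f h" using step.IH h(5) step.hyps(3) by auto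
    have nh: "\<not> adj h d" using near[OF h(1)] h a(1) by (auto simp: adj_def)
    have "avoid d f e" if "e \<in> F" "r' \<in> ends e" for e
    proof (cases "e = h")
      case False
      then have "adj h e" using that h(5) step.hyps(3) by (auto simp: adj_def)
      then have "(h, e) \<in> {(x, y). adj x y \<and> (x = f \<or> (x \<noteq> d \<and> \<not> adj x d))}" using nh h(2) by blast
      then show ?thesis using fh unfolding avoid_def by (rule rtrancl_into_rtrancl[rotated])
    qed (simp add: fh)
    then show ?case by blast
  qed
  then have "avoid d f g" using F(3) a(9) by simp
  moreover have "adj f d" "adj g d" using a F by (auto simp: adj_def)
  moreover have "\<not> adj f g" using a(2,5,6,9-11) by (auto simp: adj_def)
  moreover have "f \<noteq> a" "f \<noteq> b" "g \<noteq> a" "g \<noteq> b" using Y(4) a(3,4,7,8) by auto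
  ultimately show ?thesis unfolding detour_def using fg by blast
qed

text \<open>By parity a long odd circuit \<open>Y\<close> through \<open>d\<close> meets each
  triangle through \<open>d\<close> in an odd number of edges, hence only in \<open>d\<close>, and
  so is a detour for it. Conversely the block provides an odd circuit through \<open>d\<close>. If
  that is a triangle, a detour gives a circuit \<open>Z\<close> meeting it only in \<open>d\<close>;
  by parity \<open>Z\<close> is odd, and it is not a triangle.\<close>

lemma long_odd_circ_iff:
  assumes par: parity_cond
  shows "(\<exists>Y. circ Y \<and> Y \<subseteq> F \<and> odd (card Y) \<and> 5 \<le> card Y \<and> d \<in> Y) \<longleftrightarrow>
    odd_block d \<and> \<not> (\<exists>a b. ht d a b \<and> \<not> detour d a b)"
proof
  assume "\<exists>Y. circ Y \<and> Y \<subseteq> F \<and> odd (card Y) \<and> 5 \<le> card Y \<and> d \<in> Y"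
  then obtain Y where Y: "circ Y" "Y \<subseteq> F" "odd (card Y)" "5 \<le> card Y" "d \<in> Y" by blast
  have "detour d a b" if t: "ht d a b" for a b
  proof (rule circ_detour[OF Y(1,2)])
    note c = ht_circ[OF t]
    have fin: "finite ({d, a, b} :: nat set)" by simp
    have "Y \<inter> {d, a, b} \<noteq> {}" using Y(5) by blast
    then have od: "odd (card (Y \<inter> {d, a, b}))"
      using parity_cond_circ[OF par Y(1-3) c(1,3)] c(2) by simp
    show "Y \<inter> {d, a, b} = {d}"
    proof (rule ccontr)
      assume ne: "Y \<inter> {d, a, b} \<noteq> {d}"
      have "card (Y \<inter> {d, a, b}) \<noteq> 1"
      proof
        assume "card (Y \<inter> {d, a, b}) = 1"
        then obtain z where z: "Y \<inter> {d, a, b} = {z}" by (rule card_1_singletonE)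
        have "d \<in> Y \<inter> {d, a, b}" using Y(5) by simp
        then have "z = d" unfolding z by simp
        then show False using ne unfolding z by simp
      qed
      moreover have le: "card (Y \<inter> {d, a, b}) \<le> 3" using card_mono[OF fin, of "Y \<inter> {d, a, b}"] c(2) by simp
      moreover have "k = 3" if "k \<noteq> 1" "k \<le> 3" "odd k" for k :: nat using that by presburger
      ultimately have "card (Y \<inter> {d, a, b}) = 3" using od by blast
      then have "Y \<inter> {d, a, b} = {d, a, b}" using card_subset_eq[OF fin, of "Y \<inter> {d, a, b}"] c(2) by simp
      then have "{d, a, b} \<subseteq> Y" by blast
      then have "{d, a, b} = Y" by (rule circ_not_psubset[OF c(1) Y(1)])
      then show False using Y(4) c(2) by simp
    qed
  qed (use Y(4) in simp)
  then show "odd_block d \<and> \<not> (\<exists>a b. ht d a b \<and> \<not> detour d a b)" using circ_odd_block[OF Y(1-3,5)] by blast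
next
  assume h: "odd_block d \<and> \<not> (\<exists>a b. ht d a b \<and> \<not> detour d a b)"
  then obtain e g where e: "e \<in> F - tree" "d \<in> fund e" "flink e g" "odd (card (fund g))" unfolding odd_block_def by blast
  have g: "g \<in> F - tree" by (rule flink_nontree[OF e(3,1)])
  obtain Y where Y: "circ Y" "Y \<subseteq> F" "d \<in> Y" "odd (card Y)"
    by (rule odd_circ_through[OF circ_fund[OF g] fundF[OF g] e(4) circ_fund[OF e(1)] fundF[OF e(1)] e(2) flink_linked[OF e(3,1)]])
  have big: "5 \<le> card Z" if "circ Z" "Z \<subseteq> F" "odd (card Z)" "card Z \<noteq> 3" for Z
  proof -
    have "5 \<le> k" if "3 \<le> k" "odd k" "k \<noteq> 3" for k :: nat using that by presburger
    then show ?thesis using simple_circ_card[OF simple that(1,2)] that(3,4) by blast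
  qed
  show "\<exists>Y. circ Y \<and> Y \<subseteq> F \<and> odd (card Y) \<and> 5 \<le> card Y \<and> d \<in> Y"
  proof (cases "card Y = 3")
    case True
    obtain a b where ab: "Y = {d, a, b}" "ht d a b" using circ3_ht[OF Y(1,2) True Y(3)] .
    then have "detour d a b" using h by blast
    then obtain Z where Z: "circ Z" "Z \<subseteq> F" "Z \<inter> {d, a, b} = {d}" "card Z \<noteq> 3" by (rule detour_circ[OF ab(2)])
    have m: "Y \<inter> Z = {d}" using Z(3) ab(1) by blast
    then have "odd (card Z)" using parity_cond_circ[OF par Y(1,2,4) Z(1,2)] by simp
    then show ?thesis using big[OF Z(1,2) _ Z(4)] Z(1-3) by blast
  next
    case False
    then show ?thesis using big[OF Y(1,2,4)] Y by blast
  qed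
qed

end

section \<open>Compiling formulas to RAM programs\<close>

definition runs :: "com \<Rightarrow> memory \<Rightarrow> nat \<Rightarrow> (memory \<Rightarrow> bool) \<Rightarrow> bool" where
  "runs c m k Q \<longleftrightarrow> (\<exists>t m'. exec c m t m' \<and> t \<le> k \<and> Q m')"

lemma runs_Put: "Q (m(a := (m a)(aval i m := aval x m))) \<Longrightarrow> runs (Put a i x) m 1 Q"
  unfolding runs_def using exec.Put by blast

lemma runs_Seq: "runs c m j (\<lambda>m'. runs d m' k Q) \<Longrightarrow> runs (Seq c d) m (j + k) Q"
  unfolding runs_def using exec.Seq by (metis add_mono)

lemma runs_mono: "runs c m j Q \<Longrightarrow> j \<le> k \<Longrightarrow> (\<And>m'. Q m' \<Longrightarrow> R m') \<Longrightarrow> runs c m k R"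
  unfolding runs_def by (meson order_trans)

lemma runs_If:
  assumes "aval b m \<noteq> 0 \<Longrightarrow> runs c m k Q" "aval b m = 0 \<Longrightarrow> runs d m k Q"
  shows "runs (If b c d) m (1 + k) Q"
proof (cases "aval b m = 0")
  case True
  then obtain t m' where "exec d m t m'" "t \<le> k" "Q m'" using assms(2) by (auto simp: runs_def)
  then show ?thesis using exec.IfFalse[OF True] unfolding runs_def by (metis add_left_mono)
next
  case False
  then obtain t m' where "exec c m t m'" "t \<le> k" "Q m'" using assms(1) by (auto simp: runs_def)
  then show ?thesis using exec.IfTrue[OF False] unfolding runs_def by (metis add_left_mono)
qed

lemma runs_loop:
  assumes step: "\<And>i m. i < n \<Longrightarrow> P i m \<Longrightarrow> aval b m \<noteq> 0 \<and> runs c m k (P (Suc i))"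
    and stop: "\<And>m. P n m \<Longrightarrow> aval b m = 0"
    and P: "P 0 m"
  shows "runs (While b c) m (n * (k + 1) + 1) (P n)"
proof -
  have "runs (While b c) m ((n - i) * (k + 1) + 1) (P n)" if "i \<le> n" "P i m" for i m
    using that
  proof (induction "n - i" arbitrary: i m)
    case 0
    then have "i = n" by simp
    then have "aval b m = 0" using stop 0 by simp
    then have "exec (While b c) m 1 m" by (rule exec.WhileFalse)
    then show ?case using 0 \<open>i = n\<close> unfolding runs_def by auto
  next
    case (Suc x)
    then have i: "i < n" by simp
    have b: "aval b m \<noteq> 0" and r: "runs c m k (P (Suc i))" using step[OF i Suc.prems(2)] by auto
    obtain t m' where t: "exec c m t m'" "t \<le> k" "P (Suc i) m'" using r by (auto simp: runs_def)
    have "runs (While b c) m' ((n - Suc i) * (k + 1) + 1) (P n)"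
      by (rule Suc.hyps(1)) (use Suc.hyps(2) i t in auto)
    then obtain t' m'' where t': "exec (While b c) m' t' m''" "t' \<le> (n - Suc i) * (k + 1) + 1" "P n m''"
      by (auto simp: runs_def)
    have "n - i = Suc (n - Suc i)" using i by simp
    then have "1 + t + t' \<le> (n - i) * (k + 1) + 1" using t(2) t'(2) by simp
    then show ?case using exec.WhileTrue[OF b t(1) t'(1)] t'(3) unfolding runs_def by blast
  qed
  from this[of 0 m] show ?thesis using P by simp
qed

section \<open>Formulas and their evaluation by programs\<close>

datatype fm =
  Rel nat "nat list"
| Less nat nat
| Neg fm
| And fm fm
| Ex nat fm
| Odd nat fm

type_synonym interp = "nat \<Rightarrow> nat list \<Rightarrow> bool"

fun sat :: "nat \<Rightarrow> interp \<Rightarrow> (nat \<Rightarrow> nat) \<Rightarrow> fm \<Rightarrow> bool" where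
  "sat n I r (Rel a vs) \<longleftrightarrow> I a (map r vs)"
| "sat n I r (Less i j) \<longleftrightarrow> r i < r j"
| "sat n I r (Neg f) \<longleftrightarrow> \<not> sat n I r f"
| "sat n I r (And f g) \<longleftrightarrow> sat n I r f \<and> sat n I r g"
| "sat n I r (Ex k f) \<longleftrightarrow> (\<exists>x<n. sat n I (r(k := x)) f)"
| "sat n I r (Odd k f) \<longleftrightarrow> odd (card {x. x < n \<and> sat n I (r(k := x)) f})"

fun rels :: "fm \<Rightarrow> (nat \<times> nat) set" where
  "rels (Rel a vs) = {(a, length vs)}"
| "rels (Less i j) = {}"
| "rels (Neg f) = rels f"
| "rels (And f g) = rels f \<union> rels g"
| "rels (Ex k f) = rels f"
| "rels (Odd k f) = rels f"

lemma sat_cong: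
  "(\<And>a l. (a, l) \<in> rels f \<Longrightarrow> I a = J a) \<Longrightarrow> sat n I r f = sat n J r f"
  by (induction f arbitrary: r) auto

text \<open>Arrays 2 and 3 hold the values of the variables and the stack of the evaluation, array 5 loop
  counters, and the arrays from 6 on (as well as the input array 1) the tables of relations. Entry \<open>xs\<close>
  of a table is stored at the index with the \<open>n\<close>-ary digits \<open>xs\<close>; array 4 holds the multiples of \<open>n\<close>,
  since the machine does not multiply.\<close>

definition idx :: "nat \<Rightarrow> nat list \<Rightarrow> nat" where
  "idx n xs = foldl (\<lambda>s x. s * n + x) 0 xs"

definition idx_exp :: "nat list \<Rightarrow> aexp" where
  "idx_exp vs = foldl (\<lambda>s v. Plus (Get 4 s) (Get 2 (Num v))) (Num 0) vs"

lemma idx_snoc [simp]: "idx n (xs @ [x]) = idx n xs * n + x" "idx n [] = 0"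
  by (simp_all add: idx_def)

lemma idx_less: "set xs \<subseteq> {..<n} \<Longrightarrow> 0 < n \<Longrightarrow> idx n xs < n ^ length xs"
proof (induction xs rule: rev_induct)
  case (snoc x xs)
  then have "idx n xs < n ^ length xs" "x < n" by auto
  then have "idx n xs * n + x < (idx n xs + 1) * n" by simp
  also have "\<dots> \<le> n ^ length xs * n"
    using \<open>idx n xs < n ^ length xs\<close> by (intro mult_right_mono) auto
  finally show ?case by (simp add: mult.commute)
qed simp

lemma idx_inj:
  "length xs = length ys \<Longrightarrow> set xs \<subseteq> {..<n} \<Longrightarrow> set ys \<subseteq> {..<n} \<Longrightarrow> idx n xs = idx n ys \<Longrightarrow> xs = ys"
proof (induction xs arbitrary: ys rule: rev_induct)
  case (snoc x xs)
  then obtain zs y where ys: "ys = zs @ [y]" by (metis append_Nil2 length_0_conv rev_exhaust snoc_eq_iff_butlast)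
  have xy: "x < n" "y < n" using snoc.prems ys by auto
  have eq: "idx n xs * n + x = idx n zs * n + y" using snoc.prems ys by simp
  then have "(idx n xs * n + x) mod n = (idx n zs * n + y) mod n"
    "(idx n xs * n + x) div n = (idx n zs * n + y) div n" by simp_all
  then have "x = y" "idx n xs = idx n zs" using xy by simp_all
  then show ?case using snoc ys by simp
qed simp

text \<open>Horner's rule for tuples of length at most 5 multiplies only values of prefixes of
  length at most 4, which are below \<open>n ^ 4\<close>.\<close>

definition base :: "nat \<Rightarrow> memory \<Rightarrow> bool" where
  "base n m \<longleftrightarrow> m 0 0 = n \<and> (\<forall>i<n ^ 4. m 4 i = i * n)"

lemma aval_idx_exp:
  assumes "base n m" "0 < n" "length vs \<le> 5" "\<And>k. m 2 k < n"
  shows "aval (idx_exp vs) m = idx n (map (m 2) vs)"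
  using assms(3)
proof (induction vs rule: rev_induct)
  case Nil
  then show ?case by (simp add: idx_exp_def)
next
  case (snoc v vs)
  have "idx n (map (m 2) vs) < n ^ length (map (m 2) vs)"
    using assms by (intro idx_less) auto
  also have "\<dots> \<le> n ^ 4" using assms(2) snoc.prems by (intro power_increasing) auto
  finally have "m 4 (idx n (map (m 2) vs)) = idx n (map (m 2) vs) * n"
    using assms(1) by (simp add: base_def)
  moreover have "idx_exp (vs @ [v]) = Plus (Get 4 (idx_exp vs)) (Get 2 (Num v))"
    by (simp add: idx_exp_def)
  ultimately show ?case using snoc by simp
qed

definition rep :: "nat \<Rightarrow> (nat \<Rightarrow> nat) \<Rightarrow> interp \<Rightarrow> memory \<Rightarrow> bool" where
  "rep n ar I m \<longleftrightarrow> (\<forall>a xs. (a = 1 \<or> 6 \<le> a) \<longrightarrow> length xs = ar a \<longrightarrow> set xs \<subseteq> {..<n} \<longrightarrow>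
     m a (idx n xs) = (if I a xs then 1 else 0))"

definition wf_fm :: "(nat \<Rightarrow> nat) \<Rightarrow> fm \<Rightarrow> bool" where
  "wf_fm ar f \<longleftrightarrow> (\<forall>(a, l)\<in>rels f. (a = 1 \<or> 6 \<le> a) \<and> ar a = l \<and> l \<le> 5)"

abbreviation "NN \<equiv> Get 0 (Num 0)"
abbreviation "XX k \<equiv> Get 2 (Num k)"
abbreviation "SS k \<equiv> Get 3 (Num k)"

text \<open>Stack layout: cell \<open>d\<close> accumulates the result, cell \<open>d + 1\<close>
  saves the value of variable \<open>k\<close>, and the body leaves its value in cell
  \<open>d + 2\<close>.\<close>

definition quant :: "aexp \<Rightarrow> nat \<Rightarrow> com \<Rightarrow> nat \<Rightarrow> com" where
  "quant upd k c d = Seq (Put 3 (Num d) (Num 0)) (Seq (Put 3 (Num (d + 1)) (XX k)) (Seq (Put 2 (Num k) (Num 0))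
     (Seq (While (Minus NN (XX k)) (Seq c (Seq (Put 3 (Num d) upd) (Put 2 (Num k) (Plus (XX k) (Num 1))))))
       (Put 2 (Num k) (SS (d + 1))))))"

text \<open>Boolean operations on 0 and 1 by truncated subtraction: \<open>a - (1 - b)\<close> is
  conjunction, \<open>a + (b - a)\<close> disjunction, \<open>(a - b) + (b - a)\<close> exclusive
  or, and \<open>1 - (1 - c)\<close> is the sign of \<open>c\<close>.\<close>

fun cmp :: "fm \<Rightarrow> nat \<Rightarrow> com" where
  "cmp (Rel a vs) d = Put 3 (Num d) (Get a (idx_exp vs))"
| "cmp (Less i j) d = Put 3 (Num d) (Minus (Num 1) (Minus (Num 1) (Minus (XX j) (XX i))))"
| "cmp (Neg f) d = Seq (cmp f d) (Put 3 (Num d) (Minus (Num 1) (SS d)))"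
| "cmp (And f g) d = Seq (cmp f d) (Seq (cmp g (d + 1)) (Put 3 (Num d) (Minus (SS d) (Minus (Num 1) (SS (d + 1))))))"
| "cmp (Ex k f) d = quant (Plus (SS d) (Minus (SS (d + 2)) (SS d))) k (cmp f (d + 2)) d"
| "cmp (Odd k f) d = quant (Plus (Minus (SS d) (SS (d + 2))) (Minus (SS (d + 2)) (SS d))) k (cmp f (d + 2)) d"

fun tim :: "nat \<Rightarrow> fm \<Rightarrow> nat" where
  "tim n (Rel a vs) = 1"
| "tim n (Less i j) = 1"
| "tim n (Neg f) = tim n f + 1"
| "tim n (And f g) = tim n f + (tim n g + 1)"
| "tim n (Ex k f) = 1 + (1 + (1 + ((n * (tim n f + (1 + 1) + 1) + 1) + 1)))"
| "tim n (Odd k f) = 1 + (1 + (1 + ((n * (tim n f + (1 + 1) + 1) + 1) + 1)))"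

text \<open>The stack discipline: only array 3 changes, and only from cell \<open>d\<close> on. The
  bound \<open>a\<close> of the first conjunct ranges over arrays, while the \<open>a\<close> of the
  last one is the argument, the cell of the result.\<close>

definition computes :: "nat \<Rightarrow> memory \<Rightarrow> nat \<Rightarrow> bool \<Rightarrow> memory \<Rightarrow> bool" where
  "computes d m a b m' \<longleftrightarrow> (\<forall>a. a \<noteq> 3 \<longrightarrow> m' a = m a) \<and> (\<forall>i<d. m' 3 i = m 3 i) \<and> m' 3 a = (if b then 1 else 0)"

text \<open>\<open>acc i\<close> is the truth value accumulated from the values below
  \<open>i\<close>; in this form the lemma serves both quantifiers.\<close>

lemma runs_quant:
  fixes P :: "nat \<Rightarrow> bool" and acc :: "nat \<Rightarrow> bool"
  assumes n: "m 0 0 = n" "0 < n"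
    and c: "\<And>m' i. i < n \<Longrightarrow> \<forall>a. a \<noteq> 2 \<and> a \<noteq> 3 \<longrightarrow> m' a = m a \<Longrightarrow> m' 2 = (m 2)(k := i) \<Longrightarrow>
      runs c m' t (computes (d + 2) m' (d + 2) (P i))"
    and upd: "\<And>m' i. i < n \<Longrightarrow> m' 3 d = (if acc i then 1 else 0) \<Longrightarrow> m' 3 (d + 2) = (if P i then 1 else 0) \<Longrightarrow>
      aval upd m' = (if acc (Suc i) then 1 else 0)"
    and acc0: "\<not> acc 0"
  shows "runs (quant upd k c d) m (1 + (1 + (1 + ((n * (t + (1 + 1) + 1) + 1) + 1)))) (computes d m d (acc n))"
proof -
  define L where "L i m' \<longleftrightarrow> (\<forall>a. a \<noteq> 2 \<and> a \<noteq> 3 \<longrightarrow> m' a = m a) \<and> m' 2 = (m 2)(k := i) \<and>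
     (\<forall>j<d. m' 3 j = m 3 j) \<and> m' 3 d = (if acc i then 1 else 0) \<and> m' 3 (d + 1) = m 2 k" for i m'
  have loop: "runs (While (Minus NN (XX k)) (Seq c (Seq (Put 3 (Num d) upd) (Put 2 (Num k) (Plus (XX k) (Num 1))))))
      m' (n * (t + (1 + 1) + 1) + 1) (L n)" if "L 0 m'" for m'
  proof (rule runs_loop[where P = L])
    show "L 0 m'" by (rule that)
  next
    fix i m' assume i: "i < n" and L: "L i m'"
    have "aval (Minus NN (XX k)) m' \<noteq> 0" using L i n by (simp add: L_def)
    moreover have "runs (Seq c (Seq (Put 3 (Num d) upd) (Put 2 (Num k) (Plus (XX k) (Num 1))))) m' (t + (1 + 1)) (L (Suc i))"
    proof (rule runs_Seq, rule runs_mono[OF c[OF i] order_refl])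
      fix m'' assume C: "computes (d + 2) m' (d + 2) (P i) m''"
      have "aval upd m'' = (if acc (Suc i) then 1 else 0)"
        using C L i by (intro upd) (auto simp: computes_def L_def)
      then show "runs (Seq (Put 3 (Num d) upd) (Put 2 (Num k) (Plus (XX k) (Num 1)))) m'' (1 + 1) (L (Suc i))"
        using C L by (intro runs_Seq runs_Put) (auto simp: L_def computes_def)
    qed (use L in \<open>auto simp: L_def\<close>)
    ultimately show "aval (Minus NN (XX k)) m' \<noteq> 0 \<and>
      runs (Seq c (Seq (Put 3 (Num d) upd) (Put 2 (Num k) (Plus (XX k) (Num 1))))) m' (t + (1 + 1)) (L (Suc i))" by simp
  next
    fix m' assume "L n m'"
    then show "aval (Minus NN (XX k)) m' = 0" using n by (simp add: L_def)
  qed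
  have fin: "computes d m d (acc n) (m'(2 := (m' 2)(aval (Num k) m' := aval (SS (d + 1)) m')))" if L: "L n m'" for m'
    unfolding computes_def
  proof (intro conjI allI impI)
    fix a :: nat assume "a \<noteq> 3"
    then show "(m'(2 := (m' 2)(aval (Num k) m' := aval (SS (d + 1)) m'))) a = m a"
      using L by (cases "a = 2") (auto simp: L_def)
  qed (use L in \<open>auto simp: L_def\<close>)
  show ?thesis
    unfolding quant_def
    by (intro runs_Seq runs_Put runs_mono[OF loop order_refl]) (use acc0 fin in \<open>auto simp: L_def\<close>)
qed

lemma repD:
  "rep n ar I m \<Longrightarrow> a = 1 \<or> 6 \<le> a \<Longrightarrow> length xs = ar a \<Longrightarrow> set xs \<subseteq> {..<n} \<Longrightarrow>
    m a (idx n xs) = (if I a xs then 1 else 0)"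
  unfolding rep_def by blast

lemma runs_cmp:
  assumes "base n m" "0 < n" "rep n ar I m" "wf_fm ar f" "\<And>k. m 2 k < n"
  shows "runs (cmp f d) m (tim n f) (computes d m d (sat n I (m 2) f))"
  using assms
proof (induction f arbitrary: d m)
  case (Rel a vs)
  then have a: "a = 1 \<or> 6 \<le> a" "ar a = length vs" "length vs \<le> 5" by (auto simp: wf_fm_def)
  have "aval (idx_exp vs) m = idx n (map (m 2) vs)" by (rule aval_idx_exp) (use Rel a in auto)
  moreover have "m a (idx n (map (m 2) vs)) = (if I a (map (m 2) vs) then 1 else 0)"
    by (rule repD[OF Rel.prems(3) a(1)]) (use Rel.prems(5) a(2) in auto)
  ultimately show ?case
    unfolding cmp.simps tim.simps by (intro runs_Put) (simp add: computes_def)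
next
  case (Less i j)
  show ?case unfolding cmp.simps tim.simps by (intro runs_Put) (simp add: computes_def)
next
  case (Neg f)
  have "runs (cmp f d) m (tim n f) (computes d m d (sat n I (m 2) f))"
    using Neg by (auto simp: wf_fm_def)
  then show ?case
    unfolding cmp.simps tim.simps
    by (intro runs_Seq) (erule runs_mono, simp, intro runs_Put, simp add: computes_def)
next
  case (And f g)
  have wf: "wf_fm ar f" "wf_fm ar g" using And.prems by (auto simp: wf_fm_def)
  have "runs (cmp f d) m (tim n f) (computes d m d (sat n I (m 2) f))"
    using And wf by auto
  moreover have "runs (Seq (cmp g (d + 1)) (Put 3 (Num d) (Minus (SS d) (Minus (Num 1) (SS (d + 1)))))) m' (tim n g + 1)
      (computes d m d (sat n I (m 2) f \<and> sat n I (m 2) g))"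
    if C: "computes d m d (sat n I (m 2) f) m'" for m'
  proof (rule runs_Seq)
    have same: "m' a = m a" if "a \<noteq> 3" for a using C that by (simp add: computes_def)
    have "runs (cmp g (d + 1)) m' (tim n g) (computes (d + 1) m' (d + 1) (sat n I (m' 2) g))"
      by (rule And.IH(2)) (use And.prems wf same in \<open>auto simp: base_def rep_def\<close>)
    then show "runs (cmp g (d + 1)) m' (tim n g) (\<lambda>m''. runs (Put 3 (Num d) (Minus (SS d) (Minus (Num 1) (SS (d + 1))))) m'' 1
        (computes d m d (sat n I (m 2) f \<and> sat n I (m 2) g)))"
    proof (rule runs_mono[OF _ order_refl])
      fix m'' assume "computes (d + 1) m' (d + 1) (sat n I (m' 2) g) m''"
      then show "runs (Put 3 (Num d) (Minus (SS d) (Minus (Num 1) (SS (d + 1))))) m'' 1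
          (computes d m d (sat n I (m 2) f \<and> sat n I (m 2) g))"
        by (intro runs_Put) (use C in \<open>auto simp: computes_def\<close>)
    qed
  qed
  ultimately show ?case
    unfolding cmp.simps tim.simps sat.simps by (intro runs_Seq) (erule runs_mono, simp, blast)
next
  case (Ex k f)
  have wf: "wf_fm ar f" using Ex.prems by (simp add: wf_fm_def)
  show ?case
    unfolding cmp.simps sat.simps tim.simps
  proof (rule runs_quant[where P = "\<lambda>x. sat n I ((m 2)(k := x)) f" and acc = "\<lambda>i. \<exists>x<i. sat n I ((m 2)(k := x)) f"])
    show "m 0 0 = n" "0 < n" using Ex.prems by (auto simp: base_def)
    fix m' i assume i: "i < n" and m': "\<forall>a. a \<noteq> 2 \<and> a \<noteq> 3 \<longrightarrow> m' a = m a" "m' 2 = (m 2)(k := i)"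
    show "runs (cmp f (d + 2)) m' (tim n f) (computes (d + 2) m' (d + 2) (sat n I ((m 2)(k := i)) f))"
      unfolding m'(2)[symmetric]
      by (rule Ex.IH) (use Ex.prems wf i m' in \<open>auto simp: base_def rep_def\<close>)
  qed (auto simp: less_Suc_eq)
next
  case (Odd k f)
  have wf: "wf_fm ar f" using Odd.prems by (simp add: wf_fm_def)
  have Suc: "odd (card {x. x < Suc i \<and> p x}) \<longleftrightarrow> (odd (card {x. x < i \<and> p x}) \<noteq> p i)" for i p
  proof -
    have "{x. x < Suc i \<and> p x} = (if p i then insert i {x. x < i \<and> p x} else {x. x < i \<and> p x})"
      by (auto simp: less_Suc_eq)
    then show ?thesis by simp
  qed
  show ?case
    unfolding cmp.simps sat.simps tim.simps
  proof (rule runs_quant[where P = "\<lambda>x. sat n I ((m 2)(k := x)) f" and acc = "\<lambda>i. odd (card {x. x < i \<and> sat n I ((m 2)(k := x)) f})"])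
    show "m 0 0 = n" "0 < n" using Odd.prems by (auto simp: base_def)
    fix m' i assume i: "i < n" and m': "\<forall>a. a \<noteq> 2 \<and> a \<noteq> 3 \<longrightarrow> m' a = m a" "m' 2 = (m 2)(k := i)"
    show "runs (cmp f (d + 2)) m' (tim n f) (computes (d + 2) m' (d + 2) (sat n I ((m 2)(k := i)) f))"
      unfolding m'(2)[symmetric]
      by (rule Odd.IH) (use Odd.prems wf i m' in \<open>auto simp: base_def rep_def\<close>)
  qed (auto simp: Suc)
qed

section \<open>Loops and nested loops\<close>

definition cell :: "memory \<Rightarrow> nat \<Rightarrow> nat \<Rightarrow> nat \<Rightarrow> memory" where
  "cell m a v x = m(a := (m a)(v := x))"

text \<open>The final reset of the counter restores the environment, in which variables without a
  value are 0.\<close>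

definition for_loop :: "nat \<Rightarrow> nat \<Rightarrow> com \<Rightarrow> com" where
  "for_loop a v c = Seq (Put a (Num v) (Num 0))
     (Seq (While (Minus NN (Get a (Num v))) (Seq c (Put a (Num v) (Plus (Get a (Num v)) (Num 1)))))
       (Put a (Num v) (Num 0)))"

lemma runs_for:
  assumes P: "\<And>i m. P i m \<Longrightarrow> m 0 0 = n \<and> m a v = i"
    and step: "\<And>i m. i < n \<Longrightarrow> P i m \<Longrightarrow> runs c m t (\<lambda>m'. m' a v = i \<and> P (Suc i) (cell m' a v (Suc i)))"
    and start: "P 0 (cell m a v 0)"
  shows "runs (for_loop a v c) m (1 + ((n * (t + 1 + 1) + 1) + 1)) (\<lambda>m'. \<exists>m''. P n m'' \<and> m' = cell m'' a v 0)"
proof -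
  have loop: "runs (While (Minus NN (Get a (Num v))) (Seq c (Put a (Num v) (Plus (Get a (Num v)) (Num 1))))) m'
      (n * (t + 1 + 1) + 1) (P n)" if "P 0 m'" for m'
  proof (rule runs_loop[where P = P])
    show "P 0 m'" by (rule that)
    fix m assume "P n m"
    then show "aval (Minus NN (Get a (Num v))) m = 0" using P[of n m] by simp
  next
    fix i m assume i: "i < n" and Pi: "P i m"
    have "runs (Seq c (Put a (Num v) (Plus (Get a (Num v)) (Num 1)))) m (t + 1) (P (Suc i))"
      by (rule runs_Seq, rule runs_mono[OF step[OF i Pi] order_refl], rule runs_Put) (simp add: cell_def)
    then show "aval (Minus NN (Get a (Num v))) m \<noteq> 0 \<and>
        runs (Seq c (Put a (Num v) (Plus (Get a (Num v)) (Num 1)))) m (t + 1) (P (Suc i))"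
      using P[OF Pi] i by simp
  qed
  show ?thesis
    unfolding for_loop_def
  proof (rule runs_Seq, rule runs_Put, rule runs_Seq, rule runs_mono[OF loop order_refl])
    show "P 0 (m(a := (m a)(aval (Num v) m := aval (Num 0) m)))" using start by (simp add: cell_def)
    fix m' assume "P n m'"
    then show "runs (Put a (Num v) (Num 0)) m' 1 (\<lambda>m'. \<exists>m''. P n m'' \<and> m' = cell m'' a v 0)"
      by (intro runs_Put) (auto simp: cell_def)
  qed
qed

fun nest :: "nat \<Rightarrow> nat \<Rightarrow> nat \<Rightarrow> com \<Rightarrow> com" where
  "nest a j 0 c = c"
| "nest a j (Suc k) c = for_loop a j (nest a (Suc j) k c)"

fun nest_time :: "nat \<Rightarrow> nat \<Rightarrow> nat \<Rightarrow> nat" where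
  "nest_time n 0 t = t"
| "nest_time n (Suc k) t = 1 + ((n * (nest_time n k t + 1 + 1) + 1) + 1)"

text \<open>Nested loops repeat a program \<open>n ^ k\<close> times without multiplication. The
  counters occupy cells below \<open>J\<close> of array 5, which the repeated program must leave
  alone.\<close>

lemma runs_repeat:
  assumes P: "\<And>i m. P i m \<Longrightarrow> m 0 0 = n"
    and cell: "\<And>i m q x. P i m \<Longrightarrow> q < J \<Longrightarrow> P i (cell m 5 q x)"
    and body: "\<And>i m. P i m \<Longrightarrow> runs c m t (\<lambda>m'. P (Suc i) m' \<and> (\<forall>q<J. m' 5 q = m 5 q))"
  shows "j + k \<le> J \<Longrightarrow> P i m \<Longrightarrow>
    runs (nest 5 j k c) m (nest_time n k t) (\<lambda>m'. P (i + n ^ k) m' \<and> (\<forall>q<j. m' 5 q = m 5 q))"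
proof (induction k arbitrary: i j m)
  case 0
  then show ?case using body[OF 0(2)] by (auto elim!: runs_mono)
next
  case (Suc k)
  have j: "j < J" using Suc.prems by simp
  define L where "L l m' \<longleftrightarrow> P (i + l * n ^ k) m' \<and> m' 5 j = l \<and> (\<forall>q<j. m' 5 q = m 5 q)" for l m'
  have "runs (for_loop 5 j (nest 5 (Suc j) k c)) m (1 + ((n * (nest_time n k t + 1 + 1) + 1) + 1))
      (\<lambda>m'. \<exists>m''. L n m'' \<and> m' = cell m'' 5 j 0)"
  proof (rule runs_for)
    show "m' 0 0 = n \<and> m' 5 j = l" if "L l m'" for l m' using that P by (auto simp: L_def)
    show "L 0 (cell m 5 j 0)"
      using cell[OF Suc.prems(2) j] by (simp add: L_def cell_def)
    fix l m' assume L: "L l m'"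
    have "runs (nest 5 (Suc j) k c) m' (nest_time n k t)
        (\<lambda>m''. P (i + l * n ^ k + n ^ k) m'' \<and> (\<forall>q<Suc j. m'' 5 q = m' 5 q))"
      by (rule Suc.IH) (use Suc.prems L in \<open>auto simp: L_def\<close>)
    then show "runs (nest 5 (Suc j) k c) m' (nest_time n k t) (\<lambda>m'. m' 5 j = l \<and> L (Suc l) (cell m' 5 j (Suc l)))"
    proof (rule runs_mono[OF _ order_refl])
      fix m'' assume m'': "P (i + l * n ^ k + n ^ k) m'' \<and> (\<forall>q<Suc j. m'' 5 q = m' 5 q)"
      have e: "i + l * n ^ k + n ^ k = i + Suc l * n ^ k" by simp
      have "P (i + Suc l * n ^ k) (cell m'' 5 j (Suc l))" using m'' cell[OF _ j] unfolding e by blast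
      then show "m'' 5 j = l \<and> L (Suc l) (cell m'' 5 j (Suc l))"
        using m'' L by (auto simp: L_def cell_def)
    qed
  qed
  then show ?case
    unfolding nest.simps nest_time.simps
  proof (rule runs_mono[OF _ order_refl])
    fix m' assume "\<exists>m''. L n m'' \<and> m' = cell m'' 5 j 0"
    then obtain m'' where m'': "L n m''" "m' = cell m'' 5 j 0" by blast
    then have "P (i + n * n ^ k) m'" using cell[OF _ j] by (simp add: L_def)
    then show "P (i + n ^ Suc k) m' \<and> (\<forall>q<j. m' 5 q = m 5 q)"
      using m'' by (auto simp: L_def cell_def)
  qed
qed

section \<open>Table definitions\<close>

definition env :: "nat list \<Rightarrow> nat \<Rightarrow> nat" where
  "env xs i = (if i < length xs then xs ! i else 0)"

definition tuples :: "nat \<Rightarrow> nat \<Rightarrow> nat list set" where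
  "tuples n k = {xs. length xs = k \<and> set xs \<subseteq> {..<n}}"

text \<open>One entry is recomputed in place, so later entries of the same pass already see
  it.\<close>

definition step :: "nat \<Rightarrow> nat \<Rightarrow> fm \<Rightarrow> nat list \<Rightarrow> interp \<Rightarrow> interp" where
  "step n a f xs I = I(a := (I a)(xs := sat n I (env xs) f))"

fun exts :: "nat \<Rightarrow> nat list \<Rightarrow> nat \<Rightarrow> nat list list" where
  "exts n xs 0 = [xs]"
| "exts n xs (Suc k) = concat (map (\<lambda>x. exts n (xs @ [x]) k) [0..<n])"

lemma set_exts: "set (exts n xs k) = {xs @ ys |ys. ys \<in> tuples n k}"
proof (induction k arbitrary: xs)
  case 0
  then show ?case by (simp add: tuples_def)
next
  case (Suc k)
  show ?case
  proof (intro set_eqI iffI)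
    fix zs assume "zs \<in> set (exts n xs (Suc k))"
    then obtain x where "x < n" "zs \<in> set (exts n (xs @ [x]) k)" by auto
    then obtain ys where "x < n" "zs = xs @ x # ys" "ys \<in> tuples n k" using Suc.IH by auto
    then show "zs \<in> {xs @ ys |ys. ys \<in> tuples n (Suc k)}" by (auto simp: tuples_def)
  next
    fix zs assume "zs \<in> {xs @ ys |ys. ys \<in> tuples n (Suc k)}"
    then obtain x ys where "zs = xs @ x # ys" "x < n" "ys \<in> tuples n k"
      by (auto simp: tuples_def length_Suc_conv)
    moreover have "zs \<in> set (exts n (xs @ [x]) k)" unfolding Suc.IH using calculation by auto
    ultimately show "zs \<in> set (exts n xs (Suc k))" by force
  qed
qed

lemma env_snoc: "env (xs @ [x]) = (env xs)(length xs := x)"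
  by (auto simp: env_def nth_append fun_eq_iff)

definition state :: "nat \<Rightarrow> (nat \<Rightarrow> nat) \<Rightarrow> interp \<Rightarrow> (nat \<Rightarrow> nat) \<Rightarrow> (nat \<Rightarrow> nat) \<Rightarrow> memory \<Rightarrow> bool" where
  "state n ar I r c m \<longleftrightarrow> base n m \<and> rep n ar I m \<and> m 2 = r \<and> m 5 = c"

definition body :: "nat \<Rightarrow> nat \<Rightarrow> fm \<Rightarrow> com" where
  "body a k f = Seq (cmp f 0) (Put a (idx_exp [0..<k]) (SS 0))"

lemma runs_body:
  assumes st: "state n ar I (env xs) c m" and n: "0 < n" and xs: "xs \<in> tuples n k"
    and a: "6 \<le> a" "ar a = k" "k \<le> 5" and f: "wf_fm ar f"
  shows "runs (body a k f) m (tim n f + 1) (state n ar (step n a f xs I) (env xs) c)"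
proof -
  have b: "base n m" and r: "rep n ar I m" and m2: "m 2 = env xs" and m5: "m 5 = c"
    using st by (auto simp: state_def)
  have lx: "length xs = k" "set xs \<subseteq> {..<n}" using xs by (auto simp: tuples_def)
  have lt: "m 2 i < n" for i
    using lx n nth_mem[of i xs] unfolding m2 env_def by (auto simp del: nth_mem)
  show ?thesis
    unfolding body_def
  proof (rule runs_Seq, rule runs_mono[OF runs_cmp[OF b n r f lt] order_refl], rule runs_Put)
    fix m' assume C: "computes 0 m 0 (sat n I (m 2) f) m'"
    have same: "m' b = m b" if "b \<noteq> 3" for b using C that by (simp add: computes_def)
    have b': "base n m'" using b same by (simp add: base_def)
    have "aval (idx_exp [0..<k]) m' = idx n (map (m' 2) [0..<k])"
      by (rule aval_idx_exp[OF b' n]) (use a lt same in auto)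
    also have "map (m' 2) [0..<k] = xs"
      using lx same m2 by (intro nth_equalityI) (auto simp: env_def)
    finally have ix: "aval (idx_exp [0..<k]) m' = idx n xs" .
    have v: "aval (SS 0) m' = (if sat n I (env xs) f then 1 else 0)" using C m2 by (simp add: computes_def)
    let ?m = "m'(a := (m' a)(idx n xs := if sat n I (env xs) f then 1 else 0))"
    have "rep n ar (step n a f xs I) ?m"
      unfolding rep_def
    proof (intro allI impI)
      fix b ys assume h: "b = 1 \<or> 6 \<le> b" "length ys = ar b" "set ys \<subseteq> {..<n}"
      have old: "m' b (idx n ys) = (if I b ys then 1 else 0)" using repD[OF r h] same[of b] h(1) by auto
      show "?m b (idx n ys) = (if step n a f xs I b ys then 1 else 0)"
      proof (cases "b = a \<and> ys = xs")
        case True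
        then show ?thesis by (simp add: step_def)
      next
        case False
        then have "b \<noteq> a \<or> idx n ys \<noteq> idx n xs" using idx_inj[of ys xs n] h lx a by auto
        then show ?thesis using old False by (auto simp: step_def)
      qed
    qed
    moreover have "base n ?m" "?m 2 = env xs" "?m 5 = c" using b' same m2 m5 a by (auto simp: base_def)
    ultimately show "state n ar (step n a f xs I) (env xs) c
        (m'(a := (m' a)(aval (idx_exp [0..<k]) m' := aval (SS 0) m')))"
      unfolding ix v state_def by blast
  qed
qed

lemma state_cell2:
  assumes "state n ar I r c m"
  shows "state n ar I (r(j := x)) c (cell m 2 j x)"
  using assms by (auto simp: state_def cell_def base_def rep_def)

lemma runs_table:
  assumes n: "0 < n" and a: "6 \<le> a" "ar a = k" "k \<le> 5" and f: "wf_fm ar f"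
  shows "length xs + l = k \<Longrightarrow> set xs \<subseteq> {..<n} \<Longrightarrow> state n ar I (env xs) c m \<Longrightarrow>
    runs (nest 2 (length xs) l (body a k f)) m (nest_time n l (tim n f + 1))
      (state n ar (fold (step n a f) (exts n xs l) I) (env xs) c)"
proof (induction l arbitrary: xs I m)
  case 0
  then show ?case using runs_body[OF 0(3) n _ a f] by (simp add: tuples_def)
next
  case (Suc l)
  let ?j = "length xs"
  define L where "L i m' \<longleftrightarrow> state n ar
      (fold (step n a f) (concat (map (\<lambda>x. exts n (xs @ [x]) l) [0..<i])) I) (env (xs @ [i])) c m'" for i m'
  have "runs (for_loop 2 ?j (nest 2 (Suc ?j) l (body a k f))) m
      (1 + ((n * (nest_time n l (tim n f + 1) + 1 + 1) + 1) + 1)) (\<lambda>m'. \<exists>m''. L n m'' \<and> m' = cell m'' 2 ?j 0)"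
  proof (rule runs_for)
    show "m' 0 0 = n \<and> m' 2 ?j = i" if "L i m'" for i m'
      using that by (auto simp: L_def state_def base_def env_snoc)
    show "L 0 (cell m 2 ?j 0)"
      using state_cell2[OF Suc.prems(3)] by (simp add: L_def env_snoc)
    fix i m' assume i: "i < n" and L: "L i m'"
    have "runs (nest 2 (length (xs @ [i])) l (body a k f)) m' (nest_time n l (tim n f + 1))
      (state n ar (fold (step n a f) (exts n (xs @ [i]) l)
         (fold (step n a f) (concat (map (\<lambda>x. exts n (xs @ [x]) l) [0..<i])) I)) (env (xs @ [i])) c)"
      by (rule Suc.IH) (use Suc.prems i L in \<open>auto simp: L_def\<close>)
    from this[unfolded length_append_singleton]
    show "runs (nest 2 (Suc ?j) l (body a k f)) m' (nest_time n l (tim n f + 1))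
        (\<lambda>m'. m' 2 ?j = i \<and> L (Suc i) (cell m' 2 ?j (Suc i)))"
    proof (rule runs_mono[OF _ order_refl])
      fix m'' assume S: "state n ar (fold (step n a f) (exts n (xs @ [i]) l)
         (fold (step n a f) (concat (map (\<lambda>x. exts n (xs @ [x]) l) [0..<i])) I)) (env (xs @ [i])) c m''"
      show "m'' 2 ?j = i \<and> L (Suc i) (cell m'' 2 ?j (Suc i))"
        using S state_cell2[OF S, of ?j "Suc i"] by (simp add: L_def env_snoc state_def)
    qed
  qed
  then show ?case
    unfolding nest.simps nest_time.simps
  proof (rule runs_mono[OF _ order_refl])
    fix m' assume "\<exists>m''. L n m'' \<and> m' = cell m'' 2 ?j 0"
    then obtain m'' where m'': "L n m''" "m' = cell m'' 2 ?j 0" by blast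
    have "(env xs)(?j := 0) = env xs" by (auto simp: env_def)
    then show "state n ar (fold (step n a f) (exts n xs (Suc l)) I) (env xs) c m'"
      using state_cell2[OF m''(1)[unfolded L_def], of ?j 0] m''(2) by (simp add: env_snoc)
  qed
qed

section \<open>Explicit and inductive definitions by passes over a table\<close>

definition pass :: "nat \<Rightarrow> nat \<Rightarrow> nat \<Rightarrow> fm \<Rightarrow> interp \<Rightarrow> interp" where
  "pass n a k f I = fold (step n a f) (exts n [] k) I"

lemma set_exts_Nil: "set (exts n [] k) = tuples n k"
  by (simp add: set_exts)

lemma step_other: "b \<noteq> a \<Longrightarrow> step n a f xs I b = I b"
  by (simp add: step_def)

lemma fold_step_other: "b \<noteq> a \<Longrightarrow> fold (step n a f) L I b = I b"
  by (induction L arbitrary: I) (simp_all add: step_other)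

text \<open>The formula does not mention the table being filled, so updating in place does not
  influence later entries.\<close>

lemma pass_explicit:
  assumes "\<And>l. (a, l) \<notin> rels f" and "xs \<in> tuples n k"
  shows "pass n a k f I a xs \<longleftrightarrow> sat n I (env xs) f"
proof -
  have "fold (step n a f) L I a xs = (if xs \<in> set L then sat n I (env xs) f else I a xs)" for L I
  proof (induction L arbitrary: I)
    case (Cons y L)
    have "sat n (step n a f y I) (env xs) f = sat n I (env xs) f"
      by (rule sat_cong) (use assms(1) in \<open>auto simp: step_def\<close>)
    moreover have "step n a f y I a xs = (if xs = y then sat n I (env y) f else I a xs)"
      by (simp add: step_def)
    ultimately show ?case using Cons.IH[of "step n a f y I"] by (cases "xs = y") simp_all
  qed simp
  then show ?thesis using assms(2) by (simp add: pass_def set_exts_Nil)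
qed

text \<open>Passes become inflationary: entries are only switched on. So \<open>n ^ k\<close> passes
  reach a fixed table whatever the polarity of \<open>f\<close>.\<close>

definition closing :: "nat \<Rightarrow> nat \<Rightarrow> fm \<Rightarrow> fm" where
  "closing a k f = Neg (And (Neg (Rel a [0..<k])) (Neg f))"

lemma sat_closing: "xs \<in> tuples n k \<Longrightarrow> sat n I (env xs) (closing a k f) \<longleftrightarrow> I a xs \<or> sat n I (env xs) f"
proof -
  assume "xs \<in> tuples n k"
  then have "map (env xs) [0..<k] = xs" by (intro nth_equalityI) (auto simp: env_def tuples_def)
  then show ?thesis by (simp add: closing_def)
qed

lemma step_closing:
  assumes "xs \<in> tuples n k"
  shows "I a ys \<Longrightarrow> step n a (closing a k f) xs I a ys"
    and "step n a (closing a k f) xs I = I \<Longrightarrow> sat n I (env xs) f \<Longrightarrow> I a xs"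
proof -
  show "I a ys \<Longrightarrow> step n a (closing a k f) xs I a ys"
    using sat_closing[OF assms] by (auto simp: step_def)
  assume e: "step n a (closing a k f) xs I = I" and s: "sat n I (env xs) f"
  have "step n a (closing a k f) xs I a xs" using sat_closing[OF assms] s by (simp add: step_def)
  then show "I a xs" using e by simp
qed

lemma fold_closing_mono:
  "set L \<subseteq> tuples n k \<Longrightarrow> I a ys \<Longrightarrow> fold (step n a (closing a k f)) L I a ys"
  proof (induction L arbitrary: I)
  case (Cons xs L)
  have "step n a (closing a k f) xs I a ys" by (rule step_closing(1)[where I = I and a = a]) (use Cons.prems in auto)
  then show ?case using Cons by simp
qed simp

text \<open>As entries are only switched on, a pass that ends where it began changes nothing at any
  moment, in particular not when it treats \<open>xs\<close>.\<close>

lemma fold_closing_fix: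
  assumes "set L \<subseteq> tuples n k" "fold (step n a (closing a k f)) L I = I" "xs \<in> set L" "sat n I (env xs) f"
  shows "I a xs"
proof -
  let ?s = "step n a (closing a k f)"
  obtain L1 L2 where L: "L = L1 @ xs # L2" using assms(3) by (meson split_list)
  have sub: "set L1 \<subseteq> tuples n k" "xs \<in> tuples n k" "set L2 \<subseteq> tuples n k" using assms(1) L by auto
  have full: "fold ?s L2 (?s xs (fold ?s L1 I)) = I" using assms(2) L by simp
  have eq1: "fold ?s L1 I = I"
  proof (intro ext)
    fix b ys
    show "fold ?s L1 I b ys = I b ys"
    proof (cases "b = a")
      case True
      have "I a ys" if "fold ?s L1 I a ys"
      proof -
        have "fold ?s L2 (?s xs (fold ?s L1 I)) a ys"
          by (rule fold_closing_mono[where I = "?s xs (fold ?s L1 I)" and a = a, OF sub(3) step_closing(1)[where I = "fold ?s L1 I" and a = a, OF sub(2) that]])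
        then show ?thesis by (simp only: full)
      qed
      moreover have "fold ?s L1 I a ys" if "I a ys" by (rule fold_closing_mono[where I = I and a = a, OF sub(1) that])
      ultimately show ?thesis using True by metis
    next
      case False
      then show ?thesis by (simp add: fold_step_other)
    qed
  qed
  have "?s xs I = I"
  proof (intro ext)
    fix b ys
    show "?s xs I b ys = I b ys"
    proof (cases "b = a")
      case True
      have "I a ys" if "?s xs I a ys"
      proof -
        have "fold ?s L2 (?s xs (fold ?s L1 I)) a ys"
          unfolding eq1 by (rule fold_closing_mono[where I = "?s xs I" and a = a, OF sub(3) that])
        then show ?thesis by (simp only: full)
      qed
      moreover have "?s xs I a ys" if "I a ys" by (rule step_closing(1)[where I = I and a = a, OF sub(2) that])
      ultimately show ?thesis using True by metis
    next
      case False
      then show ?thesis by (simp add: step_other)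
    qed
  qed
  then show ?thesis by (rule step_closing(2)[where I = I and a = a, OF sub(2) _ assms(4)])
qed

lemma finite_tuples: "finite (tuples n k)" and card_tuples: "card (tuples n k) = n ^ k"
proof -
  have "tuples n k = {xs. set xs \<subseteq> {..<n} \<and> length xs = k}" by (auto simp: tuples_def)
  then show "finite (tuples n k)" "card (tuples n k) = n ^ k"
    by (simp_all add: finite_lists_length_eq card_lists_length_eq)
qed

text \<open>A pass that changes the table enlarges it.\<close>

lemma passes_stable:
  fixes I :: interp and f :: fm
  assumes "\<And>xs. I a xs \<Longrightarrow> xs \<in> tuples n k"
  defines "R \<equiv> pass n a k (closing a k f)"
  shows "R ((R ^^ (n ^ k)) I) = (R ^^ (n ^ k)) I"
proof -
  have mono: "J a ys \<Longrightarrow> R J a ys" for J ys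
    unfolding R_def pass_def by (rule fold_closing_mono) (simp add: set_exts_Nil)
  have other: "b \<noteq> a \<Longrightarrow> R J b = J b" for b J by (simp add: R_def pass_def fold_step_other)
  have fold_in: "ys \<in> tuples n k" if "set L \<subseteq> tuples n k" "fold (step n a g) L J a ys" "\<And>xs. J a xs \<Longrightarrow> xs \<in> tuples n k" for L J ys g
    using that
  proof (induction L arbitrary: J)
    case (Cons y L)
    show ?case
    proof (rule Cons.IH)
      show "set L \<subseteq> tuples n k" using Cons.prems(1) by simp
      show "fold (step n a g) L (step n a g y J) a ys" using Cons.prems(2) by simp
      show "xs \<in> tuples n k" if "step n a g y J a xs" for xs
        using that Cons.prems(1,3) by (cases "xs = y") (simp_all add: step_def)
    qed
  qed simp
  have inU: "(R ^^ i) I a ys \<Longrightarrow> ys \<in> tuples n k" for i ys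
  proof (induction i arbitrary: ys)
    case 0
    then show ?case using assms(1) by simp
  next
    case (Suc i)
    have "set (exts n [] k) \<subseteq> tuples n k" by (simp add: set_exts_Nil)
    moreover have "fold (step n a (closing a k f)) (exts n [] k) ((R ^^ i) I) a ys"
      using Suc.prems unfolding R_def pass_def by simp
    ultimately show ?case by (rule fold_in) (rule Suc.IH)
  qed
  define T where "T i = {ys. (R ^^ i) I a ys}" for i
  have TU: "T i \<subseteq> tuples n k" for i using inU by (auto simp: T_def)
  have fin: "finite (T i)" for i using TU finite_tuples finite_subset by blast
  have fixp: "R ((R ^^ i) I) = (R ^^ i) I" if "T (Suc i) = T i" for i
  proof (intro ext)
    fix b ys
    show "R ((R ^^ i) I) b ys = (R ^^ i) I b ys"
      using that other by (cases "b = a") (auto simp: T_def)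
  qed
  have sub: "T i \<subseteq> T (Suc i)" for i using mono by (auto simp: T_def)
  have grow: "i \<le> card (T i) \<or> R ((R ^^ i) I) = (R ^^ i) I" for i
  proof (induction i)
    case (Suc i)
    show ?case
    proof (cases "R ((R ^^ i) I) = (R ^^ i) I")
      case True
      then show ?thesis by simp
    next
      case False
      then have "T i \<subset> T (Suc i)" using sub fixp by blast
      then have "card (T i) < card (T (Suc i))" using fin psubset_card_mono by blast
      then show ?thesis using Suc False by simp
    qed
  qed simp
  show ?thesis
  proof (rule ccontr)
    assume n: "R ((R ^^ (n ^ k)) I) \<noteq> (R ^^ (n ^ k)) I"
    then have "T (n ^ k) \<subset> T (Suc (n ^ k))" using sub fixp by blast
    then have "card (T (n ^ k)) < card (T (Suc (n ^ k)))" using fin psubset_card_mono by blast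
    moreover have "card (T (Suc (n ^ k))) \<le> n ^ k"
      using card_mono[OF finite_tuples TU] card_tuples by metis
    moreover have "n ^ k \<le> card (T (n ^ k))" using grow[of "n ^ k"] n by blast
    ultimately show False by simp
  qed
qed

lemma passes_closed:
  assumes "\<And>xs. I a xs \<Longrightarrow> xs \<in> tuples n k" "xs \<in> tuples n k"
    "sat n ((pass n a k (closing a k f) ^^ (n ^ k)) I) (env xs) f"
  shows "(pass n a k (closing a k f) ^^ (n ^ k)) I a xs"
proof (rule fold_closing_fix[where L = "exts n [] k" and n = n and k = k and a = a and f = f
      and I = "(pass n a k (closing a k f) ^^ (n ^ k)) I"])
  show "set (exts n [] k) \<subseteq> tuples n k" "xs \<in> set (exts n [] k)" using assms(2) by (simp_all add: set_exts_Nil)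
  show "fold (step n a (closing a k f)) (exts n [] k) ((pass n a k (closing a k f) ^^ (n ^ k)) I)
      = (pass n a k (closing a k f) ^^ (n ^ k)) I"
    using passes_stable[of I a n k f, OF assms(1)] by (simp add: pass_def)
  show "sat n ((pass n a k (closing a k f) ^^ (n ^ k)) I) (env xs) f" by (rule assms(3))
qed

text \<open>\<open>S\<close> stands for the contents of table \<open>a\<close> at the moment when an
  entry is switched on, possibly in the middle of a pass; all of them satisfy \<open>Q\<close> by
  then.\<close>

lemma passes_sound:
  assumes I: "\<And>xs. \<not> I a xs"
    and Q: "\<And>S xs. xs \<in> tuples n k \<Longrightarrow> (\<And>ys. ys \<in> tuples n k \<Longrightarrow> S ys \<Longrightarrow> Q ys) \<Longrightarrow>
      sat n (I(a := S)) (env xs) f \<Longrightarrow> Q xs"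
    and xs: "xs \<in> tuples n k" and r: "(pass n a k (closing a k f) ^^ i) I a xs"
  shows "Q xs"
proof -
  define inv where "inv J \<longleftrightarrow> (\<forall>b. b \<noteq> a \<longrightarrow> J b = I b) \<and> (\<forall>ys\<in>tuples n k. J a ys \<longrightarrow> Q ys)" for J
  have st: "inv (step n a (closing a k f) ys J)" if "inv J" "ys \<in> tuples n k" for J ys
  proof -
    have "J = I(a := J a)" using that(1) by (auto simp: inv_def)
    then have "Q ys" if "sat n J (env ys) f"
      using Q[of ys "J a"] that \<open>inv J\<close> \<open>ys \<in> tuples n k\<close> by (auto simp: inv_def)
    then show ?thesis
      using that sat_closing[OF that(2), of J a f] by (auto simp: inv_def step_def)
  qed
  have "inv (fold (step n a (closing a k f)) L J)" if "inv J" "set L \<subseteq> tuples n k" for L J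
    using that by (induction L arbitrary: J) (simp_all add: st)
  then have rd: "inv (pass n a k (closing a k f) J)" if "inv J" for J
    using that by (simp add: pass_def set_exts_Nil)
  have "inv ((pass n a k (closing a k f) ^^ i) I)"
  proof (induction i)
    case 0
    then show ?case using I by (simp add: inv_def)
  qed (simp add: rd)
  then show ?thesis using xs r by (simp add: inv_def)
qed

section \<open>Scripts of table definitions\<close>

text \<open>The arity of a table is encoded in its name.\<close>

definition ar :: "nat \<Rightarrow> nat" where
  "ar a = (if a = 1 then 2 else a mod 6)"

lemma ar_le: "ar a \<le> 5"
  using mod_less_divisor[of 6 a] unfolding ar_def by simp linarith

datatype phase = Def nat fm | Fix nat fm

fun table :: "phase \<Rightarrow> nat" where
  "table (Def a f) = a"
| "table (Fix a f) = a"

fun matrix :: "phase \<Rightarrow> fm" where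
  "matrix (Def a f) = f"
| "matrix (Fix a f) = closing a (ar a) f"

fun prog :: "phase \<Rightarrow> com" where
  "prog (Def a f) = nest 2 0 (ar a) (body a (ar a) f)"
| "prog (Fix a f) = nest 5 0 (ar a) (nest 2 0 (ar a) (body a (ar a) (closing a (ar a) f)))"

fun phase_time :: "nat \<Rightarrow> phase \<Rightarrow> nat" where
  "phase_time n (Def a f) = nest_time n (ar a) (tim n f + 1)"
| "phase_time n (Fix a f) = nest_time n (ar a) (nest_time n (ar a) (tim n (closing a (ar a) f) + 1))"

fun result :: "nat \<Rightarrow> phase \<Rightarrow> interp \<Rightarrow> interp" where
  "result n (Def a f) I = pass n a (ar a) f I"
| "result n (Fix a f) I = (pass n a (ar a) (closing a (ar a) f) ^^ (n ^ ar a)) I"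

fun wf_script :: "nat set \<Rightarrow> phase list \<Rightarrow> bool" where
  "wf_script D [] \<longleftrightarrow> True"
| "wf_script D (Def a f # ps) \<longleftrightarrow>
     6 \<le> a \<and> a \<notin> D \<and> (\<forall>(b, l)\<in>rels f. b \<in> D \<and> ar b = l) \<and> wf_script (insert a D) ps"
| "wf_script D (Fix a f # ps) \<longleftrightarrow>
     6 \<le> a \<and> a \<notin> D \<and> (\<forall>(b, l)\<in>rels f. b \<in> insert a D \<and> ar b = l) \<and> wf_script (insert a D) ps"

lemma rels_closing: "rels (closing a k f) = insert (a, k) (rels f)"
  by (simp add: closing_def)

lemma runs_pass:
  assumes "0 < n" "6 \<le> a" "wf_fm ar f" "state n ar I (env []) c m"
  shows "runs (nest 2 0 (ar a) (body a (ar a) f)) m (nest_time n (ar a) (tim n f + 1))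
    (state n ar (pass n a (ar a) f I) (env []) c)"
  using runs_table[OF assms(1,2) refl ar_le assms(3), of "[]" "ar a"] assms(4)
  by (simp add: pass_def)

lemma runs_phase:
  assumes n: "0 < n" and wf: "6 \<le> table p" "wf_fm ar (matrix p)" and st: "\<exists>c. state n ar I (env []) c m"
  shows "runs (prog p) m (phase_time n p) (\<lambda>m'. \<exists>c. state n ar (result n p I) (env []) c m')"
proof (cases p)
  case (Def a f)
  obtain c where c: "state n ar I (env []) c m" using st by blast
  have "runs (nest 2 0 (ar a) (body a (ar a) f)) m (nest_time n (ar a) (tim n f + 1))
      (state n ar (pass n a (ar a) f I) (env []) c)"
    by (rule runs_pass[OF n _ _ c]) (use wf Def in simp_all)
  then show ?thesis
    unfolding Def prog.simps phase_time.simps result.simps by (rule runs_mono) blast+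
next
  case (Fix a f)
  let ?g = "closing a (ar a) f"
  define R where "R = pass n a (ar a) ?g"
  have a: "6 \<le> a" "wf_fm ar ?g" using wf Fix by simp_all
  define P where "P i m' \<longleftrightarrow> (\<exists>c. state n ar ((R ^^ i) I) (env []) c m')" for i m'
  have "runs (nest 5 0 (ar a) (nest 2 0 (ar a) (body a (ar a) ?g))) m
      (nest_time n (ar a) (nest_time n (ar a) (tim n ?g + 1))) (\<lambda>m'. P (0 + n ^ ar a) m' \<and> (\<forall>q<0. m' 5 q = m 5 q))"
  proof (rule runs_repeat[where J = "ar a"])
    show "m 0 0 = n" if "P i m" for i m using that by (auto simp: P_def state_def base_def)
    show "P i (cell m 5 q x)" if "P i m" for i m q x
      using that by (auto simp: P_def state_def base_def rep_def cell_def)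
    show "P 0 m" using st by (simp add: P_def)
    fix i m assume "P i m"
    then obtain c where c: "state n ar ((R ^^ i) I) (env []) c m" by (auto simp: P_def)
    have "runs (nest 2 0 (ar a) (body a (ar a) ?g)) m (nest_time n (ar a) (tim n ?g + 1))
        (state n ar (R ((R ^^ i) I)) (env []) c)"
      unfolding R_def by (rule runs_pass[OF n a c[unfolded R_def]])
    then show "runs (nest 2 0 (ar a) (body a (ar a) ?g)) m (nest_time n (ar a) (tim n ?g + 1))
        (\<lambda>m'. P (Suc i) m' \<and> (\<forall>q<ar a. m' 5 q = m 5 q))"
    proof (rule runs_mono[OF _ order_refl])
      fix m' assume "state n ar (R ((R ^^ i) I)) (env []) c m'"
      then show "P (Suc i) m' \<and> (\<forall>q<ar a. m' 5 q = m 5 q)" using c by (auto simp: P_def state_def)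
    qed
  qed simp
  then show ?thesis
    unfolding Fix prog.simps phase_time.simps result.simps
    by (rule runs_mono[OF _ order_refl]) (simp add: P_def R_def)
qed

fun progs :: "phase list \<Rightarrow> com" where
  "progs [] = Skip"
| "progs (p # ps) = Seq (prog p) (progs ps)"

lemma runs_progs:
  assumes "0 < n"
  shows "wf_script D ps \<Longrightarrow> (\<forall>a\<in>D. a = 1 \<or> 6 \<le> a) \<Longrightarrow> \<exists>c. state n ar I (env []) c m \<Longrightarrow>
    runs (progs ps) m (sum_list (map (phase_time n) ps) + 1) (\<lambda>m'. \<exists>c. state n ar (fold (result n) ps I) (env []) c m')"
proof (induction ps arbitrary: D I m)
  case Nil
  then show ?case unfolding runs_def using exec.Skip by fastforce
next
  case (Cons p ps)
  have wf: "6 \<le> table p" "wf_fm ar (matrix p)" "wf_script (insert (table p) D) ps"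
    using Cons.prems(1,2) ar_le by (cases p; auto simp: wf_fm_def rels_closing)+
  have "runs (prog p) m (phase_time n p) (\<lambda>m'. \<exists>c. state n ar (result n p I) (env []) c m')"
    by (rule runs_phase[OF assms wf(1,2) Cons.prems(3)])
  moreover have "runs (progs ps) m' (sum_list (map (phase_time n) ps) + 1)
      (\<lambda>m'. \<exists>c. state n ar (fold (result n) (p # ps) I) (env []) c m')"
    if "\<exists>c. state n ar (result n p I) (env []) c m'" for m'
    using Cons.IH[OF wf(3) _ that] Cons.prems(2) wf(1) by simp
  ultimately have "runs (Seq (prog p) (progs ps)) m (phase_time n p + (sum_list (map (phase_time n) ps) + 1))
      (\<lambda>m'. \<exists>c. state n ar (fold (result n) (p # ps) I) (env []) c m')"
    by (intro runs_Seq) (rule runs_mono[OF _ order_refl])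
  then show ?case by (simp add: add.assoc)
qed

text \<open>A table is never changed after its phase, so its formula may be evaluated in the final
  interpretation.\<close>

lemma result_other: "b \<noteq> table p \<Longrightarrow> result n p I b = I b"
proof (cases p)
  case (Fix a f)
  have "(pass n a k g ^^ i) I b = I b" if "b \<noteq> a" for i k g
    by (induction i) (simp_all add: pass_def fold_step_other that)
  then show "b \<noteq> table p \<Longrightarrow> ?thesis" using Fix by simp
qed (simp add: pass_def fold_step_other)

lemma fold_result_other: "b \<notin> table ` set ps \<Longrightarrow> fold (result n) ps I b = I b"
  by (induction ps arbitrary: I) (simp_all add: result_other)

lemma wf_script_append:
  "wf_script D (ps @ qs) \<longleftrightarrow> wf_script D ps \<and> wf_script (D \<union> table ` set ps) qs"
  by (induction D ps rule: wf_script.induct) (auto simp: insert_commute)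

lemma wf_script_fresh: "wf_script D ps \<Longrightarrow> D \<inter> table ` set ps = {}"
  by (induction D ps rule: wf_script.induct) auto

lemma fold_result_Def:
  assumes wf: "wf_script D ps" and p: "Def a f \<in> set ps" and xs: "xs \<in> tuples n (ar a)"
  shows "fold (result n) ps I a xs \<longleftrightarrow> sat n (fold (result n) ps I) (env xs) f"
proof -
  obtain ps1 ps2 where ps: "ps = ps1 @ Def a f # ps2" using p by (meson split_list)
  let ?D = "D \<union> table ` set ps1" and ?J = "fold (result n) ps1 I" and ?K = "fold (result n) ps I"
  have w: "a \<notin> ?D" "\<forall>(b, l)\<in>rels f. b \<in> ?D" "wf_script (insert a ?D) ps2"
    using wf unfolding ps wf_script_append by auto
  have fr: "insert a ?D \<inter> table ` set ps2 = {}" by (rule wf_script_fresh[OF w(3)])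
  have K: "?K = fold (result n) ps2 (pass n a (ar a) f ?J)" by (simp add: ps)
  have "?K a = pass n a (ar a) f ?J a" unfolding K by (rule fold_result_other) (use fr in auto)
  moreover have "pass n a (ar a) f ?J a xs \<longleftrightarrow> sat n ?J (env xs) f"
    by (rule pass_explicit[OF _ xs]) (use w in auto)
  moreover have "sat n ?J (env xs) f \<longleftrightarrow> sat n ?K (env xs) f"
  proof (rule sat_cong)
    fix b l assume "(b, l) \<in> rels f"
    then have b: "b \<in> ?D" using w(2) by auto
    then have "?K b = pass n a (ar a) f ?J b" unfolding K using fr by (intro fold_result_other) auto
    also have "\<dots> = ?J b" using b w(1) by (auto simp: pass_def intro!: fold_step_other)
    finally show "?J b = ?K b" by simp
  qed
  ultimately show ?thesis by simp
qed

text \<open>The two conclusions play the roles of the introduction rule and the induction rule of an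
  inductive definition; later only these are used about such tables.\<close>

lemma fold_result_Fix:
  assumes wf: "wf_script D ps" and p: "Fix a f \<in> set ps" and xs: "xs \<in> tuples n (ar a)"
    and I: "\<And>b xs. b \<notin> D \<Longrightarrow> \<not> I b xs"
  shows fold_result_Fix_closed: "sat n (fold (result n) ps I) (env xs) f \<Longrightarrow> fold (result n) ps I a xs"
    and fold_result_Fix_sound: "fold (result n) ps I a xs \<Longrightarrow>
      (\<And>S xs. xs \<in> tuples n (ar a) \<Longrightarrow> (\<And>ys. ys \<in> tuples n (ar a) \<Longrightarrow> S ys \<Longrightarrow> Q ys) \<Longrightarrow>
        sat n ((fold (result n) ps I)(a := S)) (env xs) f \<Longrightarrow> Q xs) \<Longrightarrow> Q xs"
proof -
  obtain ps1 ps2 where ps: "ps = ps1 @ Fix a f # ps2" using p by (meson split_list)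
  let ?D = "D \<union> table ` set ps1" and ?J = "fold (result n) ps1 I" and ?K = "fold (result n) ps I"
  let ?R = "pass n a (ar a) (closing a (ar a) f) ^^ (n ^ ar a)"
  have w: "a \<notin> ?D" "\<forall>(b, l)\<in>rels f. b \<in> insert a ?D" "wf_script (insert a ?D) ps2"
    using wf unfolding ps wf_script_append by auto
  have fr: "insert a ?D \<inter> table ` set ps2 = {}" by (rule wf_script_fresh[OF w(3)])
  have K: "?K = fold (result n) ps2 (?R ?J)" by (simp add: ps)
  have Ka: "?K a = ?R ?J a" unfolding K by (rule fold_result_other) (use fr in auto)
  have RJ: "?R ?J = result n (Fix a f) ?J" by simp
  have Kb: "?K b = ?J b" if "b \<in> ?D" for b
  proof -
    have "?K b = ?R ?J b" unfolding K using fr that by (intro fold_result_other) auto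
    also have "\<dots> = ?J b" unfolding RJ by (rule result_other) (use that w(1) in auto)
    finally show ?thesis .
  qed
  have J0: "\<not> ?J a ys" for ys using fold_result_other[of a ps1 n I] w(1) I[of a] by simp
  show "?K a xs" if s: "sat n ?K (env xs) f"
  proof -
    have "sat n (?R ?J) (env xs) f \<longleftrightarrow> sat n ?K (env xs) f"
    proof (rule sat_cong)
      fix b l assume "(b, l) \<in> rels f"
      then have "b \<in> insert a ?D" using w(2) by auto
      then show "?R ?J b = ?K b" unfolding K using fr by (intro fold_result_other[symmetric]) auto
    qed
    then have "?R ?J a xs" using s by (intro passes_closed[OF _ xs]) (auto simp: J0)
    then show ?thesis by (simp only: Ka)
  qed
  assume K': "?K a xs"
    and Q: "\<And>S xs. xs \<in> tuples n (ar a) \<Longrightarrow> (\<And>ys. ys \<in> tuples n (ar a) \<Longrightarrow> S ys \<Longrightarrow> Q ys) \<Longrightarrow>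
        sat n (?K(a := S)) (env xs) f \<Longrightarrow> Q xs"
  show "Q xs"
  proof (rule passes_sound[where I = ?J and a = a and i = "n ^ ar a"])
    show "\<not> ?J a ys" for ys by (rule J0)
    show "xs \<in> tuples n (ar a)" by (rule xs)
    show "?R ?J a xs" using K' by (simp only: Ka)
    fix S ys assume h: "ys \<in> tuples n (ar a)" "\<And>zs. zs \<in> tuples n (ar a) \<Longrightarrow> S zs \<Longrightarrow> Q zs"
      "sat n (?J(a := S)) (env ys) f"
    have "sat n (?J(a := S)) (env ys) f \<longleftrightarrow> sat n (?K(a := S)) (env ys) f"
    proof (rule sat_cong)
      fix b l assume "(b, l) \<in> rels f"
      then have "b \<in> insert a ?D" using w(2) by auto
      then show "(?J(a := S)) b = (?K(a := S)) b" using Kb[of b] by auto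
    qed
    then show "Q ys" using Q[OF h(1,2)] h(3) by blast
  qed
qed

section \<open>The complete program and its running time\<close>

text \<open>Four nested loops run the body \<open>n ^ 4\<close> times. The number of runs is counted
  in cell 9 of array 5, out of reach of the loop counters, and each multiple is obtained from the
  previous one.\<close>

definition multiples :: com where
  "multiples = nest 5 0 4 (Seq (Put 4 (Plus (Get 5 (Num 9)) (Num 1)) (Plus (Get 4 (Get 5 (Num 9))) NN))
     (Put 5 (Num 9) (Plus (Get 5 (Num 9)) (Num 1))))"

definition adjacency :: "nat set set \<Rightarrow> interp" where
  "adjacency E a xs \<longleftrightarrow> a = 1 \<and> {xs ! 0, xs ! 1} \<in> E"

lemma runs_multiples:
  assumes n: "0 < n"
  shows "runs multiples (graph_input n E) (nest_time n 4 2)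
    (\<lambda>m. \<exists>c. state n ar (adjacency E) (env []) c m)"
proof -
  let ?m0 = "graph_input n E"
  define P where "P i m \<longleftrightarrow> m 5 9 = i \<and> (\<forall>j\<le>i. m 4 j = j * n) \<and> (\<forall>a. a \<noteq> 4 \<and> a \<noteq> 5 \<longrightarrow> m a = ?m0 a)"
    for i and m :: memory
  have n0: "m 0 0 = n" if "P i m" for i m using that by (simp add: P_def graph_input_def)
  have "runs multiples ?m0 (nest_time n 4 2) (\<lambda>m. P (0 + n ^ 4) m \<and> (\<forall>q<0. m 5 q = ?m0 5 q))"
    unfolding multiples_def
  proof (rule runs_repeat[where J = 9])
    show "m 0 0 = n" if "P i m" for i m using n0[OF that] .
    show "P i (cell m 5 q x)" if "P i m" "q < 9" for i m q x using that by (auto simp: P_def cell_def)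
    show "P 0 ?m0" by (simp add: P_def graph_input_def)
    fix i m assume Pi: "P i m"
    have "m 4 i = i * n" using Pi by (simp add: P_def)
    then have "runs (Seq (Put 4 (Plus (Get 5 (Num 9)) (Num 1)) (Plus (Get 4 (Get 5 (Num 9))) NN))
       (Put 5 (Num 9) (Plus (Get 5 (Num 9)) (Num 1)))) m (1 + 1) (\<lambda>m'. P (Suc i) m' \<and> (\<forall>q<9. m' 5 q = m 5 q))"
      using Pi n0[OF Pi] by (intro runs_Seq runs_Put) (auto simp: P_def le_Suc_eq)
    then show "runs (Seq (Put 4 (Plus (Get 5 (Num 9)) (Num 1)) (Plus (Get 4 (Get 5 (Num 9))) NN))
       (Put 5 (Num 9) (Plus (Get 5 (Num 9)) (Num 1)))) m 2 (\<lambda>m'. P (Suc i) m' \<and> (\<forall>q<9. m' 5 q = m 5 q))"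
      by (simp only: one_add_one)
  qed simp
  then show ?thesis
  proof (rule runs_mono[OF _ order_refl])
    fix m assume "P (0 + n ^ 4) m \<and> (\<forall>q<0. m 5 q = ?m0 5 q)"
    then have P: "P (n ^ 4) m" by simp
    have same: "m a = ?m0 a" if "a \<noteq> 4" "a \<noteq> 5" for a using P that by (simp add: P_def)
    have "rep n ar (adjacency E) m"
      unfolding rep_def
    proof (intro allI impI)
      fix a and xs :: "nat list"
      assume h: "a = 1 \<or> 6 \<le> a" "length xs = ar a" "set xs \<subseteq> {..<n}"
      show "m a (idx n xs) = (if adjacency E a xs then 1 else 0)"
      proof (cases "a = 1")
        case True
        then have "length xs = Suc (Suc 0)" using h(2) by (simp add: ar_def)
        then obtain x y where xs: "xs = [x, y]" by (auto simp: length_Suc_conv)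
        have xy: "x < n" "y < n" using h(3) xs by auto
        have "idx n xs = x * n + y" by (simp add: xs idx_def)
        moreover have "x * n + y < n * n"
        proof -
          have "x * n + y < Suc x * n" using xy by simp
          also have "\<dots> \<le> n * n" using xy by (intro mult_right_mono) auto
          finally show ?thesis .
        qed
        ultimately show ?thesis
          using same[of 1] True xy by (simp add: graph_input_def adjacency_def xs)
      next
        case False
        then show ?thesis using same[of a] h(1) by (simp add: graph_input_def adjacency_def)
      qed
    qed
    moreover have "base n m" using P n0[OF P] by (simp add: base_def P_def)
    moreover have "m 2 = env []" using same[of 2] by (auto simp: graph_input_def env_def)
    ultimately show "\<exists>c. state n ar (adjacency E) (env []) c m" by (simp add: state_def)
  qed
qed

text \<open>Inputs with \<open>n < 2\<close> are accepted at once: beyond them, variables have a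
  nonzero value to code the second end of an edge.\<close>

definition compile :: "phase list \<Rightarrow> fm \<Rightarrow> com" where
  "compile ps g = If (Minus NN (Num 1))
     (Seq multiples (Seq (progs ps) (Seq (cmp g 0) (Put 0 (Num 0) (SS 0)))))
     (Put 0 (Num 0) (Num 1))"

definition compile_time :: "nat \<Rightarrow> phase list \<Rightarrow> fm \<Rightarrow> nat" where
  "compile_time n ps g = 1 + (nest_time n 4 2 + ((sum_list (map (phase_time n) ps) + 1) + (tim n g + 1)))"

definition tables :: "nat set set \<Rightarrow> nat \<Rightarrow> phase list \<Rightarrow> interp" where
  "tables E n ps = fold (result n) ps (adjacency E)"

lemma runs_compile:
  assumes wf: "wf_script {1} ps" and g: "wf_fm ar g"
  shows "runs (compile ps g) (graph_input n E) (compile_time n ps g)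
    (\<lambda>m. m 0 0 = (if n < 2 \<or> sat n (tables E n ps) (env []) g then 1 else 0))"
  unfolding compile_def compile_time_def
proof (rule runs_If)
  assume "aval (Minus NN (Num 1)) (graph_input n E) \<noteq> 0"
  then have n: "0 < n" "\<not> n < 2" by (simp_all add: graph_input_def)
  show "runs (Seq multiples (Seq (progs ps) (Seq (cmp g 0) (Put 0 (Num 0) (SS 0))))) (graph_input n E)
     (nest_time n 4 2 + ((sum_list (map (phase_time n) ps) + 1) + (tim n g + 1)))
     (\<lambda>m. m 0 0 = (if n < 2 \<or> sat n (tables E n ps) (env []) g then 1 else 0))"
  proof (rule runs_Seq, rule runs_mono[OF runs_multiples[OF n(1)] order_refl], rule runs_Seq,
      rule runs_mono[OF runs_progs[OF n(1) wf] order_refl])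
    fix m assume "\<exists>c. state n ar (adjacency E) (env []) c m"
    then show "\<exists>c. state n ar (adjacency E) (env []) c m" .
  next
    fix m assume "\<exists>c. state n ar (fold (result n) ps (adjacency E)) (env []) c m"
    then have st: "base n m" "rep n ar (tables E n ps) m" "m 2 = env []"
      by (auto simp: state_def tables_def)
    have lt: "m 2 k < n" for k using st(3) n(1) by (simp add: env_def)
    have "runs (cmp g 0) m (tim n g) (computes 0 m 0 (sat n (tables E n ps) (m 2) g))"
      by (rule runs_cmp[OF st(1) n(1) st(2) g lt])
    then show "runs (Seq (cmp g 0) (Put 0 (Num 0) (SS 0))) m (tim n g + 1)
        (\<lambda>m. m 0 0 = (if n < 2 \<or> sat n (tables E n ps) (env []) g then 1 else 0))"
      unfolding st(3)
    proof (rule runs_Seq[OF runs_mono[OF _ order_refl]])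
      fix m' assume "computes 0 m 0 (sat n (tables E n ps) (env []) g) m'"
      then show "runs (Put 0 (Num 0) (SS 0)) m' 1
        (\<lambda>m. m 0 0 = (if n < 2 \<or> sat n (tables E n ps) (env []) g then 1 else 0))"
        using n(2) by (intro runs_Put) (simp add: computes_def)
    qed
  qed simp
next
  assume "aval (Minus NN (Num 1)) (graph_input n E) = 0"
  then have "n < 2" by (simp add: graph_input_def)
  then have "runs (Put 0 (Num 0) (Num 1)) (graph_input n E) 1
      (\<lambda>m. m 0 0 = (if n < 2 \<or> sat n (tables E n ps) (env []) g then 1 else 0))"
    by (intro runs_Put) simp
  then show "runs (Put 0 (Num 0) (Num 1)) (graph_input n E)
     (nest_time n 4 2 + ((sum_list (map (phase_time n) ps) + 1) + (tim n g + 1)))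
     (\<lambda>m. m 0 0 = (if n < 2 \<or> sat n (tables E n ps) (env []) g then 1 else 0))"
    by (rule runs_mono) simp_all
qed

section \<open>Polynomial time bounds\<close>

definition poly_bounded :: "(nat \<Rightarrow> nat) \<Rightarrow> bool" where
  "poly_bounded t \<longleftrightarrow> (\<exists>p :: nat poly. \<forall>n. t n \<le> poly p n)"

lemma poly_bounded_const [simp]: "poly_bounded (\<lambda>n. k)"
  unfolding poly_bounded_def by (rule exI[of _ "[:k:]"]) simp

lemma poly_bounded_id [simp]: "poly_bounded (\<lambda>n. n)"
  unfolding poly_bounded_def by (rule exI[of _ "[:0, 1:]"]) simp

lemma poly_bounded_add: "poly_bounded s \<Longrightarrow> poly_bounded t \<Longrightarrow> poly_bounded (\<lambda>n. s n + t n)"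
  unfolding poly_bounded_def by (metis add_mono poly_add)

lemma poly_bounded_mult: "poly_bounded s \<Longrightarrow> poly_bounded t \<Longrightarrow> poly_bounded (\<lambda>n. s n * t n)"
  unfolding poly_bounded_def by (metis mult_mono' poly_mult zero_le)

lemmas poly_bounded_intros = poly_bounded_add poly_bounded_mult poly_bounded_const poly_bounded_id

lemma poly_bounded_tim: "poly_bounded (\<lambda>n. tim n f)"
  by (induction f) (unfold tim.simps, (rule poly_bounded_intros | assumption)+)

lemma poly_bounded_nest: "poly_bounded t \<Longrightarrow> poly_bounded (\<lambda>n. nest_time n k (t n))"
  by (induction k) (unfold nest_time.simps, (rule poly_bounded_intros | assumption)+)

lemma poly_bounded_phase: "poly_bounded (\<lambda>n. phase_time n p)"
  by (cases p; simp only: phase_time.simps)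
    (intro poly_bounded_nest poly_bounded_add poly_bounded_tim poly_bounded_const)+

lemma poly_bounded_compile: "poly_bounded (\<lambda>n. compile_time n ps g)"
proof -
  have "poly_bounded (\<lambda>n. sum_list (map (phase_time n) ps))"
  proof (induction ps)
    case (Cons p ps)
    then show ?case using poly_bounded_add[OF poly_bounded_phase[of p]] by simp
  qed simp
  then show ?thesis
    unfolding compile_time_def
    by (intro poly_bounded_add poly_bounded_const poly_bounded_nest poly_bounded_tim)
qed

lemma script_decides:
  assumes wf: "wf_script {1} ps" and g: "wf_fm ar g"
    and P: "\<And>n E. simple_graph {..<n} E \<Longrightarrow> Q {..<n} E \<Longrightarrow>
      P {..<n} E \<longleftrightarrow> n < 2 \<or> sat n (tables E n ps) (env []) g"
  shows "decides_in_polynomial_time (compile ps g) Q P"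
proof -
  obtain p :: "nat poly" where p: "\<And>n. compile_time n ps g \<le> poly p n"
    using poly_bounded_compile unfolding poly_bounded_def by blast
  show ?thesis
    unfolding decides_in_polynomial_time_def
  proof (intro exI[of _ p] allI impI)
    fix n and E :: "nat set set" assume h: "simple_graph {..<n} E \<and> Q {..<n} E"
    obtain t m where "exec (compile ps g) (graph_input n E) t m" "t \<le> compile_time n ps g"
      "m 0 0 = (if n < 2 \<or> sat n (tables E n ps) (env []) g then 1 else 0)"
      using runs_compile[OF wf g, of n E] unfolding runs_def by blast
    moreover have "P {..<n} E \<longleftrightarrow> n < 2 \<or> sat n (tables E n ps) (env []) g" using P h by blast
    ultimately have "exec (compile ps g) (graph_input n E) t m" "t \<le> poly p n"
      "m 0 0 = (if P {..<n} E then 1 else 0)"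
      using order_trans[OF _ p[of n]] by simp_all
    then show "\<exists>t m. exec (compile ps g) (graph_input n E) t m \<and> t \<le> poly p n \<and>
        m 0 0 = (if P {..<n} E then 1 else 0)" by blast
  qed
qed

section \<open>The algorithm\<close>

definition Or :: "fm \<Rightarrow> fm \<Rightarrow> fm" where
  "Or f g = Neg (And (Neg f) (Neg g))"

definition Iff :: "fm \<Rightarrow> fm \<Rightarrow> fm" where
  "Iff f g = Or (And f g) (And (Neg f) (Neg g))"

definition All :: "nat \<Rightarrow> fm \<Rightarrow> fm" where
  "All k f = Neg (Ex k (Neg f))"

definition Eq :: "nat \<Rightarrow> nat \<Rightarrow> fm" where
  "Eq i j = And (Neg (Less i j)) (Neg (Less j i))"

fun Conj :: "fm list \<Rightarrow> fm" where
  "Conj [] = Eq 0 0"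
| "Conj (f # fs) = And f (Conj fs)"

definition Zero :: "nat \<Rightarrow> fm" where
  "Zero i = Neg (Ex (i + 1) (Less (i + 1) i))"

lemma sat_sugar [simp]:
  "sat n I r (Or f g) \<longleftrightarrow> sat n I r f \<or> sat n I r g"
  "sat n I r (Iff f g) \<longleftrightarrow> (sat n I r f \<longleftrightarrow> sat n I r g)"
  "sat n I r (All k f) \<longleftrightarrow> (\<forall>x<n. sat n I (r(k := x)) f)"
  "sat n I r (Eq i j) \<longleftrightarrow> r i = r j"
  by (auto simp: Or_def Iff_def All_def Eq_def)

lemma sat_Zero [simp]: "r i < n \<Longrightarrow> sat n I r (Zero i) \<longleftrightarrow> r i = 0"
  by (auto simp: Zero_def)

lemma rels_sugar [simp]:
  "rels (Or f g) = rels f \<union> rels g"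
  "rels (Iff f g) = rels f \<union> rels g"
  "rels (All k f) = rels f"
  "rels (Eq i j) = {}"
  "rels (Zero i) = {}"
  by (auto simp: Or_def Iff_def All_def Eq_def Zero_def)

abbreviation "Adj i j \<equiv> Rel 1 [i, j]"
abbreviation "Twin i j \<equiv> Rel 8 [i, j]"
abbreviation "Rep i \<equiv> Rel 7 [i]"
abbreviation "Conn i j \<equiv> Rel 20 [i, j]"
abbreviation "Kept i \<equiv> Rel 13 [i]"
abbreviation "KAdj i j \<equiv> Rel 26 [i, j]"
abbreviation "Tri i j k \<equiv> Rel 9 [i, j, k]"
abbreviation "First i j \<equiv> Rel 38 [i, j]"
abbreviation "At0 i j \<equiv> Rel 32 [i, j]"
abbreviation "Same i s j t \<equiv> Rel 10 [i, s, j, t]"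
abbreviation "Before i j s \<equiv> Rel 15 [i, j, s]"
abbreviation "Tree i \<equiv> Rel 19 [i]"
abbreviation "Without i k j s \<equiv> Rel 16 [i, k, j, s]"
abbreviation "Fund i j \<equiv> Rel 44 [i, j]"
abbreviation "Common i j \<equiv> Rel 50 [i, j]"
abbreviation "Link i j \<equiv> Rel 56 [i, j]"
abbreviation "OddBlock i \<equiv> Rel 25 [i]"
abbreviation "Avoid i j k \<equiv> Rel 21 [i, j, k]"

text \<open>How to read the less obvious tables. An argument \<open>s\<close> or \<open>t\<close>
  selects an end of the edge before it: end 0 if zero, otherwise the other end.
  \<open>Before e x s\<close>: that end of \<open>x\<close> is joined to end 0 of \<open>e\<close>
  by kept edges below \<open>e\<close>. \<open>Without e f x s\<close>: the same inside the tree
  without \<open>f\<close>. \<open>Common e g\<close>: the fundamental circuits share an odd number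
  of edges, so \<open>Common e e\<close> is the parity of a length. \<open>Link\<close> is
  \<open>flink\<close>, and \<open>OddBlock\<close> asks for an odd fundamental circuit in the
  class.\<close>

definition script :: "phase list" where
  "script = [
    Def 8 (And (Adj 0 1) (All 2 (Or (Or (Eq 2 0) (Eq 2 1)) (Iff (Adj 2 0) (Adj 2 1))))),
    Def 7 (Neg (Ex 1 (And (Less 1 0) (Twin 1 0)))),
    Fix 20 (Or (Eq 0 1) (Ex 2 (Conj [Conn 0 2, Rep 2, Rep 1, Adj 2 1]))),
    Def 13 (And (Rep 0) (Ex 1 (Ex 2 (Ex 3 (Conj [Rep 1, Rep 2, Rep 3, Conn 0 1, Conn 0 2, Conn 0 3,
      Neg (Eq 1 2), Neg (Eq 1 3), Neg (Eq 2 3), Neg (Adj 1 2), Neg (Adj 1 3)]))))),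
    Def 26 (Conj [Kept 0, Kept 1, Adj 0 1]),
    Def 9 (Conj [KAdj 0 1, KAdj 1 2, KAdj 0 2,
      All 3 (Or (Neg (Kept 3)) (Iff (KAdj 3 2) (Neg (Iff (KAdj 3 0) (KAdj 3 1)))))]),
    Def 38 (And (KAdj 0 1) (Neg (Ex 2 (And (Less 2 1) (KAdj 0 2))))),
    Def 32 (Ex 2 (And (First 0 2) (Or (Eq 1 2) (And (KAdj 1 2) (Neg (Tri 0 1 2)))))),
    Def 10 (Or (And (Eq 0 2) (Iff (Zero 1) (Zero 3)))
      (Conj [KAdj 0 2, Iff (Zero 1) (At0 0 2), Iff (Zero 3) (At0 2 0)])),
    Fix 15 (And (Kept 1) (Or (Ex 3 (And (Zero 3) (Same 0 3 1 2)))
      (Ex 3 (Ex 4 (Ex 5 (Conj [Before 0 3 4, Kept 3, Less 3 0, Iff (Zero 5) (Neg (Zero 4)), Same 3 5 1 2])))))),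
    Def 19 (And (Kept 0) (Neg (Ex 1 (And (Neg (Zero 1)) (Before 0 0 1))))),
    Fix 16 (And (Kept 2) (Or (Ex 4 (And (Zero 4) (Same 0 4 2 3)))
      (Ex 4 (Ex 5 (Ex 6 (Conj [Without 0 1 4 5, Tree 4, Neg (Eq 4 1), Iff (Zero 6) (Neg (Zero 5)), Same 4 6 2 3])))))),
    Def 44 (Conj [Kept 0, Neg (Tree 0),
      Or (Eq 1 0) (And (Tree 1) (Neg (Ex 2 (And (Neg (Zero 2)) (Without 0 1 0 2)))))]),
    Def 50 (Odd 2 (And (Fund 0 2) (Fund 1 2))),
    Fix 56 (Or (Eq 0 1) (Ex 2 (Ex 3 (Conj [Link 0 2, Fund 2 3, Fund 1 3])))),
    Def 25 (Ex 1 (And (Link 0 1) (Common 1 1))),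
    Fix 21 (Or (Eq 2 1) (Ex 3 (Conj [Avoid 0 1 3, KAdj 3 2, Or (Eq 3 1) (And (Neg (Eq 3 0)) (Neg (KAdj 3 0)))])))]"

text \<open>The first conjunct is the parity condition. The second denies a kept edge with a twin on
  an odd circuit of length at least five, in the form of \<open>long_odd_circ_iff\<close>: variables
  1 and 2 complete a triangle, and 3 and 4 are the first and last edge of a detour.\<close>

definition goal :: fm where
  "goal = And
    (All 0 (All 1 (Or (Neg (Conj [Kept 0, Neg (Tree 0), Link 0 1, OddBlock 0]))
      (Iff (Common 0 1) (And (Common 0 0) (Common 1 1))))))
    (Neg (Ex 0 (Conj [Kept 0, Ex 1 (Twin 0 1), Ex 1 (And (Fund 1 0) (OddBlock 1)),
      Neg (Ex 1 (Ex 2 (And (Tri 0 1 2) (Neg (Ex 3 (Ex 4 (Conj [KAdj 3 0, KAdj 4 0,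
        Neg (Eq 3 1), Neg (Eq 3 2), Neg (Eq 4 1), Neg (Eq 4 2), Neg (Eq 3 4), Neg (KAdj 3 4), Avoid 0 3 4])))))))])))"

lemma wf_goal: "wf_fm ar goal"
  by (simp add: wf_fm_def goal_def ar_def)

lemma wf_script: "wf_script {1} script"
  by (simp add: script_def ar_def)

lemma tuples_simps [simp]:
  "[x] \<in> tuples n k \<longleftrightarrow> k = 1 \<and> x < n"
  "[x, y] \<in> tuples n k \<longleftrightarrow> k = 2 \<and> x < n \<and> y < n"
  "[x, y, z] \<in> tuples n k \<longleftrightarrow> k = 3 \<and> x < n \<and> y < n \<and> z < n"
  "[x, y, z, w] \<in> tuples n k \<longleftrightarrow> k = 4 \<and> x < n \<and> y < n \<and> z < n \<and> w < n"
  by (auto simp: tuples_def)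

lemma tuples_elims:
  "xs \<in> tuples n 2 \<Longrightarrow> (\<And>x y. xs = [x, y] \<Longrightarrow> x < n \<Longrightarrow> y < n \<Longrightarrow> thesis) \<Longrightarrow> thesis"
  "xs \<in> tuples n 3 \<Longrightarrow> (\<And>x y z. xs = [x, y, z] \<Longrightarrow> x < n \<Longrightarrow> y < n \<Longrightarrow> z < n \<Longrightarrow> thesis) \<Longrightarrow> thesis"
  "xs \<in> tuples n 4 \<Longrightarrow> (\<And>x y z w. xs = [x, y, z, w] \<Longrightarrow> x < n \<Longrightarrow> y < n \<Longrightarrow> z < n \<Longrightarrow> w < n \<Longrightarrow> thesis) \<Longrightarrow> thesis"
  by (auto simp: tuples_def length_Suc_conv numeral_eq_Suc)

text \<open>Kept edges form whole components of the representatives, so connections and the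
  witnesses of \<open>spread\<close> survive the restriction.\<close>

lemma (in ordered_multi) kept_spread: "spread_multi kept ends"
proof -
  interpret K: ordered_multi kept ends using multi_sub[OF keptF] by (simp add: ordered_multi_def)
  have K: "K.adj x y \<longleftrightarrow> x \<in> kept \<and> y \<in> kept \<and> adj x y" for x y
    using keptF by (auto simp: K.adj_def adj_def)
  have aconn: "K.aconn x y" if x: "x \<in> kept" and c: "conn x y" for x y
    using c unfolding conn_def
  proof (induction rule: rtrancl_induct)
    case base
    show ?case by (simp add: K.aconn_def)
  next
    case (step y z)
    have "conn x y" using step.hyps(1) by (simp add: conn_def)
    then have "y \<in> kept" "z \<in> kept"
      using step.hyps(2) kept_conn[OF x] conn_trans[of x y z] conn_adj[of y z] by auto
    then show ?case using step.IH step.hyps(2) K unfolding K.aconn_def by (auto intro: rtrancl_into_rtrancl)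
  qed
  show ?thesis
  proof (unfold_locales)
    show K.simple unfolding K.simple_def using reps_simple kept_reps by blast
    fix x assume x: "x \<in> kept"
    then obtain w w1 w2 where "conn x w" "conn x w1" "conn x w2"
      "w \<noteq> w1" "w \<noteq> w2" "w1 \<noteq> w2" "\<not> adj w w1" "\<not> adj w w2"
      unfolding kept_def spread_def by blast
    then show "\<exists>w w1 w2. K.aconn x w \<and> K.aconn x w1 \<and> K.aconn x w2 \<and>
      w \<noteq> w1 \<and> w \<noteq> w2 \<and> w1 \<noteq> w2 \<and> \<not> K.adj w w1 \<and> \<not> K.adj w w2"
      using aconn[OF x] K by blast
  qed
qed

section \<open>The meaning of the computed tables\<close>

locale line_tables = ordered_multi "{..<n}" ends for n :: nat and ends :: "nat \<Rightarrow> 'w set" +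
  assumes n: "1 < n"
begin

definition T :: interp where
  "T = tables (line_graph_edges {..<n} ends) n script"

lemma T_Def: "Def a f \<in> set script \<Longrightarrow> xs \<in> tuples n (ar a) \<Longrightarrow> T a xs \<longleftrightarrow> sat n T (env xs) f"
  unfolding T_def tables_def by (rule fold_result_Def[OF wf_script])

lemma T_closed:
  assumes "Fix a f \<in> set script" "xs \<in> tuples n (ar a)" "sat n T (env xs) f"
  shows "T a xs"
  using fold_result_Fix_closed[OF wf_script assms(1,2), of "adjacency (line_graph_edges {..<n} ends)"] assms(3)
  unfolding T_def tables_def by (simp add: adjacency_def)

lemma T_sound:
  assumes "Fix a f \<in> set script" "xs \<in> tuples n (ar a)" "T a xs"
    and "\<And>S xs. xs \<in> tuples n (ar a) \<Longrightarrow> (\<And>ys. ys \<in> tuples n (ar a) \<Longrightarrow> S ys \<Longrightarrow> Q ys) \<Longrightarrow>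
        sat n (T(a := S)) (env xs) f \<Longrightarrow> Q xs"
  shows "Q xs"
proof (rule fold_result_Fix_sound[OF wf_script assms(1,2), of "adjacency (line_graph_edges {..<n} ends)"])
  show "fold (result n) script (adjacency (line_graph_edges {..<n} ends)) a xs"
    using assms(3) by (simp add: T_def tables_def)
qed (use assms(4) in \<open>auto simp: adjacency_def T_def tables_def\<close>)

lemma adj_table [simp]: "T (Suc 0) [x, y] \<longleftrightarrow> adj x y"
proof -
  have "T 1 = adjacency (line_graph_edges {..<n} ends) 1"
    unfolding T_def tables_def by (rule fold_result_other) (simp add: script_def)
  then show ?thesis by (simp add: adjacency_def line_edge_iff adj_def)
qed

lemma adj_lt: "adj x y \<Longrightarrow> x < n \<and> y < n"
  by (simp add: adj_def)

lemma twin_table [simp]: "x < n \<Longrightarrow> y < n \<Longrightarrow> T 8 [x, y] \<longleftrightarrow> twin x y"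
  using T_Def[of 8 _ "[x, y]"] by (auto simp: script_def ar_def env_def twin_def)

lemma rep_table [simp]: "x < n \<Longrightarrow> T 7 [x] \<longleftrightarrow> x \<in> reps"
  using T_Def[of 7 _ "[x]"] by (auto simp: script_def ar_def env_def reps_def)

lemma conn_table [simp]:
  assumes "x < n" "y < n" shows "T 20 [x, y] \<longleftrightarrow> conn x y"
proof -
  have F: "Fix 20 (Or (Eq 0 1) (Ex 2 (Conj [Conn 0 2, Rep 2, Rep 1, Adj 2 1]))) \<in> set script"
    by (simp add: script_def)
  have a: "ar 20 = 2" by (simp add: ar_def)
  show ?thesis
  proof
    assume t: "T 20 [x, y]"
    have "case [x, y] of [x, y] \<Rightarrow> conn x y"
    proof (rule T_sound[OF F _ t])
      show "[x, y] \<in> tuples n (ar 20)" using assms by (simp add: a)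
      fix S xs assume xs: "xs \<in> tuples n (ar 20)"
        and S: "\<And>ys. ys \<in> tuples n (ar 20) \<Longrightarrow> S ys \<Longrightarrow> case ys of [x, y] \<Rightarrow> conn x y"
        and s: "sat n (T(20 := S)) (env xs) (Or (Eq 0 1) (Ex 2 (Conj [Conn 0 2, Rep 2, Rep 1, Adj 2 1])))"
      from xs obtain p q where pq: "xs = [p, q]" "p < n" "q < n" unfolding a by (rule tuples_elims)
      have S': "S [p, z] \<Longrightarrow> conn p z" if "z < n" for z using S[of "[p, z]"] that pq by (simp add: a)
      from s consider "p = q" | z where "z < n" "S [p, z]" "z \<in> reps" "q \<in> reps" "adj z q"
        using pq by (auto simp: env_def)
      then show "case xs of [x, y] \<Rightarrow> conn x y"
        using pq S' conn_trans conn_adj by cases (simp, fastforce)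
    qed
    then show "conn x y" by simp
  next
    assume c: "conn x y"
    have "y < n \<longrightarrow> T 20 [x, y]"
      using c unfolding conn_def
    proof (induction rule: rtrancl_induct)
      case base
      show ?case using T_closed[OF F, of "[x, x]"] by (auto simp: a env_def)
    next
      case (step y z)
      then have "y < n" "z < n" "T 20 [x, y]" "y \<in> reps" "z \<in> reps" "adj y z" by (auto dest: adj_lt)
      moreover from this have "\<exists>w<n. T 20 [x, w] \<and> w \<in> reps \<and> adj w z" by blast
      ultimately show ?case
        using assms(1) by (auto intro!: T_closed[OF F] simp: a env_def cong: conj_cong)
    qed
    then show "T 20 [x, y]" using assms(2) by blast
  qed
qed

lemma reps_lt: "x \<in> reps \<Longrightarrow> x < n"
  using repsF by auto

lemma kept_lt: "x \<in> kept \<Longrightarrow> x < n"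
  using keptF by auto

lemma kept_table [simp]:
  assumes "x < n" shows "T 13 [x] \<longleftrightarrow> x \<in> kept"
proof -
  have "T 13 [x] \<longleftrightarrow> x \<in> reps \<and> (\<exists>w<n. \<exists>w1<n. \<exists>w2<n. w \<in> reps \<and> w1 \<in> reps \<and> w2 \<in> reps \<and>
      conn x w \<and> conn x w1 \<and> conn x w2 \<and> w \<noteq> w1 \<and> w \<noteq> w2 \<and> w1 \<noteq> w2 \<and> \<not> adj w w1 \<and> \<not> adj w w2)"
    using T_Def[of 13 _ "[x]"] assms by (simp add: script_def ar_def env_def cong: conj_cong)
  also have "\<dots> \<longleftrightarrow> x \<in> kept"
    unfolding kept_def spread_def using reps_lt by blast
  finally show ?thesis .
qed

interpretation K: spread_multi kept ends
  by (rule kept_spread)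

lemma Kadj_lt: "K.adj x y \<Longrightarrow> x < n \<and> y < n \<and> x \<in> kept \<and> y \<in> kept"
  using kept_lt by (auto simp: K.adj_def)

lemma Kadj_table [simp]: "x < n \<Longrightarrow> y < n \<Longrightarrow> T 26 [x, y] \<longleftrightarrow> K.adj x y"
  using T_Def[of 26 _ "[x, y]"] by (auto simp: script_def ar_def env_def K.adj_def adj_def)

lemma ht_table [simp]:
  assumes "x < n" "y < n" "z < n" shows "T 9 [x, y, z] \<longleftrightarrow> K.ht x y z"
proof -
  have "T 9 [x, y, z] \<longleftrightarrow> K.adj x y \<and> K.adj y z \<and> K.adj x z \<and>
      (\<forall>w<n. w \<in> kept \<longrightarrow> (K.adj w z \<longleftrightarrow> K.adj w x \<noteq> K.adj w y))"
    using T_Def[of 9 _ "[x, y, z]"] assms by (simp add: script_def ar_def env_def)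
  then show ?thesis unfolding K.ht_def using kept_lt by blast
qed

lemma first_table [simp]:
  assumes "x < n" "y < n" "x \<in> kept" shows "T 38 [x, y] \<longleftrightarrow> y = K.nb x"
proof -
  have "T 38 [x, y] \<longleftrightarrow> K.adj x y \<and> \<not> (\<exists>z<n. z < y \<and> K.adj x z)"
    using T_Def[of 38 _ "[x, y]"] assms by (simp add: script_def ar_def env_def cong: conj_cong)
  also have "\<dots> \<longleftrightarrow> K.adj x y \<and> (\<forall>z. K.adj x z \<longrightarrow> y \<le> z)"
    using Kadj_lt by (meson not_le)
  also have "\<dots> \<longleftrightarrow> y = K.nb x"
    using K.nb[OF assms(3)] unfolding K.nb_def by (metis Least_equality Least_le)
  finally show ?thesis .
qed

lemma at0_table [simp]:
  assumes "x < n" "y < n" "x \<in> kept" shows "T 32 [x, y] \<longleftrightarrow> K.at0 x y"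
proof -
  have nb: "K.nb x < n" using K.nb[OF assms(3)] Kadj_lt by blast
  have "T 32 [x, y] \<longleftrightarrow> (\<exists>f<n. f = K.nb x \<and> (y = f \<or> (K.adj y f \<and> \<not> K.ht x y f)))"
    using T_Def[of 32 _ "[x, y]"] assms by (simp add: script_def ar_def env_def cong: conj_cong)
  then show ?thesis using nb unfolding K.at0_def by blast
qed

lemma same_table [simp]:
  assumes "x < n" "y < n" "s < n" "t < n" "x \<in> kept" "y \<in> kept"
  shows "T 10 [x, s, y, t] \<longleftrightarrow> K.same x s y t"
  using T_Def[of 10 _ "[x, s, y, t]"] assms by (simp add: script_def ar_def env_def K.same_def)

lemma zero_lt: "0 < n"
  using n by simp

text \<open>One direction extends joins by \<open>joined_half_step\<close>, the other is
  \<open>joined_half_induct\<close>. In the former, the property to be preserved speaks only of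
  tuples that start with \<open>e\<close>, since the formula passes its first argument on
  unchanged.\<close>

lemma before_table [simp]:
  assumes e: "e \<in> kept" and x: "x \<in> kept" and s: "s < n"
  shows "T 15 [e, x, s] \<longleftrightarrow> K.joined {f \<in> kept. f < e} (K.endv e 0) (K.endv x s)"
proof -
  let ?S = "{f \<in> kept. f < e}"
  let ?f = "And (Kept 1) (Or (Ex 3 (And (Zero 3) (Same 0 3 1 2)))
      (Ex 3 (Ex 4 (Ex 5 (Conj [Before 0 3 4, Kept 3, Less 3 0, Iff (Zero 5) (Neg (Zero 4)), Same 3 5 1 2])))))"
  have F: "Fix 15 ?f \<in> set script" by (simp add: script_def)
  have a: "ar 15 = 3" by (simp add: ar_def)
  have en: "e < n" using kept_lt[OF e] .
  show ?thesis
  proof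
    assume t: "T 15 [e, x, s]"
    have "case [e, x, s] of [e', x, s] \<Rightarrow> e' = e \<longrightarrow> x \<in> kept \<and> K.joined ?S (K.endv e 0) (K.endv x s)"
    proof (rule T_sound[OF F _ t])
      show "[e, x, s] \<in> tuples n (ar 15)" using en kept_lt[OF x] s by (simp add: a)
      fix R xs assume xs: "xs \<in> tuples n (ar 15)"
        and R: "\<And>ys. ys \<in> tuples n (ar 15) \<Longrightarrow> R ys \<Longrightarrow>
          case ys of [e', x, s] \<Rightarrow> e' = e \<longrightarrow> x \<in> kept \<and> K.joined ?S (K.endv e 0) (K.endv x s)"
        and st: "sat n (T(15 := R)) (env xs) ?f"
      from xs obtain e' p q where pq: "xs = [e', p, q]" "e' < n" "p < n" "q < n" unfolding a by (rule tuples_elims)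
      show "case xs of [e', x, s] \<Rightarrow> e' = e \<longrightarrow> x \<in> kept \<and> K.joined ?S (K.endv e 0) (K.endv x s)"
        unfolding pq list.case
      proof
        assume e': "e' = e"
        have R': "y \<in> kept \<and> K.joined ?S (K.endv e 0) (K.endv y t)" if "R [e, y, t]" "y < n" "t < n" for y t
          using R[of "[e, y, t]"] that en by (simp add: a)
        from st have p: "p \<in> kept" using pq by (simp add: env_def)
        have "T 10 [e, 0, p, q] \<or> (\<exists>y<n. \<exists>t<n. \<exists>u<n. R [e, y, t] \<and> y \<in> kept \<and> y < e \<and>
            (u = 0 \<longleftrightarrow> t \<noteq> 0) \<and> T 10 [y, u, p, q])"
          using st pq e' p zero_lt by (simp add: env_def cong: conj_cong del: same_table)
        then consider "T 10 [e, 0, p, q]"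
          | y t u where "R [e, y, t]" "y \<in> kept" "y < e" "t < n" "u < n" "u = 0 \<longleftrightarrow> t \<noteq> 0" "T 10 [y, u, p, q]"
          by blast
        then have "K.joined ?S (K.endv e 0) (K.endv p q)"
        proof cases
          case 1
          then have "K.same e 0 p q" using same_table[OF en pq(3) zero_lt pq(4) e p] by blast
          then show ?thesis using K.same_iff[OF e p] by simp
        next
          case 2
          have yn: "y < n" using kept_lt[OF 2(2)] .
          have j: "K.joined ?S (K.endv e 0) (K.endv y t)" using R'[OF 2(1) yn 2(4)] by blast
          have sm: "K.same y u p q" using same_table[OF yn pq(3) 2(5) pq(4) 2(2) p] 2(7) by blast
          show ?thesis by (rule K.joined_half_step[OF j _ _ 2(6) sm p]) (use 2 in auto)
        qed
        then show "p \<in> kept \<and> K.joined ?S (K.endv e 0) (K.endv p q)" using p by blast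
      qed
    qed
    then show "K.joined ?S (K.endv e 0) (K.endv x s)" by simp
  next
    assume j: "K.joined ?S (K.endv e 0) (K.endv x s)"
    show "T 15 [e, x, s]"
    proof (rule K.joined_half_induct[OF j _ e n _ _ x s refl])
      show "?S \<subseteq> kept" by blast
      fix x s assume h: "x \<in> kept" "s < n"
      have xn: "x < n" using kept_lt[OF h(1)] .
      have in_t: "[e, x, s] \<in> tuples n (ar 15)" using en xn h(2) by (simp add: a)
      show "T 15 [e, x, s]" if "K.same e 0 x s"
        by (rule T_closed[OF F in_t])
          (use that h xn en e same_table[OF en xn zero_lt h(2) e h(1)] zero_lt in \<open>simp add: env_def cong: conj_cong\<close>)
      show "T 15 [e, x, s]" if g: "t < n" "u < n" "T 15 [e, y, t]" "y \<in> ?S" "u = 0 \<longleftrightarrow> t \<noteq> 0" "K.same y u x s" for y t u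
      proof (rule T_closed[OF F in_t])
        have y: "y \<in> kept" "y < e" "y < n" using g(4) kept_lt by auto
        have "T 10 [y, u, x, s]" using same_table[OF y(3) xn g(2) h(2) y(1) h(1)] g(6) by blast
        then have "\<exists>y<n. \<exists>t<n. \<exists>u<n. T 15 [e, y, t] \<and> y \<in> kept \<and> y < e \<and> (u = 0 \<longleftrightarrow> t \<noteq> 0) \<and> T 10 [y, u, x, s]"
          using g y by blast
        then show "sat n T (env [e, x, s]) ?f"
          using h(1) xn by (simp add: env_def cong: conj_cong del: same_table)
      qed
    qed
  qed
qed

lemma tree_table [simp]:
  assumes "e < n" shows "T 19 [e] \<longleftrightarrow> e \<in> K.tree"
proof (cases "e \<in> kept")
  case True
  have "T 19 [e] \<longleftrightarrow> \<not> (\<exists>s<n. s \<noteq> 0 \<and> T 15 [e, e, s])"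
    using T_Def[of 19 _ "[e]"] assms True by (simp add: script_def ar_def env_def cong: conj_cong)
  also have "\<dots> \<longleftrightarrow> \<not> (\<exists>s<n. s \<noteq> 0 \<and> K.endjoined {f \<in> kept. f < e} e)"
    using K.endjoined_endv[OF True] before_table[OF True True] by blast
  \<comment> \<open>\<open>1 < n\<close> provides a nonzero \<open>s\<close>, a code for the second
    end of \<open>e\<close>.\<close>
  also have "\<dots> \<longleftrightarrow> e \<in> K.tree" using n True by (auto simp: K.tree_def)
  finally show ?thesis .
next
  case False
  then show ?thesis
    using T_Def[of 19 _ "[e]"] assms K.treeF by (auto simp: script_def ar_def env_def)
qed

lemma without_table [simp]:
  assumes e: "e \<in> kept" and f: "f < n" and x: "x \<in> kept" and s: "s < n"
  shows "T 16 [e, f, x, s] \<longleftrightarrow> K.joined (K.tree - {f}) (K.endv e 0) (K.endv x s)"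
proof -
  let ?S = "K.tree - {f}"
  let ?f = "And (Kept 2) (Or (Ex 4 (And (Zero 4) (Same 0 4 2 3)))
      (Ex 4 (Ex 5 (Ex 6 (Conj [Without 0 1 4 5, Tree 4, Neg (Eq 4 1), Iff (Zero 6) (Neg (Zero 5)), Same 4 6 2 3])))))"
  have F: "Fix 16 ?f \<in> set script" by (simp add: script_def)
  have a: "ar 16 = 4" by (simp add: ar_def)
  have en: "e < n" using kept_lt[OF e] .
  have SF: "?S \<subseteq> kept" using K.treeF by blast
  show ?thesis
  proof
    assume t: "T 16 [e, f, x, s]"
    have "case [e, f, x, s] of [e', f', x, s] \<Rightarrow> e' = e \<longrightarrow> f' = f \<longrightarrow>
        x \<in> kept \<and> K.joined ?S (K.endv e 0) (K.endv x s)"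
    proof (rule T_sound[OF F _ t])
      show "[e, f, x, s] \<in> tuples n (ar 16)" using en f kept_lt[OF x] s by (simp add: a)
      fix R xs assume xs: "xs \<in> tuples n (ar 16)"
        and R: "\<And>ys. ys \<in> tuples n (ar 16) \<Longrightarrow> R ys \<Longrightarrow>
          case ys of [e', f', x, s] \<Rightarrow> e' = e \<longrightarrow> f' = f \<longrightarrow> x \<in> kept \<and> K.joined ?S (K.endv e 0) (K.endv x s)"
        and st: "sat n (T(16 := R)) (env xs) ?f"
      from xs obtain e' f' p q where pq: "xs = [e', f', p, q]" "e' < n" "f' < n" "p < n" "q < n"
        unfolding a by (rule tuples_elims)
      show "case xs of [e', f', x, s] \<Rightarrow> e' = e \<longrightarrow> f' = f \<longrightarrow> x \<in> kept \<and> K.joined ?S (K.endv e 0) (K.endv x s)"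
        unfolding pq list.case
      proof (intro impI)
        assume e': "e' = e" "f' = f"
        have R': "y \<in> kept \<and> K.joined ?S (K.endv e 0) (K.endv y t)" if "R [e, f, y, t]" "y < n" "t < n" for y t
          using R[of "[e, f, y, t]"] that en f by (simp add: a)
        from st have p: "p \<in> kept" using pq by (simp add: env_def)
        have "T 10 [e, 0, p, q] \<or> (\<exists>y<n. \<exists>t<n. \<exists>u<n. R [e, f, y, t] \<and> y \<in> K.tree \<and> y \<noteq> f \<and>
            (u = 0 \<longleftrightarrow> t \<noteq> 0) \<and> T 10 [y, u, p, q])"
          using st pq e' p zero_lt by (simp add: env_def cong: conj_cong del: same_table)
        then consider "T 10 [e, 0, p, q]"
          | y t u where "R [e, f, y, t]" "y \<in> K.tree" "y \<noteq> f" "t < n" "u < n" "u = 0 \<longleftrightarrow> t \<noteq> 0" "T 10 [y, u, p, q]"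
          by blast
        then have "K.joined ?S (K.endv e 0) (K.endv p q)"
        proof cases
          case 1
          then have "K.same e 0 p q" using same_table[OF en pq(4) zero_lt pq(5) e p] by blast
          then show ?thesis using K.same_iff[OF e p] by simp
        next
          case 2
          have y: "y \<in> kept" using 2(2) K.treeF by blast
          have yn: "y < n" using kept_lt[OF y] .
          have j: "K.joined ?S (K.endv e 0) (K.endv y t)" using R'[OF 2(1) yn 2(4)] by blast
          have sm: "K.same y u p q" using same_table[OF yn pq(4) 2(5) pq(5) y p] 2(7) by blast
          show ?thesis by (rule K.joined_half_step[OF j _ SF 2(6) sm p]) (use 2 in auto)
        qed
        then show "p \<in> kept \<and> K.joined ?S (K.endv e 0) (K.endv p q)" using p by blast
      qed
    qed
    then show "K.joined ?S (K.endv e 0) (K.endv x s)" by simp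
  next
    assume j: "K.joined ?S (K.endv e 0) (K.endv x s)"
    show "T 16 [e, f, x, s]"
    proof (rule K.joined_half_induct[OF j SF e n _ _ x s refl])
      fix x s assume h: "x \<in> kept" "s < n"
      have xn: "x < n" using kept_lt[OF h(1)] .
      have in_t: "[e, f, x, s] \<in> tuples n (ar 16)" using en f xn h(2) by (simp add: a)
      show "T 16 [e, f, x, s]" if "K.same e 0 x s"
        by (rule T_closed[OF F in_t])
          (use that h xn en e same_table[OF en xn zero_lt h(2) e h(1)] zero_lt in \<open>simp add: env_def cong: conj_cong\<close>)
      show "T 16 [e, f, x, s]" if g: "t < n" "u < n" "T 16 [e, f, y, t]" "y \<in> ?S" "u = 0 \<longleftrightarrow> t \<noteq> 0" "K.same y u x s" for y t u
      proof (rule T_closed[OF F in_t])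
        have y: "y \<in> kept" "y \<in> K.tree" "y \<noteq> f" "y < n" using g(4) SF kept_lt by auto
        have "T 10 [y, u, x, s]" using same_table[OF y(4) xn g(2) h(2) y(1) h(1)] g(6) by blast
        then have "\<exists>y<n. \<exists>t<n. \<exists>u<n. T 16 [e, f, y, t] \<and> y \<in> K.tree \<and> y \<noteq> f \<and> (u = 0 \<longleftrightarrow> t \<noteq> 0) \<and> T 10 [y, u, x, s]"
          using g y by blast
        then show "sat n T (env [e, f, x, s]) ?f"
          using h(1) xn by (simp add: env_def cong: conj_cong del: same_table)
      qed
    qed
  qed
qed

lemma fund_table [simp]:
  assumes "e < n" "f < n" shows "T 44 [e, f] \<longleftrightarrow> e \<in> kept - K.tree \<and> f \<in> K.fund e"
proof (cases "e \<in> kept - K.tree")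
  case True
  then have e: "e \<in> kept" by blast
  have "T 44 [e, f] \<longleftrightarrow> f = e \<or> (f \<in> K.tree \<and> \<not> (\<exists>s<n. s \<noteq> 0 \<and> T 16 [e, f, e, s]))"
    using T_Def[of 44 _ "[e, f]"] assms True by (simp add: script_def ar_def env_def cong: conj_cong)
  also have "\<dots> \<longleftrightarrow> f = e \<or> (f \<in> K.tree \<and> \<not> (\<exists>s<n. s \<noteq> 0 \<and> K.endjoined (K.tree - {f}) e))"
    using K.endjoined_endv[OF e] without_table[OF e assms(2) e] by blast
  also have "\<dots> \<longleftrightarrow> f \<in> K.fund e" using n K.mem_fund_iff[OF True] by auto
  finally show ?thesis using True by blast
next
  case False
  then show ?thesis using T_Def[of 44 _ "[e, f]"] assms by (auto simp: script_def ar_def env_def)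
qed

lemma fund_lt: "e \<in> kept - K.tree \<Longrightarrow> f \<in> K.fund e \<Longrightarrow> f < n"
  using K.fundF kept_lt by blast

lemma common_table [simp]:
  assumes "e < n" "g < n" "e \<in> kept - K.tree" "g \<in> kept - K.tree"
  shows "T 50 [e, g] \<longleftrightarrow> odd (card (K.fund e \<inter> K.fund g))"
proof -
  have "{f. f < n \<and> f \<in> K.fund e \<and> f \<in> K.fund g} = K.fund e \<inter> K.fund g" using fund_lt assms by blast
  moreover have "T 50 [e, g] \<longleftrightarrow> odd (card {f. f < n \<and> f \<in> K.fund e \<and> f \<in> K.fund g})"
    using T_Def[of 50 _ "[e, g]"] assms by (simp add: script_def ar_def env_def cong: conj_cong)
  ultimately show ?thesis by simp
qed

lemma link_table [simp]:
  assumes "e < n" "g < n" "e \<in> kept - K.tree"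
  shows "T 56 [e, g] \<longleftrightarrow> K.flink e g"
proof -
  let ?f = "Or (Eq 0 1) (Ex 2 (Ex 3 (Conj [Link 0 2, Fund 2 3, Fund 1 3])))"
  have F: "Fix 56 ?f \<in> set script" by (simp add: script_def)
  have a: "ar 56 = 2" by (simp add: ar_def)
  show ?thesis
  proof
    assume t: "T 56 [e, g]"
    have "case [e, g] of [e', g] \<Rightarrow> e' = e \<longrightarrow> K.flink e g"
    proof (rule T_sound[OF F _ t])
      show "[e, g] \<in> tuples n (ar 56)" using assms by (simp add: a)
      fix S xs assume xs: "xs \<in> tuples n (ar 56)"
        and S: "\<And>ys. ys \<in> tuples n (ar 56) \<Longrightarrow> S ys \<Longrightarrow> case ys of [e', g] \<Rightarrow> e' = e \<longrightarrow> K.flink e g"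
        and s: "sat n (T(56 := S)) (env xs) ?f"
      from xs obtain p q where pq: "xs = [p, q]" "p < n" "q < n" unfolding a by (rule tuples_elims)
      show "case xs of [e', g] \<Rightarrow> e' = e \<longrightarrow> K.flink e g"
        unfolding pq list.case
      proof
        assume p: "p = e"
        have S': "S [e, z] \<Longrightarrow> K.flink e z" if "z < n" for z using S[of "[e, z]"] that pq p by (simp add: a)
        from s consider "q = e" | h f where "h < n" "f < n" "S [e, h]" "h \<in> kept - K.tree" "f \<in> K.fund h"
            "q \<in> kept - K.tree" "f \<in> K.fund q"
          using pq p by (auto simp: env_def)
        then show "K.flink e q"
        proof cases
          case 2
          have "K.flink h q" by (rule K.flink_meet[OF 2(4,6)]) (use 2(5,7) in blast)
          then show ?thesis using S'[OF 2(1,3)] K.flink_trans by blast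
        qed simp
      qed
    qed
    then show "K.flink e g" by simp
  next
    assume "K.flink e g"
    then have "g < n \<longrightarrow> T 56 [e, g]"
      unfolding K.flink_def
    proof (induction rule: rtrancl_induct)
      case base
      show ?case using T_closed[OF F, of "[e, e]"] by (auto simp: a env_def)
    next
      case (step y z)
      then have h: "y \<in> kept - K.tree" "z \<in> kept - K.tree" "K.fund y \<inter> K.fund z \<noteq> {}" by auto
      then obtain f where f: "f \<in> K.fund y" "f \<in> K.fund z" by blast
      have lt: "y < n" "z < n" "f < n" using h kept_lt fund_lt[OF h(1) f(1)] by auto
      have "T 44 [y, f]" "T 44 [z, f]" "T 56 [e, y]" using h f lt step.IH by auto
      then have "\<exists>y<n. \<exists>f<n. T 56 [e, y] \<and> T 44 [y, f] \<and> T 44 [z, f]" using lt by blast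
      then have "T 56 [e, z]"
        using assms(1) lt by (intro T_closed[OF F]) (simp_all add: a env_def del: fund_table)
      then show ?case by blast
    qed
    then show "T 56 [e, g]" using assms by blast
  qed
qed

lemma nontree_lt: "e \<in> kept - K.tree \<Longrightarrow> e < n"
  using kept_lt by blast

lemma odd_block_table [simp]:
  assumes "e < n" "e \<in> kept - K.tree"
  shows "T 25 [e] \<longleftrightarrow> (\<exists>h. K.flink e h \<and> odd (card (K.fund h)))"
proof -
  have "T 25 [e] \<longleftrightarrow> (\<exists>h<n. T 56 [e, h] \<and> T 50 [h, h])"
    using T_Def[of 25 _ "[e]"] assms(1) by (simp add: script_def ar_def env_def)
  also have "\<dots> \<longleftrightarrow> (\<exists>h<n. K.flink e h \<and> odd (card (K.fund h)))"
    using assms common_table[of h h for h] K.flink_nontree[OF _ assms(2)] by (metis Int_absorb link_table)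
  also have "\<dots> \<longleftrightarrow> (\<exists>h. K.flink e h \<and> odd (card (K.fund h)))"
    using K.flink_nontree[OF _ assms(2)] nontree_lt by blast
  finally show ?thesis .
qed

lemma avoid_table [simp]:
  assumes "d < n" "f < n" "x < n"
  shows "T 21 [d, f, x] \<longleftrightarrow> K.avoid d f x"
proof -
  let ?f = "Or (Eq 2 1) (Ex 3 (Conj [Avoid 0 1 3, KAdj 3 2, Or (Eq 3 1) (And (Neg (Eq 3 0)) (Neg (KAdj 3 0)))]))"
  have F: "Fix 21 ?f \<in> set script" by (simp add: script_def)
  have a: "ar 21 = 3" by (simp add: ar_def)
  show ?thesis
  proof
    assume t: "T 21 [d, f, x]"
    have "case [d, f, x] of [d, f, x] \<Rightarrow> K.avoid d f x"
    proof (rule T_sound[OF F _ t])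
      show "[d, f, x] \<in> tuples n (ar 21)" using assms by (simp add: a)
      fix S xs assume xs: "xs \<in> tuples n (ar 21)"
        and S: "\<And>ys. ys \<in> tuples n (ar 21) \<Longrightarrow> S ys \<Longrightarrow> case ys of [d, f, x] \<Rightarrow> K.avoid d f x"
        and s: "sat n (T(21 := S)) (env xs) ?f"
      from xs obtain p q r where pq: "xs = [p, q, r]" "p < n" "q < n" "r < n" unfolding a by (rule tuples_elims)
      have S': "S [p, q, z] \<Longrightarrow> K.avoid p q z" if "z < n" for z using S[of "[p, q, z]"] that pq by (simp add: a)
      from s consider "r = q" | y where "y < n" "S [p, q, y]" "K.adj y r" "y = q \<or> (y \<noteq> p \<and> \<not> K.adj y p)"
        using pq by (auto simp: env_def)
      then show "case xs of [d, f, x] \<Rightarrow> K.avoid d f x"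
        unfolding pq list.case
      proof cases
        case 2
        then have "(y, r) \<in> {(x, y). K.adj x y \<and> (x = q \<or> (x \<noteq> p \<and> \<not> K.adj x p))}" by blast
        then show "K.avoid p q r" using S'[OF 2(1,2)] unfolding K.avoid_def by (rule rtrancl_into_rtrancl[rotated])
      qed (simp add: K.avoid_def)
    qed
    then show "K.avoid d f x" by simp
  next
    assume "K.avoid d f x"
    then have "x < n \<longrightarrow> T 21 [d, f, x]"
      unfolding K.avoid_def
    proof (induction rule: rtrancl_induct)
      case base
      show ?case using T_closed[OF F, of "[d, f, f]"] assms by (simp add: a env_def)
    next
      case (step y z)
      then have h: "K.adj y z" "y = f \<or> (y \<noteq> d \<and> \<not> K.adj y d)" by auto
      have lt: "y < n" "z < n" using Kadj_lt[OF h(1)] by auto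
      have "\<exists>y<n. T 21 [d, f, y] \<and> K.adj y z \<and> (y = f \<or> (y \<noteq> d \<and> \<not> K.adj y d))"
        using h lt step.IH by blast
      then have "T 21 [d, f, z]"
        using assms lt by (intro T_closed[OF F]) (auto simp: a env_def)
      then show ?case by blast
    qed
    then show "T 21 [d, f, x]" using assms by blast
  qed
qed

lemma parity_table:
  "K.parity_cond \<longleftrightarrow> (\<forall>e<n. \<forall>g<n. \<not> (e \<in> kept \<and> e \<notin> K.tree \<and> T 56 [e, g] \<and> T 25 [e]) \<or>
    (T 50 [e, g] \<longleftrightarrow> T 50 [e, e] \<and> T 50 [g, g]))" (is "_ \<longleftrightarrow> ?r")
proof
  assume par: K.parity_cond
  show ?r
  proof (intro allI impI)
    fix e g assume lt: "e < n" "g < n"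
    show "\<not> (e \<in> kept \<and> e \<notin> K.tree \<and> T 56 [e, g] \<and> T 25 [e]) \<or> (T 50 [e, g] \<longleftrightarrow> T 50 [e, e] \<and> T 50 [g, g])"
    proof (rule disjCI)
      assume "\<not> (T 50 [e, g] \<longleftrightarrow> T 50 [e, e] \<and> T 50 [g, g])"
      show "\<not> (e \<in> kept \<and> e \<notin> K.tree \<and> T 56 [e, g] \<and> T 25 [e])"
      proof
        assume h: "e \<in> kept \<and> e \<notin> K.tree \<and> T 56 [e, g] \<and> T 25 [e]"
        then have e: "e \<in> kept - K.tree" by blast
        have eg: "K.flink e g" using h link_table[OF lt e] by blast
        have g: "g \<in> kept - K.tree" by (rule K.flink_nontree[OF eg e])
        have "\<exists>h. K.flink e h \<and> odd (card (K.fund h))" using h odd_block_table[OF lt(1) e] by blast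
        then have "odd (card (K.fund e \<inter> K.fund g)) \<longleftrightarrow> odd (card (K.fund e)) \<and> odd (card (K.fund g))"
          using par e eg unfolding K.parity_cond_def by blast
        then show False
          using \<open>\<not> (T 50 [e, g] \<longleftrightarrow> T 50 [e, e] \<and> T 50 [g, g])\<close> common_table[OF lt e g]
            common_table[OF lt(1,1) e e, unfolded Int_absorb] common_table[OF lt(2,2) g g, unfolded Int_absorb] by blast
      qed
    qed
  qed
next
  assume r: ?r
  show K.parity_cond
    unfolding K.parity_cond_def
  proof (intro allI impI)
    fix e g assume e: "e \<in> kept - K.tree" and eg: "K.flink e g" and od: "\<exists>h. K.flink e h \<and> odd (card (K.fund h))"
    have g: "g \<in> kept - K.tree" by (rule K.flink_nontree[OF eg e])
    have lt: "e < n" "g < n" using e g nontree_lt by auto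
    have "T 56 [e, g]" "T 25 [e]" using e eg od lt by simp_all
    then have "T 50 [e, g] \<longleftrightarrow> T 50 [e, e] \<and> T 50 [g, g]" using r lt e by blast
    then show "odd (card (K.fund e \<inter> K.fund g)) \<longleftrightarrow> odd (card (K.fund e)) \<and> odd (card (K.fund g))"
      using common_table[OF lt e g] common_table[OF lt(1,1) e e, unfolded Int_absorb]
        common_table[OF lt(2,2) g g, unfolded Int_absorb] by blast
  qed
qed

lemma odd_block_iff:
  "K.odd_block d \<longleftrightarrow> (\<exists>e<n. T 44 [e, d] \<and> T 25 [e])" if "d < n"
proof -
  have "(\<exists>e<n. T 44 [e, d] \<and> T 25 [e]) \<longleftrightarrow> (\<exists>e<n. e \<in> kept - K.tree \<and> d \<in> K.fund e \<and> T 25 [e])"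
    using fund_table that by blast
  also have "\<dots> \<longleftrightarrow> (\<exists>e<n. e \<in> kept - K.tree \<and> d \<in> K.fund e \<and> (\<exists>h. K.flink e h \<and> odd (card (K.fund h))))"
    using odd_block_table by blast
  also have "\<dots> \<longleftrightarrow> K.odd_block d" unfolding K.odd_block_def using nontree_lt by blast
  finally show ?thesis by blast
qed

lemma detour_iff:
  assumes "d < n" "a < n" "b < n"
  shows "K.detour d a b \<longleftrightarrow> (\<exists>f<n. \<exists>g<n. K.adj f d \<and> K.adj g d \<and> f \<noteq> a \<and> f \<noteq> b \<and> g \<noteq> a \<and> g \<noteq> b \<and>
    f \<noteq> g \<and> \<not> K.adj f g \<and> T 21 [d, f, g])"
proof -
  define X where "X f g \<longleftrightarrow> K.adj f d \<and> K.adj g d \<and> f \<noteq> a \<and> f \<noteq> b \<and> g \<noteq> a \<and> g \<noteq> b \<and> f \<noteq> g \<and> \<not> K.adj f g" for f g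
  have X: "X f g \<Longrightarrow> f < n \<and> g < n" for f g unfolding X_def using Kadj_lt by blast
  have "K.detour d a b \<longleftrightarrow> (\<exists>f g. X f g \<and> K.avoid d f g)" by (simp add: K.detour_def X_def)
  also have "\<dots> \<longleftrightarrow> (\<exists>f<n. \<exists>g<n. X f g \<and> T 21 [d, f, g])" using X avoid_table[OF assms(1)] by meson
  finally show ?thesis by (simp add: X_def)
qed

lemma sat_goal: "sat n T (env []) goal \<longleftrightarrow> K.parity_cond \<and> twins_cond"
proof -
  define G where "G d \<longleftrightarrow> d \<in> kept \<and> (\<exists>t<n. twin d t) \<and> (\<exists>e<n. T 44 [e, d] \<and> T 25 [e]) \<and>
    \<not> (\<exists>a<n. \<exists>b<n. K.ht d a b \<and> \<not> (\<exists>f<n. \<exists>g<n. K.adj f d \<and> K.adj g d \<and> f \<noteq> a \<and> f \<noteq> b \<and> g \<noteq> a \<and> g \<noteq> b \<and>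
      f \<noteq> g \<and> \<not> K.adj f g \<and> T 21 [d, f, g]))" for d
  have "sat n T (env []) goal \<longleftrightarrow> (\<forall>e<n. \<forall>g<n. \<not> (e \<in> kept \<and> e \<notin> K.tree \<and> T 56 [e, g] \<and> T 25 [e]) \<or>
    (T 50 [e, g] \<longleftrightarrow> T 50 [e, e] \<and> T 50 [g, g])) \<and> \<not> (\<exists>d<n. G d)"
    unfolding goal_def G_def by (simp add: env_def cong: conj_cong del: fund_table common_table link_table odd_block_table avoid_table)
  also have "\<dots> \<longleftrightarrow> K.parity_cond \<and> \<not> (\<exists>d<n. G d)" by (simp only: parity_table)
  also have "\<dots> \<longleftrightarrow> K.parity_cond \<and> twins_cond"
  \<comment> \<open>The second conjunct expresses \<open>twins_cond\<close> only under the parity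
    condition, on which \<open>long_odd_circ_iff\<close> relies.\<close>
  proof (rule conj_cong[OF refl])
    assume par: K.parity_cond
    have "G d \<longleftrightarrow> d \<in> kept \<and> (\<exists>t. twin d t) \<and> K.odd_block d \<and> \<not> (\<exists>a b. K.ht d a b \<and> \<not> K.detour d a b)" if "d < n" for d
    proof -
      have ht: "K.ht d a b \<Longrightarrow> a < n \<and> b < n" for a b unfolding K.ht_def using Kadj_lt by blast
      have "(\<exists>t<n. twin d t) \<longleftrightarrow> (\<exists>t. twin d t)" using twinF by auto
      moreover have "(\<exists>a<n. \<exists>b<n. K.ht d a b \<and> \<not> (\<exists>f<n. \<exists>g<n. K.adj f d \<and> K.adj g d \<and> f \<noteq> a \<and> f \<noteq> b \<and> g \<noteq> a \<and> g \<noteq> b \<and>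
          f \<noteq> g \<and> \<not> K.adj f g \<and> T 21 [d, f, g])) \<longleftrightarrow> (\<exists>a<n. \<exists>b<n. K.ht d a b \<and> \<not> K.detour d a b)"
        by (intro ex_cong1 conj_cong refl) (simp only: detour_iff[OF that])
      moreover have "\<dots> \<longleftrightarrow> (\<exists>a b. K.ht d a b \<and> \<not> K.detour d a b)" using ht by blast
      ultimately show ?thesis unfolding G_def odd_block_iff[OF that] by simp
    qed
    then have "(\<exists>d<n. G d) \<longleftrightarrow> (\<exists>d. d \<in> kept \<and> (\<exists>t. twin d t) \<and>
        (\<exists>Y. K.circ Y \<and> Y \<subseteq> kept \<and> odd (card Y) \<and> 5 \<le> card Y \<and> d \<in> Y))"
      unfolding K.long_odd_circ_iff[OF par] using kept_lt by blast
    also have "\<dots> \<longleftrightarrow> (\<exists>Y d t. K.circ Y \<and> Y \<subseteq> kept \<and> odd (card Y) \<and> 5 \<le> card Y \<and> d \<in> Y \<and> twin d t)"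
      by blast
    finally show "\<not> (\<exists>d<n. G d) \<longleftrightarrow> twins_cond" unfolding twins_cond_def by blast
  qed
  finally show ?thesis .
qed

lemma h_perfect_iff_sat: "h_perfect {..<n} (line_graph_edges {..<n} ends) \<longleftrightarrow> sat n T (env []) goal"
  unfolding h_perfect_iff_no_bad sat_goal by (rule no_bad_iff)

end

theorem theorem1p5:
  shows "\<exists>c. decides_in_polynomial_time c line_graph h_perfect"
proof (rule exI, rule script_decides[OF wf_script wf_goal])
  fix n :: nat and E :: "nat set set"
  assume "simple_graph {..<n} E" "line_graph {..<n} E"
  then obtain W :: "nat set" and ends where m: "multigraph W {..<n} ends" and E: "E = line_graph_edges {..<n} ends"
    by (auto simp: line_graph_def)
  interpret ordered_multi "{..<n}" ends
    using m by unfold_locales (auto simp: multigraph_def)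
  show "h_perfect {..<n} E \<longleftrightarrow> n < 2 \<or> sat n (tables E n script) (env []) goal"
  proof (cases "n < 2")
    case True
    \<comment> \<open>A circuit has at least two edges, so the immediate answer 1 is correct
      here.\<close>
    have "\<not> bad C P" if "C \<union> P \<subseteq> {..<n}" for C P
    proof
      assume "bad C P"
      then have "circ C" using thetaD by (auto simp: bad_def)
      then have "2 \<le> card C" using circ_card_ge2 that by blast
      moreover have "card C \<le> n" using card_mono[of "{..<n}" C] that by simp
      ultimately show False using True
        by simp
    qed
    then show ?thesis unfolding E h_perfect_iff_no_bad using True by blast
  next
    case False
    interpret line_tables n ends by unfold_locales (use False in simp)
    show ?thesis using h_perfect_iff_sat False unfolding T_def E by simp
  qed
qed

end
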